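(* Let $K$ be a commutative ring with unit and let $(\mathfrak q,\mathfrak p,\eta)$ be a crossed module of Leibniz algebras over $K$. Then its universal enveloping crossed module of algebras $\mathrm{XUL}(\mathfrak q,\mathfrak p,\eta)$ is isomorphic, as a crossed module of associative algebras, to $$\Big(\operatorname{Ker}\overline{\mathrm U}(s_1)\oplus\operatorname{Ker}\overline{\mathrm U}(s_2),\ \big(\mathrm U(\mathrm{Lie}(\mathfrak p))\otimes\mathfrak p\big)\oplus \mathrm U(\mathrm{Lie}(\mathfrak p)),\ \big(\overline{\mathrm U}(t_1),\overline{\mathrm U}(t_2)\big)\Big),$$ the crossed module of associative algebras associated with the universal enveloping crossed module, in the Loday–Pirashvili category $\mathcal{LM}$ of linear maps, of $(\mathfrak q,\mathfrak p,\eta)$ viewed as a Lie crossed module in $\mathcal{LM}$.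
   Context: All algebras are over $K$, $\otimes=\otimes_K$. A (right) Leibniz algebra is a $K$-module $\mathfrak p$ with a bilinear bracket satisfying $[[x,y],z]=[x,[y,z]]+[[x,z],y]$. An action of a Leibniz algebra $\mathfrak p$ on a Leibniz algebra $\mathfrak q$ is a pair of bilinear maps $\mathfrak p\times\mathfrak q\to\mathfrak q$, $\mathfrak q\times\mathfrak p\to\mathfrak q$, both written $[\ ,\ ]$, such that the Leibniz identity holds whenever two of the three elements lie in $\mathfrak p$ and one in $\mathfrak q$, or one in $\mathfrak p$ and two in $\mathfrak q$. The semidirect product $\mathfrak q\rtimes\mathfrak p$ is $\mathfrak q\oplus\mathfrak p$ with $[(q_1,p_1),(q_2,p_2)]=([q_1,q_2]+[p_1,q_2]+[q_1,p_2],[p_1,p_2])$. A crossed module of Leibniz algebras $(\mathfrak q,\mathfrak p,\eta)$ is a morphism of Leibniz algebras $\eta:\mathfrak q\to\mathfrak p$ with an action of $\mathfrak p$ on $\mathfrak q$ such that $\eta([p,q])=[p,\eta(q)]$, $\eta([q,p])=[\eta(q),p]$, $[\eta(q_1),q_2]=[q_1,q_2]=[q_1,\eta(q_2)]$. A crossed module of (associative) algebras $(B,A,\rho)$ is an algebra homomorphism $\rho:B\to A$ with an action of $A$ on $B$ (an $A$-bimodule structure on $B$ with $a(bb')=(ab)b'$, $(ba)b'=b(ab')$, $(bb')a=b(b'a)$) such that $\rho(ab)=a\rho(b)$, $\rho(ba)=\rho(b)a$, $\rho(b_1)b_2=b_1b_2=b_1\rho(b_2)$. A morphism $(\varphi,\psi):(B,A,\rho)\to(B',A',\rho')$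 is a pair of algebra homomorphisms with $\psi\rho=\rho'\varphi$, $\varphi(ba)=\varphi(b)\psi(a)$, $\varphi(ab)=\psi(a)\varphi(b)$. **The crossed module $\mathrm{XUL}$.** For a Leibniz algebra $\mathfrak p$ let $\mathfrak p^l,\mathfrak p^r$ be two copies of $\mathfrak p$, with $x_l,x_r$ corresponding to $x\in\mathfrak p$. $\mathrm{UL}(\mathfrak p)$ is the quotient of the unital tensor algebra $T(\mathfrak p^l\oplus\mathfrak p^r)$ by the two-sided ideal generated by the relations $[x,y]_r=x_ry_r-y_rx_r$, $[x,y]_l=x_ly_r-y_rx_l$, $(y_r+y_l)x_l=0$ $(x,y\in\mathfrak p)$; it is functorial. Given $(\mathfrak q,\mathfrak p,\eta)$ let $s,t:\mathfrak q\rtimes\mathfrak p\to\mathfrak p$, $s(q,p)=p$, $t(q,p)=\eta(q)+p$. Put $\mathcal X=\operatorname{Ker}\mathrm{UL}(s)\operatorname{Ker}\mathrm{UL}(t)+\operatorname{Ker}\mathrm{UL}(t)\operatorname{Ker}\mathrm{UL}(s)$ and $\overline{\mathrm{UL}}(\mathfrak q\rtimes\mathfrak p)=\mathrm{UL}(\mathfrak q\rtimes\mathfrak p)/\mathcal X$, with induced maps $\overline{\mathrm{UL}}(s),\overline{\mathrm{UL}}(t)$ to $\mathrm{UL}(\mathfrak p)$. Then $\mathrm{XUL}(\mathfrak q,\mathfrak p,\eta)=(\operatorname{Ker}\overline{\mathrm{UL}}(s),\mathrm{UL}(\mathfrak p),\overline{\mathrm{UL}}(t)|_{\operatorname{Ker}\overline{\mathrm{UL}}(s)})$,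 where $\mathrm{UL}(\mathfrak p)$, a subalgebra of $\overline{\mathrm{UL}}(\mathfrak q\rtimes\mathfrak p)$ via $p\mapsto(0,p)$, acts by multiplication. **The crossed module coming from $\mathcal{LM}$.** $\mathrm{Lie}(\mathfrak p)$ is the quotient of the Leibniz algebra $\mathfrak p$ by the ideal generated by all $[p,p]$. Put $\mathfrak g=\mathrm{Lie}(\mathfrak p)$ and $\mathfrak h=\mathrm{Lie}(\mathfrak q)/[\mathfrak q,\mathfrak p]_{\mathtt x}$, where $[\mathfrak q,\mathfrak p]_{\mathtt x}$ is the ideal generated by the (classes of the) elements $[q,p]+[p,q]$, $p\in\mathfrak p$, $q\in\mathfrak q$. The right action $[\bar q,\bar p]=\overline{[q,p]}$ of $\mathfrak g$ on $\mathfrak h$ and the induced map $\bar\eta:\mathfrak h\to\mathfrak g$ form a Lie crossed module. Let $\mathfrak h\rtimes\mathfrak g$ be the semidirect product Lie algebra, with $[(h,g),(h',g')]=([h,h']+[h,g']-[h',g],[g,g'])$. The $K$-module $\mathfrak q\oplus\mathfrak p$ is a right $(\mathfrak h\rtimes\mathfrak g)$-representation by $[(q,p),(\bar q',\bar p')]=([q,q']+[q,p']+[p,q'],[p,p'])$, $\mathfrak p$ is a right $\mathfrak g$-representation by $[p,\bar p']=[p,p']$, and the quotient maps $\mathfrak q\oplus\mathfrak p\to\mathfrak h\rtimes\mathfrak g$, $\mathfrak p\to\mathfrak g$ are equivariant. (In $\mathcal{LM}$, the category whose objects are $K$-linear maps, this says that $(\mathfrak q\to\mathfrak h)\to(\mathfrak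 p\to\mathfrak g)$ is a Lie crossed module, with $(\mathfrak q\oplus\mathfrak p\to\mathfrak h\rtimes\mathfrak g)$ its semidirect product.) For a Lie algebra $\mathfrak l$, a right $\mathfrak l$-representation $V$ and an $\mathfrak l$-equivariant map $\alpha:V\to\mathfrak l$, let $\mathrm U(\mathfrak l)$ be the usual (unital) universal enveloping algebra; $\mathrm U(\mathfrak l)\otimes V$ is a $\mathrm U(\mathfrak l)$-bimodule by $g(x\otimes v)=gx\otimes v$, $(x\otimes v)g=xg\otimes v+x\otimes[v,g]$ ($g\in\mathfrak l$), and $\mathrm U(\alpha):\mathrm U(\mathfrak l)\otimes V\to\mathrm U(\mathfrak l)$, $x\otimes v\mapsto x\alpha(v)$, is a bimodule map. Let $s_1,t_1:\mathfrak q\oplus\mathfrak p\to\mathfrak p$, $s_1(q,p)=p$, $t_1(q,p)=\eta(q)+p$, and $s_2,t_2:\mathfrak h\rtimes\mathfrak g\to\mathfrak g$, $s_2(h,g)=g$, $t_2(h,g)=\bar\eta(h)+g$. They induce algebra maps $\mathrm U(s_2),\mathrm U(t_2):\mathrm U(\mathfrak h\rtimes\mathfrak g)\to\mathrm U(\mathfrak g)$ and $\mathrm U(s_1)=\mathrm U(s_2)\otimes s_1$, $\mathrm U(t_1)=\mathrm U(t_2)\otimes t_1$ from $\mathrm U(\mathfrak h\rtimes\mathfrak g)\otimes(\mathfrak q\oplus\mathfrak p)$ to $\mathrm U(\mathfrak g)\otimes\mathfrak p$. Put $$\mathcal X'=\operatorname{Ker}\mathrm U(s_2)\operatorname{Ker}\mathrm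 U(t_2)+\operatorname{Ker}\mathrm U(t_2)\operatorname{Ker}\mathrm U(s_2),$$ $$\mathcal Y'=\operatorname{Ker}\mathrm U(s_1)\operatorname{Ker}\mathrm U(t_2)+\operatorname{Ker}\mathrm U(s_2)\operatorname{Ker}\mathrm U(t_1)+\operatorname{Ker}\mathrm U(t_1)\operatorname{Ker}\mathrm U(s_2)+\operatorname{Ker}\mathrm U(t_2)\operatorname{Ker}\mathrm U(s_1),$$ and let $\overline{\mathrm U}(s_i),\overline{\mathrm U}(t_i)$ be the induced maps on $\big(\mathrm U(\mathfrak h\rtimes\mathfrak g)\otimes(\mathfrak q\oplus\mathfrak p)\big)/\mathcal Y'$ $(i=1)$ and $\mathrm U(\mathfrak h\rtimes\mathfrak g)/\mathcal X'$ $(i=2)$. Whenever $R$ is an associative algebra, $A$ an $R$-bimodule and $\alpha:A\to R$ a bimodule map, $A\oplus R$ is an associative algebra with product $(a,r)(a',r')=(\alpha(a)a'+ar'+ra',\,rr')$. Apply this to $(\mathrm U(\mathfrak g)\otimes\mathfrak p\to\mathrm U(\mathfrak g))$ to get the algebra $E_0=(\mathrm U(\mathfrak g)\otimes\mathfrak p)\oplus\mathrm U(\mathfrak g)$, and to $\big(\mathrm U(\mathfrak h\rtimes\mathfrak g)\otimes(\mathfrak q\oplus\mathfrak p)\big)/\mathcal Y'\to\mathrm U(\mathfrak h\rtimes\mathfrak g)/\mathcal X'$ to get an algebra $E_1$. The map $E_0\to E_1$ induced by $p\mapsto(0,p)$, $g\mapsto(0,g)$ makes $E_0$ a subalgebra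 of $E_1$. The crossed module in the claim is the ideal $\operatorname{Ker}\overline{\mathrm U}(s_1)\oplus\operatorname{Ker}\overline{\mathrm U}(s_2)$ of $E_1$, with $E_0$ acting by multiplication in $E_1$, and the restriction of $(\overline{\mathrm U}(t_1),\overline{\mathrm U}(t_2)):E_1\to E_0$ as structure map. *)

theory Defs
  imports "HOL-Algebra.Module" "HOL-Algebra.QuotRing"
begin

text \<open>
  Every algebraic structure over the commutative ring \<open>K\<close> (modules, Leibniz and Lie algebras,
  associative algebras) is a HOL-Algebra record of type \<open>('k, 'a) module\<close>. The field \<^const>\<open>mult\<close> is
  the bilinear product, i.e. the bracket in the case of Leibniz and Lie algebras. The field
  \<^const>\<open>one\<close> is meaningful only for unital associative algebras, and \<^const>\<open>mult\<close> is ignored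
  whenever a record is used merely as a module.
\<close>

section \<open>Linear and bilinear maps, algebras\<close>

definition mod_hom ::
    "('k, 'z) ring_scheme \<Rightarrow> ('k, 'a) module \<Rightarrow> ('k, 'b) module \<Rightarrow> ('a \<Rightarrow> 'b) set" where
  "mod_hom K M N = {f \<in> carrier M \<rightarrow> carrier N.
     (\<forall>x\<in>carrier M. \<forall>y\<in>carrier M. f (x \<oplus>\<^bsub>M\<^esub> y) = f x \<oplus>\<^bsub>N\<^esub> f y) \<and>
     (\<forall>k\<in>carrier K. \<forall>x\<in>carrier M. f (k \<odot>\<^bsub>M\<^esub> x) = k \<odot>\<^bsub>N\<^esub> f x)}"

definition bilinear_map ::
    "('k, 'z) ring_scheme \<Rightarrow> ('k, 'a) module \<Rightarrow> ('k, 'b) module \<Rightarrow> ('k, 'c) module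
      \<Rightarrow> ('a \<Rightarrow> 'b \<Rightarrow> 'c) \<Rightarrow> bool" where
  "bilinear_map K M N L f \<longleftrightarrow>
     (\<forall>x\<in>carrier M. (\<lambda>y. f x y) \<in> mod_hom K N L) \<and>
     (\<forall>y\<in>carrier N. (\<lambda>x. f x y) \<in> mod_hom K M L)"

definition alg_hom ::
    "('k, 'z) ring_scheme \<Rightarrow> ('k, 'a) module \<Rightarrow> ('k, 'b) module \<Rightarrow> ('a \<Rightarrow> 'b) set" where
  "alg_hom K A B = {f \<in> mod_hom K A B.
     \<forall>x\<in>carrier A. \<forall>y\<in>carrier A. f (x \<otimes>\<^bsub>A\<^esub> y) = f x \<otimes>\<^bsub>B\<^esub> f y}"

locale bilinear_algebra = module K A
  for K :: "('k, 'z) ring_scheme" and A :: "('k, 'a) module" +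
  assumes bilinear_mult: "bilinear_map K A A A (\<otimes>\<^bsub>A\<^esub>)"

locale leibniz_algebra = bilinear_algebra K P
  for K :: "('k, 'z) ring_scheme" and P :: "('k, 'a) module" +
  assumes leibniz_identity:
    "\<lbrakk>x \<in> carrier P; y \<in> carrier P; z \<in> carrier P\<rbrakk> \<Longrightarrow>
      (x \<otimes>\<^bsub>P\<^esub> y) \<otimes>\<^bsub>P\<^esub> z = x \<otimes>\<^bsub>P\<^esub> (y \<otimes>\<^bsub>P\<^esub> z) \<oplus>\<^bsub>P\<^esub> (x \<otimes>\<^bsub>P\<^esub> z) \<otimes>\<^bsub>P\<^esub> y"

text \<open>Associative algebras are not required to be unital (the kernels below are not).\<close>

locale assoc_algebra = bilinear_algebra K A
  for K :: "('k, 'z) ring_scheme" and A :: "('k, 'a) module" +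
  assumes mult_assoc:
    "\<lbrakk>x \<in> carrier A; y \<in> carrier A; z \<in> carrier A\<rbrakk> \<Longrightarrow>
      (x \<otimes>\<^bsub>A\<^esub> y) \<otimes>\<^bsub>A\<^esub> z = x \<otimes>\<^bsub>A\<^esub> (y \<otimes>\<^bsub>A\<^esub> z)"


section \<open>Crossed modules\<close>

text \<open>The data of a crossed module: a map \<open>bd\<close> from \<open>xtop\<close> to \<open>xbase\<close> and a left
  and a right action of \<open>xbase\<close> on \<open>xtop\<close>. The same record carries a bimodule over an
  algebra together with a bimodule map into that algebra.\<close>

record ('k, 'b, 'a) xmod =
  xtop :: "('k, 'b) module"
  xbase :: "('k, 'a) module"
  bd :: "'b \<Rightarrow> 'a"
  lact :: "'a \<Rightarrow> 'b \<Rightarrow> 'b"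
  ract :: "'b \<Rightarrow> 'a \<Rightarrow> 'b"

text \<open>For an action of \<open>P\<close> on \<open>Q\<close>, the brackets are \<open>[p, q] = L p q\<close> and \<open>[q, p] = R q p\<close>.\<close>

definition leibniz_action ::
    "('k, 'z) ring_scheme \<Rightarrow> ('k, 'p) module \<Rightarrow> ('k, 'q) module
      \<Rightarrow> ('p \<Rightarrow> 'q \<Rightarrow> 'q) \<Rightarrow> ('q \<Rightarrow> 'p \<Rightarrow> 'q) \<Rightarrow> bool" where
  "leibniz_action K P Q L R \<longleftrightarrow>
     bilinear_map K P Q Q L \<and> bilinear_map K Q P Q R \<and>
     (\<forall>p\<in>carrier P. \<forall>p'\<in>carrier P. \<forall>q\<in>carrier Q.
        R (R q p) p' = R q (p \<otimes>\<^bsub>P\<^esub> p') \<oplus>\<^bsub>Q\<^esub> R (R q p') p \<and>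
        R (L p q) p' = L p (R q p') \<oplus>\<^bsub>Q\<^esub> L (p \<otimes>\<^bsub>P\<^esub> p') q \<and>
        L (p \<otimes>\<^bsub>P\<^esub> p') q = L p (L p' q) \<oplus>\<^bsub>Q\<^esub> R (L p q) p') \<and>
     (\<forall>p\<in>carrier P. \<forall>q\<in>carrier Q. \<forall>q'\<in>carrier Q.
        L p q \<otimes>\<^bsub>Q\<^esub> q' = L p (q \<otimes>\<^bsub>Q\<^esub> q') \<oplus>\<^bsub>Q\<^esub> L p q' \<otimes>\<^bsub>Q\<^esub> q \<and>
        R q p \<otimes>\<^bsub>Q\<^esub> q' = q \<otimes>\<^bsub>Q\<^esub> L p q' \<oplus>\<^bsub>Q\<^esub> R (q \<otimes>\<^bsub>Q\<^esub> q') p \<and>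
        R (q \<otimes>\<^bsub>Q\<^esub> q') p = q \<otimes>\<^bsub>Q\<^esub> R q' p \<oplus>\<^bsub>Q\<^esub> R q p \<otimes>\<^bsub>Q\<^esub> q')"

definition leibniz_xmod :: "('k, 'z) ring_scheme \<Rightarrow> ('k, 'q, 'p) xmod \<Rightarrow> bool" where
  "leibniz_xmod K C \<longleftrightarrow>
     leibniz_algebra K (xtop C) \<and> leibniz_algebra K (xbase C) \<and>
     bd C \<in> alg_hom K (xtop C) (xbase C) \<and>
     leibniz_action K (xbase C) (xtop C) (lact C) (ract C) \<and>
     (\<forall>p\<in>carrier (xbase C). \<forall>q\<in>carrier (xtop C).
        bd C (lact C p q) = p \<otimes>\<^bsub>xbase C\<^esub> bd C q \<and>
        bd C (ract C q p) = bd C q \<otimes>\<^bsub>xbase C\<^esub> p) \<and>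
     (\<forall>q\<in>carrier (xtop C). \<forall>q'\<in>carrier (xtop C).
        lact C (bd C q) q' = q \<otimes>\<^bsub>xtop C\<^esub> q' \<and>
        ract C q (bd C q') = q \<otimes>\<^bsub>xtop C\<^esub> q')"

definition assoc_xmod :: "('k, 'z) ring_scheme \<Rightarrow> ('k, 'b, 'a) xmod \<Rightarrow> bool" where
  "assoc_xmod K C \<longleftrightarrow>
     assoc_algebra K (xtop C) \<and> assoc_algebra K (xbase C) \<and>
     bd C \<in> alg_hom K (xtop C) (xbase C) \<and>
     bilinear_map K (xbase C) (xtop C) (xtop C) (lact C) \<and>
     bilinear_map K (xtop C) (xbase C) (xtop C) (ract C) \<and>
     (\<forall>a\<in>carrier (xbase C). \<forall>a'\<in>carrier (xbase C). \<forall>b\<in>carrier (xtop C).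
        lact C (a \<otimes>\<^bsub>xbase C\<^esub> a') b = lact C a (lact C a' b) \<and>
        ract C b (a \<otimes>\<^bsub>xbase C\<^esub> a') = ract C (ract C b a) a' \<and>
        ract C (lact C a b) a' = lact C a (ract C b a')) \<and>
     (\<forall>a\<in>carrier (xbase C). \<forall>b\<in>carrier (xtop C). \<forall>b'\<in>carrier (xtop C).
        lact C a (b \<otimes>\<^bsub>xtop C\<^esub> b') = lact C a b \<otimes>\<^bsub>xtop C\<^esub> b' \<and>
        ract C b a \<otimes>\<^bsub>xtop C\<^esub> b' = b \<otimes>\<^bsub>xtop C\<^esub> lact C a b' \<and>
        ract C (b \<otimes>\<^bsub>xtop C\<^esub> b') a = b \<otimes>\<^bsub>xtop C\<^esub> ract C b' a) \<and>
     (\<forall>a\<in>carrier (xbase C). \<forall>b\<in>carrier (xtop C).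
        bd C (lact C a b) = a \<otimes>\<^bsub>xbase C\<^esub> bd C b \<and>
        bd C (ract C b a) = bd C b \<otimes>\<^bsub>xbase C\<^esub> a) \<and>
     (\<forall>b\<in>carrier (xtop C). \<forall>b'\<in>carrier (xtop C).
        lact C (bd C b) b' = b \<otimes>\<^bsub>xtop C\<^esub> b' \<and>
        ract C b (bd C b') = b \<otimes>\<^bsub>xtop C\<^esub> b')"

definition assoc_xmod_hom ::
    "('k, 'z) ring_scheme \<Rightarrow> ('k, 'b, 'a) xmod \<Rightarrow> ('k, 'd, 'c) xmod
      \<Rightarrow> (('b \<Rightarrow> 'd) \<times> ('a \<Rightarrow> 'c)) set" where
  "assoc_xmod_hom K C D = {(\<phi>, \<psi>).
     \<phi> \<in> alg_hom K (xtop C) (xtop D) \<and> \<psi> \<in> alg_hom K (xbase C) (xbase D) \<and>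
     (\<forall>b\<in>carrier (xtop C). \<psi> (bd C b) = bd D (\<phi> b)) \<and>
     (\<forall>a\<in>carrier (xbase C). \<forall>b\<in>carrier (xtop C).
        \<phi> (ract C b a) = ract D (\<phi> b) (\<psi> a) \<and>
        \<phi> (lact C a b) = lact D (\<psi> a) (\<phi> b))}"

definition assoc_xmod_isomorphic ::
    "('k, 'z) ring_scheme \<Rightarrow> ('k, 'b, 'a) xmod \<Rightarrow> ('k, 'd, 'c) xmod \<Rightarrow> bool" where
  "assoc_xmod_isomorphic K C D \<longleftrightarrow>
     assoc_xmod K C \<and> assoc_xmod K D \<and>
     (\<exists>\<phi> \<psi>. (\<phi>, \<psi>) \<in> assoc_xmod_hom K C D \<and>
        bij_betw \<phi> (carrier (xtop C)) (carrier (xtop D)) \<and>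
        bij_betw \<psi> (carrier (xbase C)) (carrier (xbase D)))"


section \<open>Spans, ideals and quotients\<close>

definition mod_span :: "('k, 'z) ring_scheme \<Rightarrow> ('k, 'a) module \<Rightarrow> 'a set \<Rightarrow> 'a set" where
  "mod_span K M S = \<Inter>{N. submodule N K M \<and> S \<subseteq> N}"

definition alg_ideal :: "('k, 'z) ring_scheme \<Rightarrow> ('k, 'a) module \<Rightarrow> 'a set \<Rightarrow> bool" where
  "alg_ideal K A I \<longleftrightarrow> submodule I K A \<and>
     (\<forall>a\<in>carrier A. \<forall>x\<in>I. a \<otimes>\<^bsub>A\<^esub> x \<in> I \<and> x \<otimes>\<^bsub>A\<^esub> a \<in> I)"

definition alg_idl :: "('k, 'z) ring_scheme \<Rightarrow> ('k, 'a) module \<Rightarrow> 'a set \<Rightarrow> 'a set" where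
  "alg_idl K A S = \<Inter>{I. alg_ideal K A I \<and> S \<subseteq> I}"

text \<open>The product of two subsets under a bilinear pairing, i.e. all finite sums of products; it
  is used both for products of ideals and for products of an ideal with a sub-bimodule.\<close>

definition prod_span ::
    "('k, 'z) ring_scheme \<Rightarrow> ('k, 'c) module \<Rightarrow> ('a \<Rightarrow> 'b \<Rightarrow> 'c) \<Rightarrow> 'a set \<Rightarrow> 'b set \<Rightarrow> 'c set" where
  "prod_span K M f A B = mod_span K M {f a b | a b. a \<in> A \<and> b \<in> B}"

text \<open>The carrier consists of cosets, as in \<^const>\<open>FactRing\<close>.\<close>

definition quot :: "('k, 'a) module \<Rightarrow> 'a set \<Rightarrow> ('k, 'a set) module" where
  "quot A I = \<lparr>carrier = a_rcosets\<^bsub>A\<^esub> I, mult = rcoset_mult A I, one = I +>\<^bsub>A\<^esub> \<one>\<^bsub>A\<^esub>,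
     zero = I, add = set_add A, smult = (\<lambda>k S. \<Union>x\<in>S. I +>\<^bsub>A\<^esub> (k \<odot>\<^bsub>A\<^esub> x))\<rparr>"

text \<open>The map induced on cosets by a map that is constant on each coset.\<close>

definition quot_lift :: "('a \<Rightarrow> 'b) \<Rightarrow> 'a set \<Rightarrow> 'b" where
  "quot_lift f S = the_elem (f ` S)"

definition xmod_quot :: "('k, 'b, 'a) xmod \<Rightarrow> 'b set \<Rightarrow> 'a set \<Rightarrow> ('k, 'b set, 'a set) xmod" where
  "xmod_quot C N I =
     \<lparr>xtop = quot (xtop C) N,
      xbase = quot (xbase C) I,
      bd = quot_lift (\<lambda>b. I +>\<^bsub>xbase C\<^esub> bd C b),
      lact = (\<lambda>S T. the_elem {N +>\<^bsub>xtop C\<^esub> lact C a b | a b. a \<in> S \<and> b \<in> T}),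
      ract = (\<lambda>T S. the_elem {N +>\<^bsub>xtop C\<^esub> ract C b a | a b. a \<in> S \<and> b \<in> T})\<rparr>"


section \<open>Free modules, free algebras, tensor products and tensor algebras\<close>

definition free_mod :: "('k, 'z) ring_scheme \<Rightarrow> 's set \<Rightarrow> ('k, 's \<Rightarrow> 'k) module" where
  "free_mod K S =
     \<lparr>carrier = {a. range a \<subseteq> carrier K \<and> finite {x. a x \<noteq> \<zero>\<^bsub>K\<^esub>} \<and> {x. a x \<noteq> \<zero>\<^bsub>K\<^esub>} \<subseteq> S},
      mult = undefined, one = undefined,
      zero = (\<lambda>x. \<zero>\<^bsub>K\<^esub>),
      add = (\<lambda>a b x. a x \<oplus>\<^bsub>K\<^esub> b x),
      smult = (\<lambda>k a x. k \<otimes>\<^bsub>K\<^esub> a x)\<rparr>"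

definition single :: "('k, 'z) ring_scheme \<Rightarrow> 's \<Rightarrow> 's \<Rightarrow> 'k" where
  "single K x = (\<lambda>y. if y = x then \<one>\<^bsub>K\<^esub> else \<zero>\<^bsub>K\<^esub>)"

definition lin_ext ::
    "('k, 'z) ring_scheme \<Rightarrow> ('k, 'a) module \<Rightarrow> ('s \<Rightarrow> 'a) \<Rightarrow> ('s \<Rightarrow> 'k) \<Rightarrow> 'a" where
  "lin_ext K N f a = (\<Oplus>\<^bsub>N\<^esub>x\<in>{x. a x \<noteq> \<zero>\<^bsub>K\<^esub>}. a x \<odot>\<^bsub>N\<^esub> f x)"

text \<open>The free unital associative algebra: the free module on the words over \<open>S\<close>, with the
  product induced by concatenation.\<close>

definition free_alg :: "('k, 'z) ring_scheme \<Rightarrow> 's set \<Rightarrow> ('k, 's list \<Rightarrow> 'k) module" where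
  "free_alg K S = (free_mod K (lists S))
     \<lparr>mult := (\<lambda>a b w. \<Oplus>\<^bsub>K\<^esub>i\<in>{..length w}. a (take i w) \<otimes>\<^bsub>K\<^esub> b (drop i w)),
      one := single K []\<rparr>"

definition word_val :: "('k, 'a) module \<Rightarrow> ('s \<Rightarrow> 'a) \<Rightarrow> 's list \<Rightarrow> 'a" where
  "word_val A f w = foldr (\<lambda>x y. f x \<otimes>\<^bsub>A\<^esub> y) w \<one>\<^bsub>A\<^esub>"

definition tensor_ideal ::
    "('k, 'z) ring_scheme \<Rightarrow> ('k, 'a) module \<Rightarrow> ('a list \<Rightarrow> 'k) set" where
  "tensor_ideal K M = (let F = free_alg K (carrier M); e = (\<lambda>x. single K [x]) in
     alg_idl K F
       ({e (x \<oplus>\<^bsub>M\<^esub> y) \<ominus>\<^bsub>F\<^esub> (e x \<oplus>\<^bsub>F\<^esub> e y) | x y. x \<in> carrier M \<and> y \<in> carrier M} \<union>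
        {e (k \<odot>\<^bsub>M\<^esub> x) \<ominus>\<^bsub>F\<^esub> k \<odot>\<^bsub>F\<^esub> e x | k x. k \<in> carrier K \<and> x \<in> carrier M}))"

text \<open>The tensor algebra \<open>T(M)\<close>: the free algebra on the set \<open>M\<close>, modulo linearity of the
  generators.\<close>

definition tensor_alg ::
    "('k, 'z) ring_scheme \<Rightarrow> ('k, 'a) module \<Rightarrow> ('k, ('a list \<Rightarrow> 'k) set) module" where
  "tensor_alg K M = quot (free_alg K (carrier M)) (tensor_ideal K M)"

definition tensor_gen ::
    "('k, 'z) ring_scheme \<Rightarrow> ('k, 'a) module \<Rightarrow> 'a \<Rightarrow> ('a list \<Rightarrow> 'k) set" where
  "tensor_gen K M x = tensor_ideal K M +>\<^bsub>free_alg K (carrier M)\<^esub> single K [x]"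

text \<open>The unital algebra morphism \<open>T(M) \<rightarrow> A\<close> extending a linear map \<open>f : M \<rightarrow> A\<close>.\<close>

definition tensor_alg_lift ::
    "('k, 'z) ring_scheme \<Rightarrow> ('k, 'b) module \<Rightarrow> ('a \<Rightarrow> 'b) \<Rightarrow> ('a list \<Rightarrow> 'k) set \<Rightarrow> 'b" where
  "tensor_alg_lift K A f = quot_lift (lin_ext K A (word_val A f))"

definition tprod_rel ::
    "('k, 'z) ring_scheme \<Rightarrow> ('k, 'a) module \<Rightarrow> ('k, 'b) module \<Rightarrow> ('a \<times> 'b \<Rightarrow> 'k) set" where
  "tprod_rel K M N = (let F = free_mod K (carrier M \<times> carrier N); e = (\<lambda>x y. single K (x, y)) in
     mod_span K F
       ({e (x \<oplus>\<^bsub>M\<^esub> x') y \<ominus>\<^bsub>F\<^esub> (e x y \<oplus>\<^bsub>F\<^esub> e x' y) | x x' y.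
            x \<in> carrier M \<and> x' \<in> carrier M \<and> y \<in> carrier N} \<union>
        {e x (y \<oplus>\<^bsub>N\<^esub> y') \<ominus>\<^bsub>F\<^esub> (e x y \<oplus>\<^bsub>F\<^esub> e x y') | x y y'.
            x \<in> carrier M \<and> y \<in> carrier N \<and> y' \<in> carrier N} \<union>
        {e (k \<odot>\<^bsub>M\<^esub> x) y \<ominus>\<^bsub>F\<^esub> k \<odot>\<^bsub>F\<^esub> e x y | k x y.
            k \<in> carrier K \<and> x \<in> carrier M \<and> y \<in> carrier N} \<union>
        {e x (k \<odot>\<^bsub>N\<^esub> y) \<ominus>\<^bsub>F\<^esub> k \<odot>\<^bsub>F\<^esub> e x y | k x y.
            k \<in> carrier K \<and> x \<in> carrier M \<and> y \<in> carrier N}))"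

definition tprod ::
    "('k, 'z) ring_scheme \<Rightarrow> ('k, 'a) module \<Rightarrow> ('k, 'b) module
      \<Rightarrow> ('k, ('a \<times> 'b \<Rightarrow> 'k) set) module" where
  "tprod K M N = quot (free_mod K (carrier M \<times> carrier N)) (tprod_rel K M N)"

definition pure_tensor ::
    "('k, 'z) ring_scheme \<Rightarrow> ('k, 'a) module \<Rightarrow> ('k, 'b) module \<Rightarrow> 'a \<Rightarrow> 'b
      \<Rightarrow> ('a \<times> 'b \<Rightarrow> 'k) set" where
  "pure_tensor K M N x y =
     tprod_rel K M N +>\<^bsub>free_mod K (carrier M \<times> carrier N)\<^esub> single K (x, y)"

text \<open>The linear map \<open>M \<otimes> N \<rightarrow> L\<close> induced by a bilinear map \<open>f\<close>.\<close>

definition tprod_lift ::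
    "('k, 'z) ring_scheme \<Rightarrow> ('k, 'c) module \<Rightarrow> ('a \<Rightarrow> 'b \<Rightarrow> 'c) \<Rightarrow> ('a \<times> 'b \<Rightarrow> 'k) set \<Rightarrow> 'c" where
  "tprod_lift K L f = quot_lift (lin_ext K L (\<lambda>(x, y). f x y))"

text \<open>The map \<open>f \<otimes> g\<close> with codomain \<open>M' \<otimes> N'\<close>.\<close>

definition tprod_map ::
    "('k, 'z) ring_scheme \<Rightarrow> ('k, 'c) module \<Rightarrow> ('k, 'd) module \<Rightarrow> ('a \<Rightarrow> 'c) \<Rightarrow> ('b \<Rightarrow> 'd)
      \<Rightarrow> ('a \<times> 'b \<Rightarrow> 'k) set \<Rightarrow> ('c \<times> 'd \<Rightarrow> 'k) set" where
  "tprod_map K M' N' f g =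
     tprod_lift K (tprod K M' N') (\<lambda>x y. pure_tensor K M' N' (f x) (g y))"

definition dsum :: "('k, 'a) module \<Rightarrow> ('k, 'b) module \<Rightarrow> ('k, 'a \<times> 'b) module" where
  "dsum M N =
     \<lparr>carrier = carrier M \<times> carrier N,
      mult = undefined, one = undefined,
      zero = (\<zero>\<^bsub>M\<^esub>, \<zero>\<^bsub>N\<^esub>),
      add = (\<lambda>(x, y) (x', y'). (x \<oplus>\<^bsub>M\<^esub> x', y \<oplus>\<^bsub>N\<^esub> y')),
      smult = (\<lambda>k (x, y). (k \<odot>\<^bsub>M\<^esub> x, k \<odot>\<^bsub>N\<^esub> y))\<rparr>"


section \<open>Enveloping algebras\<close>

text \<open>The morphism induced by a linear map \<open>f : M \<rightarrow> A\<close> on a quotient of \<open>T(M)\<close>.\<close>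

definition env_lift ::
    "('k, 'z) ring_scheme \<Rightarrow> ('k, 'b) module \<Rightarrow> ('a \<Rightarrow> 'b) \<Rightarrow> ('a list \<Rightarrow> 'k) set set \<Rightarrow> 'b" where
  "env_lift K A f = quot_lift (tensor_alg_lift K A f)"

text \<open>\<open>UL(P)\<close>: the two copies \<open>P\<^sup>l\<close> and \<open>P\<^sup>r\<close> are the first and the second summand of
  \<open>P \<oplus> P\<close>.\<close>

definition UL_ideal ::
    "('k, 'z) ring_scheme \<Rightarrow> ('k, 'p) module \<Rightarrow> (('p \<times> 'p) list \<Rightarrow> 'k) set set" where
  "UL_ideal K P = (let T = tensor_alg K (dsum P P);
       l = (\<lambda>x. tensor_gen K (dsum P P) (x, \<zero>\<^bsub>P\<^esub>));
       r = (\<lambda>x. tensor_gen K (dsum P P) (\<zero>\<^bsub>P\<^esub>, x)) in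
     alg_idl K T
       ({r (x \<otimes>\<^bsub>P\<^esub> y) \<ominus>\<^bsub>T\<^esub> (r x \<otimes>\<^bsub>T\<^esub> r y \<ominus>\<^bsub>T\<^esub> r y \<otimes>\<^bsub>T\<^esub> r x) | x y.
            x \<in> carrier P \<and> y \<in> carrier P} \<union>
        {l (x \<otimes>\<^bsub>P\<^esub> y) \<ominus>\<^bsub>T\<^esub> (l x \<otimes>\<^bsub>T\<^esub> r y \<ominus>\<^bsub>T\<^esub> r y \<otimes>\<^bsub>T\<^esub> l x) | x y.
            x \<in> carrier P \<and> y \<in> carrier P} \<union>
        {(r y \<oplus>\<^bsub>T\<^esub> l y) \<otimes>\<^bsub>T\<^esub> l x | x y. x \<in> carrier P \<and> y \<in> carrier P}))"

definition UL ::
    "('k, 'z) ring_scheme \<Rightarrow> ('k, 'p) module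
      \<Rightarrow> ('k, (('p \<times> 'p) list \<Rightarrow> 'k) set set) module" where
  "UL K P = quot (tensor_alg K (dsum P P)) (UL_ideal K P)"

definition UL_gen ::
    "('k, 'z) ring_scheme \<Rightarrow> ('k, 'p) module \<Rightarrow> 'p \<times> 'p \<Rightarrow> (('p \<times> 'p) list \<Rightarrow> 'k) set set" where
  "UL_gen K P v = UL_ideal K P +>\<^bsub>tensor_alg K (dsum P P)\<^esub> tensor_gen K (dsum P P) v"

text \<open>\<open>UL(f)\<close> for a morphism \<open>f\<close> with codomain \<open>P'\<close>.\<close>

definition UL_map ::
    "('k, 'z) ring_scheme \<Rightarrow> ('k, 'b) module \<Rightarrow> ('a \<Rightarrow> 'b)
      \<Rightarrow> (('a \<times> 'a) list \<Rightarrow> 'k) set set \<Rightarrow> (('b \<times> 'b) list \<Rightarrow> 'k) set set" where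
  "UL_map K P' f = env_lift K (UL K P') (\<lambda>(x, y). UL_gen K P' (f x, f y))"

definition U_ideal ::
    "('k, 'z) ring_scheme \<Rightarrow> ('k, 'l) module \<Rightarrow> ('l list \<Rightarrow> 'k) set set" where
  "U_ideal K L = (let T = tensor_alg K L; e = tensor_gen K L in
     alg_idl K T
       {e (x \<otimes>\<^bsub>L\<^esub> y) \<ominus>\<^bsub>T\<^esub> (e x \<otimes>\<^bsub>T\<^esub> e y \<ominus>\<^bsub>T\<^esub> e y \<otimes>\<^bsub>T\<^esub> e x) | x y.
          x \<in> carrier L \<and> y \<in> carrier L})"

definition U ::
    "('k, 'z) ring_scheme \<Rightarrow> ('k, 'l) module \<Rightarrow> ('k, ('l list \<Rightarrow> 'k) set set) module" where
  "U K L = quot (tensor_alg K L) (U_ideal K L)"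

definition U_gen ::
    "('k, 'z) ring_scheme \<Rightarrow> ('k, 'l) module \<Rightarrow> 'l \<Rightarrow> ('l list \<Rightarrow> 'k) set set" where
  "U_gen K L x = U_ideal K L +>\<^bsub>tensor_alg K L\<^esub> tensor_gen K L x"

definition U_map ::
    "('k, 'z) ring_scheme \<Rightarrow> ('k, 'b) module \<Rightarrow> ('a \<Rightarrow> 'b)
      \<Rightarrow> ('a list \<Rightarrow> 'k) set set \<Rightarrow> ('b list \<Rightarrow> 'k) set set" where
  "U_map K L' f = env_lift K (U K L') (\<lambda>x. U_gen K L' (f x))"

text \<open>The bimodule \<open>U(L) \<otimes> V\<close> with its bimodule map to \<open>U(L)\<close>, for a right representation
  \<open>act\<close> of \<open>L\<close> on \<open>V\<close> and an equivariant map \<open>\<alpha> : V \<rightarrow> L\<close>.\<close>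

definition U_tensor_lact ::
    "('k, 'z) ring_scheme \<Rightarrow> ('k, 'l) module \<Rightarrow> ('k, 'v) module
      \<Rightarrow> ('l list \<Rightarrow> 'k) set set
      \<Rightarrow> (('l list \<Rightarrow> 'k) set set \<times> 'v \<Rightarrow> 'k) set
      \<Rightarrow> (('l list \<Rightarrow> 'k) set set \<times> 'v \<Rightarrow> 'k) set" where
  "U_tensor_lact K L V u = tprod_lift K (tprod K (U K L) V)
     (\<lambda>x v. pure_tensor K (U K L) V (u \<otimes>\<^bsub>U K L\<^esub> x) v)"

definition U_tensor_ract_gen ::
    "('k, 'z) ring_scheme \<Rightarrow> ('k, 'l) module \<Rightarrow> ('k, 'v) module \<Rightarrow> ('v \<Rightarrow> 'l \<Rightarrow> 'v)
      \<Rightarrow> (('l list \<Rightarrow> 'k) set set \<times> 'v \<Rightarrow> 'k) set \<Rightarrow> 'l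
      \<Rightarrow> (('l list \<Rightarrow> 'k) set set \<times> 'v \<Rightarrow> 'k) set" where
  "U_tensor_ract_gen K L V act m g = tprod_lift K (tprod K (U K L) V)
     (\<lambda>x v. pure_tensor K (U K L) V (x \<otimes>\<^bsub>U K L\<^esub> U_gen K L g) v
            \<oplus>\<^bsub>tprod K (U K L) V\<^esub> pure_tensor K (U K L) V x (act v g)) m"

text \<open>A word \<open>g\<^sub>1 \<dots> g\<^sub>n\<close> acts from the right by \<open>g\<^sub>1\<close> first and \<open>g\<^sub>n\<close> last; the two
  \<^const>\<open>quot_lift\<close> descend from the free algebra to \<open>T(L)\<close> and then to \<open>U(L)\<close>.\<close>

definition U_tensor_ract ::
    "('k, 'z) ring_scheme \<Rightarrow> ('k, 'l) module \<Rightarrow> ('k, 'v) module \<Rightarrow> ('v \<Rightarrow> 'l \<Rightarrow> 'v)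
      \<Rightarrow> (('l list \<Rightarrow> 'k) set set \<times> 'v \<Rightarrow> 'k) set
      \<Rightarrow> ('l list \<Rightarrow> 'k) set set
      \<Rightarrow> (('l list \<Rightarrow> 'k) set set \<times> 'v \<Rightarrow> 'k) set" where
  "U_tensor_ract K L V act m =
     quot_lift (quot_lift (lin_ext K (tprod K (U K L) V)
       (\<lambda>w. foldl (U_tensor_ract_gen K L V act) m w)))"

definition U_tensor_map ::
    "('k, 'z) ring_scheme \<Rightarrow> ('k, 'l) module \<Rightarrow> ('v \<Rightarrow> 'l)
      \<Rightarrow> (('l list \<Rightarrow> 'k) set set \<times> 'v \<Rightarrow> 'k) set \<Rightarrow> ('l list \<Rightarrow> 'k) set set" where
  "U_tensor_map K L \<alpha> = tprod_lift K (U K L) (\<lambda>x v. x \<otimes>\<^bsub>U K L\<^esub> U_gen K L (\<alpha> v))"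

definition LM_env ::
    "('k, 'z) ring_scheme \<Rightarrow> ('k, 'l) module \<Rightarrow> ('k, 'v) module \<Rightarrow> ('v \<Rightarrow> 'l \<Rightarrow> 'v) \<Rightarrow> ('v \<Rightarrow> 'l)
      \<Rightarrow> ('k, (('l list \<Rightarrow> 'k) set set \<times> 'v \<Rightarrow> 'k) set, ('l list \<Rightarrow> 'k) set set) xmod" where
  "LM_env K L V act \<alpha> =
     \<lparr>xtop = tprod K (U K L) V, xbase = U K L, bd = U_tensor_map K L \<alpha>,
      lact = U_tensor_lact K L V, ract = U_tensor_ract K L V act\<rparr>"

text \<open>The associative algebra \<open>A \<oplus> R\<close> of a bimodule map \<open>\<alpha> : A \<rightarrow> R\<close>.\<close>

definition LM_sum_alg :: "('k, 'b, 'a) xmod \<Rightarrow> ('k, 'b \<times> 'a) module" where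
  "LM_sum_alg C = (dsum (xtop C) (xbase C))
     \<lparr>mult := (\<lambda>(a, r) (a', r').
         (lact C (bd C a) a' \<oplus>\<^bsub>xtop C\<^esub> ract C a r' \<oplus>\<^bsub>xtop C\<^esub> lact C r a', r \<otimes>\<^bsub>xbase C\<^esub> r')),
      one := (\<zero>\<^bsub>xtop C\<^esub>, \<one>\<^bsub>xbase C\<^esub>)\<rparr>"


section \<open>The crossed module XUL\<close>

definition semidirect :: "('k, 'q, 'p) xmod \<Rightarrow> ('k, 'q \<times> 'p) module" where
  "semidirect C = (dsum (xtop C) (xbase C))
     \<lparr>mult := (\<lambda>(q1, p1) (q2, p2).
        (q1 \<otimes>\<^bsub>xtop C\<^esub> q2 \<oplus>\<^bsub>xtop C\<^esub> lact C p1 q2 \<oplus>\<^bsub>xtop C\<^esub> ract C q1 p2, p1 \<otimes>\<^bsub>xbase C\<^esub> p2))\<rparr>"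

definition s_map :: "'q \<times> 'p \<Rightarrow> 'p" where
  "s_map = (\<lambda>(q, p). p)"

definition t_map :: "('k, 'q, 'p) xmod \<Rightarrow> 'q \<times> 'p \<Rightarrow> 'p" where
  "t_map C = (\<lambda>(q, p). bd C q \<oplus>\<^bsub>xbase C\<^esub> p)"

definition i_map :: "('k, 'q, 'p) xmod \<Rightarrow> 'p \<Rightarrow> 'q \<times> 'p" where
  "i_map C p = (\<zero>\<^bsub>xtop C\<^esub>, p)"

definition XUL_ideal ::
    "('k, 'z) ring_scheme \<Rightarrow> ('k, 'q, 'p) xmod
      \<Rightarrow> ((('q \<times> 'p) \<times> ('q \<times> 'p)) list \<Rightarrow> 'k) set set set" where
  "XUL_ideal K C =
     (let E = UL K (semidirect C);
          Ks = a_kernel E (UL K (xbase C)) (UL_map K (xbase C) s_map);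
          Kt = a_kernel E (UL K (xbase C)) (UL_map K (xbase C) (t_map C))
      in prod_span K E (\<otimes>\<^bsub>E\<^esub>) Ks Kt <+>\<^bsub>E\<^esub> prod_span K E (\<otimes>\<^bsub>E\<^esub>) Kt Ks)"

definition UL_bar ::
    "('k, 'z) ring_scheme \<Rightarrow> ('k, 'q, 'p) xmod
      \<Rightarrow> ('k, ((('q \<times> 'p) \<times> ('q \<times> 'p)) list \<Rightarrow> 'k) set set set) module" where
  "UL_bar K C = quot (UL K (semidirect C)) (XUL_ideal K C)"

definition XUL ::
    "('k, 'z) ring_scheme \<Rightarrow> ('k, 'q, 'p) xmod
      \<Rightarrow> ('k, ((('q \<times> 'p) \<times> ('q \<times> 'p)) list \<Rightarrow> 'k) set set set,
              (('p \<times> 'p) list \<Rightarrow> 'k) set set) xmod" where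
  "XUL K C =
     (let E = UL_bar K C;
          s = quot_lift (UL_map K (xbase C) s_map);
          t = quot_lift (UL_map K (xbase C) (t_map C));
          j = (\<lambda>a. XUL_ideal K C +>\<^bsub>UL K (semidirect C)\<^esub>
                     UL_map K (semidirect C) (i_map C) a)
      in \<lparr>xtop = E\<lparr>carrier := a_kernel E (UL K (xbase C)) s\<rparr>,
          xbase = UL K (xbase C),
          bd = t,
          lact = (\<lambda>a b. j a \<otimes>\<^bsub>E\<^esub> b),
          ract = (\<lambda>b a. b \<otimes>\<^bsub>E\<^esub> j a)\<rparr>)"


section \<open>The crossed module coming from linear maps\<close>

definition lie_ideal :: "('k, 'z) ring_scheme \<Rightarrow> ('k, 'p) module \<Rightarrow> 'p set" where
  "lie_ideal K P = alg_idl K P {p \<otimes>\<^bsub>P\<^esub> p | p. p \<in> carrier P}"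

definition Lie :: "('k, 'z) ring_scheme \<Rightarrow> ('k, 'p) module \<Rightarrow> ('k, 'p set) module" where
  "Lie K P = quot P (lie_ideal K P)"

definition lie_class :: "('k, 'z) ring_scheme \<Rightarrow> ('k, 'p) module \<Rightarrow> 'p \<Rightarrow> 'p set" where
  "lie_class K P p = lie_ideal K P +>\<^bsub>P\<^esub> p"

text \<open>The ideal \<open>[\<qq>, \<pp>]\<^sub>x\<close> of \<open>Lie(\<qq>)\<close>, the Lie algebra \<open>\<hh> = Lie(\<qq>)/[\<qq>, \<pp>]\<^sub>x\<close>, and the
  quotient map \<open>\<qq> \<rightarrow> \<hh>\<close>.\<close>

definition cross_ideal :: "('k, 'z) ring_scheme \<Rightarrow> ('k, 'q, 'p) xmod \<Rightarrow> 'q set set" where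
  "cross_ideal K C = alg_idl K (Lie K (xtop C))
     {lie_class K (xtop C) (ract C q p \<oplus>\<^bsub>xtop C\<^esub> lact C p q) | q p.
        q \<in> carrier (xtop C) \<and> p \<in> carrier (xbase C)}"

definition lie_top ::
    "('k, 'z) ring_scheme \<Rightarrow> ('k, 'q, 'p) xmod \<Rightarrow> ('k, 'q set set) module" where
  "lie_top K C = quot (Lie K (xtop C)) (cross_ideal K C)"

definition lie_top_class ::
    "('k, 'z) ring_scheme \<Rightarrow> ('k, 'q, 'p) xmod \<Rightarrow> 'q \<Rightarrow> 'q set set" where
  "lie_top_class K C q = cross_ideal K C +>\<^bsub>Lie K (xtop C)\<^esub> lie_class K (xtop C) q"

definition lie_ract ::
    "('k, 'z) ring_scheme \<Rightarrow> ('k, 'q, 'p) xmod \<Rightarrow> 'q set set \<Rightarrow> 'p set \<Rightarrow> 'q set set" where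
  "lie_ract K C h g = the_elem {lie_top_class K C (ract C q p) | q p.
     q \<in> carrier (xtop C) \<and> p \<in> carrier (xbase C) \<and>
     lie_top_class K C q = h \<and> lie_class K (xbase C) p = g}"

text \<open>The Lie crossed module \<open>\<hh> \<rightarrow> \<gg>\<close>. The left action is minus the right one, so that
  \<^const>\<open>semidirect\<close> yields the bracket \<open>([h,h'] + [h,g'] - [h',g], [g,g'])\<close>.\<close>

definition lie_xmod ::
    "('k, 'z) ring_scheme \<Rightarrow> ('k, 'q, 'p) xmod \<Rightarrow> ('k, 'q set set, 'p set) xmod" where
  "lie_xmod K C =
     \<lparr>xtop = lie_top K C,
      xbase = Lie K (xbase C),
      bd = (\<lambda>h. the_elem {lie_class K (xbase C) (bd C q) | q.
                  q \<in> carrier (xtop C) \<and> lie_top_class K C q = h}),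
      lact = (\<lambda>g h. \<ominus>\<^bsub>lie_top K C\<^esub> lie_ract K C h g),
      ract = lie_ract K C\<rparr>"

text \<open>The right representation of \<open>\<gg>\<close> on \<open>\<pp>\<close>, and that of \<open>\<hh> \<rtimes> \<gg>\<close> on the module
  \<open>\<qq> \<oplus> \<pp>\<close>. In the latter, \<open>[(q,p), (q',p')] = ([q,q'] + [q,p'] + [p,q'], [p,p'])\<close> is the
  product of \<^const>\<open>semidirect\<close>.\<close>

definition base_rep ::
    "('k, 'z) ring_scheme \<Rightarrow> ('k, 'q, 'p) xmod \<Rightarrow> 'p \<Rightarrow> 'p set \<Rightarrow> 'p" where
  "base_rep K C p g = the_elem {p \<otimes>\<^bsub>xbase C\<^esub> p' | p'.
     p' \<in> carrier (xbase C) \<and> lie_class K (xbase C) p' = g}"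

definition semi_rep ::
    "('k, 'z) ring_scheme \<Rightarrow> ('k, 'q, 'p) xmod \<Rightarrow> 'q \<times> 'p \<Rightarrow> 'q set set \<times> 'p set \<Rightarrow> 'q \<times> 'p" where
  "semi_rep K C v = (\<lambda>(h, g). the_elem {v \<otimes>\<^bsub>semidirect C\<^esub> (q', p') | q' p'.
     q' \<in> carrier (xtop C) \<and> p' \<in> carrier (xbase C) \<and>
     lie_top_class K C q' = h \<and> lie_class K (xbase C) p' = g})"

definition semi_class ::
    "('k, 'z) ring_scheme \<Rightarrow> ('k, 'q, 'p) xmod \<Rightarrow> 'q \<times> 'p \<Rightarrow> 'q set set \<times> 'p set" where
  "semi_class K C = (\<lambda>(q, p). (lie_top_class K C q, lie_class K (xbase C) p))"

text \<open>\<open>U(\<gg>) \<otimes> \<pp> \<rightarrow> U(\<gg>)\<close> and \<open>U(\<hh> \<rtimes> \<gg>) \<otimes> (\<qq> \<oplus> \<pp>) \<rightarrow> U(\<hh> \<rtimes> \<gg>)\<close>.\<close>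

definition env0 ::
    "('k, 'z) ring_scheme \<Rightarrow> ('k, 'q, 'p) xmod
      \<Rightarrow> ('k, (('p set list \<Rightarrow> 'k) set set \<times> 'p \<Rightarrow> 'k) set, ('p set list \<Rightarrow> 'k) set set) xmod" where
  "env0 K C = LM_env K (Lie K (xbase C)) (xbase C) (base_rep K C) (lie_class K (xbase C))"

definition env1 ::
    "('k, 'z) ring_scheme \<Rightarrow> ('k, 'q, 'p) xmod
      \<Rightarrow> ('k, ((('q set set \<times> 'p set) list \<Rightarrow> 'k) set set \<times> ('q \<times> 'p) \<Rightarrow> 'k) set,
              (('q set set \<times> 'p set) list \<Rightarrow> 'k) set set) xmod" where
  "env1 K C =
     LM_env K (semidirect (lie_xmod K C)) (semidirect C) (semi_rep K C) (semi_class K C)"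

text \<open>\<open>U(s\<^sub>2), U(t\<^sub>2)\<close>, \<open>U(s\<^sub>1) = U(s\<^sub>2) \<otimes> s\<^sub>1\<close>, \<open>U(t\<^sub>1) = U(t\<^sub>2) \<otimes> t\<^sub>1\<close>, and, in the opposite
  direction, the maps induced by \<open>p \<mapsto> (0,p)\<close> and \<open>g \<mapsto> (0,g)\<close>.\<close>

definition Us2 where
  "Us2 K C = U_map K (Lie K (xbase C)) (s_map :: 'q set set \<times> 'p set \<Rightarrow> 'p set)"
  for K :: "('k, 'z) ring_scheme" and C :: "('k, 'q, 'p) xmod"

definition Ut2 where
  "Ut2 K C = U_map K (Lie K (xbase C)) (t_map (lie_xmod K C))"
  for K :: "('k, 'z) ring_scheme" and C :: "('k, 'q, 'p) xmod"

definition Us1 where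
  "Us1 K C = tprod_map K (U K (Lie K (xbase C))) (xbase C) (Us2 K C) (s_map :: 'q \<times> 'p \<Rightarrow> 'p)"
  for K :: "('k, 'z) ring_scheme" and C :: "('k, 'q, 'p) xmod"

definition Ut1 where
  "Ut1 K C = tprod_map K (U K (Lie K (xbase C))) (xbase C) (Ut2 K C) (t_map C)"
  for K :: "('k, 'z) ring_scheme" and C :: "('k, 'q, 'p) xmod"

definition Ui2 where
  "Ui2 K C = U_map K (semidirect (lie_xmod K C)) (i_map (lie_xmod K C))"
  for K :: "('k, 'z) ring_scheme" and C :: "('k, 'q, 'p) xmod"

definition Ui1 where
  "Ui1 K C = tprod_map K (U K (semidirect (lie_xmod K C))) (semidirect C) (Ui2 K C) (i_map C)"
  for K :: "('k, 'z) ring_scheme" and C :: "('k, 'q, 'p) xmod"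

definition X_ideal where
  "X_ideal K C =
     (let A = xbase (env1 K C);
          Ks2 = a_kernel A (xbase (env0 K C)) (Us2 K C);
          Kt2 = a_kernel A (xbase (env0 K C)) (Ut2 K C)
      in prod_span K A (\<otimes>\<^bsub>A\<^esub>) Ks2 Kt2 <+>\<^bsub>A\<^esub> prod_span K A (\<otimes>\<^bsub>A\<^esub>) Kt2 Ks2)"
  for K :: "('k, 'z) ring_scheme" and C :: "('k, 'q, 'p) xmod"

definition Y_ideal where
  "Y_ideal K C =
     (let A = xbase (env1 K C); M = xtop (env1 K C);
          l = lact (env1 K C); r = ract (env1 K C);
          Ks1 = a_kernel M (xtop (env0 K C)) (Us1 K C);
          Kt1 = a_kernel M (xtop (env0 K C)) (Ut1 K C);
          Ks2 = a_kernel A (xbase (env0 K C)) (Us2 K C);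
          Kt2 = a_kernel A (xbase (env0 K C)) (Ut2 K C)
      in prod_span K M r Ks1 Kt2 <+>\<^bsub>M\<^esub> prod_span K M l Ks2 Kt1
         <+>\<^bsub>M\<^esub> prod_span K M r Kt1 Ks2 <+>\<^bsub>M\<^esub> prod_span K M l Kt2 Ks1)"
  for K :: "('k, 'z) ring_scheme" and C :: "('k, 'q, 'p) xmod"

definition E0 where
  "E0 K C = LM_sum_alg (env0 K C)"
  for K :: "('k, 'z) ring_scheme" and C :: "('k, 'q, 'p) xmod"

definition env1_bar where
  "env1_bar K C = xmod_quot (env1 K C) (Y_ideal K C) (X_ideal K C)"
  for K :: "('k, 'z) ring_scheme" and C :: "('k, 'q, 'p) xmod"

definition E1 where
  "E1 K C = LM_sum_alg (env1_bar K C)"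
  for K :: "('k, 'z) ring_scheme" and C :: "('k, 'q, 'p) xmod"

definition E0_to_E1 where
  "E0_to_E1 K C = (\<lambda>(a, r). (Y_ideal K C +>\<^bsub>xtop (env1 K C)\<^esub> Ui1 K C a,
                             X_ideal K C +>\<^bsub>xbase (env1 K C)\<^esub> Ui2 K C r))"
  for K :: "('k, 'z) ring_scheme" and C :: "('k, 'q, 'p) xmod"

definition LM_xmod where
  "LM_xmod K C =
     (let E = E1 K C; j = E0_to_E1 K C;
          s1 = quot_lift (Us1 K C); t1 = quot_lift (Ut1 K C);
          s2 = quot_lift (Us2 K C); t2 = quot_lift (Ut2 K C)
      in \<lparr>xtop = E\<lparr>carrier := a_kernel (xtop (env1_bar K C)) (xtop (env0 K C)) s1
                          \<times> a_kernel (xbase (env1_bar K C)) (xbase (env0 K C)) s2\<rparr>,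
          xbase = E0 K C,
          bd = (\<lambda>(a, r). (t1 a, t2 r)),
          lact = (\<lambda>e b. j e \<otimes>\<^bsub>E\<^esub> b),
          ract = (\<lambda>b e. b \<otimes>\<^bsub>E\<^esub> j e)\<rparr>)"
  for K :: "('k, 'z) ring_scheme" and C :: "('k, 'q, 'p) xmod"

end

theory Submission
  imports Defs
begin

text \<open>
  For a Leibniz algebra \<open>P\<close> with Lie quotient \<open>L\<close>, the elements \<open>x\<^sub>r\<close> generate an image of \<open>U(L)\<close> in
  \<open>UL(P)\<close>, and the relations \<open>x\<^sub>l y\<^sub>r = [x,y]\<^sub>l + y\<^sub>r x\<^sub>l\<close> and \<open>y\<^sub>l x\<^sub>l = - y\<^sub>r x\<^sub>l\<close> show that the
  remaining elements are spanned by the products \<open>u v\<^sub>l\<close> with \<open>u \<in> U(L)\<close>. Hence the map \<open>iota\<close> from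
  \<open>(U(L) \<otimes> P) \<oplus> U(L)\<close> to \<open>UL(P)\<close> with \<open>u \<otimes> v \<mapsto> - u v\<^sub>l\<close> on the first summand is onto. It is injective over
  every commutative ring: \<open>UL(P)\<close> acts from the right on \<open>(U(L) \<otimes> P) \<oplus> U(L)\<close> by
  \<open>(a,u) x\<^sub>r = (a x, u x)\<close> and \<open>(a,u) x\<^sub>l = (- (\<alpha>(a) + u) \<otimes> x, 0)\<close>, and acting on \<open>(0,1)\<close> inverts \<open>iota\<close>.

  This isomorphism is multiplicative and natural in \<open>P\<close>. For \<open>\<qq> \<rtimes> \<pp>\<close>, whose Lie quotient is
  \<open>\<hh> \<rtimes> \<gg>\<close>, it identifies the kernels of \<open>s\<close> and \<open>t\<close> on both sides, therefore \<open>\<Y>' \<oplus> \<X>'\<close> with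
  \<open>\<X>\<close>, and induces \<open>E\<^sub>1 \<cong> UL(\<qq> \<rtimes> \<pp>)/\<X>\<close>. The crossed module axioms need a proof only for
  \<open>XUL\<close>, where they amount to \<open>i(t(b)) - b \<in> Ker t\<close>; they pass to the other side along the
  isomorphism.
\<close>

subsection \<open>Submodules, bilinear maps and ideals\<close>

text \<open>The formula for \<open>x\<^sub>l\<close> has a source: in
  \<open>(U(L) \<otimes> P) \<oplus> U(L)\<close> the elements \<open>x\<^sub>r\<close> and
  \<open>x\<^sub>l\<close> must be \<open>(0, x)\<close> and \<open>(- 1 \<otimes> x, 0)\<close>,
  and the two displayed maps are right multiplication by them. The obstacle is that this product is
  not yet known to be associative. An action of \<open>UL(P)\<close> only has to satisfy the three
  defining relations as identities between operators, and these follow from the bracket identities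
  of the right action on \<open>U(L) \<otimes> P\<close> and its compatibility with \<alpha>.
  Associativity is then inherited from \<open>UL(P)\<close>.

  The same exchange governs the quotients. That the two actions descend modulo \<open>\<Y>'\<close>
  and \<open>\<X>'\<close> is read off in \<open>UL(\<qq> \<rtimes> \<pp>)/\<X>\<close>, where
  products of classes make sense and where the images of \<open>U \<otimes> V\<close> and
  \<open>U\<close> vanish exactly on \<open>\<Y>'\<close> and \<open>\<X>'\<close>.

  Lie quotients are taken by squares. Polarization turns squares into \<open>[x,y] + [y,x]\<close>
  without division by 2, which keeps every step valid over any commutative ring.\<close>

lemma (in abelian_group) a_inv_zero [simp]: "\<ominus> \<zero> = \<zero>"
  using l_neg[of \<zero>] r_zero[of "\<ominus> \<zero>"] by simp

lemma (in abelian_group) a_minus_eq_zero_iff: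
  "\<lbrakk>x \<in> carrier G; y \<in> carrier G\<rbrakk> \<Longrightarrow> x \<ominus> y = \<zero> \<longleftrightarrow> x = y"
  using r_neg[of y] minus_equality[of x "\<ominus> y"] minus_minus[of y] by (auto simp: a_minus_def)

text \<open>Closure under negation is scaling by -1, so it does not appear among the
  conditions.\<close>

lemma submodule_intro:
  assumes "module K M" "N \<subseteq> carrier M" "\<zero>\<^bsub>M\<^esub> \<in> N"
    and "\<And>x y. \<lbrakk>x \<in> N; y \<in> N\<rbrakk> \<Longrightarrow> x \<oplus>\<^bsub>M\<^esub> y \<in> N"
    and "\<And>k x. \<lbrakk>k \<in> carrier K; x \<in> N\<rbrakk> \<Longrightarrow> k \<odot>\<^bsub>M\<^esub> x \<in> N"
  shows "submodule N K M"
proof -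
  interpret module K M by fact
  show ?thesis
  proof (rule submoduleI)
    fix a assume a: "a \<in> N"
    have "(\<ominus>\<^bsub>K\<^esub> \<one>\<^bsub>K\<^esub>) \<odot>\<^bsub>M\<^esub> a \<in> N" by (rule assms(5)) (use a in auto)
    then show "\<ominus>\<^bsub>M\<^esub> a \<in> N" using a assms(2) by (auto simp: smult_l_minus)
  qed (use assms in auto)
qed

lemma submodule_facts:
  assumes "module K M" "submodule N K M"
  shows "N \<subseteq> carrier M" "\<zero>\<^bsub>M\<^esub> \<in> N"
    and "\<And>x y. \<lbrakk>x \<in> N; y \<in> N\<rbrakk> \<Longrightarrow> x \<oplus>\<^bsub>M\<^esub> y \<in> N"
    and "\<And>k x. \<lbrakk>k \<in> carrier K; x \<in> N\<rbrakk> \<Longrightarrow> k \<odot>\<^bsub>M\<^esub> x \<in> N"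
    and "\<And>x. x \<in> N \<Longrightarrow> \<ominus>\<^bsub>M\<^esub> x \<in> N"
    and "\<And>x y. \<lbrakk>x \<in> N; y \<in> N\<rbrakk> \<Longrightarrow> x \<ominus>\<^bsub>M\<^esub> y \<in> N"
    and "additive_subgroup N M"
proof -
  interpret module K M by fact
  note E = submoduleE[OF assms(2)]
  show "N \<subseteq> carrier M" "\<And>x. x \<in> N \<Longrightarrow> \<ominus>\<^bsub>M\<^esub> x \<in> N"
    "\<And>x y. \<lbrakk>x \<in> N; y \<in> N\<rbrakk> \<Longrightarrow> x \<oplus>\<^bsub>M\<^esub> y \<in> N"
    "\<And>k x. \<lbrakk>k \<in> carrier K; x \<in> N\<rbrakk> \<Longrightarrow> k \<odot>\<^bsub>M\<^esub> x \<in> N" using E by auto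
  then show "\<And>x y. \<lbrakk>x \<in> N; y \<in> N\<rbrakk> \<Longrightarrow> x \<ominus>\<^bsub>M\<^esub> y \<in> N" by (simp add: a_minus_def)
  show "additive_subgroup N M"
    using assms(2) by (simp add: additive_subgroup_def submodule_def)
  then show "\<zero>\<^bsub>M\<^esub> \<in> N" by (rule additive_subgroup.zero_closed)
qed

section \<open>Linear maps\<close>

lemma mod_homI:
  assumes "\<And>x. x \<in> carrier M \<Longrightarrow> f x \<in> carrier N"
    and "\<And>x y. \<lbrakk>x \<in> carrier M; y \<in> carrier M\<rbrakk> \<Longrightarrow> f (x \<oplus>\<^bsub>M\<^esub> y) = f x \<oplus>\<^bsub>N\<^esub> f y"
    and "\<And>k x. \<lbrakk>k \<in> carrier K; x \<in> carrier M\<rbrakk> \<Longrightarrow> f (k \<odot>\<^bsub>M\<^esub> x) = k \<odot>\<^bsub>N\<^esub> f x"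
  shows "f \<in> mod_hom K M N"
  using assms by (auto simp: mod_hom_def)

lemma mod_homD:
  assumes "f \<in> mod_hom K M N"
  shows "x \<in> carrier M \<Longrightarrow> f x \<in> carrier N"
    and "\<lbrakk>x \<in> carrier M; y \<in> carrier M\<rbrakk> \<Longrightarrow> f (x \<oplus>\<^bsub>M\<^esub> y) = f x \<oplus>\<^bsub>N\<^esub> f y"
    and "\<lbrakk>k \<in> carrier K; x \<in> carrier M\<rbrakk> \<Longrightarrow> f (k \<odot>\<^bsub>M\<^esub> x) = k \<odot>\<^bsub>N\<^esub> f x"
  using assms by (auto simp: mod_hom_def)

text \<open>\<open>mod_hom\<close> speaks of sums and multiples only; zero and negatives are the
  multiples by 0 and by -1.\<close>

lemma mod_hom_neg:
  assumes "module K M" "module K N" "f \<in> mod_hom K M N"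
  shows "f \<zero>\<^bsub>M\<^esub> = \<zero>\<^bsub>N\<^esub>"
    and "x \<in> carrier M \<Longrightarrow> f (\<ominus>\<^bsub>M\<^esub> x) = \<ominus>\<^bsub>N\<^esub> f x"
    and "\<lbrakk>x \<in> carrier M; y \<in> carrier M\<rbrakk> \<Longrightarrow> f (x \<ominus>\<^bsub>M\<^esub> y) = f x \<ominus>\<^bsub>N\<^esub> f y"
proof -
  interpret M: module K M by fact
  interpret N: module K N by fact
  note D = mod_homD[OF assms(3)]
  have "f (\<zero>\<^bsub>K\<^esub> \<odot>\<^bsub>M\<^esub> \<zero>\<^bsub>M\<^esub>) = \<zero>\<^bsub>K\<^esub> \<odot>\<^bsub>N\<^esub> f \<zero>\<^bsub>M\<^esub>" by (rule D) auto
  then show z: "f \<zero>\<^bsub>M\<^esub> = \<zero>\<^bsub>N\<^esub>" using D(1)[of "\<zero>\<^bsub>M\<^esub>"] by simp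
  have neg: "f (\<ominus>\<^bsub>M\<^esub> x) = \<ominus>\<^bsub>N\<^esub> f x" if "x \<in> carrier M" for x
    using D(3)[of "\<ominus>\<^bsub>K\<^esub> \<one>\<^bsub>K\<^esub>" x] that D(1)[of x] by (simp add: M.smult_l_minus N.smult_l_minus)
  then show "x \<in> carrier M \<Longrightarrow> f (\<ominus>\<^bsub>M\<^esub> x) = \<ominus>\<^bsub>N\<^esub> f x" .
  show "f (x \<ominus>\<^bsub>M\<^esub> y) = f x \<ominus>\<^bsub>N\<^esub> f y" if "x \<in> carrier M" "y \<in> carrier M"
    using that by (simp add: a_minus_def D neg)
qed

lemma mod_hom_comp:
  assumes "f \<in> mod_hom K M N" "g \<in> mod_hom K N L"
  shows "(\<lambda>x. g (f x)) \<in> mod_hom K M L"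
  using assms by (auto simp: mod_hom_def Pi_iff)

lemma mod_hom_add:
  assumes "module K N" "f \<in> mod_hom K M N" "g \<in> mod_hom K M N"
  shows "(\<lambda>x. f x \<oplus>\<^bsub>N\<^esub> g x) \<in> mod_hom K M N"
proof -
  interpret N: module K N by fact
  show ?thesis
    by (rule mod_homI)
      (auto simp: mod_homD[OF assms(2)] mod_homD[OF assms(3)] N.smult_r_distr N.a_ac)
qed

lemma mod_hom_uminus:
  assumes "module K N" "f \<in> mod_hom K M N"
  shows "(\<lambda>x. \<ominus>\<^bsub>N\<^esub> f x) \<in> mod_hom K M N"
proof -
  interpret N: module K N by fact
  show ?thesis
    by (rule mod_homI)
      (auto simp: mod_homD[OF assms(2)] N.smult_r_minus N.minus_add)
qed

lemma mod_hom_cong: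
  assumes "f \<in> mod_hom K M N" "module K M" "\<And>x. x \<in> carrier M \<Longrightarrow> g x = f x"
  shows "g \<in> mod_hom K M N"
proof -
  interpret M: module K M by fact
  show ?thesis by (rule mod_homI) (auto simp: assms(3) mod_homD[OF assms(1)])
qed

lemma submodule_preimage:
  assumes "module K M" "module K N" "f \<in> mod_hom K M N" "submodule N' K N"
  shows "submodule {x \<in> carrier M. f x \<in> N'} K M"
proof -
  interpret M: module K M by fact
  note D = mod_homD[OF assms(3)] and S = submodule_facts[OF assms(2,4)]
  show ?thesis
    by (rule submodule_intro[OF assms(1)])
      (auto simp: D S mod_hom_neg(1)[OF assms(1-3)])
qed

lemma submodule_zero:
  assumes "module K M" shows "submodule {\<zero>\<^bsub>M\<^esub>} K M"
proof -
  interpret M: module K M by fact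
  show ?thesis by (rule submodule_intro[OF assms]) auto
qed

lemma submodule_image:
  assumes "module K M" "module K N" "f \<in> mod_hom K M N" "submodule M' K M"
  shows "submodule (f ` M') K N"
proof -
  note D = mod_homD[OF assms(3)] and S = submodule_facts[OF assms(1,4)]
  show ?thesis
  proof (rule submodule_intro[OF assms(2)])
    show "f ` M' \<subseteq> carrier N" using D S by auto
    show "\<zero>\<^bsub>N\<^esub> \<in> f ` M'" using mod_hom_neg(1)[OF assms(1-3)] S(2) by force
  next
    fix x y assume "x \<in> f ` M'" "y \<in> f ` M'"
    then obtain a b where ab: "a \<in> M'" "b \<in> M'" "x = f a" "y = f b" by auto
    then have "x \<oplus>\<^bsub>N\<^esub> y = f (a \<oplus>\<^bsub>M\<^esub> b)" using subsetD[OF S(1)] D(2)[of a b] by simp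
    then show "x \<oplus>\<^bsub>N\<^esub> y \<in> f ` M'" using S(3) ab by auto
  next
    fix k x assume "k \<in> carrier K" "x \<in> f ` M'"
    then obtain a where ab: "k \<in> carrier K" "a \<in> M'" "x = f a" by auto
    then have "k \<odot>\<^bsub>N\<^esub> x = f (k \<odot>\<^bsub>M\<^esub> a)" using subsetD[OF S(1)] D(3)[of k a] by simp
    then show "k \<odot>\<^bsub>N\<^esub> x \<in> f ` M'" using S(4) ab by auto
  qed
qed

lemma submodule_Inter:
  assumes "module K M" "\<And>N. N \<in> F \<Longrightarrow> submodule N K M" "F \<noteq> {}"
  shows "submodule (\<Inter>F) K M"
proof (rule submodule_intro[OF assms(1)])
  note S = submodule_facts[OF assms(1) assms(2)]
  show "\<Inter>F \<subseteq> carrier M" using S(1) assms(3) by blast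
  show "\<zero>\<^bsub>M\<^esub> \<in> \<Inter>F" using S(2) by blast
  show "x \<oplus>\<^bsub>M\<^esub> y \<in> \<Inter>F" if "x \<in> \<Inter>F" "y \<in> \<Inter>F" for x y using S(3) that by blast
  show "k \<odot>\<^bsub>M\<^esub> x \<in> \<Inter>F" if "k \<in> carrier K" "x \<in> \<Inter>F" for k x using S(4) that by blast
qed

lemma mod_span_submodule:
  assumes "module K M" "S \<subseteq> carrier M"
  shows "submodule (mod_span K M S) K M"
  unfolding mod_span_def
  by (rule submodule_Inter) (use assms module.carrier_is_submodule in auto)

lemma mod_span_superset: "S \<subseteq> mod_span K M S"
  by (auto simp: mod_span_def)

lemma mod_span_least:
  assumes "submodule N K M" "S \<subseteq> N" shows "mod_span K M S \<subseteq> N"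
  using assms by (auto simp: mod_span_def)

text \<open>The preimage of a submodule is a submodule, so it contains the span as soon as it
  contains the generators.\<close>

lemma mod_hom_span:
  assumes "module K M" "module K N" "f \<in> mod_hom K M N" "submodule N' K N" "S \<subseteq> carrier M"
    and "\<And>x. x \<in> S \<Longrightarrow> f x \<in> N'" "x \<in> mod_span K M S"
  shows "f x \<in> N'"
proof -
  have "mod_span K M S \<subseteq> {x \<in> carrier M. f x \<in> N'}"
    by (rule mod_span_least[OF submodule_preimage[OF assms(1-4)]]) (use assms in auto)
  then show ?thesis using assms by auto
qed

text \<open>Turns an equation between two linear maps into a submodule, which is the form that
  \<open>tprod_span\<close>, \<open>U_induct\<close> and \<open>UL_induct\<close> take.\<close>

lemma submodule_equalizer:
  assumes "module K M" "module K N" "f \<in> mod_hom K M N" "g \<in> mod_hom K M N"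
  shows "submodule {x \<in> carrier M. f x = g x} K M"
proof -
  interpret M: module K M by fact
  show ?thesis
    by (rule submodule_intro[OF assms(1)])
      (auto simp: mod_homD[OF assms(3)] mod_homD[OF assms(4)]
        mod_hom_neg(1)[OF assms(1-3)] mod_hom_neg(1)[OF assms(1,2,4)])
qed

lemma mod_hom_eq_on_span:
  assumes "module K M" "module K N" "f \<in> mod_hom K M N" "g \<in> mod_hom K M N" "S \<subseteq> carrier M"
    and "\<And>x. x \<in> S \<Longrightarrow> f x = g x" "x \<in> mod_span K M S"
  shows "f x = g x"
  using mod_span_least[OF submodule_equalizer[OF assms(1-4)], of S] assms(5-) by auto

section \<open>Bilinear maps\<close>

lemma bilinear_mapI:
  assumes "\<And>x. x \<in> carrier M \<Longrightarrow> (\<lambda>y. f x y) \<in> mod_hom K N L"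
    and "\<And>y. y \<in> carrier N \<Longrightarrow> (\<lambda>x. f x y) \<in> mod_hom K M L"
  shows "bilinear_map K M N L f"
  using assms by (auto simp: bilinear_map_def)

lemma bilinear_mapD:
  assumes "bilinear_map K M N L f"
  shows "x \<in> carrier M \<Longrightarrow> f x \<in> mod_hom K N L"
    and "y \<in> carrier N \<Longrightarrow> (\<lambda>x. f x y) \<in> mod_hom K M L"
  using assms by (auto simp: bilinear_map_def)

lemma bilinear_map_simps:
  assumes "bilinear_map K M N L f"
  shows "\<lbrakk>x \<in> carrier M; y \<in> carrier N\<rbrakk> \<Longrightarrow> f x y \<in> carrier L"
    and "\<lbrakk>x \<in> carrier M; y \<in> carrier N; y' \<in> carrier N\<rbrakk>
          \<Longrightarrow> f x (y \<oplus>\<^bsub>N\<^esub> y') = f x y \<oplus>\<^bsub>L\<^esub> f x y'"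
    and "\<lbrakk>x \<in> carrier M; x' \<in> carrier M; y \<in> carrier N\<rbrakk>
          \<Longrightarrow> f (x \<oplus>\<^bsub>M\<^esub> x') y = f x y \<oplus>\<^bsub>L\<^esub> f x' y"
    and "\<lbrakk>k \<in> carrier K; x \<in> carrier M; y \<in> carrier N\<rbrakk>
          \<Longrightarrow> f x (k \<odot>\<^bsub>N\<^esub> y) = k \<odot>\<^bsub>L\<^esub> f x y"
    and "\<lbrakk>k \<in> carrier K; x \<in> carrier M; y \<in> carrier N\<rbrakk>
          \<Longrightarrow> f (k \<odot>\<^bsub>M\<^esub> x) y = k \<odot>\<^bsub>L\<^esub> f x y"
  using mod_homD[OF bilinear_mapD(1)[OF assms]] mod_homD[OF bilinear_mapD(2)[OF assms]]
  by auto

lemma bilinear_map_neg: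
  assumes "module K M" "module K N" "module K L" "bilinear_map K M N L f"
  shows "x \<in> carrier M \<Longrightarrow> f x \<zero>\<^bsub>N\<^esub> = \<zero>\<^bsub>L\<^esub>"
    and "y \<in> carrier N \<Longrightarrow> f \<zero>\<^bsub>M\<^esub> y = \<zero>\<^bsub>L\<^esub>"
    and "\<lbrakk>x \<in> carrier M; y \<in> carrier N\<rbrakk> \<Longrightarrow> f x (\<ominus>\<^bsub>N\<^esub> y) = \<ominus>\<^bsub>L\<^esub> f x y"
    and "\<lbrakk>x \<in> carrier M; y \<in> carrier N\<rbrakk> \<Longrightarrow> f (\<ominus>\<^bsub>M\<^esub> x) y = \<ominus>\<^bsub>L\<^esub> f x y"
    and "\<lbrakk>x \<in> carrier M; y \<in> carrier N; y' \<in> carrier N\<rbrakk>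
          \<Longrightarrow> f x (y \<ominus>\<^bsub>N\<^esub> y') = f x y \<ominus>\<^bsub>L\<^esub> f x y'"
    and "\<lbrakk>x \<in> carrier M; x' \<in> carrier M; y \<in> carrier N\<rbrakk>
          \<Longrightarrow> f (x \<ominus>\<^bsub>M\<^esub> x') y = f x y \<ominus>\<^bsub>L\<^esub> f x' y"
  using mod_hom_neg[OF assms(2,3) bilinear_mapD(1)[OF assms(4)]]
    mod_hom_neg[OF assms(1,3) bilinear_mapD(2)[OF assms(4)]]
  by auto

text \<open>The agreement is spread over the second argument, for a fixed generator in the first,
  and then over the first.\<close>

lemma bilinear_map_eq_on_span:
  assumes "module K M" "module K N" "module K L" "bilinear_map K M N L f" "bilinear_map K M N L g"
    and "S \<subseteq> carrier M" "T \<subseteq> carrier N"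
    and "\<And>x y. \<lbrakk>x \<in> S; y \<in> T\<rbrakk> \<Longrightarrow> f x y = g x y"
    and "x \<in> mod_span K M S" "y \<in> mod_span K N T"
  shows "f x y = g x y"
proof -
  have y: "y \<in> carrier N"
    using assms(10) mod_span_least[OF module.carrier_is_submodule[OF assms(2)] assms(7)] by auto
  have 1: "f s y = g s y" if "s \<in> S" for s
    by (rule mod_hom_eq_on_span[OF assms(2,3) bilinear_mapD(1)[OF assms(4)]
          bilinear_mapD(1)[OF assms(5)] assms(7) _ assms(10)])
      (use that assms in auto)
  show ?thesis
    by (rule mod_hom_eq_on_span[OF assms(1,3) bilinear_mapD(2)[OF assms(4) y]
          bilinear_mapD(2)[OF assms(5) y] assms(6) 1 assms(9)])
qed

lemma bilinear_map_comp_left: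
  assumes "bilinear_map K M N L f" "h \<in> mod_hom K M' M"
  shows "bilinear_map K M' N L (\<lambda>x y. f (h x) y)"
  using assms
  by (intro bilinear_mapI bilinear_mapD(1)[OF assms(1)]
      mod_hom_comp[OF assms(2) bilinear_mapD(2)[OF assms(1)]] mod_homD(1)[OF assms(2)])

lemma bilinear_map_comp_right:
  assumes "bilinear_map K M N L f" "h \<in> mod_hom K N' N"
  shows "bilinear_map K M N' L (\<lambda>x y. f x (h y))"
  using assms
  by (intro bilinear_mapI bilinear_mapD(2)[OF assms(1)]
      mod_hom_comp[OF assms(2) bilinear_mapD(1)[OF assms(1)]] mod_homD(1)[OF assms(2)])

lemma bilinear_map_comp:
  assumes "bilinear_map K M N L f" "h \<in> mod_hom K L L'"
  shows "bilinear_map K M N L' (\<lambda>x y. h (f x y))"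
  by (intro bilinear_mapI mod_hom_comp[OF bilinear_mapD(1)[OF assms(1)] assms(2)]
      mod_hom_comp[OF bilinear_mapD(2)[OF assms(1)] assms(2)])

lemma bilinear_map_add:
  assumes "module K L" "bilinear_map K M N L f" "bilinear_map K M N L g"
  shows "bilinear_map K M N L (\<lambda>x y. f x y \<oplus>\<^bsub>L\<^esub> g x y)"
  by (intro bilinear_mapI mod_hom_add[OF assms(1)] bilinear_mapD[OF assms(2)] bilinear_mapD[OF assms(3)])

lemma bilinear_map_uminus:
  assumes "module K L" "bilinear_map K M N L f"
  shows "bilinear_map K M N L (\<lambda>x y. \<ominus>\<^bsub>L\<^esub> f x y)"
  by (intro bilinear_mapI mod_hom_uminus[OF assms(1)] bilinear_mapD[OF assms(2)])

section \<open>Algebra homomorphisms and two-sided ideals\<close>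

lemma bilinear_algebraD:
  assumes "bilinear_algebra K A"
  shows "module K A" "bilinear_map K A A A (\<otimes>\<^bsub>A\<^esub>)"
  using assms by (auto simp: bilinear_algebra_def bilinear_algebra_axioms_def)

lemma bilinear_algebraI:
  assumes "module K A" "bilinear_map K A A A (\<otimes>\<^bsub>A\<^esub>)"
  shows "bilinear_algebra K A"
  using assms by (auto simp: bilinear_algebra_def bilinear_algebra_axioms_def)

lemma alg_homI:
  assumes "f \<in> mod_hom K A B"
    and "\<And>x y. \<lbrakk>x \<in> carrier A; y \<in> carrier A\<rbrakk> \<Longrightarrow> f (x \<otimes>\<^bsub>A\<^esub> y) = f x \<otimes>\<^bsub>B\<^esub> f y"
  shows "f \<in> alg_hom K A B"
  using assms by (auto simp: alg_hom_def)

lemma alg_homD: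
  assumes "f \<in> alg_hom K A B"
  shows "f \<in> mod_hom K A B"
    and "\<lbrakk>x \<in> carrier A; y \<in> carrier A\<rbrakk> \<Longrightarrow> f (x \<otimes>\<^bsub>A\<^esub> y) = f x \<otimes>\<^bsub>B\<^esub> f y"
  using assms by (auto simp: alg_hom_def)

lemma alg_idealI:
  assumes "submodule I K A"
    and "\<And>a x. \<lbrakk>a \<in> carrier A; x \<in> I\<rbrakk> \<Longrightarrow> a \<otimes>\<^bsub>A\<^esub> x \<in> I"
    and "\<And>a x. \<lbrakk>a \<in> carrier A; x \<in> I\<rbrakk> \<Longrightarrow> x \<otimes>\<^bsub>A\<^esub> a \<in> I"
  shows "alg_ideal K A I"
  using assms by (auto simp: alg_ideal_def)

lemma alg_idealD:
  assumes "alg_ideal K A I"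
  shows "submodule I K A"
    and "\<lbrakk>a \<in> carrier A; x \<in> I\<rbrakk> \<Longrightarrow> a \<otimes>\<^bsub>A\<^esub> x \<in> I"
    and "\<lbrakk>a \<in> carrier A; x \<in> I\<rbrakk> \<Longrightarrow> x \<otimes>\<^bsub>A\<^esub> a \<in> I"
  using assms by (auto simp: alg_ideal_def)

lemma alg_idl_ideal:
  assumes "bilinear_algebra K A" "S \<subseteq> carrier A"
  shows "alg_ideal K A (alg_idl K A S)"
proof -
  note A = bilinear_algebraD[OF assms(1)]
  have c: "alg_ideal K A (carrier A)"
    using module.carrier_is_submodule[OF A(1)] bilinear_map_simps(1)[OF A(2)]
    by (auto simp: alg_ideal_def)
  have "submodule (alg_idl K A S) K A"
    unfolding alg_idl_def by (rule submodule_Inter[OF A(1)]) (use c assms in \<open>auto simp: alg_ideal_def\<close>)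
  then show ?thesis
    by (auto simp: alg_ideal_def alg_idl_def)
qed

lemma alg_idl_superset: "S \<subseteq> alg_idl K A S"
  by (auto simp: alg_idl_def)

lemma alg_idl_least:
  assumes "alg_ideal K A I" "S \<subseteq> I" shows "alg_idl K A S \<subseteq> I"
  using assms by (auto simp: alg_idl_def)

lemma alg_ideal_preimage:
  assumes "bilinear_algebra K A" "bilinear_algebra K B" "f \<in> alg_hom K A B" "alg_ideal K B J"
  shows "alg_ideal K A {x \<in> carrier A. f x \<in> J}"
proof (rule alg_idealI)
  note A = bilinear_algebraD[OF assms(1)] and B = bilinear_algebraD[OF assms(2)]
    and f = alg_homD[OF assms(3)] and J = alg_idealD[OF assms(4)]
  show "submodule {x \<in> carrier A. f x \<in> J} K A"
    by (rule submodule_preimage[OF A(1) B(1) f(1) J(1)])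
  fix a x assume "a \<in> carrier A" "x \<in> {x \<in> carrier A. f x \<in> J}"
  then show "a \<otimes>\<^bsub>A\<^esub> x \<in> {x \<in> carrier A. f x \<in> J}" "x \<otimes>\<^bsub>A\<^esub> a \<in> {x \<in> carrier A. f x \<in> J}"
    using bilinear_map_simps(1)[OF A(2)] J f(2) mod_homD(1)[OF f(1)] by auto
qed

lemma alg_ideal_zero:
  assumes "bilinear_algebra K A" shows "alg_ideal K A {\<zero>\<^bsub>A\<^esub>}"
  by (rule alg_idealI) (use submodule_zero bilinear_algebraD[OF assms]
      bilinear_map_neg[OF _ _ _ bilinear_algebraD(2)[OF assms]] in auto)

text \<open>The preimage of an ideal is an ideal, so only the generators have to be checked. With
  \<open>J\<close> the zero ideal this is how homomorphisms are seen to descend to quotients by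
  generated ideals.\<close>

lemma alg_hom_alg_idl:
  assumes "bilinear_algebra K A" "bilinear_algebra K B" "f \<in> alg_hom K A B"
    and "alg_ideal K B J" "S \<subseteq> carrier A" "\<And>x. x \<in> S \<Longrightarrow> f x \<in> J" "x \<in> alg_idl K A S"
  shows "f x \<in> J"
  using alg_idl_least[OF alg_ideal_preimage[OF assms(1-4)], of S] assms(5-) by auto

lemma mem_a_kernel: "x \<in> a_kernel A B f \<longleftrightarrow> x \<in> carrier A \<and> f x = \<zero>\<^bsub>B\<^esub>"
  by (simp add: a_kernel_def kernel_def)

subsection \<open>Quotients\<close>

lemma mem_coset_iff:
  assumes "module K M" "submodule N K M" "x \<in> carrier M"
  shows "y \<in> N +>\<^bsub>M\<^esub> x \<longleftrightarrow> y \<in> carrier M \<and> y \<ominus>\<^bsub>M\<^esub> x \<in> N"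
proof -
  interpret M: module K M by fact
  note N = submodule_facts[OF assms(1,2)]
  have 1: "n \<oplus>\<^bsub>M\<^esub> x \<ominus>\<^bsub>M\<^esub> x = n" if "n \<in> N" for n
    using subsetD[OF N(1) that] assms(3) by (simp add: a_minus_def M.a_assoc M.r_neg)
  have 2: "y = (y \<ominus>\<^bsub>M\<^esub> x) \<oplus>\<^bsub>M\<^esub> x" if "y \<in> carrier M"
    using that assms(3) by (simp add: a_minus_def M.a_assoc M.l_neg)
  have "y \<in> N +>\<^bsub>M\<^esub> x \<longleftrightarrow> (\<exists>n\<in>N. y = n \<oplus>\<^bsub>M\<^esub> x)" by (simp add: a_r_coset_def')
  then show ?thesis using 1 2 subsetD[OF N(1)] assms(3) by (metis M.a_closed)
qed

lemma coset_eq_iff: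
  assumes "module K M" "submodule N K M" "x \<in> carrier M" "y \<in> carrier M"
  shows "N +>\<^bsub>M\<^esub> x = N +>\<^bsub>M\<^esub> y \<longleftrightarrow> x \<ominus>\<^bsub>M\<^esub> y \<in> N"
proof
  interpret M: module K M by fact
  note N = submodule_facts[OF assms(1,2)] and m = mem_coset_iff[OF assms(1,2)]
  {
    assume "N +>\<^bsub>M\<^esub> x = N +>\<^bsub>M\<^esub> y"
    moreover have "x \<in> N +>\<^bsub>M\<^esub> x" using assms(3) N(2) by (simp add: m M.minus_eq M.r_neg)
    ultimately show "x \<ominus>\<^bsub>M\<^esub> y \<in> N" using assms(4) by (simp add: m)
  next
    assume *: "x \<ominus>\<^bsub>M\<^esub> y \<in> N"
    have "\<ominus>\<^bsub>M\<^esub> (x \<ominus>\<^bsub>M\<^esub> y) = y \<ominus>\<^bsub>M\<^esub> x"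
      using assms(3,4) by (simp add: a_minus_def M.minus_add M.a_comm)
    then have dd: "y \<ominus>\<^bsub>M\<^esub> x \<in> N" using N(5)[OF *] by simp
    have sum: "z \<ominus>\<^bsub>M\<^esub> b = (z \<ominus>\<^bsub>M\<^esub> a) \<oplus>\<^bsub>M\<^esub> (a \<ominus>\<^bsub>M\<^esub> b)"
      if "z \<in> carrier M" "a \<in> carrier M" "b \<in> carrier M" for z a b
      using that by (simp add: a_minus_def M.a_assoc M.r_neg1)
    have "z \<ominus>\<^bsub>M\<^esub> y \<in> N \<longleftrightarrow> z \<ominus>\<^bsub>M\<^esub> x \<in> N" if z: "z \<in> carrier M" for z
      using N(3) * dd sum[OF z assms(3,4)] sum[OF z assms(4,3)] by metis
    then show "N +>\<^bsub>M\<^esub> x = N +>\<^bsub>M\<^esub> y" using assms(3,4) by (auto simp: m)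
  }
qed

lemma coset_eq_self_iff:
  assumes "module K M" "submodule N K M" "x \<in> carrier M"
  shows "N +>\<^bsub>M\<^esub> x = N \<longleftrightarrow> x \<in> N"
proof -
  interpret M: module K M by fact
  show ?thesis
    using coset_eq_iff[OF assms(1-3) M.zero_closed] assms(3)
      submodule_facts(1)[OF assms(1,2)] by (simp add: a_minus_def)
qed

text \<open>\<open>quot_lift\<close> picks the only element of the image of the coset, so it has a
  meaning only where \<open>f\<close> is constant on that coset.\<close>

lemma quot_lift_coset:
  assumes "module K M" "submodule N K M" "x \<in> carrier M"
    and "\<And>y. \<lbrakk>y \<in> carrier M; y \<ominus>\<^bsub>M\<^esub> x \<in> N\<rbrakk> \<Longrightarrow> f y = f x"
  shows "quot_lift f (N +>\<^bsub>M\<^esub> x) = f x"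
proof -
  interpret M: module K M by fact
  note m = mem_coset_iff[OF assms(1-3)]
  have "x \<in> N +>\<^bsub>M\<^esub> x"
    using assms(3) submodule_facts(2)[OF assms(1,2)] by (simp add: m a_minus_def M.r_neg)
  then have "f ` (N +>\<^bsub>M\<^esub> x) = {f x}" using assms(4) m by blast
  then show ?thesis by (simp add: quot_lift_def)
qed

lemma quot_lift_hom:
  assumes "module K M" "module K L" "submodule N K M" "f \<in> mod_hom K M L"
    and "\<And>x. x \<in> N \<Longrightarrow> f x = \<zero>\<^bsub>L\<^esub>" "x \<in> carrier M"
  shows "quot_lift f (N +>\<^bsub>M\<^esub> x) = f x"
proof (rule quot_lift_coset[OF assms(1,3,6)])
  interpret L: module K L by fact
  fix y assume y: "y \<in> carrier M" "y \<ominus>\<^bsub>M\<^esub> x \<in> N"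
  then have "f y \<ominus>\<^bsub>L\<^esub> f x = \<zero>\<^bsub>L\<^esub>" using assms(5) mod_hom_neg(3)[OF assms(1,2,4)] assms(6) by metis
  then show "f y = f x" using mod_homD(1)[OF assms(4)] y(1) assms(6) by (simp add: L.a_minus_eq_zero_iff)
qed

lemma quot_simps:
  "carrier (quot M N) = (\<lambda>x. N +>\<^bsub>M\<^esub> x) ` carrier M"
  "\<zero>\<^bsub>quot M N\<^esub> = N" "\<one>\<^bsub>quot M N\<^esub> = N +>\<^bsub>M\<^esub> \<one>\<^bsub>M\<^esub>"
  by (auto simp: quot_def A_RCOSETS_def')

lemma quot_add:
  assumes "module K M" "submodule N K M" "x \<in> carrier M" "y \<in> carrier M"
  shows "(N +>\<^bsub>M\<^esub> x) \<oplus>\<^bsub>quot M N\<^esub> (N +>\<^bsub>M\<^esub> y) = N +>\<^bsub>M\<^esub> (x \<oplus>\<^bsub>M\<^esub> y)"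
proof -
  interpret M: module K M by fact
  interpret abelian_subgroup N M
    by (rule abelian_subgroupI3)
      (auto intro: submodule_facts(7)[OF assms(1,2)] M.abelian_group_axioms)
  show ?thesis using a_rcos_sum[OF assms(3,4)] by (simp add: quot_def)
qed

text \<open>The multiple is encoded as a union over all members of the coset; every member
  contributes the same coset, because \<open>N\<close> is closed under multiples.\<close>

lemma quot_smult:
  assumes "module K M" "submodule N K M" "k \<in> carrier K" "x \<in> carrier M"
  shows "k \<odot>\<^bsub>quot M N\<^esub> (N +>\<^bsub>M\<^esub> x) = N +>\<^bsub>M\<^esub> (k \<odot>\<^bsub>M\<^esub> x)"
proof -
  interpret M: module K M by fact
  note m = mem_coset_iff[OF assms(1,2,4)] and N = submodule_facts[OF assms(1,2)]
  have x: "x \<in> N +>\<^bsub>M\<^esub> x" using assms(4) N(2) by (simp add: m a_minus_def M.r_neg)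
  have "N +>\<^bsub>M\<^esub> (k \<odot>\<^bsub>M\<^esub> y) = N +>\<^bsub>M\<^esub> (k \<odot>\<^bsub>M\<^esub> x)" if y: "y \<in> N +>\<^bsub>M\<^esub> x" for y
  proof -
    have "k \<odot>\<^bsub>M\<^esub> y \<ominus>\<^bsub>M\<^esub> k \<odot>\<^bsub>M\<^esub> x = k \<odot>\<^bsub>M\<^esub> (y \<ominus>\<^bsub>M\<^esub> x)"
      using y assms(3,4) by (simp add: m a_minus_def M.smult_r_distr M.smult_r_minus)
    then show ?thesis using y assms N(4) m coset_eq_iff[OF assms(1,2)] by auto
  qed
  then have "(\<Union>y\<in>N +>\<^bsub>M\<^esub> x. N +>\<^bsub>M\<^esub> (k \<odot>\<^bsub>M\<^esub> y)) = N +>\<^bsub>M\<^esub> (k \<odot>\<^bsub>M\<^esub> x)"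
    by (intro UN_constant_eq[OF x] ballI)
  then show ?thesis by (simp add: quot_def)
qed

lemma quot_mult:
  assumes "bilinear_algebra K A" "alg_ideal K A I" "x \<in> carrier A" "y \<in> carrier A"
  shows "(I +>\<^bsub>A\<^esub> x) \<otimes>\<^bsub>quot A I\<^esub> (I +>\<^bsub>A\<^esub> y) = I +>\<^bsub>A\<^esub> (x \<otimes>\<^bsub>A\<^esub> y)"
proof -
  note A = bilinear_algebraD[OF assms(1)] and I = alg_idealD[OF assms(2)]
  interpret M: module K A by fact
  note m = mem_coset_iff[OF A(1) I(1)] and N = submodule_facts[OF A(1) I(1)]
    and b = bilinear_map_simps[OF A(2)] and n = bilinear_map_neg[OF A(1) A(1) A(1) A(2)]
  have x: "x \<in> I +>\<^bsub>A\<^esub> x" "y \<in> I +>\<^bsub>A\<^esub> y"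
    using assms(3,4) N(2) by (simp_all add: m a_minus_def M.r_neg)
  have "I +>\<^bsub>A\<^esub> (u \<otimes>\<^bsub>A\<^esub> v) = I +>\<^bsub>A\<^esub> (x \<otimes>\<^bsub>A\<^esub> y)" if "u \<in> I +>\<^bsub>A\<^esub> x" "v \<in> I +>\<^bsub>A\<^esub> y" for u v
  proof -
    have c: "u \<in> carrier A" "v \<in> carrier A" "u \<ominus>\<^bsub>A\<^esub> x \<in> I" "v \<ominus>\<^bsub>A\<^esub> y \<in> I"
      using that assms(3,4) by (auto simp: m)
    have "u \<otimes>\<^bsub>A\<^esub> v \<ominus>\<^bsub>A\<^esub> x \<otimes>\<^bsub>A\<^esub> y = (u \<ominus>\<^bsub>A\<^esub> x) \<otimes>\<^bsub>A\<^esub> v \<oplus>\<^bsub>A\<^esub> x \<otimes>\<^bsub>A\<^esub> (v \<ominus>\<^bsub>A\<^esub> y)"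
      using c assms(3,4) by (simp add: n b a_minus_def M.a_assoc M.r_neg1)
    moreover have "\<dots> \<in> I" using c assms(3,4) I N by auto
    ultimately show ?thesis using c assms(3,4) coset_eq_iff[OF A(1) I(1)] b(1) by auto
  qed
  then have "(\<Union>u\<in>I +>\<^bsub>A\<^esub> x. \<Union>v\<in>I +>\<^bsub>A\<^esub> y. I +>\<^bsub>A\<^esub> (u \<otimes>\<^bsub>A\<^esub> v)) = I +>\<^bsub>A\<^esub> (x \<otimes>\<^bsub>A\<^esub> y)"
    by (intro UN_constant_eq[OF x(1)] UN_constant_eq[OF x(2)] ballI)
  then show ?thesis by (simp add: quot_def rcoset_mult_def)
qed

text \<open>The module axioms are equations apart from the inverse, and equations pass along a
  surjection that respects the operations. Nothing is presupposed about \<open>Q\<close>, so the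
  rule serves for quotients, for records that differ from a known module only in \<open>mult\<close>
  and \<open>one\<close> (with \<open>f\<close> the identity), and for transport along
  bijections.\<close>

lemma module_surj_image:
  assumes "module K M" "carrier Q = f ` carrier M" "f \<zero>\<^bsub>M\<^esub> = \<zero>\<^bsub>Q\<^esub>"
    and add: "\<And>x y. \<lbrakk>x \<in> carrier M; y \<in> carrier M\<rbrakk> \<Longrightarrow> f x \<oplus>\<^bsub>Q\<^esub> f y = f (x \<oplus>\<^bsub>M\<^esub> y)"
    and smult: "\<And>k x. \<lbrakk>k \<in> carrier K; x \<in> carrier M\<rbrakk> \<Longrightarrow> k \<odot>\<^bsub>Q\<^esub> f x = f (k \<odot>\<^bsub>M\<^esub> x)"
  shows "module K Q"
proof -
  interpret M: module K M by fact
  have neg: "\<exists>y\<in>carrier M. f y \<oplus>\<^bsub>Q\<^esub> f x = \<zero>\<^bsub>Q\<^esub>" if "x \<in> carrier M" for x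
    using that by (intro bexI[of _ "\<ominus>\<^bsub>M\<^esub> x"]) (auto simp: add M.l_neg assms(3))
  \<comment> \<open>The same inverse in the shape that appears once \<open>add\<close> has moved the
    sum inside \<open>f\<close>.\<close>
  have neg': "\<exists>y\<in>carrier M. f (x \<oplus>\<^bsub>M\<^esub> y) = f \<zero>\<^bsub>M\<^esub>" if "x \<in> carrier M" for x
    using neg[OF that] add assms(3) that by (metis M.a_comm)
  have "abelian_group Q"
    by (rule abelian_groupI)
      (auto simp: assms(2) assms(3)[symmetric] add M.a_ac neg')
  then show ?thesis
    by (intro moduleI M.R.cring_axioms)
      (auto simp: assms(2) add smult M.smult_l_distr M.smult_r_distr M.smult_assoc1)
qed

text \<open>On images, \<open>g'\<close> equals \<open>j\<close> of the bilinear map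
  \<open>g\<close>. In this way an operation on classes is bilinear once its value on
  representatives is known.\<close>

lemma bilinear_map_surj_image:
  assumes "bilinear_map K M N L g" "module K M" "module K N"
    and "f \<in> mod_hom K M M'" "h \<in> mod_hom K N N'" "j \<in> mod_hom K L L'"
    and "carrier M' = f ` carrier M" "carrier N' = h ` carrier N"
    and "\<And>x y. \<lbrakk>x \<in> carrier M; y \<in> carrier N\<rbrakk> \<Longrightarrow> g' (f x) (h y) = j (g x y)"
  shows "bilinear_map K M' N' L' g'"
proof -
  interpret M: module K M by fact
  interpret N: module K N by fact
  note b = bilinear_map_simps[OF assms(1)]
  have "g' (f x) (h y \<oplus>\<^bsub>N'\<^esub> h y') = g' (f x) (h y) \<oplus>\<^bsub>L'\<^esub> g' (f x) (h y')"
    if "x \<in> carrier M" "y \<in> carrier N" "y' \<in> carrier N" for x y y'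
    using that by (simp add: mod_homD(2)[OF assms(5), symmetric] assms(9) b mod_homD[OF assms(6)])
  moreover have "g' (f x \<oplus>\<^bsub>M'\<^esub> f x') (h y) = g' (f x) (h y) \<oplus>\<^bsub>L'\<^esub> g' (f x') (h y)"
    if "x \<in> carrier M" "x' \<in> carrier M" "y \<in> carrier N" for x x' y
    using that by (simp add: mod_homD(2)[OF assms(4), symmetric] assms(9) b mod_homD[OF assms(6)])
  moreover have "g' (f x) (k \<odot>\<^bsub>N'\<^esub> h y) = k \<odot>\<^bsub>L'\<^esub> g' (f x) (h y)"
    "g' (k \<odot>\<^bsub>M'\<^esub> f x) (h y) = k \<odot>\<^bsub>L'\<^esub> g' (f x) (h y)"
    if "x \<in> carrier M" "y \<in> carrier N" "k \<in> carrier K" for x y k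
    using that by (simp_all add: mod_homD(3)[OF assms(5), symmetric]
        mod_homD(3)[OF assms(4), symmetric] assms(9) b mod_homD[OF assms(6)])
  moreover have "g' (f x) (h y) \<in> carrier L'" if "x \<in> carrier M" "y \<in> carrier N" for x y
    using that by (simp add: assms(9) b mod_homD[OF assms(6)])
  ultimately show ?thesis
    by (intro bilinear_mapI mod_homI) (auto simp: assms(7,8))
qed

lemma quot_module:
  assumes "module K M" "submodule N K M"
  shows "module K (quot M N)" "(\<lambda>x. N +>\<^bsub>M\<^esub> x) \<in> mod_hom K M (quot M N)"
proof -
  interpret M: module K M by fact
  have z: "N +>\<^bsub>M\<^esub> \<zero>\<^bsub>M\<^esub> = \<zero>\<^bsub>quot M N\<^esub>"
    using submodule_facts(1)[OF assms] by (simp add: quot_simps)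
  show "module K (quot M N)"
    by (rule module_surj_image[where f = "\<lambda>x. N +>\<^bsub>M\<^esub> x", OF assms(1) _ z])
      (auto simp: quot_simps quot_add[OF assms] quot_smult[OF assms])
  show "(\<lambda>x. N +>\<^bsub>M\<^esub> x) \<in> mod_hom K M (quot M N)"
    by (rule mod_homI) (auto simp: quot_simps quot_add[OF assms] quot_smult[OF assms])
qed

lemma quot_algebra:
  assumes "bilinear_algebra K A" "alg_ideal K A I"
  shows "bilinear_algebra K (quot A I)" "(\<lambda>x. I +>\<^bsub>A\<^esub> x) \<in> alg_hom K A (quot A I)"
proof -
  note A = bilinear_algebraD[OF assms(1)] and I = alg_idealD(1)[OF assms(2)]
  note q = quot_module[OF A(1) I]
  show "bilinear_algebra K (quot A I)"
    by (rule bilinear_algebraI[OF q(1)], rule bilinear_map_surj_image[OF A(2) A(1) A(1) q(2) q(2) q(2)])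
      (auto simp: quot_simps quot_mult[OF assms])
  show "(\<lambda>x. I +>\<^bsub>A\<^esub> x) \<in> alg_hom K A (quot A I)"
    by (rule alg_homI[OF q(2)]) (simp add: quot_mult[OF assms])
qed

lemma quot_lift_mod_hom:
  assumes "module K M" "module K L" "submodule N K M" "f \<in> mod_hom K M L"
    and "\<And>x. x \<in> N \<Longrightarrow> f x = \<zero>\<^bsub>L\<^esub>"
  shows "quot_lift f \<in> mod_hom K (quot M N) L"
proof -
  interpret M: module K M by fact
  note v = quot_lift_hom[OF assms] and D = mod_homD[OF assms(4)]
  show ?thesis
    by (rule mod_homI) (auto simp: quot_simps quot_add[OF assms(1,3)] quot_smult[OF assms(1,3)] v D)
qed

lemma quot_lift_alg_hom:
  assumes "bilinear_algebra K A" "bilinear_algebra K B" "alg_ideal K A I" "f \<in> alg_hom K A B"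
    and "\<And>x. x \<in> I \<Longrightarrow> f x = \<zero>\<^bsub>B\<^esub>"
  shows "quot_lift f \<in> alg_hom K (quot A I) B"
proof -
  note A = bilinear_algebraD[OF assms(1)] and B = bilinear_algebraD[OF assms(2)]
    and I = alg_idealD(1)[OF assms(3)] and f = alg_homD[OF assms(4)]
  note h = quot_lift_mod_hom[OF A(1) B(1) I f(1) assms(5)] and v = quot_lift_hom[OF A(1) B(1) I f(1) assms(5)]
  show ?thesis
    by (rule alg_homI[OF h])
      (auto simp: quot_simps quot_mult[OF assms(1,3)] v f bilinear_map_simps[OF A(2)])
qed

text \<open>The enveloping algebras have a unit, the kernels in the crossed modules do not. The unit
  is the value of the empty word and the start of every induction over an enveloping
  algebra.\<close>

locale unital_algebra = assoc_algebra K A for K :: "('k, 'z) ring_scheme" and A :: "('k, 'a) module" +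
  assumes one_closed: "\<one>\<^bsub>A\<^esub> \<in> carrier A"
    and one_left: "x \<in> carrier A \<Longrightarrow> \<one>\<^bsub>A\<^esub> \<otimes>\<^bsub>A\<^esub> x = x"
    and one_right: "x \<in> carrier A \<Longrightarrow> x \<otimes>\<^bsub>A\<^esub> \<one>\<^bsub>A\<^esub> = x"

lemma unital_algebraI:
  assumes "bilinear_algebra K A" "\<one>\<^bsub>A\<^esub> \<in> carrier A"
    and "\<And>x y z. \<lbrakk>x \<in> carrier A; y \<in> carrier A; z \<in> carrier A\<rbrakk> \<Longrightarrow>
      (x \<otimes>\<^bsub>A\<^esub> y) \<otimes>\<^bsub>A\<^esub> z = x \<otimes>\<^bsub>A\<^esub> (y \<otimes>\<^bsub>A\<^esub> z)"
    and "\<And>x. x \<in> carrier A \<Longrightarrow> \<one>\<^bsub>A\<^esub> \<otimes>\<^bsub>A\<^esub> x = x"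
    and "\<And>x. x \<in> carrier A \<Longrightarrow> x \<otimes>\<^bsub>A\<^esub> \<one>\<^bsub>A\<^esub> = x"
  shows "unital_algebra K A"
  using assms
  by (auto simp: unital_algebra_def unital_algebra_axioms_def assoc_algebra_def assoc_algebra_axioms_def)

lemma unital_algebraD:
  assumes "unital_algebra K A"
  shows "bilinear_algebra K A" "module K A" "bilinear_map K A A A (\<otimes>\<^bsub>A\<^esub>)" "ring A"
proof -
  interpret unital_algebra K A by fact
  show b: "bilinear_algebra K A" "module K A" "bilinear_map K A A A (\<otimes>\<^bsub>A\<^esub>)"
    by (auto intro: bilinear_algebra_axioms module_axioms bilinear_mult)
  note s = bilinear_map_simps[OF b(3)]
  show "ring A"
    by (rule ringI)
      (auto intro!: M.abelian_group_axioms monoidI simp: s one_closed one_left one_right mult_assoc)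
qed

lemma unital_algebra_quot:
  assumes "unital_algebra K A" "alg_ideal K A I"
  shows "unital_algebra K (quot A I)"
proof -
  interpret unital_algebra K A by fact
  note b = unital_algebraD[OF assms(1)]
  note m = quot_mult[OF b(1) assms(2)] and s = bilinear_map_simps[OF b(3)]
  show ?thesis
    by (rule unital_algebraI)
      (auto simp: quot_simps m s mult_assoc one_closed one_left one_right
        intro: quot_algebra[OF b(1) assms(2)])
qed

subsection \<open>Free modules and free algebras\<close>

lemma free_mod_simps:
  "carrier (free_mod K S) = {a. range a \<subseteq> carrier K \<and> finite {x. a x \<noteq> \<zero>\<^bsub>K\<^esub>} \<and> {x. a x \<noteq> \<zero>\<^bsub>K\<^esub>} \<subseteq> S}"
  "\<zero>\<^bsub>free_mod K S\<^esub> = (\<lambda>x. \<zero>\<^bsub>K\<^esub>)"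
  "a \<oplus>\<^bsub>free_mod K S\<^esub> b = (\<lambda>x. a x \<oplus>\<^bsub>K\<^esub> b x)"
  "k \<odot>\<^bsub>free_mod K S\<^esub> a = (\<lambda>x. k \<otimes>\<^bsub>K\<^esub> a x)"
  by (auto simp: free_mod_def)

lemma free_mod_module:
  fixes K :: "('k, 'z) ring_scheme" and S :: "'s set"
  assumes "cring K" shows "module K (free_mod K S)"
proof -
  interpret K: cring K by fact
  have fin: "finite {x. a x \<oplus>\<^bsub>K\<^esub> b x \<noteq> \<zero>\<^bsub>K\<^esub>}"
    if "finite {x. a x \<noteq> \<zero>\<^bsub>K\<^esub>}" "finite {x. b x \<noteq> \<zero>\<^bsub>K\<^esub>}" for a b :: "'s \<Rightarrow> 'k"
    by (rule finite_subset[of _ "{x. a x \<noteq> \<zero>\<^bsub>K\<^esub>} \<union> {x. b x \<noteq> \<zero>\<^bsub>K\<^esub>}"]) (use that in auto)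
  have fin2: "finite {x. k \<otimes>\<^bsub>K\<^esub> a x \<noteq> \<zero>\<^bsub>K\<^esub>}"
    if "finite {x. a x \<noteq> \<zero>\<^bsub>K\<^esub>}" "k \<in> carrier K" for a :: "'s \<Rightarrow> 'k" and k
    by (rule finite_subset[of _ "{x. a x \<noteq> \<zero>\<^bsub>K\<^esub>}"]) (use that in auto)
  have neg: "\<exists>b\<in>carrier (free_mod K S). b \<oplus>\<^bsub>free_mod K S\<^esub> a = \<zero>\<^bsub>free_mod K S\<^esub>"
    if a: "a \<in> carrier (free_mod K S)" for a
  proof (rule bexI)
    have "\<ominus>\<^bsub>K\<^esub> y \<noteq> \<zero>\<^bsub>K\<^esub> \<longleftrightarrow> y \<noteq> \<zero>\<^bsub>K\<^esub>" if "y \<in> carrier K" for y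
      using that K.minus_minus by fastforce
    then have "{x. \<ominus>\<^bsub>K\<^esub> a x \<noteq> \<zero>\<^bsub>K\<^esub>} = {x. a x \<noteq> \<zero>\<^bsub>K\<^esub>}" using a by (simp add: free_mod_simps image_subset_iff)
    then show "(\<lambda>x. \<ominus>\<^bsub>K\<^esub> a x) \<in> carrier (free_mod K S)" using a by (auto simp: free_mod_simps)
    show "(\<lambda>x. \<ominus>\<^bsub>K\<^esub> a x) \<oplus>\<^bsub>free_mod K S\<^esub> a = \<zero>\<^bsub>free_mod K S\<^esub>"
      using a by (simp add: free_mod_simps K.l_neg image_subset_iff)
  qed
  have rng: "a x \<in> carrier K" if "range a \<subseteq> carrier K" for a :: "'s \<Rightarrow> 'k" and x using that by auto
  have "abelian_group (free_mod K S)"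
  proof (rule abelian_groupI)
    fix a b assume ab: "a \<in> carrier (free_mod K S)" "b \<in> carrier (free_mod K S)"
    show "a \<oplus>\<^bsub>free_mod K S\<^esub> b \<in> carrier (free_mod K S)"
    proof -
      have "range (\<lambda>x. a x \<oplus>\<^bsub>K\<^esub> b x) \<subseteq> carrier K" using ab by (auto simp: free_mod_simps)
      moreover have "{x. a x \<oplus>\<^bsub>K\<^esub> b x \<noteq> \<zero>\<^bsub>K\<^esub>} \<subseteq> {x. a x \<noteq> \<zero>\<^bsub>K\<^esub>} \<union> {x. b x \<noteq> \<zero>\<^bsub>K\<^esub>}" by auto
      then have "{x. a x \<oplus>\<^bsub>K\<^esub> b x \<noteq> \<zero>\<^bsub>K\<^esub>} \<subseteq> S"
        by (rule order_trans) (use ab in \<open>auto simp: free_mod_simps\<close>)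
      ultimately show ?thesis using ab fin by (simp add: free_mod_simps)
    qed
    show "a \<oplus>\<^bsub>free_mod K S\<^esub> b = b \<oplus>\<^bsub>free_mod K S\<^esub> a"
      using ab by (auto simp: free_mod_simps rng K.a_comm)
  next
    fix a b c
    assume "a \<in> carrier (free_mod K S)" "b \<in> carrier (free_mod K S)" "c \<in> carrier (free_mod K S)"
    then show "a \<oplus>\<^bsub>free_mod K S\<^esub> b \<oplus>\<^bsub>free_mod K S\<^esub> c = a \<oplus>\<^bsub>free_mod K S\<^esub> (b \<oplus>\<^bsub>free_mod K S\<^esub> c)"
      by (auto simp: free_mod_simps rng K.a_assoc)
  next
    show "\<exists>b\<in>carrier (free_mod K S). b \<oplus>\<^bsub>free_mod K S\<^esub> a = \<zero>\<^bsub>free_mod K S\<^esub>"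
      if "a \<in> carrier (free_mod K S)" for a by (rule neg[OF that])
  qed (auto simp: free_mod_simps rng)
  then show ?thesis
  proof (rule moduleI[OF assms])
    fix k a assume k: "k \<in> carrier K" and a: "a \<in> carrier (free_mod K S)"
    have "{x. k \<otimes>\<^bsub>K\<^esub> a x \<noteq> \<zero>\<^bsub>K\<^esub>} \<subseteq> {x. a x \<noteq> \<zero>\<^bsub>K\<^esub>}" using k by auto
    then have "{x. k \<otimes>\<^bsub>K\<^esub> a x \<noteq> \<zero>\<^bsub>K\<^esub>} \<subseteq> S"
      by (rule order_trans) (use a in \<open>simp add: free_mod_simps\<close>)
    then show "k \<odot>\<^bsub>free_mod K S\<^esub> a \<in> carrier (free_mod K S)"
      using fin2[OF _ k] a k by (simp add: free_mod_simps image_subset_iff)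
  qed (simp_all add: free_mod_simps image_subset_iff K.l_distr K.r_distr K.m_assoc)
qed

lemma single_closed:
  assumes "cring K" "x \<in> S" shows "single K x \<in> carrier (free_mod K S)"
proof -
  interpret K: cring K by fact
  have "{y. single K x y \<noteq> \<zero>\<^bsub>K\<^esub>} \<subseteq> {x}" by (auto simp: single_def)
  moreover from this have "finite {y. single K x y \<noteq> \<zero>\<^bsub>K\<^esub>}" by (rule finite_subset) auto
  moreover have "range (single K x) \<subseteq> carrier K" by (auto simp: single_def)
  ultimately show ?thesis using assms by (auto simp: free_mod_simps)
qed

lemma free_mod_span:
  fixes K :: "('k, 'z) ring_scheme" and S :: "'s set"
  assumes "cring K" "a \<in> carrier (free_mod K S)"
  shows "a \<in> mod_span K (free_mod K S) (single K ` S)"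
proof -
  interpret K: cring K by fact
  let ?F = "free_mod K S"
  note F = free_mod_module[OF assms(1), of S]
  have sub: "submodule (mod_span K ?F (single K ` S)) K ?F"
    by (rule mod_span_submodule[OF F]) (use single_closed[OF assms(1)] in auto)
  note N = submodule_facts[OF F sub]
  \<comment> \<open>Induction on a finite set that contains the support rather than on the support
    itself: a point with coefficient zero is then dropped without changing \<open>a\<close>.\<close>
  have "a \<in> mod_span K ?F (single K ` S)"
    if "finite X" "{x. a x \<noteq> \<zero>\<^bsub>K\<^esub>} \<subseteq> X" "a \<in> carrier ?F" for X and a :: "'s \<Rightarrow> 'k"
    using that
  proof (induction X arbitrary: a rule: finite_induct)
    case empty
    then have "a = \<zero>\<^bsub>?F\<^esub>" by (auto simp: free_mod_simps)
    then show ?case using N(2) by simp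
  next
    case (insert x X)
    show ?case
    proof (cases "a x = \<zero>\<^bsub>K\<^esub>")
      case True
      then show ?thesis using insert by blast
    next
      case False
      have c: "a y \<in> carrier K" for y using insert.prems by (auto simp: free_mod_simps)
      have x: "x \<in> S" using False insert.prems by (auto simp: free_mod_simps)
      define b where "b = a(x := \<zero>\<^bsub>K\<^esub>)"
      have b: "{y. b y \<noteq> \<zero>\<^bsub>K\<^esub>} \<subseteq> {y. a y \<noteq> \<zero>\<^bsub>K\<^esub>}" by (auto simp: b_def)
      then have "finite {y. b y \<noteq> \<zero>\<^bsub>K\<^esub>}"
        using insert.prems finite_subset by (auto simp: free_mod_simps)
      then have "b \<in> carrier ?F" using insert.prems b c by (auto simp: free_mod_simps b_def)
      moreover have "{y. b y \<noteq> \<zero>\<^bsub>K\<^esub>} \<subseteq> X" using insert.prems(1) by (auto simp: b_def)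
      ultimately have "b \<in> mod_span K ?F (single K ` S)" using insert.IH by blast
      moreover have "single K x \<in> mod_span K ?F (single K ` S)" by (rule subsetD[OF mod_span_superset imageI[OF x]])
      moreover have "a = b \<oplus>\<^bsub>?F\<^esub> a x \<odot>\<^bsub>?F\<^esub> single K x"
        using c by (auto simp: free_mod_simps b_def single_def)
      ultimately show ?thesis using N(3,4) c by metis
    qed
  qed
  then show ?thesis using assms(2) by (auto simp: free_mod_simps)
qed

text \<open>\<open>lin_ext\<close> sums over the exact support, and supports can shrink under
  addition and scaling. Comparing two values needs a common index set, on which the extra terms are
  zero.\<close>

lemma lin_ext_superset:
  assumes "module K N" "a \<in> carrier (free_mod K S)" "f ` S \<subseteq> carrier N"
    and "finite X" "{x. a x \<noteq> \<zero>\<^bsub>K\<^esub>} \<subseteq> X" "X \<subseteq> S"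
  shows "lin_ext K N f a = (\<Oplus>\<^bsub>N\<^esub>x\<in>X. a x \<odot>\<^bsub>N\<^esub> f x)"
proof -
  interpret N: module K N by fact
  have c: "a y \<in> carrier K" for y using assms(2) by (auto simp: free_mod_simps)
  have 0: "a x \<odot>\<^bsub>N\<^esub> f x = \<zero>\<^bsub>N\<^esub>" if "x \<in> X - {x. a x \<noteq> \<zero>\<^bsub>K\<^esub>}" for x
    using that assms(3,6) by (auto simp: image_subset_iff subset_iff)
  have 1: "(\<lambda>x. a x \<odot>\<^bsub>N\<^esub> f x) \<in> X \<rightarrow> carrier N" using assms(3,6) c by auto
  show ?thesis
    unfolding lin_ext_def
    by (rule N.M.add.finprod_mono_neutral_cong_left[OF assms(4,5) 0 refl 1])
qed

lemma lin_ext_hom: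
  assumes "module K N" "f ` S \<subseteq> carrier N"
  shows "lin_ext K N f \<in> mod_hom K (free_mod K S) N"
proof -
  interpret N: module K N by fact
  note F = free_mod_module[OF N.R.cring_axioms, of S]
  interpret F: module K "free_mod K S" by (rule F)
  have fS: "f x \<in> carrier N" if "x \<in> S" for x using assms(2) that by auto
  have c: "a y \<in> carrier K" if "a \<in> carrier (free_mod K S)" for a y
    using that by (auto simp: free_mod_simps)
  let ?X = "\<lambda>a. {x. a x \<noteq> \<zero>\<^bsub>K\<^esub>}"
  have X: "finite (?X a)" "?X a \<subseteq> S" if "a \<in> carrier (free_mod K S)" for a
    using that by (auto simp: free_mod_simps)
  show ?thesis
  proof (rule mod_homI)
    fix a assume a: "a \<in> carrier (free_mod K S)"
    show "lin_ext K N f a \<in> carrier N"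
      unfolding lin_ext_def using X[OF a] c[OF a] fS by (intro N.M.finsum_closed) auto
    fix b assume b: "b \<in> carrier (free_mod K S)"
    have ab: "a \<oplus>\<^bsub>free_mod K S\<^esub> b \<in> carrier (free_mod K S)" using a b by auto
    let ?Y = "?X a \<union> ?X b \<union> ?X (a \<oplus>\<^bsub>free_mod K S\<^esub> b)"
    have Y: "finite ?Y" "?Y \<subseteq> S" using X[OF a] X[OF b] X[OF ab] by auto
    have ca: "(\<lambda>x. a x \<odot>\<^bsub>N\<^esub> f x) \<in> ?Y \<rightarrow> carrier N" using Y fS c[OF a] by blast
    have cb: "(\<lambda>x. b x \<odot>\<^bsub>N\<^esub> f x) \<in> ?Y \<rightarrow> carrier N" using Y fS c[OF b] by blast
    have "lin_ext K N f (a \<oplus>\<^bsub>free_mod K S\<^esub> b) = (\<Oplus>\<^bsub>N\<^esub>x\<in>?Y. (a x \<oplus>\<^bsub>K\<^esub> b x) \<odot>\<^bsub>N\<^esub> f x)"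
      using lin_ext_superset[OF assms(1) ab assms(2) Y(1) _ Y(2)] by (simp add: free_mod_simps)
    also have "\<dots> = (\<Oplus>\<^bsub>N\<^esub>x\<in>?Y. a x \<odot>\<^bsub>N\<^esub> f x \<oplus>\<^bsub>N\<^esub> b x \<odot>\<^bsub>N\<^esub> f x)"
    proof (rule N.M.finsum_cong'[OF refl])
      show "(\<lambda>x. a x \<odot>\<^bsub>N\<^esub> f x \<oplus>\<^bsub>N\<^esub> b x \<odot>\<^bsub>N\<^esub> f x) \<in> ?Y \<rightarrow> carrier N"
        using ca cb by (simp add: Pi_iff)
    next
      fix i assume "i \<in> ?Y"
      then have "f i \<in> carrier N" using Y fS by blast
      then show "(a i \<oplus>\<^bsub>K\<^esub> b i) \<odot>\<^bsub>N\<^esub> f i = a i \<odot>\<^bsub>N\<^esub> f i \<oplus>\<^bsub>N\<^esub> b i \<odot>\<^bsub>N\<^esub> f i"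
        using c[OF a] c[OF b] by (simp add: N.smult_l_distr)
    qed
    also have "\<dots> = (\<Oplus>\<^bsub>N\<^esub>x\<in>?Y. a x \<odot>\<^bsub>N\<^esub> f x) \<oplus>\<^bsub>N\<^esub> (\<Oplus>\<^bsub>N\<^esub>x\<in>?Y. b x \<odot>\<^bsub>N\<^esub> f x)"
      by (rule N.M.finsum_addf[OF ca cb])
    also have "\<dots> = lin_ext K N f a \<oplus>\<^bsub>N\<^esub> lin_ext K N f b"
      using lin_ext_superset[OF assms(1) a assms(2) Y(1) _ Y(2)]
        lin_ext_superset[OF assms(1) b assms(2) Y(1) _ Y(2)] by (simp add: le_supI1)
    finally show "lin_ext K N f (a \<oplus>\<^bsub>free_mod K S\<^esub> b) = lin_ext K N f a \<oplus>\<^bsub>N\<^esub> lin_ext K N f b" .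
  next
    fix k a assume k: "k \<in> carrier K" and a: "a \<in> carrier (free_mod K S)"
    have ka: "k \<odot>\<^bsub>free_mod K S\<^esub> a \<in> carrier (free_mod K S)" using k a by auto
    have sub: "?X (k \<odot>\<^bsub>free_mod K S\<^esub> a) \<subseteq> ?X a" using k by (auto simp: free_mod_simps)
    have ca: "(\<lambda>x. a x \<odot>\<^bsub>N\<^esub> f x) \<in> ?X a \<rightarrow> carrier N" using X(2)[OF a] fS c[OF a] by blast
    have "lin_ext K N f (k \<odot>\<^bsub>free_mod K S\<^esub> a) = (\<Oplus>\<^bsub>N\<^esub>x\<in>?X a. (k \<otimes>\<^bsub>K\<^esub> a x) \<odot>\<^bsub>N\<^esub> f x)"
      using lin_ext_superset[OF assms(1) ka assms(2) X(1)[OF a] sub X(2)[OF a]]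
      by (simp add: free_mod_simps)
    also have "\<dots> = (\<Oplus>\<^bsub>N\<^esub>x\<in>?X a. k \<odot>\<^bsub>N\<^esub> (a x \<odot>\<^bsub>N\<^esub> f x))"
    proof (rule N.M.finsum_cong'[OF refl])
      show "(\<lambda>x. k \<odot>\<^bsub>N\<^esub> (a x \<odot>\<^bsub>N\<^esub> f x)) \<in> ?X a \<rightarrow> carrier N"
        using ca k by (simp add: Pi_iff)
    next
      fix i assume "i \<in> ?X a"
      then have "f i \<in> carrier N" using X(2)[OF a] fS by blast
      then show "(k \<otimes>\<^bsub>K\<^esub> a i) \<odot>\<^bsub>N\<^esub> f i = k \<odot>\<^bsub>N\<^esub> (a i \<odot>\<^bsub>N\<^esub> f i)"
        using c[OF a] k by (simp add: N.smult_assoc1)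
    qed
    also have "\<dots> = k \<odot>\<^bsub>N\<^esub> lin_ext K N f a"
      unfolding lin_ext_def by (rule N.finsum_smult_ldistr[OF X(1)[OF a] k ca, symmetric])
    finally show "lin_ext K N f (k \<odot>\<^bsub>free_mod K S\<^esub> a) = k \<odot>\<^bsub>N\<^esub> lin_ext K N f a" .
  qed
qed

lemma lin_ext_single:
  assumes "module K N" "f ` S \<subseteq> carrier N" "x \<in> S"
  shows "lin_ext K N f (single K x) = f x"
proof -
  interpret N: module K N by fact
  have x: "f x \<in> carrier N" using assms by auto
  have "lin_ext K N f (single K x) = (\<Oplus>\<^bsub>N\<^esub>y\<in>{x}. single K x y \<odot>\<^bsub>N\<^esub> f y)"
    by (rule lin_ext_superset[OF assms(1) single_closed[OF N.R.cring_axioms assms(3)] assms(2)])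
      (use assms(3) in \<open>auto simp: single_def\<close>)
  then show ?thesis using x by (simp add: single_def)
qed

lemma free_mod_hom_eq:
  assumes "module K N" "f \<in> mod_hom K (free_mod K S) N" "g \<in> mod_hom K (free_mod K S) N"
    and "\<And>x. x \<in> S \<Longrightarrow> f (single K x) = g (single K x)" "a \<in> carrier (free_mod K S)"
  shows "f a = g a"
proof -
  have K: "cring K" using assms(1) by (simp add: module_def)
  show ?thesis
    by (rule mod_hom_eq_on_span[OF free_mod_module[OF K] assms(1-3) _ _ free_mod_span[OF K assms(5)]])
      (use single_closed[OF K] assms(4) in auto)
qed

text \<open>Additivity in the function that is extended, not in the argument.
  \<open>free_alg_right_action\<close> needs it because there the extended function
  \<open>foldl g n\<close> depends on a module element \<open>n\<close>.\<close>

lemma lin_ext_add: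
  assumes "module K N" "f ` S \<subseteq> carrier N" "g ` S \<subseteq> carrier N" "a \<in> carrier (free_mod K S)"
  shows "lin_ext K N (\<lambda>x. f x \<oplus>\<^bsub>N\<^esub> g x) a = lin_ext K N f a \<oplus>\<^bsub>N\<^esub> lin_ext K N g a"
proof -
  interpret N: module K N by fact
  have S: "(\<lambda>x. f x \<oplus>\<^bsub>N\<^esub> g x) ` S \<subseteq> carrier N" using assms by auto
  show ?thesis
    by (rule free_mod_hom_eq[OF assms(1) lin_ext_hom[OF assms(1) S]
          mod_hom_add[OF assms(1) lin_ext_hom[OF assms(1,2)] lin_ext_hom[OF assms(1,3)]] _ assms(4)])
      (simp add: lin_ext_single[OF assms(1) S] lin_ext_single[OF assms(1,2)]
        lin_ext_single[OF assms(1,3)])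
qed

lemma lin_ext_smult:
  assumes "module K N" "f ` S \<subseteq> carrier N" "k \<in> carrier K" "a \<in> carrier (free_mod K S)"
  shows "lin_ext K N (\<lambda>x. k \<odot>\<^bsub>N\<^esub> f x) a = k \<odot>\<^bsub>N\<^esub> lin_ext K N f a"
proof -
  interpret N: module K N by fact
  have S: "(\<lambda>x. k \<odot>\<^bsub>N\<^esub> f x) ` S \<subseteq> carrier N" using assms by auto
  have "(\<lambda>y. k \<odot>\<^bsub>N\<^esub> y) \<in> mod_hom K N N"
    by (rule mod_homI) (use assms(3) in \<open>auto simp: N.smult_r_distr N.smult_assoc1[symmetric] N.R.m_comm\<close>)
  then show ?thesis
    by (intro free_mod_hom_eq[OF assms(1) lin_ext_hom[OF assms(1) S]
          mod_hom_comp[OF lin_ext_hom[OF assms(1,2)]] _ assms(4)])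
      (auto simp add: lin_ext_single[OF assms(1) S] lin_ext_single[OF assms(1,2)])
qed

section \<open>Free algebras\<close>

lemma free_alg_simps:
  "carrier (free_alg K S) = carrier (free_mod K (lists S))"
  "\<zero>\<^bsub>free_alg K S\<^esub> = (\<lambda>x. \<zero>\<^bsub>K\<^esub>)"
  "a \<oplus>\<^bsub>free_alg K S\<^esub> b = a \<oplus>\<^bsub>free_mod K (lists S)\<^esub> b"
  "k \<odot>\<^bsub>free_alg K S\<^esub> a = k \<odot>\<^bsub>free_mod K (lists S)\<^esub> a"
  "a \<otimes>\<^bsub>free_alg K S\<^esub> b = (\<lambda>w. \<Oplus>\<^bsub>K\<^esub>i\<in>{..length w}. a (take i w) \<otimes>\<^bsub>K\<^esub> b (drop i w))"
  "\<one>\<^bsub>free_alg K S\<^esub> = single K []"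
  by (auto simp: free_alg_def free_mod_simps)

text \<open>\<open>free_alg\<close> is \<open>free_mod\<close> on words with \<open>mult\<close> and
  \<open>one\<close> replaced, and linear maps and spans do not look at these two fields.\<close>

lemma mod_hom_free_alg:
  "mod_hom K (free_alg K S) N = mod_hom K (free_mod K (lists S)) N"
  "mod_span K (free_alg K S) X = mod_span K (free_mod K (lists S)) X"
proof -
  show "mod_hom K (free_alg K S) N = mod_hom K (free_mod K (lists S)) N"
    by (simp add: mod_hom_def free_alg_simps)
  have "add_monoid (free_alg K S) = add_monoid (free_mod K (lists S))"
    by (simp add: free_alg_def)
  then have "submodule N K (free_alg K S) = submodule N K (free_mod K (lists S))" for N
    by (simp add: submodule_def submodule_axioms_def free_alg_simps)
  then show "mod_span K (free_alg K S) X = mod_span K (free_mod K (lists S)) X"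
    by (simp add: mod_span_def)
qed

lemma free_alg_module:
  assumes "cring K" shows "module K (free_alg K S)"
  by (rule module_surj_image[where f = "\<lambda>x. x", OF free_mod_module[OF assms, of "lists S"]])
    (auto simp: free_alg_simps free_mod_simps)

lemma free_alg_bilinear:
  fixes K :: "('k, 'z) ring_scheme" and S :: "'s set"
  assumes "cring K" shows "bilinear_algebra K (free_alg K S)"
proof (rule bilinear_algebraI[OF free_alg_module[OF assms]])
  interpret K: cring K by fact
  let ?F = "free_alg K S"
  have c: "a y \<in> carrier K" if "a \<in> carrier ?F" for a and y :: "'s list"
    using that by (auto simp: free_alg_simps free_mod_simps)
  have closed: "a \<otimes>\<^bsub>?F\<^esub> b \<in> carrier ?F" if a: "a \<in> carrier ?F" and b: "b \<in> carrier ?F" for a b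
  proof -
    let ?X = "\<lambda>a. {x. a x \<noteq> \<zero>\<^bsub>K\<^esub>}"
    \<comment> \<open>A nonzero coefficient of the product at \<open>w\<close> requires a cut of
      \<open>w\<close> into two words with nonzero coefficients, so the support consists of
      concatenations.\<close>
    have sub: "?X (a \<otimes>\<^bsub>?F\<^esub> b) \<subseteq> (\<lambda>(u, v). u @ v) ` (?X a \<times> ?X b)"
    proof
      fix w assume w: "w \<in> ?X (a \<otimes>\<^bsub>?F\<^esub> b)"
      then obtain i where "a (take i w) \<otimes>\<^bsub>K\<^esub> b (drop i w) \<noteq> \<zero>\<^bsub>K\<^esub>"
        using K.add.finprod_one_eqI[of "{..length w}" "\<lambda>i. a (take i w) \<otimes>\<^bsub>K\<^esub> b (drop i w)"]
        by (auto simp: free_alg_simps)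
      then have "a (take i w) \<noteq> \<zero>\<^bsub>K\<^esub>" "b (drop i w) \<noteq> \<zero>\<^bsub>K\<^esub>" using c[OF a] c[OF b] by auto
      then show "w \<in> (\<lambda>(u, v). u @ v) ` (?X a \<times> ?X b)"
        by (intro image_eqI[of _ _ "(take i w, drop i w)"]) auto
    qed
    have X: "finite (?X a)" "finite (?X b)" "?X a \<subseteq> lists S" "?X b \<subseteq> lists S"
      using a b by (auto simp: free_alg_simps free_mod_simps)
    have "finite (?X (a \<otimes>\<^bsub>?F\<^esub> b))" by (rule finite_subset[OF sub]) (use X in auto)
    moreover have "?X (a \<otimes>\<^bsub>?F\<^esub> b) \<subseteq> lists S"
    proof (rule order_trans[OF sub], clarify)
      fix u v x assume "a u \<noteq> \<zero>\<^bsub>K\<^esub>" "b v \<noteq> \<zero>\<^bsub>K\<^esub>" "x \<in> set (u @ v)"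
      then show "x \<in> S" using X(3,4) by auto
    qed
    moreover have "range (a \<otimes>\<^bsub>?F\<^esub> b) \<subseteq> carrier K"
      using c[OF a] c[OF b] by (auto simp: free_alg_simps intro!: K.finsum_closed)
    ultimately show ?thesis by (simp add: free_alg_simps free_mod_simps)
  qed
  have cm: "(\<lambda>i. a (take i w) \<otimes>\<^bsub>K\<^esub> b (drop i w)) \<in> {..length w} \<rightarrow> carrier K"
    if "a \<in> carrier ?F" "b \<in> carrier ?F" for a b w
    using c that by simp
  show "bilinear_map K ?F ?F ?F (\<otimes>\<^bsub>?F\<^esub>)"
  proof (intro bilinear_mapI mod_homI closed)
    fix a b d assume abd: "a \<in> carrier ?F" "b \<in> carrier ?F" "d \<in> carrier ?F"
    show "a \<otimes>\<^bsub>?F\<^esub> (b \<oplus>\<^bsub>?F\<^esub> d) = a \<otimes>\<^bsub>?F\<^esub> b \<oplus>\<^bsub>?F\<^esub> a \<otimes>\<^bsub>?F\<^esub> d"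
      unfolding free_alg_simps(3,5) free_mod_simps
      by (rule ext, subst K.finsum_addf[OF cm cm, symmetric])
        (auto intro!: K.finsum_cong' simp: c abd K.r_distr)
    show "(b \<oplus>\<^bsub>?F\<^esub> d) \<otimes>\<^bsub>?F\<^esub> a = b \<otimes>\<^bsub>?F\<^esub> a \<oplus>\<^bsub>?F\<^esub> d \<otimes>\<^bsub>?F\<^esub> a"
      unfolding free_alg_simps(3,5) free_mod_simps
      by (rule ext, subst K.finsum_addf[OF cm cm, symmetric])
        (auto intro!: K.finsum_cong' simp: c abd K.l_distr)
  next
    fix a b k assume abd: "a \<in> carrier ?F" "b \<in> carrier ?F" "k \<in> carrier K"
    show "a \<otimes>\<^bsub>?F\<^esub> (k \<odot>\<^bsub>?F\<^esub> b) = k \<odot>\<^bsub>?F\<^esub> (a \<otimes>\<^bsub>?F\<^esub> b)"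
      unfolding free_alg_simps(4,5) free_mod_simps
      by (rule ext, subst K.finsum_rdistr[OF _ abd(3) cm])
        (auto intro!: K.finsum_cong' simp: c abd K.m_lcomm)
    show "(k \<odot>\<^bsub>?F\<^esub> b) \<otimes>\<^bsub>?F\<^esub> a = k \<odot>\<^bsub>?F\<^esub> (b \<otimes>\<^bsub>?F\<^esub> a)"
      unfolding free_alg_simps(4,5) free_mod_simps
      by (rule ext, subst K.finsum_rdistr[OF _ abd(3) cm])
        (auto intro!: K.finsum_cong' simp: c abd K.m_assoc)
  qed
qed

text \<open>Among all cuts of \<open>u @ v\<close>, only the one at position \<open>length u\<close>
  contributes to the convolution sum.\<close>

lemma single_append:
  assumes "cring K"
  shows "single K u \<otimes>\<^bsub>free_alg K S\<^esub> single K v = single K (u @ v)"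
proof
  interpret K: cring K by fact
  fix w
  show "(single K u \<otimes>\<^bsub>free_alg K S\<^esub> single K v) w = single K (u @ v) w"
  proof (cases "w = u @ v")
    case True
    have "take i w = u \<and> drop i w = v \<longleftrightarrow> length u = i" if "i \<le> length w" for i
      using that True by (metis append_eq_conv_conj length_take min.absorb2)
    then have "(\<Oplus>\<^bsub>K\<^esub>i\<in>{..length w}. single K u (take i w) \<otimes>\<^bsub>K\<^esub> single K v (drop i w))
        = (\<Oplus>\<^bsub>K\<^esub>i\<in>{..length w}. if length u = i then \<one>\<^bsub>K\<^esub> else \<zero>\<^bsub>K\<^esub>)"
      by (intro K.finsum_cong') (auto simp: single_def)
    also have "\<dots> = \<one>\<^bsub>K\<^esub>"
      using True by (subst K.add.finprod_singleton[where f = "\<lambda>_. \<one>\<^bsub>K\<^esub>"]) auto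
    finally show ?thesis using True by (simp add: free_alg_simps single_def)
  next
    case False
    have "single K u (take i w) \<otimes>\<^bsub>K\<^esub> single K v (drop i w) = \<zero>\<^bsub>K\<^esub>" for i
      using False append_take_drop_id[of i w] by (auto simp: single_def)
    then show ?thesis using False by (simp add: free_alg_simps single_def)
  qed
qed

lemma single_in_free_alg:
  assumes "cring K" "w \<in> lists S" shows "single K w \<in> carrier (free_alg K S)"
  unfolding free_alg_simps by (rule single_closed[OF assms])

lemma free_alg_span:
  assumes "cring K" "a \<in> carrier (free_alg K S)"
  shows "a \<in> mod_span K (free_alg K S) (single K ` lists S)"
  using free_mod_span[OF assms(1), of a "lists S"] assms(2) by (simp add: mod_hom_free_alg free_alg_simps)

text \<open>On words the laws are those of concatenation. Associativity is extended from words to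
  all elements in one variable at a time, starting with the last.\<close>

lemma free_alg_unital:
  fixes K :: "('k, 'z) ring_scheme"
  assumes K: "cring K" shows "unital_algebra K (free_alg K S)"
proof -
  let ?F = "free_alg K S"
  note B = free_alg_bilinear[OF K, of S]
  note b = bilinear_algebraD[OF B] and c = single_in_free_alg[OF K] and sp = free_alg_span[OF K]
  interpret module K ?F by (rule b)
  note s = bilinear_map_simps[OF b(2)]
  have sub: "single K ` lists S \<subseteq> carrier ?F" by (auto del: in_listsD intro: c)
  have one: "single K [] \<in> carrier ?F" by (rule c) simp
  note e = single_append[OF K, where S = S]
  note L = bilinear_mapD(1)[OF b(2)] and R = bilinear_mapD(2)[OF b(2)]
  have 1: "(single K u \<otimes>\<^bsub>?F\<^esub> single K v) \<otimes>\<^bsub>?F\<^esub> z = single K u \<otimes>\<^bsub>?F\<^esub> (single K v \<otimes>\<^bsub>?F\<^esub> z)"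
    if "u \<in> lists S" "v \<in> lists S" "z \<in> carrier ?F" for u v z
    by (rule mod_hom_eq_on_span[OF b(1) b(1) L mod_hom_comp[OF L L] sub _ sp])
      (use that in \<open>auto simp: e c del: in_listsD\<close>)
  have 2: "(single K u \<otimes>\<^bsub>?F\<^esub> y) \<otimes>\<^bsub>?F\<^esub> z = single K u \<otimes>\<^bsub>?F\<^esub> (y \<otimes>\<^bsub>?F\<^esub> z)"
    if "u \<in> lists S" "y \<in> carrier ?F" "z \<in> carrier ?F" for u y z
    by (rule mod_hom_eq_on_span[OF b(1) b(1) mod_hom_comp[OF L R] mod_hom_comp[OF R L] sub _ sp])
      (use that in \<open>auto simp: 1 c del: in_listsD\<close>)
  have 3: "(x \<otimes>\<^bsub>?F\<^esub> y) \<otimes>\<^bsub>?F\<^esub> z = x \<otimes>\<^bsub>?F\<^esub> (y \<otimes>\<^bsub>?F\<^esub> z)"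
    if "x \<in> carrier ?F" "y \<in> carrier ?F" "z \<in> carrier ?F" for x y z
    by (rule mod_hom_eq_on_span[OF b(1) b(1) mod_hom_comp[OF R R] R sub _ sp])
      (use that in \<open>auto simp: 2 c s del: in_listsD\<close>)
  have id: "(\<lambda>x. x) \<in> mod_hom K ?F ?F" by (rule mod_homI) simp_all
  have 4: "single K [] \<otimes>\<^bsub>?F\<^esub> x = x" if "x \<in> carrier ?F" for x
    by (rule mod_hom_eq_on_span[OF b(1) b(1) L id sub _ sp]) (use that in \<open>auto simp: e one\<close>)
  have 5: "x \<otimes>\<^bsub>?F\<^esub> single K [] = x" if "x \<in> carrier ?F" for x
    by (rule mod_hom_eq_on_span[OF b(1) b(1) R id sub _ sp]) (use that in \<open>auto simp: e one\<close>)
  show ?thesis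
    by (rule unital_algebraI[OF B]) (simp_all add: free_alg_simps(6) one 3 4 5)
qed

text \<open>Evaluating a word in \<open>A\<close> turns concatenation into the product, by
  associativity of \<open>A\<close>; bilinearity carries this from words to all elements.\<close>

lemma free_alg_lift:
  assumes A: "unital_algebra K A" and f: "f ` S \<subseteq> carrier A"
  shows "lin_ext K A (word_val A f) \<in> alg_hom K (free_alg K S) A"
    and "lin_ext K A (word_val A f) \<one>\<^bsub>free_alg K S\<^esub> = \<one>\<^bsub>A\<^esub>"
    and "x \<in> S \<Longrightarrow> lin_ext K A (word_val A f) (single K [x]) = f x"
proof -
  interpret A: unital_algebra K A by fact
  note b = unital_algebraD[OF A] and K = A.R.cring_axioms
  note s = bilinear_map_simps[OF b(3)]
  let ?F = "free_alg K S" and ?h = "lin_ext K A (word_val A f)"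
  note F = bilinear_algebraD[OF free_alg_bilinear[OF K, of S]]
  have wc: "word_val A f w \<in> carrier A" if "w \<in> lists S" for w
    using that f by (induction w) (auto simp: word_val_def A.one_closed s)
  have wa: "word_val A f (u @ v) = word_val A f u \<otimes>\<^bsub>A\<^esub> word_val A f v"
    if "u \<in> lists S" "v \<in> lists S" for u v
    using that
  proof (induction u)
    case Nil
    then show ?case using wc by (simp add: word_val_def A.one_left)
  next
    case (Cons x u)
    have "f x \<in> carrier A" using Cons f by auto
    moreover have "word_val A f u \<in> carrier A" "word_val A f v \<in> carrier A"
      using Cons by (auto intro!: wc)
    ultimately show ?case using Cons by (simp add: word_val_def A.mult_assoc)
  qed
  have W: "word_val A f ` lists S \<subseteq> carrier A" using wc by auto
  note h = lin_ext_hom[OF b(2) W] and hs = lin_ext_single[OF b(2) W]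
  have hF: "?h \<in> mod_hom K ?F A" using h by (simp add: mod_hom_free_alg)
  have "?h (x \<otimes>\<^bsub>?F\<^esub> y) = ?h x \<otimes>\<^bsub>A\<^esub> ?h y" if "x \<in> carrier ?F" "y \<in> carrier ?F" for x y
  proof (rule bilinear_map_eq_on_span[OF F(1) F(1) b(2) bilinear_map_comp[OF F(2) hF]
        bilinear_map_comp_left[OF bilinear_map_comp_right[OF b(3) hF] hF] _ _ _
        free_alg_span[OF K that(1)] free_alg_span[OF K that(2)]])
    show "single K ` lists S \<subseteq> carrier ?F" "single K ` lists S \<subseteq> carrier ?F"
      by (auto del: in_listsD intro: single_in_free_alg[OF K])
    fix a c assume "a \<in> single K ` lists S" "c \<in> single K ` lists S"
    then show "?h (a \<otimes>\<^bsub>?F\<^esub> c) = ?h a \<otimes>\<^bsub>A\<^esub> ?h c"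
      by (auto simp: single_append[OF K] hs append_in_lists_conv[THEN iffD2] wa del: in_listsD)
  qed
  then show "?h \<in> alg_hom K ?F A" using hF by (intro alg_homI)
  show "?h \<one>\<^bsub>?F\<^esub> = \<one>\<^bsub>A\<^esub>" using hs[of "[]"] by (simp add: free_alg_simps word_val_def)
  show "?h (single K [x]) = f x" if "x \<in> S"
    using hs[of "[x]"] that f by (auto simp: word_val_def image_subset_iff A.one_right)
qed

subsection \<open>Right actions\<close>

text \<open>A right module over a unital algebra, encoded by its operation. A homomorphism into an
  endomorphism algebra would say the same, but that algebra would have to be constructed
  first.\<close>

definition right_action ::
    "('k, 'z) ring_scheme \<Rightarrow> ('k, 'a) module \<Rightarrow> ('k, 'n) module \<Rightarrow> ('n \<Rightarrow> 'a \<Rightarrow> 'n) \<Rightarrow> bool" where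
  "right_action K A N R \<longleftrightarrow> bilinear_map K N A N R \<and>
     (\<forall>n\<in>carrier N. \<forall>a\<in>carrier A. \<forall>b\<in>carrier A. R (R n a) b = R n (a \<otimes>\<^bsub>A\<^esub> b)) \<and>
     (\<forall>n\<in>carrier N. R n \<one>\<^bsub>A\<^esub> = n)"

lemma right_actionD:
  assumes "right_action K A N R"
  shows "bilinear_map K N A N R"
    and "\<lbrakk>n \<in> carrier N; a \<in> carrier A; b \<in> carrier A\<rbrakk> \<Longrightarrow> R n (a \<otimes>\<^bsub>A\<^esub> b) = R (R n a) b"
    and "n \<in> carrier N \<Longrightarrow> R n \<one>\<^bsub>A\<^esub> = n"
  using assms by (auto simp: right_action_def)

text \<open>A word acts letter by letter, the leftmost letter first, which is \<open>foldl\<close>.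
  Linearity in \<open>n\<close> is clear for a single word and reaches linear combinations through
  \<open>lin_ext_add\<close> and \<open>lin_ext_smult\<close>.\<close>

lemma free_alg_right_action:
  fixes K :: "('k, 'z) ring_scheme" and N :: "('k, 'n) module"
  assumes N: "module K N" and g: "\<And>x. x \<in> S \<Longrightarrow> (\<lambda>n. g n x) \<in> mod_hom K N N"
  defines "R \<equiv> \<lambda>n. lin_ext K N (\<lambda>w. foldl g n w)"
  shows "right_action K (free_alg K S) N R"
    and "\<lbrakk>n \<in> carrier N; x \<in> S\<rbrakk> \<Longrightarrow> R n (single K [x]) = g n x"
proof -
  interpret N: module K N by fact
  note K = N.R.cring_axioms
  let ?F = "free_alg K S"
  note F = bilinear_algebraD[OF free_alg_bilinear[OF K, of S]]
  have fh: "(\<lambda>n. foldl g n w) \<in> mod_hom K N N" if "w \<in> lists S" for w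
    using that
  proof (induction w)
    case Nil
    show ?case by (rule mod_homI) auto
  next
    case (Cons x w)
    then show ?case using mod_hom_comp[OF g[of x], of "\<lambda>n. foldl g n w"] by auto
  qed
  have W: "(\<lambda>w. foldl g n w) ` lists S \<subseteq> carrier N" if "n \<in> carrier N" for n
    using that mod_homD(1)[OF fh] by auto
  have hs: "R n (single K w) = foldl g n w" if "n \<in> carrier N" "w \<in> lists S" for n w
    unfolding R_def by (rule lin_ext_single[OF N W[OF that(1)] that(2)])
  have Rh: "R n \<in> mod_hom K ?F N" if "n \<in> carrier N" for n
    unfolding R_def using lin_ext_hom[OF N W[OF that]] by (simp add: mod_hom_free_alg)
  note h = mod_homD[OF Rh]
  have Rh2: "(\<lambda>n. R n a) \<in> mod_hom K N N" if a: "a \<in> carrier ?F" for a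
  proof (rule mod_homI)
    fix x y assume x: "x \<in> carrier N" and y: "y \<in> carrier N"
    have "lin_ext K N (\<lambda>w. foldl g (x \<oplus>\<^bsub>N\<^esub> y) w) a
      = lin_ext K N (\<lambda>w. foldl g x w \<oplus>\<^bsub>N\<^esub> foldl g y w) a"
      by (rule free_mod_hom_eq[OF N lin_ext_hom[OF N W] lin_ext_hom[OF N]])
        (use x y a mod_homD[OF fh] W in \<open>auto simp: free_alg_simps lin_ext_single[OF N, of _ "lists S"] image_subset_iff\<close>)
    then show "R (x \<oplus>\<^bsub>N\<^esub> y) a = R x a \<oplus>\<^bsub>N\<^esub> R y a"
      using lin_ext_add[OF N W[OF x] W[OF y], of a] a by (simp add: R_def free_alg_simps)
  next
    fix k x assume k: "k \<in> carrier K" and x: "x \<in> carrier N"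
    have "lin_ext K N (\<lambda>w. foldl g (k \<odot>\<^bsub>N\<^esub> x) w) a
      = lin_ext K N (\<lambda>w. k \<odot>\<^bsub>N\<^esub> foldl g x w) a"
      by (rule free_mod_hom_eq[OF N lin_ext_hom[OF N W] lin_ext_hom[OF N]])
        (use x k a mod_homD[OF fh] W in \<open>auto simp: free_alg_simps lin_ext_single[OF N, of _ "lists S"] image_subset_iff\<close>)
    then show "R (k \<odot>\<^bsub>N\<^esub> x) a = k \<odot>\<^bsub>N\<^esub> R x a"
      using lin_ext_smult[OF N W[OF x] k, of a] a by (simp add: R_def free_alg_simps)
  qed (use h a in auto)
  have bil: "bilinear_map K N ?F N R" by (rule bilinear_mapI[OF Rh Rh2])
  have "R (R n a) b = R n (a \<otimes>\<^bsub>?F\<^esub> b)" if n: "n \<in> carrier N" and ab: "a \<in> carrier ?F" "b \<in> carrier ?F" for n a b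
  proof (rule bilinear_map_eq_on_span[OF F(1) F(1) N bilinear_map_comp_left[OF bil Rh[OF n]]
        bilinear_map_comp[OF F(2) Rh[OF n]] _ _ _ free_alg_span[OF K ab(1)] free_alg_span[OF K ab(2)]])
    show "single K ` lists S \<subseteq> carrier ?F" "single K ` lists S \<subseteq> carrier ?F"
      by (auto del: in_listsD intro: single_in_free_alg[OF K])
    fix a c assume "a \<in> single K ` lists S" "c \<in> single K ` lists S"
    then show "R (R n a) c = R n (a \<otimes>\<^bsub>?F\<^esub> c)"
      using n mod_homD(1)[OF fh]
      by (auto simp: single_append[OF K] hs append_in_lists_conv[THEN iffD2] del: in_listsD)
  qed
  moreover have "R n \<one>\<^bsub>?F\<^esub> = n" if "n \<in> carrier N" for n
    using hs[OF that, of "[]"] by (simp add: free_alg_simps)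
  ultimately show "right_action K ?F N R" using bil by (auto simp: right_action_def)
  show "R n (single K [x]) = g n x" if "n \<in> carrier N" "x \<in> S"
    using hs[OF that(1), of "[x]"] that by simp
qed

text \<open>The elements that act as zero on the whole module form a two-sided ideal. An action
  therefore descends to a quotient by relations once the relations themselves act as zero.\<close>

lemma right_action_annihilator:
  assumes "bilinear_algebra K A" "module K N" "right_action K A N R" "S \<subseteq> carrier A"
    and "\<And>n s. \<lbrakk>n \<in> carrier N; s \<in> S\<rbrakk> \<Longrightarrow> R n s = \<zero>\<^bsub>N\<^esub>"
    and "s \<in> alg_idl K A S" "n \<in> carrier N"
  shows "R n s = \<zero>\<^bsub>N\<^esub>"
proof -
  note A = bilinear_algebraD[OF assms(1)] and r = right_actionD[OF assms(3)]
  note s = bilinear_map_simps[OF r(1)] and z = bilinear_map_neg[OF assms(2) A(1) assms(2) r(1)]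
  interpret A: module K A by fact
  interpret N: module K N by fact
  let ?I = "{a \<in> carrier A. \<forall>n\<in>carrier N. R n a = \<zero>\<^bsub>N\<^esub>}"
  have "submodule ?I K A"
    by (rule submodule_intro[OF A(1)]) (auto simp: s z)
  then have "alg_ideal K A ?I"
    by (rule alg_idealI) (auto simp: bilinear_map_simps[OF A(2)] r(2) s z)
  then have "alg_idl K A S \<subseteq> ?I" by (rule alg_idl_least) (use assms(4,5) in auto)
  then show ?thesis using assms(6,7) by auto
qed

lemma right_action_quot:
  assumes "bilinear_algebra K A" "\<one>\<^bsub>A\<^esub> \<in> carrier A" "module K N" "right_action K A N R" "alg_ideal K A I"
    and "\<And>n s. \<lbrakk>n \<in> carrier N; s \<in> I\<rbrakk> \<Longrightarrow> R n s = \<zero>\<^bsub>N\<^esub>"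
  shows "right_action K (quot A I) N (\<lambda>n. quot_lift (R n))"
    and "\<lbrakk>n \<in> carrier N; a \<in> carrier A\<rbrakk> \<Longrightarrow> quot_lift (R n) (I +>\<^bsub>A\<^esub> a) = R n a"
proof -
  note A = bilinear_algebraD[OF assms(1)] and r = right_actionD[OF assms(4)] and I = alg_idealD[OF assms(5)]
  note s = bilinear_map_simps[OF r(1)]
  interpret A: module K A by fact
  interpret N: module K N by fact
  have q: "quot_lift (R n) (I +>\<^bsub>A\<^esub> a) = R n a" if "n \<in> carrier N" "a \<in> carrier A" for n a
    by (rule quot_lift_hom[OF A(1) assms(3) I(1) bilinear_mapD(1)[OF r(1) that(1)] assms(6)[OF that(1)] that(2)])
  have id: "(\<lambda>x. x) \<in> mod_hom K N N" by (rule mod_homI) simp_all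
  have "bilinear_map K N (quot A I) N (\<lambda>n. quot_lift (R n))"
    by (rule bilinear_map_surj_image[OF r(1) assms(3) A(1) id quot_module(2)[OF A(1) I(1)] id])
      (auto simp: quot_simps q)
  then show "right_action K (quot A I) N (\<lambda>n. quot_lift (R n))"
    using assms(2) by (auto simp: right_action_def quot_simps q s quot_mult[OF assms(1,5)] r bilinear_map_simps[OF A(2)])
  show "\<lbrakk>n \<in> carrier N; a \<in> carrier A\<rbrakk> \<Longrightarrow> quot_lift (R n) (I +>\<^bsub>A\<^esub> a) = R n a" by (rule q)
qed

subsection \<open>Tensor algebras and their quotients\<close>

lemma tensor_ideal_ideal:
  assumes M: "module K M"
  shows "alg_ideal K (free_alg K (carrier M)) (tensor_ideal K M)"
proof -
  interpret M: module K M by fact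
  let ?F = "free_alg K (carrier M)"
  note K = M.R.cring_axioms
  interpret F: module K ?F by (rule free_alg_module[OF K])
  have e: "single K [x] \<in> carrier ?F" if "x \<in> carrier M" for x
    using that by (auto intro!: single_in_free_alg[OF K])
  show ?thesis
    unfolding tensor_ideal_def Let_def by (rule alg_idl_ideal[OF free_alg_bilinear[OF K]]) (auto intro!: e)
qed

lemma tensor_ideal_rels:
  "\<lbrakk>x \<in> carrier M; y \<in> carrier M\<rbrakk> \<Longrightarrow> single K [x \<oplus>\<^bsub>M\<^esub> y] \<ominus>\<^bsub>free_alg K (carrier M)\<^esub>
     (single K [x] \<oplus>\<^bsub>free_alg K (carrier M)\<^esub> single K [y]) \<in> tensor_ideal K M"
  "\<lbrakk>k \<in> carrier K; x \<in> carrier M\<rbrakk> \<Longrightarrow> single K [k \<odot>\<^bsub>M\<^esub> x] \<ominus>\<^bsub>free_alg K (carrier M)\<^esub>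
     (k \<odot>\<^bsub>free_alg K (carrier M)\<^esub> single K [x]) \<in> tensor_ideal K M"
  unfolding tensor_ideal_def Let_def by (rule subsetD[OF alg_idl_superset], blast)+

lemma tensor_alg_unital:
  assumes M: "module K M"
  shows "unital_algebra K (tensor_alg K M)"
proof -
  have K: "cring K" using M by (simp add: module_def)
  show ?thesis
    unfolding tensor_alg_def by (rule unital_algebra_quot[OF free_alg_unital[OF K] tensor_ideal_ideal[OF M]])
qed

lemma tensor_gen_hom:
  assumes M: "module K M"
  shows "tensor_gen K M \<in> mod_hom K M (tensor_alg K M)"
proof -
  interpret M: module K M by fact
  let ?F = "free_alg K (carrier M)"
  note K = M.R.cring_axioms
  note F = free_alg_module[OF K, of "carrier M"] and I = alg_idealD(1)[OF tensor_ideal_ideal[OF M]]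
  interpret F: module K ?F by (rule F)
  have e: "single K [x] \<in> carrier ?F" if "x \<in> carrier M" for x
    using that by (auto intro!: single_in_free_alg[OF K])
  show ?thesis
    unfolding tensor_gen_def tensor_alg_def
    by (rule mod_homI)
      (auto simp: quot_simps e quot_add[OF F I] quot_smult[OF F I] coset_eq_iff[OF F I] tensor_ideal_rels)
qed

text \<open>Stated for a linear map \<open>h\<close> into any module, because it is used both for an
  algebra homomorphism and for the map \<open>R n\<close> of a right action.\<close>

lemma tensor_ideal_kill:
  assumes M: "module K M" and N: "module K N"
    and h: "h \<in> mod_hom K (free_alg K (carrier M)) N"
    and f: "f \<in> mod_hom K M N" and hf: "\<And>x. x \<in> carrier M \<Longrightarrow> h (single K [x]) = f x"
  shows "x \<in> {single K [x \<oplus>\<^bsub>M\<^esub> y] \<ominus>\<^bsub>free_alg K (carrier M)\<^esub>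
        (single K [x] \<oplus>\<^bsub>free_alg K (carrier M)\<^esub> single K [y]) | x y. x \<in> carrier M \<and> y \<in> carrier M}
      \<union> {single K [k \<odot>\<^bsub>M\<^esub> x] \<ominus>\<^bsub>free_alg K (carrier M)\<^esub>
        (k \<odot>\<^bsub>free_alg K (carrier M)\<^esub> single K [x]) | k x. k \<in> carrier K \<and> x \<in> carrier M}
    \<Longrightarrow> h x = \<zero>\<^bsub>N\<^esub>"
proof -
  interpret M: module K M by fact
  interpret N: module K N by fact
  let ?F = "free_alg K (carrier M)"
  note K = M.R.cring_axioms
  note F = free_alg_module[OF K, of "carrier M"]
  interpret F: module K ?F by (rule F)
  have e: "single K [x] \<in> carrier ?F" if "x \<in> carrier M" for x
    using that by (auto intro!: single_in_free_alg[OF K])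
  note hh = mod_homD[OF h] mod_hom_neg[OF F N h] and ff = mod_homD[OF f]
  assume "x \<in> {single K [x \<oplus>\<^bsub>M\<^esub> y] \<ominus>\<^bsub>free_alg K (carrier M)\<^esub>
        (single K [x] \<oplus>\<^bsub>free_alg K (carrier M)\<^esub> single K [y]) | x y. x \<in> carrier M \<and> y \<in> carrier M}
      \<union> {single K [k \<odot>\<^bsub>M\<^esub> x] \<ominus>\<^bsub>free_alg K (carrier M)\<^esub>
        (k \<odot>\<^bsub>free_alg K (carrier M)\<^esub> single K [x]) | k x. k \<in> carrier K \<and> x \<in> carrier M}"
  then show "h x = \<zero>\<^bsub>N\<^esub>"
    by (elim UnE CollectE exE conjE) (simp_all add: hh ff e hf N.a_minus_eq_zero_iff)
qed

lemma tensor_alg_lift: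
  assumes M: "module K M" and A: "unital_algebra K A" and f: "f \<in> mod_hom K M A"
  shows "tensor_alg_lift K A f \<in> alg_hom K (tensor_alg K M) A"
    and "tensor_alg_lift K A f \<one>\<^bsub>tensor_alg K M\<^esub> = \<one>\<^bsub>A\<^esub>"
    and "x \<in> carrier M \<Longrightarrow> tensor_alg_lift K A f (tensor_gen K M x) = f x"
proof -
  interpret M: module K M by fact
  let ?F = "free_alg K (carrier M)" and ?h = "lin_ext K A (word_val A f)"
  note K = M.R.cring_axioms and a = unital_algebraD[OF A]
  note FU = free_alg_unital[OF K, of "carrier M"]
  note F = unital_algebraD[OF FU]
  interpret F: module K ?F by (rule F)
  have fc: "f ` carrier M \<subseteq> carrier A" using mod_homD(1)[OF f] by auto
  note L = free_alg_lift[OF A fc] and I = tensor_ideal_ideal[OF M]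
  have e: "single K [x] \<in> carrier ?F" if "x \<in> carrier M" for x
    using that by (auto intro!: single_in_free_alg[OF K])
  have "?h x \<in> {\<zero>\<^bsub>A\<^esub>}" if "x \<in> tensor_ideal K M" for x
    by (rule alg_hom_alg_idl[OF F(1) a(1) L(1) alg_ideal_zero[OF a(1)] _ _ that[unfolded tensor_ideal_def Let_def]])
      (use tensor_ideal_kill[OF M a(2) alg_homD(1)[OF L(1)] f L(3)] e in auto)
  then have z: "?h x = \<zero>\<^bsub>A\<^esub>" if "x \<in> tensor_ideal K M" for x using that by auto
  show "tensor_alg_lift K A f \<in> alg_hom K (tensor_alg K M) A"
    unfolding tensor_alg_lift_def tensor_alg_def by (rule quot_lift_alg_hom[OF F(1) a(1) I L(1) z])
  note v = quot_lift_hom[OF F(2) a(2) alg_idealD(1)[OF I] alg_homD(1)[OF L(1)] z]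
  show "tensor_alg_lift K A f \<one>\<^bsub>tensor_alg K M\<^esub> = \<one>\<^bsub>A\<^esub>"
    unfolding tensor_alg_lift_def tensor_alg_def using L(2) unital_algebra.one_closed[OF FU]
    by (simp add: quot_simps v)
  show "tensor_alg_lift K A f (tensor_gen K M x) = f x" if "x \<in> carrier M"
    unfolding tensor_alg_lift_def tensor_gen_def using L(3) that e by (simp add: v)
qed

lemma tensor_right_action:
  assumes M: "module K M" and N: "module K N" and g: "bilinear_map K N M N g"
  defines "R \<equiv> \<lambda>n. quot_lift (lin_ext K N (\<lambda>w. foldl g n w))"
  shows "right_action K (tensor_alg K M) N R"
    and "\<lbrakk>n \<in> carrier N; x \<in> carrier M\<rbrakk> \<Longrightarrow> R n (tensor_gen K M x) = g n x"
proof -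
  interpret M: module K M by fact
  let ?F = "free_alg K (carrier M)" and ?R = "\<lambda>n. lin_ext K N (\<lambda>w. foldl g n w)"
  note K = M.R.cring_axioms
  note FU = free_alg_unital[OF K, of "carrier M"]
  note F = unital_algebraD[OF FU] and I = tensor_ideal_ideal[OF M]
  interpret F: module K ?F by (rule F)
  note L = free_alg_right_action[OF N bilinear_mapD(2)[OF g]]
  have e: "single K [x] \<in> carrier ?F" if "x \<in> carrier M" for x
    using that by (auto intro!: single_in_free_alg[OF K])
  have z: "?R n x = \<zero>\<^bsub>N\<^esub>" if "n \<in> carrier N" "x \<in> tensor_ideal K M" for x n
    by (rule right_action_annihilator[OF F(1) N L(1) _ _ that(2)[unfolded tensor_ideal_def Let_def] that(1)])
     (use tensor_ideal_kill[OF M N bilinear_mapD(1)[OF right_actionD(1)[OF L(1)]] bilinear_mapD(1)[OF g] L(2)] e in auto)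
  note q = right_action_quot[OF F(1) unital_algebra.one_closed[OF FU] N L(1) I z]
  show "right_action K (tensor_alg K M) N R" unfolding tensor_alg_def R_def by (rule q(1))
  show "R n (tensor_gen K M x) = g n x" if "n \<in> carrier N" "x \<in> carrier M"
    unfolding tensor_gen_def R_def using that q(2) e L(2) by simp
qed

text \<open>Every word is built from the empty one by adding letters at one end, and words span. The
  disjunction leaves the side open: most applications multiply on the right,
  \<open>rl_annihilates\<close> multiplies on the left.\<close>

lemma tensor_alg_induct:
  assumes M: "module K M" and N: "submodule N K (tensor_alg K M)" and one: "\<one>\<^bsub>tensor_alg K M\<^esub> \<in> N"
    and step: "(\<forall>y\<in>N. \<forall>x\<in>carrier M. y \<otimes>\<^bsub>tensor_alg K M\<^esub> tensor_gen K M x \<in> N)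
      \<or> (\<forall>y\<in>N. \<forall>x\<in>carrier M. tensor_gen K M x \<otimes>\<^bsub>tensor_alg K M\<^esub> y \<in> N)"
    and z: "z \<in> carrier (tensor_alg K M)"
  shows "z \<in> N"
proof -
  interpret M: module K M by fact
  let ?F = "free_alg K (carrier M)" and ?I = "tensor_ideal K M"
  note K = M.R.cring_axioms
  note FU = free_alg_unital[OF K, of "carrier M"]
  note F = unital_algebraD[OF FU] and I = tensor_ideal_ideal[OF M] and T = unital_algebraD[OF tensor_alg_unital[OF M]]
  note p = quot_module(2)[OF F(2) alg_idealD(1)[OF I], folded tensor_alg_def]
  note m = quot_mult[OF F(1) I, folded tensor_alg_def, symmetric]
  have w: "?I +>\<^bsub>?F\<^esub> single K w \<in> N" if "w \<in> lists (carrier M)" for w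
    using step
  proof
    assume st: "\<forall>y\<in>N. \<forall>x\<in>carrier M. y \<otimes>\<^bsub>tensor_alg K M\<^esub> tensor_gen K M x \<in> N"
    from that show ?thesis
    proof (induction w rule: rev_induct)
      case Nil
      then show ?case using one by (simp add: tensor_alg_def quot_simps free_alg_simps)
    next
      case (snoc x w)
      then have c: "single K w \<in> carrier ?F" "single K [x] \<in> carrier ?F"
        by (auto intro!: single_in_free_alg[OF K])
      have "?I +>\<^bsub>?F\<^esub> single K (w @ [x]) = (?I +>\<^bsub>?F\<^esub> single K w) \<otimes>\<^bsub>tensor_alg K M\<^esub> tensor_gen K M x"
        unfolding tensor_gen_def single_append[OF K, where u = w and v = "[x]" and S = "carrier M", symmetric] by (rule m[OF c])
      then show ?case using st snoc by simp
    qed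
  next
    assume st: "\<forall>y\<in>N. \<forall>x\<in>carrier M. tensor_gen K M x \<otimes>\<^bsub>tensor_alg K M\<^esub> y \<in> N"
    from that show ?thesis
    proof (induction w)
      case Nil
      then show ?case using one by (simp add: tensor_alg_def quot_simps free_alg_simps)
    next
      case (Cons x w)
      then have c: "single K [x] \<in> carrier ?F" "single K w \<in> carrier ?F"
        by (auto intro!: single_in_free_alg[OF K])
      have "?I +>\<^bsub>?F\<^esub> single K ([x] @ w) = tensor_gen K M x \<otimes>\<^bsub>tensor_alg K M\<^esub> (?I +>\<^bsub>?F\<^esub> single K w)"
        unfolding tensor_gen_def single_append[OF K, where u = "[x]" and v = w and S = "carrier M", symmetric] by (rule m[OF c])
      then show ?case using st Cons by simp
    qed
  qed
  obtain a where a: "a \<in> carrier ?F" "z = ?I +>\<^bsub>?F\<^esub> a" using z by (auto simp: tensor_alg_def quot_simps)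
  show ?thesis
    unfolding a(2)
    by (rule mod_hom_span[OF F(2) T(2) p N _ _ free_alg_span[OF K a(1)]])
      (use w in \<open>auto intro: single_in_free_alg[OF K] del: in_listsD\<close>)
qed

lemma tensor_quot_gen_hom:
  assumes M: "module K M" and J: "alg_ideal K (tensor_alg K M) J"
  shows "(\<lambda>x. J +>\<^bsub>tensor_alg K M\<^esub> tensor_gen K M x) \<in> mod_hom K M (quot (tensor_alg K M) J)"
  using mod_hom_comp[OF tensor_gen_hom[OF M] quot_module(2)[OF unital_algebraD(2)[OF tensor_alg_unital[OF M]] alg_idealD(1)[OF J]]] .

lemma tensor_quot_induct:
  assumes M: "module K M" and J: "alg_ideal K (tensor_alg K M) J"
  defines "E \<equiv> quot (tensor_alg K M) J" and "e \<equiv> \<lambda>x. J +>\<^bsub>tensor_alg K M\<^esub> tensor_gen K M x"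
  assumes N: "submodule N K E" and one: "\<one>\<^bsub>E\<^esub> \<in> N"
    and step: "(\<forall>y\<in>N. \<forall>x\<in>carrier M. y \<otimes>\<^bsub>E\<^esub> e x \<in> N) \<or> (\<forall>y\<in>N. \<forall>x\<in>carrier M. e x \<otimes>\<^bsub>E\<^esub> y \<in> N)"
    and z: "z \<in> carrier E"
  shows "z \<in> N"
proof -
  let ?T = "tensor_alg K M"
  note T = unital_algebraD[OF tensor_alg_unital[OF M]]
  note p = quot_module[OF T(2) alg_idealD(1)[OF J], folded E_def]
  note m = quot_mult[OF T(1) J, folded E_def] and g = mod_homD(1)[OF tensor_gen_hom[OF M]]
  let ?N = "{a \<in> carrier ?T. J +>\<^bsub>?T\<^esub> a \<in> N}"
  have sub: "submodule ?N K ?T" by (rule submodule_preimage[OF T(2) p N])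
  note s = bilinear_map_simps[OF T(3)]
  have one': "\<one>\<^bsub>?T\<^esub> \<in> ?N" using one unital_algebra.one_closed[OF tensor_alg_unital[OF M]]
    by (simp add: E_def quot_simps)
  have "a \<in> ?N" if "a \<in> carrier ?T" for a
    by (rule tensor_alg_induct[OF M sub one' _ that])
      (use step in \<open>auto simp: s g e_def m[symmetric]\<close>)
  then show ?thesis using z by (auto simp: E_def quot_simps)
qed

text \<open>The generating set \<open>S\<close> of the ideal is a parameter, so that this one lemma
  gives the universal properties of both \<open>U\<close> and \<open>UL\<close>.
  \<open>env_right_action\<close> has the same form for actions.\<close>

lemma env_lift:
  assumes M: "module K M" and A: "unital_algebra K A" and f: "f \<in> mod_hom K M A"
    and S: "S \<subseteq> carrier (tensor_alg K M)" "\<And>x. x \<in> S \<Longrightarrow> tensor_alg_lift K A f x = \<zero>\<^bsub>A\<^esub>"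
  defines "T \<equiv> tensor_alg K M" and "J \<equiv> alg_idl K (tensor_alg K M) S"
  shows "env_lift K A f \<in> alg_hom K (quot T J) A"
    and "env_lift K A f \<one>\<^bsub>quot T J\<^esub> = \<one>\<^bsub>A\<^esub>"
    and "x \<in> carrier M \<Longrightarrow> env_lift K A f (J +>\<^bsub>T\<^esub> tensor_gen K M x) = f x"
proof -
  note TU = tensor_alg_unital[OF M, folded T_def]
  note T = unital_algebraD[OF TU] and a = unital_algebraD[OF A] and S = S[folded T_def]
  note L = tensor_alg_lift[OF M A f, folded T_def] and I = alg_idl_ideal[OF T(1) S(1), folded J_def[folded T_def]]
  have "tensor_alg_lift K A f x \<in> {\<zero>\<^bsub>A\<^esub>}" if "x \<in> J" for x
    by (rule alg_hom_alg_idl[OF T(1) a(1) L(1) alg_ideal_zero[OF a(1)] S(1) _ that[unfolded J_def, folded T_def]])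
      (use S(2) in auto)
  then have z: "tensor_alg_lift K A f x = \<zero>\<^bsub>A\<^esub>" if "x \<in> J" for x using that by auto
  show "env_lift K A f \<in> alg_hom K (quot T J) A"
    unfolding env_lift_def by (rule quot_lift_alg_hom[OF T(1) a(1) I L(1) z])
  note v = quot_lift_hom[OF T(2) a(2) alg_idealD(1)[OF I] alg_homD(1)[OF L(1)] z]
  show "env_lift K A f \<one>\<^bsub>quot T J\<^esub> = \<one>\<^bsub>A\<^esub>"
    unfolding env_lift_def using L(2) unital_algebra.one_closed[OF TU] by (simp add: quot_simps v)
  show "env_lift K A f (J +>\<^bsub>T\<^esub> tensor_gen K M x) = f x" if "x \<in> carrier M"
    unfolding env_lift_def
    using L(3)[OF that] v[OF _ mod_homD(1)[OF tensor_gen_hom[OF M] that, folded T_def]] by simp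
qed

lemma env_right_action:
  assumes M: "module K M" and N: "module K N" and g: "bilinear_map K N M N g"
    and S: "S \<subseteq> carrier (tensor_alg K M)"
  defines "T \<equiv> tensor_alg K M" and "J \<equiv> alg_idl K (tensor_alg K M) S"
    and "R' \<equiv> \<lambda>n. quot_lift (lin_ext K N (\<lambda>w. foldl g n w))"
  assumes kill: "\<And>n x. \<lbrakk>n \<in> carrier N; x \<in> S\<rbrakk> \<Longrightarrow> R' n x = \<zero>\<^bsub>N\<^esub>"
  shows "right_action K (quot T J) N (\<lambda>n. quot_lift (R' n))"
    and "\<lbrakk>n \<in> carrier N; x \<in> carrier M\<rbrakk> \<Longrightarrow> quot_lift (R' n) (J +>\<^bsub>T\<^esub> tensor_gen K M x) = g n x"
proof -
  note TU = tensor_alg_unital[OF M, folded T_def]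
  note T = unital_algebraD[OF TU] and S = S[folded T_def]
  note L = tensor_right_action[OF M N g, folded T_def, folded R'_def] and I = alg_idl_ideal[OF T(1) S(1), folded J_def[folded T_def]]
  have z: "R' n x = \<zero>\<^bsub>N\<^esub>" if "n \<in> carrier N" "x \<in> J" for x n
    by (rule right_action_annihilator[OF T(1) N L(1) S kill that(2)[unfolded J_def, folded T_def] that(1)])
  note q = right_action_quot[OF T(1) unital_algebra.one_closed[OF TU] N L(1) I z]
  show "right_action K (quot T J) N (\<lambda>n. quot_lift (R' n))" by (rule q(1))
  show "quot_lift (R' n) (J +>\<^bsub>T\<^esub> tensor_gen K M x) = g n x" if "n \<in> carrier N" "x \<in> carrier M"
    using q(2)[OF _ _ that(1) mod_homD(1)[OF tensor_gen_hom[OF M] that(2), folded T_def]] L(2)[OF that]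
    by (simp add: R'_def)
qed

subsection \<open>Tensor products\<close>

lemma tprod_rel_submodule:
  assumes "module K M" "module K N"
  shows "submodule (tprod_rel K M N) K (free_mod K (carrier M \<times> carrier N))"
proof -
  interpret M: module K M by fact
  interpret N: module K N by fact
  note F = free_mod_module[OF M.R.cring_axioms, of "carrier M \<times> carrier N"]
  interpret F: module K "free_mod K (carrier M \<times> carrier N)" by (rule F)
  show ?thesis
    unfolding tprod_rel_def Let_def
    by (rule mod_span_submodule[OF F]) (auto intro!: F.minus_closed single_closed[OF M.R.cring_axioms] F.a_closed F.smult_closed)
qed

lemma tprod_module:
  assumes "module K M" "module K N" shows "module K (tprod K M N)"
  unfolding tprod_def
  by (rule quot_module(1)[OF free_mod_module tprod_rel_submodule[OF assms]]) (use assms in \<open>simp add: module_def\<close>)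

lemma tprod_rel_rels:
  fixes K :: "('k, 'z) ring_scheme" and M :: "('k, 'a) module" and N :: "('k, 'b) module"
  defines "F \<equiv> free_mod K (carrier M \<times> carrier N)"
  shows "\<lbrakk>x \<in> carrier M; x' \<in> carrier M; y \<in> carrier N\<rbrakk> \<Longrightarrow>
      single K (x \<oplus>\<^bsub>M\<^esub> x', y) \<ominus>\<^bsub>F\<^esub> (single K (x, y) \<oplus>\<^bsub>F\<^esub> single K (x', y)) \<in> tprod_rel K M N"
    "\<lbrakk>x \<in> carrier M; y \<in> carrier N; y' \<in> carrier N\<rbrakk> \<Longrightarrow>
      single K (x, y \<oplus>\<^bsub>N\<^esub> y') \<ominus>\<^bsub>F\<^esub> (single K (x, y) \<oplus>\<^bsub>F\<^esub> single K (x, y')) \<in> tprod_rel K M N"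
    "\<lbrakk>k \<in> carrier K; x \<in> carrier M; y \<in> carrier N\<rbrakk> \<Longrightarrow>
      single K (k \<odot>\<^bsub>M\<^esub> x, y) \<ominus>\<^bsub>F\<^esub> (k \<odot>\<^bsub>F\<^esub> single K (x, y)) \<in> tprod_rel K M N"
    "\<lbrakk>k \<in> carrier K; x \<in> carrier M; y \<in> carrier N\<rbrakk> \<Longrightarrow>
      single K (x, k \<odot>\<^bsub>N\<^esub> y) \<ominus>\<^bsub>F\<^esub> (k \<odot>\<^bsub>F\<^esub> single K (x, y)) \<in> tprod_rel K M N"
  unfolding tprod_rel_def Let_def F_def by (rule subsetD[OF mod_span_superset], blast)+

lemma pure_tensor_bilinear:
  assumes "module K M" "module K N"
  shows "bilinear_map K M N (tprod K M N) (pure_tensor K M N)"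
proof -
  interpret M: module K M by fact
  interpret N: module K N by fact
  note K = M.R.cring_axioms and I = tprod_rel_submodule[OF assms]
  let ?F = "free_mod K (carrier M \<times> carrier N)"
  note F = free_mod_module[OF K, of "carrier M \<times> carrier N"]
  interpret F: module K ?F by (rule F)
  have e: "single K (x, y) \<in> carrier ?F" if "x \<in> carrier M" "y \<in> carrier N" for x y
    using that by (auto intro!: single_closed[OF K])
  show ?thesis
    unfolding pure_tensor_def tprod_def
    by (intro bilinear_mapI mod_homI)
      (auto simp: quot_simps e quot_add[OF F I] quot_smult[OF F I] coset_eq_iff[OF F I] tprod_rel_rels)
qed

lemma tprod_span:
  assumes M: "module K M" and N: "module K N" and L: "submodule L K (tprod K M N)"
    and p: "\<And>x y. \<lbrakk>x \<in> carrier M; y \<in> carrier N\<rbrakk> \<Longrightarrow> pure_tensor K M N x y \<in> L"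
    and z: "z \<in> carrier (tprod K M N)"
  shows "z \<in> L"
proof -
  have K: "cring K" using M by (simp add: module_def)
  let ?F = "free_mod K (carrier M \<times> carrier N)"
  note F = free_mod_module[OF K, of "carrier M \<times> carrier N"] and I = tprod_rel_submodule[OF M N]
  note q = quot_module[OF F I, folded tprod_def]
  obtain a where a: "a \<in> carrier ?F" "z = tprod_rel K M N +>\<^bsub>?F\<^esub> a" using z by (auto simp: tprod_def quot_simps)
  show ?thesis
    unfolding a(2)
    by (rule mod_hom_span[OF F q L _ _ free_mod_span[OF K a(1)]])
      (use single_closed[OF K, of _ "carrier M \<times> carrier N"] p in \<open>auto simp: pure_tensor_def\<close>)
qed

text \<open>Pure tensors span. Identities between linear maps on \<open>U(L) \<otimes> P\<close> are
  later checked through the instance \<open>M_eq\<close> of this lemma.\<close>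

lemma tprod_hom_eq:
  assumes M: "module K M" and N: "module K N" and L: "module K L"
    and f: "f \<in> mod_hom K (tprod K M N) L" and g: "g \<in> mod_hom K (tprod K M N) L"
    and p: "\<And>x y. \<lbrakk>x \<in> carrier M; y \<in> carrier N\<rbrakk> \<Longrightarrow> f (pure_tensor K M N x y) = g (pure_tensor K M N x y)"
    and z: "z \<in> carrier (tprod K M N)"
  shows "f z = g z"
  using tprod_span[OF M N submodule_equalizer[OF tprod_module[OF M N] L f g] _ z] p
    bilinear_map_simps(1)[OF pure_tensor_bilinear[OF M N]] by auto

lemma tprod_lift:
  assumes M: "module K M" and N: "module K N" and L: "module K L"
    and f: "bilinear_map K M N L f"
  shows "tprod_lift K L f \<in> mod_hom K (tprod K M N) L"
    and "\<lbrakk>x \<in> carrier M; y \<in> carrier N\<rbrakk> \<Longrightarrow> tprod_lift K L f (pure_tensor K M N x y) = f x y"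
proof -
  interpret M: module K M by fact
  interpret N: module K N by fact
  interpret L: module K L by fact
  note K = M.R.cring_axioms
  let ?F = "free_mod K (carrier M \<times> carrier N)" and ?f = "\<lambda>(x, y). f x y"
  note F = free_mod_module[OF K, of "carrier M \<times> carrier N"] and I = tprod_rel_submodule[OF M N]
  interpret F: module K ?F by (rule F)
  note s = bilinear_map_simps[OF f]
  have fc: "?f ` (carrier M \<times> carrier N) \<subseteq> carrier L" using s(1) by auto
  note h = lin_ext_hom[OF L fc]
  have v: "lin_ext K L ?f (single K (x, y)) = f x y" if "x \<in> carrier M" "y \<in> carrier N" for x y
    using lin_ext_single[OF L fc, of "(x, y)"] that by simp
  have e: "single K (x, y) \<in> carrier ?F" if "x \<in> carrier M" "y \<in> carrier N" for x y
    using that by (auto intro!: single_closed[OF K])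
  note hh = mod_homD[OF h] mod_hom_neg[OF F L h]
  have "lin_ext K L ?f x \<in> {\<zero>\<^bsub>L\<^esub>}" if "x \<in> tprod_rel K M N" for x
    by (rule mod_hom_span[OF F L h submodule_zero[OF L] _ _ that[unfolded tprod_rel_def Let_def]])
      (auto simp: hh v e s L.a_minus_eq_zero_iff)
  then have z: "lin_ext K L ?f x = \<zero>\<^bsub>L\<^esub>" if "x \<in> tprod_rel K M N" for x using that by auto
  show "tprod_lift K L f \<in> mod_hom K (tprod K M N) L"
    unfolding tprod_lift_def tprod_def by (rule quot_lift_mod_hom[OF F L I h z])
  show "tprod_lift K L f (pure_tensor K M N x y) = f x y" if "x \<in> carrier M" "y \<in> carrier N"
    unfolding tprod_lift_def pure_tensor_def
    using quot_lift_hom[OF F L I h z e[OF that]] v[OF that] by simp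
qed

lemma tprod_map:
  assumes M: "module K M" and N: "module K N" and M': "module K M'" and N': "module K N'"
    and f: "f \<in> mod_hom K M M'" and g: "g \<in> mod_hom K N N'"
  shows "tprod_map K M' N' f g \<in> mod_hom K (tprod K M N) (tprod K M' N')"
    and "\<lbrakk>x \<in> carrier M; y \<in> carrier N\<rbrakk>
      \<Longrightarrow> tprod_map K M' N' f g (pure_tensor K M N x y) = pure_tensor K M' N' (f x) (g y)"
  using tprod_lift[OF M N tprod_module[OF M' N']
      bilinear_map_comp_left[OF bilinear_map_comp_right[OF pure_tensor_bilinear[OF M' N'] g] f]]
  by (simp_all add: tprod_map_def)

subsection \<open>Direct sums\<close>

lemma dsum_simps:
  "carrier (dsum M N) = carrier M \<times> carrier N"
  "\<zero>\<^bsub>dsum M N\<^esub> = (\<zero>\<^bsub>M\<^esub>, \<zero>\<^bsub>N\<^esub>)"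
  "(x, y) \<oplus>\<^bsub>dsum M N\<^esub> (x', y') = (x \<oplus>\<^bsub>M\<^esub> x', y \<oplus>\<^bsub>N\<^esub> y')"
  "k \<odot>\<^bsub>dsum M N\<^esub> (x, y) = (k \<odot>\<^bsub>M\<^esub> x, k \<odot>\<^bsub>N\<^esub> y)"
  by (simp_all add: dsum_def)

lemma dsum_module:
  assumes "module K M" "module K N" shows "module K (dsum M N)"
proof -
  interpret M: module K M by fact
  interpret N: module K N by fact
  have "abelian_group (dsum M N)"
  proof (rule abelian_groupI)
    fix x assume "x \<in> carrier (dsum M N)"
    then show "\<exists>y\<in>carrier (dsum M N). y \<oplus>\<^bsub>dsum M N\<^esub> x = \<zero>\<^bsub>dsum M N\<^esub>"
      by (intro bexI[of _ "(\<ominus>\<^bsub>M\<^esub> fst x, \<ominus>\<^bsub>N\<^esub> snd x)"]) (auto simp: dsum_simps M.l_neg N.l_neg)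
  qed (auto simp: dsum_simps M.a_ac N.a_ac)
  then show ?thesis
    by (rule moduleI[OF M.R.cring_axioms])
      (auto simp: dsum_simps M.smult_l_distr N.smult_l_distr M.smult_r_distr N.smult_r_distr
        M.smult_assoc1 N.smult_assoc1)
qed

lemma dsum_neg:
  assumes "module K M" "module K N" "x \<in> carrier M" "y \<in> carrier N"
  shows "\<ominus>\<^bsub>dsum M N\<^esub> (x, y) = (\<ominus>\<^bsub>M\<^esub> x, \<ominus>\<^bsub>N\<^esub> y)"
proof -
  interpret M: module K M by fact
  interpret N: module K N by fact
  interpret D: module K "dsum M N" by (rule dsum_module[OF assms(1,2)])
  show ?thesis
    by (rule D.minus_equality) (use assms(3,4) in \<open>auto simp: dsum_simps M.l_neg N.l_neg\<close>)
qed

lemma dsum_minus: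
  assumes "module K M" "module K N" "x \<in> carrier M" "y \<in> carrier N" "x' \<in> carrier M" "y' \<in> carrier N"
  shows "(x, y) \<ominus>\<^bsub>dsum M N\<^esub> (x', y') = (x \<ominus>\<^bsub>M\<^esub> x', y \<ominus>\<^bsub>N\<^esub> y')"
  using assms by (simp add: a_minus_def dsum_neg dsum_simps)

lemma dsum_homs:
  assumes M: "module K M" and N: "module K N"
  shows "(\<lambda>x. (x, \<zero>\<^bsub>N\<^esub>)) \<in> mod_hom K M (dsum M N)" "(\<lambda>y. (\<zero>\<^bsub>M\<^esub>, y)) \<in> mod_hom K N (dsum M N)"
    "fst \<in> mod_hom K (dsum M N) M" "snd \<in> mod_hom K (dsum M N) N"
proof -
  interpret M: module K M by fact
  interpret N: module K N by fact
  show "(\<lambda>x. (x, \<zero>\<^bsub>N\<^esub>)) \<in> mod_hom K M (dsum M N)" "(\<lambda>y. (\<zero>\<^bsub>M\<^esub>, y)) \<in> mod_hom K N (dsum M N)"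
    "fst \<in> mod_hom K (dsum M N) M" "snd \<in> mod_hom K (dsum M N) N"
    by (rule mod_homI; auto simp: dsum_simps)+
qed

lemma dsum_hom:
  assumes L: "module K L" and f: "f \<in> mod_hom K M L" and g: "g \<in> mod_hom K N L"
  shows "(\<lambda>(x, y). f x \<oplus>\<^bsub>L\<^esub> g y) \<in> mod_hom K (dsum M N) L"
proof -
  interpret L: module K L by fact
  show ?thesis
    by (rule mod_homI)
      (auto simp: dsum_simps mod_homD[OF f] mod_homD[OF g] L.smult_r_distr L.a_ac)
qed

lemma mod_hom_pair:
  assumes "f \<in> mod_hom K L M" "g \<in> mod_hom K L N"
  shows "(\<lambda>x. (f x, g x)) \<in> mod_hom K L (dsum M N)"
  by (rule mod_homI) (auto simp: dsum_simps mod_homD[OF assms(1)] mod_homD[OF assms(2)])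

subsection \<open>Universal enveloping algebras of Lie algebras\<close>

lemma quot_rel_eq:
  assumes "module K M" "submodule N K M" "x \<in> carrier M" "y \<in> carrier M" "x \<ominus>\<^bsub>M\<^esub> y \<in> N"
  shows "N +>\<^bsub>M\<^esub> x = N +>\<^bsub>M\<^esub> y"
  using coset_eq_iff[OF assms(1-4)] assms(5) by simp

lemma U_rels_closed:
  assumes "bilinear_algebra K L"
  shows "{tensor_gen K L (x \<otimes>\<^bsub>L\<^esub> y) \<ominus>\<^bsub>tensor_alg K L\<^esub> (tensor_gen K L x \<otimes>\<^bsub>tensor_alg K L\<^esub> tensor_gen K L y
      \<ominus>\<^bsub>tensor_alg K L\<^esub> tensor_gen K L y \<otimes>\<^bsub>tensor_alg K L\<^esub> tensor_gen K L x) | x y.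
        x \<in> carrier L \<and> y \<in> carrier L} \<subseteq> carrier (tensor_alg K L)"
proof -
  note L = bilinear_algebraD[OF assms]
  note T = unital_algebraD[OF tensor_alg_unital[OF L(1)]]
  interpret T: module K "tensor_alg K L" by (rule T)
  show ?thesis
    by (auto simp: mod_homD(1)[OF tensor_gen_hom[OF L(1)]] bilinear_map_simps[OF T(3)] bilinear_map_simps[OF L(2)])
qed

lemma U_ideal_ideal:
  assumes "bilinear_algebra K L" shows "alg_ideal K (tensor_alg K L) (U_ideal K L)"
  unfolding U_ideal_def Let_def
  by (rule alg_idl_ideal[OF unital_algebraD(1)[OF tensor_alg_unital] U_rels_closed[OF assms]])
    (rule bilinear_algebraD[OF assms])

lemma U_unital:
  assumes "bilinear_algebra K L" shows "unital_algebra K (U K L)"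
  unfolding U_def
  by (rule unital_algebra_quot[OF tensor_alg_unital U_ideal_ideal[OF assms]]) (rule bilinear_algebraD[OF assms])

lemma U_gen_hom:
  assumes "bilinear_algebra K L" shows "U_gen K L \<in> mod_hom K L (U K L)"
  using tensor_quot_gen_hom[OF bilinear_algebraD(1)[OF assms] U_ideal_ideal[OF assms]]
  by (simp add: U_gen_def[abs_def] U_def)

lemma U_gen_bracket:
  assumes "bilinear_algebra K L" "x \<in> carrier L" "y \<in> carrier L"
  shows "U_gen K L (x \<otimes>\<^bsub>L\<^esub> y) = U_gen K L x \<otimes>\<^bsub>U K L\<^esub> U_gen K L y \<ominus>\<^bsub>U K L\<^esub> U_gen K L y \<otimes>\<^bsub>U K L\<^esub> U_gen K L x"
proof -
  note L = bilinear_algebraD[OF assms(1)]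
  let ?T = "tensor_alg K L"
  note T = unital_algebraD[OF tensor_alg_unital[OF L(1)]] and I = U_ideal_ideal[OF assms(1)]
  interpret T: module K ?T by (rule T)
  note q = quot_module[OF T(2) alg_idealD(1)[OF I]]
  note c = mod_homD(1)[OF tensor_gen_hom[OF L(1)]] and s = bilinear_map_simps(1)[OF T(3)] and sl = bilinear_map_simps(1)[OF L(2)]
  let ?x = "tensor_gen K L x" and ?y = "tensor_gen K L y"
  have cl: "?x \<otimes>\<^bsub>?T\<^esub> ?y \<in> carrier ?T" "?y \<otimes>\<^bsub>?T\<^esub> ?x \<in> carrier ?T" "tensor_gen K L (x \<otimes>\<^bsub>L\<^esub> y) \<in> carrier ?T"
    using assms(2,3) by (simp_all add: c s sl)
  have "tensor_gen K L (x \<otimes>\<^bsub>L\<^esub> y) \<ominus>\<^bsub>?T\<^esub> (?x \<otimes>\<^bsub>?T\<^esub> ?y \<ominus>\<^bsub>?T\<^esub> ?y \<otimes>\<^bsub>?T\<^esub> ?x) \<in> U_ideal K L"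
    unfolding U_ideal_def Let_def by (rule subsetD[OF alg_idl_superset]) (use assms(2,3) in blast)
  then have "U_ideal K L +>\<^bsub>?T\<^esub> tensor_gen K L (x \<otimes>\<^bsub>L\<^esub> y) = U_ideal K L +>\<^bsub>?T\<^esub> (?x \<otimes>\<^bsub>?T\<^esub> ?y \<ominus>\<^bsub>?T\<^esub> ?y \<otimes>\<^bsub>?T\<^esub> ?x)"
    by (intro quot_rel_eq[OF T(2) alg_idealD(1)[OF I]]) (use cl in auto)
  then show ?thesis
    unfolding U_gen_def U_def
    using assms(2,3) cl by (simp add: mod_hom_neg(3)[OF T(2) q] quot_mult[OF T(1) I] c)
qed

lemma U_induct:
  assumes L: "bilinear_algebra K L" and N: "submodule N K (U K L)" "\<one>\<^bsub>U K L\<^esub> \<in> N"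
    and st: "(\<forall>y\<in>N. \<forall>x\<in>carrier L. y \<otimes>\<^bsub>U K L\<^esub> U_gen K L x \<in> N) \<or> (\<forall>y\<in>N. \<forall>x\<in>carrier L. U_gen K L x \<otimes>\<^bsub>U K L\<^esub> y \<in> N)"
    and z: "z \<in> carrier (U K L)"
  shows "z \<in> N"
  using tensor_quot_induct[OF bilinear_algebraD(1)[OF L] U_ideal_ideal[OF L], folded U_def, folded U_gen_def, OF N st z] .

lemma U_lift:
  assumes L: "bilinear_algebra K L" and A: "unital_algebra K A" and f: "f \<in> mod_hom K L A"
    and br: "\<And>x y. \<lbrakk>x \<in> carrier L; y \<in> carrier L\<rbrakk> \<Longrightarrow> f (x \<otimes>\<^bsub>L\<^esub> y) = f x \<otimes>\<^bsub>A\<^esub> f y \<ominus>\<^bsub>A\<^esub> f y \<otimes>\<^bsub>A\<^esub> f x"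
  shows "env_lift K A f \<in> alg_hom K (U K L) A" "env_lift K A f \<one>\<^bsub>U K L\<^esub> = \<one>\<^bsub>A\<^esub>"
    "x \<in> carrier L \<Longrightarrow> env_lift K A f (U_gen K L x) = f x"
proof -
  note l = bilinear_algebraD[OF L] and a = unital_algebraD[OF A]
  let ?T = "tensor_alg K L"
  note T = unital_algebraD[OF tensor_alg_unital[OF l(1)]]
  interpret T: module K ?T by (rule T)
  interpret A: module K A by (rule a)
  note t = tensor_alg_lift[OF l(1) A f]
  note c = mod_homD(1)[OF tensor_gen_hom[OF l(1)]] and s = bilinear_map_simps(1)[OF T(3)]
    and sl = bilinear_map_simps(1)[OF l(2)] and sa = bilinear_map_simps(1)[OF a(3)]
  note n = mod_hom_neg(3)[OF T(2) a(2) alg_homD(1)[OF t(1)]]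
  note E = env_lift[OF l(1) A f U_rels_closed[OF L]]
  have k: "tensor_alg_lift K A f z = \<zero>\<^bsub>A\<^esub>" if "z \<in> {tensor_gen K L (x \<otimes>\<^bsub>L\<^esub> y) \<ominus>\<^bsub>?T\<^esub>
      (tensor_gen K L x \<otimes>\<^bsub>?T\<^esub> tensor_gen K L y \<ominus>\<^bsub>?T\<^esub> tensor_gen K L y \<otimes>\<^bsub>?T\<^esub> tensor_gen K L x) | x y.
        x \<in> carrier L \<and> y \<in> carrier L}" for z
    using that by (auto simp: n c s sl t alg_homD(2)[OF t(1)] br sa mod_homD(1)[OF f] A.a_minus_eq_zero_iff)
  note E = E[OF k, folded U_ideal_def[unfolded Let_def], folded U_def, folded U_gen_def]
  show "env_lift K A f \<in> alg_hom K (U K L) A" by (rule E(1))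
  show "env_lift K A f \<one>\<^bsub>U K L\<^esub> = \<one>\<^bsub>A\<^esub>" by (rule E(2))
  show "env_lift K A f (U_gen K L x) = f x" if "x \<in> carrier L" by (rule E(3)) (use that in auto)
qed

lemma U_map:
  assumes L: "bilinear_algebra K L" and L': "bilinear_algebra K L'" and f: "f \<in> alg_hom K L L'"
  shows "U_map K L' f \<in> alg_hom K (U K L) (U K L')" "U_map K L' f \<one>\<^bsub>U K L\<^esub> = \<one>\<^bsub>U K L'\<^esub>"
    "x \<in> carrier L \<Longrightarrow> U_map K L' f (U_gen K L x) = U_gen K L' (f x)"
proof -
  note h = mod_hom_comp[OF alg_homD(1)[OF f] U_gen_hom[OF L']]
  have b: "U_gen K L' (f (x \<otimes>\<^bsub>L\<^esub> y)) = U_gen K L' (f x) \<otimes>\<^bsub>U K L'\<^esub> U_gen K L' (f y)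
      \<ominus>\<^bsub>U K L'\<^esub> U_gen K L' (f y) \<otimes>\<^bsub>U K L'\<^esub> U_gen K L' (f x)" if "x \<in> carrier L" "y \<in> carrier L" for x y
    using that by (simp add: alg_homD(2)[OF f] U_gen_bracket[OF L'] mod_homD(1)[OF alg_homD(1)[OF f]])
  note E = U_lift[OF L U_unital[OF L'] h b, folded U_map_def]
  show "U_map K L' f \<in> alg_hom K (U K L) (U K L')" by (rule E(1))
  show "U_map K L' f \<one>\<^bsub>U K L\<^esub> = \<one>\<^bsub>U K L'\<^esub>" by (rule E(2))
  show "U_map K L' f (U_gen K L x) = U_gen K L' (f x)" if "x \<in> carrier L" by (rule E(3)) (use that in auto)
qed

text \<open>In a right action \<open>x y\<close> acts by \<open>x\<close> before \<open>y\<close>,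
  which fixes the order in the commutator. The body of \<open>R\<close> is that of
  \<open>U_tensor_ract\<close>, so the action on \<open>U(L) \<otimes> P\<close> is an instance by
  unfolding.\<close>

lemma U_right_action:
  assumes L: "bilinear_algebra K L" and N: "module K N" and g: "bilinear_map K N L N g"
    and br: "\<And>n x y. \<lbrakk>n \<in> carrier N; x \<in> carrier L; y \<in> carrier L\<rbrakk> \<Longrightarrow> g n (x \<otimes>\<^bsub>L\<^esub> y) = g (g n x) y \<ominus>\<^bsub>N\<^esub> g (g n y) x"
  defines "R \<equiv> \<lambda>n. quot_lift (quot_lift (lin_ext K N (\<lambda>w. foldl g n w)))"
  shows "right_action K (U K L) N R" "\<lbrakk>n \<in> carrier N; x \<in> carrier L\<rbrakk> \<Longrightarrow> R n (U_gen K L x) = g n x"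
proof -
  note l = bilinear_algebraD[OF L]
  let ?T = "tensor_alg K L"
  note T = unital_algebraD[OF tensor_alg_unital[OF l(1)]]
  interpret T: module K ?T by (rule T)
  interpret N: module K N by (rule N)
  note t = tensor_right_action[OF l(1) N g] 
  note tb = right_actionD(1)[OF t(1)]
  note c = mod_homD(1)[OF tensor_gen_hom[OF l(1)]] and s = bilinear_map_simps(1)[OF T(3)]
    and sl = bilinear_map_simps(1)[OF l(2)] and sg = bilinear_map_simps(1)[OF g]
  note n = bilinear_map_neg(5)[OF N T(2) N tb]
  note E = env_right_action[OF l(1) N g U_rels_closed[OF L]]
  have k: "quot_lift (lin_ext K N (\<lambda>w. foldl g m w)) z = \<zero>\<^bsub>N\<^esub>" if "m \<in> carrier N" "z \<in> {tensor_gen K L (x \<otimes>\<^bsub>L\<^esub> y) \<ominus>\<^bsub>?T\<^esub>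
      (tensor_gen K L x \<otimes>\<^bsub>?T\<^esub> tensor_gen K L y \<ominus>\<^bsub>?T\<^esub> tensor_gen K L y \<otimes>\<^bsub>?T\<^esub> tensor_gen K L x) | x y.
        x \<in> carrier L \<and> y \<in> carrier L}" for z m
    using that by (auto simp: n c s sl t right_actionD(2)[OF t(1)] br sg N.a_minus_eq_zero_iff)
  note E = E[OF k, folded U_ideal_def[unfolded Let_def], folded U_def, folded U_gen_def]
  show "right_action K (U K L) N R" unfolding R_def by (rule E(1))
  show "R n (U_gen K L x) = g n x" if "n \<in> carrier N" "x \<in> carrier L"
    unfolding R_def by (rule E(2)) (use that in auto)
qed

subsection \<open>Universal enveloping algebras of Leibniz algebras\<close>

abbreviation UL_l :: "('k, 'z) ring_scheme \<Rightarrow> ('k, 'p) module \<Rightarrow> 'p \<Rightarrow> (('p \<times> 'p) list \<Rightarrow> 'k) set set" where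
  "UL_l K P x \<equiv> UL_gen K P (x, \<zero>\<^bsub>P\<^esub>)"

abbreviation UL_r :: "('k, 'z) ring_scheme \<Rightarrow> ('k, 'p) module \<Rightarrow> 'p \<Rightarrow> (('p \<times> 'p) list \<Rightarrow> 'k) set set" where
  "UL_r K P x \<equiv> UL_gen K P (\<zero>\<^bsub>P\<^esub>, x)"

text \<open>The generators of \<open>UL_ideal\<close>, given a name because \<open>env_lift\<close>
  and \<open>env_right_action\<close> take the generating set as a parameter.\<close>

definition UL_rels :: "('k, 'z) ring_scheme \<Rightarrow> ('k, 'p) module \<Rightarrow> (('p \<times> 'p) list \<Rightarrow> 'k) set set" where
  "UL_rels K P = (let T = tensor_alg K (dsum P P);
       l = (\<lambda>x. tensor_gen K (dsum P P) (x, \<zero>\<^bsub>P\<^esub>));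
       r = (\<lambda>x. tensor_gen K (dsum P P) (\<zero>\<^bsub>P\<^esub>, x)) in
       ({r (x \<otimes>\<^bsub>P\<^esub> y) \<ominus>\<^bsub>T\<^esub> (r x \<otimes>\<^bsub>T\<^esub> r y \<ominus>\<^bsub>T\<^esub> r y \<otimes>\<^bsub>T\<^esub> r x) | x y.
            x \<in> carrier P \<and> y \<in> carrier P} \<union>
        {l (x \<otimes>\<^bsub>P\<^esub> y) \<ominus>\<^bsub>T\<^esub> (l x \<otimes>\<^bsub>T\<^esub> r y \<ominus>\<^bsub>T\<^esub> r y \<otimes>\<^bsub>T\<^esub> l x) | x y.
            x \<in> carrier P \<and> y \<in> carrier P} \<union>
        {(r y \<oplus>\<^bsub>T\<^esub> l y) \<otimes>\<^bsub>T\<^esub> l x | x y. x \<in> carrier P \<and> y \<in> carrier P}))"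

lemma UL_ideal_rels: "UL_ideal K P = alg_idl K (tensor_alg K (dsum P P)) (UL_rels K P)"
  by (simp add: UL_ideal_def UL_rels_def Let_def)

lemma UL_rels_cases:
  assumes "z \<in> UL_rels K P"
  fixes T defines "T \<equiv> tensor_alg K (dsum P P)"
  fixes l defines "l \<equiv> \<lambda>x. tensor_gen K (dsum P P) (x, \<zero>\<^bsub>P\<^esub>)"
  fixes r defines "r \<equiv> \<lambda>x. tensor_gen K (dsum P P) (\<zero>\<^bsub>P\<^esub>, x)"
  obtains x y where "x \<in> carrier P" "y \<in> carrier P" "z = r (x \<otimes>\<^bsub>P\<^esub> y) \<ominus>\<^bsub>T\<^esub> (r x \<otimes>\<^bsub>T\<^esub> r y \<ominus>\<^bsub>T\<^esub> r y \<otimes>\<^bsub>T\<^esub> r x)"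
  | x y where "x \<in> carrier P" "y \<in> carrier P" "z = l (x \<otimes>\<^bsub>P\<^esub> y) \<ominus>\<^bsub>T\<^esub> (l x \<otimes>\<^bsub>T\<^esub> r y \<ominus>\<^bsub>T\<^esub> r y \<otimes>\<^bsub>T\<^esub> l x)"
  | x y where "x \<in> carrier P" "y \<in> carrier P" "z = (r y \<oplus>\<^bsub>T\<^esub> l y) \<otimes>\<^bsub>T\<^esub> l x"
  using assms(1) unfolding UL_rels_def Let_def T_def l_def r_def by blast

context
  fixes K :: "('k, 'z) ring_scheme" and P :: "('k, 'p) module"
  assumes P: "bilinear_algebra K P"
begin

private lemma PP: "module K (dsum P P)"
  by (intro dsum_module bilinear_algebraD[OF P])

private lemma gen_closed:
  assumes "x \<in> carrier P"
  shows "tensor_gen K (dsum P P) (x, \<zero>\<^bsub>P\<^esub>) \<in> carrier (tensor_alg K (dsum P P))"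
    "tensor_gen K (dsum P P) (\<zero>\<^bsub>P\<^esub>, x) \<in> carrier (tensor_alg K (dsum P P))"
proof -
  interpret P: module K P by (rule bilinear_algebraD[OF P])
  show "tensor_gen K (dsum P P) (x, \<zero>\<^bsub>P\<^esub>) \<in> carrier (tensor_alg K (dsum P P))"
    "tensor_gen K (dsum P P) (\<zero>\<^bsub>P\<^esub>, x) \<in> carrier (tensor_alg K (dsum P P))"
    using assms by (auto intro!: mod_homD(1)[OF tensor_gen_hom[OF PP]] simp: dsum_simps)
qed

lemma UL_rels_closed: "UL_rels K P \<subseteq> carrier (tensor_alg K (dsum P P))"
proof
  note T = unital_algebraD[OF tensor_alg_unital[OF PP]] and p = bilinear_algebraD[OF P]
  interpret T: module K "tensor_alg K (dsum P P)" by (rule T)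
  fix z assume "z \<in> UL_rels K P"
  then show "z \<in> carrier (tensor_alg K (dsum P P))"
    by (cases rule: UL_rels_cases)
      (auto simp: gen_closed bilinear_map_simps(1)[OF T(3)] bilinear_map_simps(1)[OF p(2)])
qed

lemma UL_ideal_ideal: "alg_ideal K (tensor_alg K (dsum P P)) (UL_ideal K P)"
  unfolding UL_ideal_rels
  by (rule alg_idl_ideal[OF unital_algebraD(1)[OF tensor_alg_unital[OF PP]] UL_rels_closed])

lemma UL_unital: "unital_algebra K (UL K P)"
  unfolding UL_def by (rule unital_algebra_quot[OF tensor_alg_unital[OF PP] UL_ideal_ideal])

lemma UL_gen_hom: "UL_gen K P \<in> mod_hom K (dsum P P) (UL K P)"
  using tensor_quot_gen_hom[OF PP UL_ideal_ideal] by (simp add: UL_gen_def[abs_def] UL_def)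

lemma UL_l_hom: "UL_l K P \<in> mod_hom K P (UL K P)"
  using mod_hom_comp[OF dsum_homs(1) UL_gen_hom] bilinear_algebraD[OF P] by blast

lemma UL_r_hom: "UL_r K P \<in> mod_hom K P (UL K P)"
  using mod_hom_comp[OF dsum_homs(2) UL_gen_hom] bilinear_algebraD[OF P] by blast

lemma UL_gen_split:
  assumes "x \<in> carrier P" "y \<in> carrier P"
  shows "UL_gen K P (x, y) = UL_l K P x \<oplus>\<^bsub>UL K P\<^esub> UL_r K P y"
proof -
  interpret P: module K P by (rule bilinear_algebraD[OF P])
  show ?thesis using assms mod_homD(2)[OF UL_gen_hom, of "(x, \<zero>\<^bsub>P\<^esub>)" "(\<zero>\<^bsub>P\<^esub>, y)"]
    by (simp add: dsum_simps)
qed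

lemma UL_relations:
  assumes "x \<in> carrier P" "y \<in> carrier P"
  shows "UL_r K P (x \<otimes>\<^bsub>P\<^esub> y) = UL_r K P x \<otimes>\<^bsub>UL K P\<^esub> UL_r K P y \<ominus>\<^bsub>UL K P\<^esub> UL_r K P y \<otimes>\<^bsub>UL K P\<^esub> UL_r K P x"
    "UL_l K P (x \<otimes>\<^bsub>P\<^esub> y) = UL_l K P x \<otimes>\<^bsub>UL K P\<^esub> UL_r K P y \<ominus>\<^bsub>UL K P\<^esub> UL_r K P y \<otimes>\<^bsub>UL K P\<^esub> UL_l K P x"
    "(UL_r K P y \<oplus>\<^bsub>UL K P\<^esub> UL_l K P y) \<otimes>\<^bsub>UL K P\<^esub> UL_l K P x = \<zero>\<^bsub>UL K P\<^esub>"
proof -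
  let ?T = "tensor_alg K (dsum P P)"
  note T = unital_algebraD[OF tensor_alg_unital[OF PP]] and p = bilinear_algebraD[OF P] and I = UL_ideal_ideal
  interpret T: module K ?T by (rule T)
  define l where "l = (\<lambda>x. tensor_gen K (dsum P P) (x, \<zero>\<^bsub>P\<^esub>))"
  define r where "r = (\<lambda>x. tensor_gen K (dsum P P) (\<zero>\<^bsub>P\<^esub>, x))"
  note q = quot_module[OF T(2) alg_idealD(1)[OF I]]
  have gc: "l z \<in> carrier ?T" "r z \<in> carrier ?T" if "z \<in> carrier P" for z
    using that by (simp_all add: l_def r_def gen_closed)
  have lr: "UL_l K P z = UL_ideal K P +>\<^bsub>?T\<^esub> l z" "UL_r K P z = UL_ideal K P +>\<^bsub>?T\<^esub> r z" for z
    by (simp_all add: UL_gen_def l_def r_def)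
  note s = gc bilinear_map_simps(1)[OF T(3)] bilinear_map_simps(1)[OF p(2)]
  note qs = quot_mult[OF T(1) I] mod_hom_neg(3)[OF T(2) q] quot_add[OF T(2) alg_idealD(1)[OF I]]
  have mem: "r (x \<otimes>\<^bsub>P\<^esub> y) \<ominus>\<^bsub>?T\<^esub> (r x \<otimes>\<^bsub>?T\<^esub> r y \<ominus>\<^bsub>?T\<^esub> r y \<otimes>\<^bsub>?T\<^esub> r x) \<in> UL_ideal K P"
    "l (x \<otimes>\<^bsub>P\<^esub> y) \<ominus>\<^bsub>?T\<^esub> (l x \<otimes>\<^bsub>?T\<^esub> r y \<ominus>\<^bsub>?T\<^esub> r y \<otimes>\<^bsub>?T\<^esub> l x) \<in> UL_ideal K P"
    "(r y \<oplus>\<^bsub>?T\<^esub> l y) \<otimes>\<^bsub>?T\<^esub> l x \<in> UL_ideal K P"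
    unfolding UL_ideal_rels by (rule subsetD[OF alg_idl_superset]; use assms in \<open>unfold UL_rels_def Let_def l_def r_def, blast\<close>)+
  note eq = quot_rel_eq[OF T(2) alg_idealD(1)[OF I] _ _ mem(1)] quot_rel_eq[OF T(2) alg_idealD(1)[OF I] _ _ mem(2)]
  show "UL_r K P (x \<otimes>\<^bsub>P\<^esub> y) = UL_r K P x \<otimes>\<^bsub>UL K P\<^esub> UL_r K P y \<ominus>\<^bsub>UL K P\<^esub> UL_r K P y \<otimes>\<^bsub>UL K P\<^esub> UL_r K P x"
    using eq(1) assms unfolding lr UL_def by (simp add: s qs)
  show "UL_l K P (x \<otimes>\<^bsub>P\<^esub> y) = UL_l K P x \<otimes>\<^bsub>UL K P\<^esub> UL_r K P y \<ominus>\<^bsub>UL K P\<^esub> UL_r K P y \<otimes>\<^bsub>UL K P\<^esub> UL_l K P x"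
    using eq(2) assms unfolding lr UL_def by (simp add: s qs)
  have "UL_ideal K P +>\<^bsub>?T\<^esub> ((r y \<oplus>\<^bsub>?T\<^esub> l y) \<otimes>\<^bsub>?T\<^esub> l x) = UL_ideal K P"
    by (subst coset_eq_self_iff[OF T(2) alg_idealD(1)[OF I]]) (use assms mem(3) in \<open>simp_all add: s\<close>)
  then show "(UL_r K P y \<oplus>\<^bsub>UL K P\<^esub> UL_l K P y) \<otimes>\<^bsub>UL K P\<^esub> UL_l K P x = \<zero>\<^bsub>UL K P\<^esub>"
    using assms unfolding lr UL_def by (simp add: s qs quot_simps)
qed

lemma UL_induct:
  assumes N: "submodule N K (UL K P)" "\<one>\<^bsub>UL K P\<^esub> \<in> N"
    and st: "\<And>y x. \<lbrakk>y \<in> N; x \<in> carrier P\<rbrakk> \<Longrightarrow> y \<otimes>\<^bsub>UL K P\<^esub> UL_l K P x \<in> N"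
      "\<And>y x. \<lbrakk>y \<in> N; x \<in> carrier P\<rbrakk> \<Longrightarrow> y \<otimes>\<^bsub>UL K P\<^esub> UL_r K P x \<in> N"
    and z: "z \<in> carrier (UL K P)"
  shows "z \<in> N"
proof -
  note u = unital_algebraD[OF UL_unital]
  interpret P: module K P by (rule bilinear_algebraD[OF P])
  note S = submodule_facts[OF u(2) N(1)]
  have "y \<otimes>\<^bsub>UL K P\<^esub> UL_gen K P v \<in> N" if "y \<in> N" "v \<in> carrier (dsum P P)" for y v
  proof -
    have v: "v = (fst v, snd v)" "fst v \<in> carrier P" "snd v \<in> carrier P"
      using that(2) by (simp_all add: dsum_simps(1) mem_Times_iff)
    have "y \<otimes>\<^bsub>UL K P\<^esub> UL_gen K P (fst v, snd v)
        = y \<otimes>\<^bsub>UL K P\<^esub> UL_l K P (fst v) \<oplus>\<^bsub>UL K P\<^esub> y \<otimes>\<^bsub>UL K P\<^esub> UL_r K P (snd v)"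
      unfolding UL_gen_split[OF v(2,3)]
      by (rule bilinear_map_simps(2)[OF u(3) subsetD[OF S(1) that(1)] mod_homD(1)[OF UL_l_hom v(2)] mod_homD(1)[OF UL_r_hom v(3)]])
    also have "\<dots> \<in> N" by (intro S(3) st that(1) v)
    finally show ?thesis by simp
  qed
  then have "\<forall>y\<in>N. \<forall>x\<in>carrier (dsum P P). y \<otimes>\<^bsub>UL K P\<^esub> UL_gen K P x \<in> N" by blast
  then show ?thesis
    using tensor_quot_induct[OF PP UL_ideal_ideal, folded UL_def, folded UL_gen_def, OF N _ z] by blast
qed

text \<open>\<open>f\<close> is prescribed on pairs from the carrier only, because
  \<open>UL_map\<close> lifts a case expression that becomes a sum only through
  \<open>UL_gen_split\<close>.\<close>

lemma UL_lift:
  assumes A: "unital_algebra K A" and l: "l \<in> mod_hom K P A" and r: "r \<in> mod_hom K P A"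
    and rr: "\<And>x y. \<lbrakk>x \<in> carrier P; y \<in> carrier P\<rbrakk> \<Longrightarrow> r (x \<otimes>\<^bsub>P\<^esub> y) = r x \<otimes>\<^bsub>A\<^esub> r y \<ominus>\<^bsub>A\<^esub> r y \<otimes>\<^bsub>A\<^esub> r x"
    and lr: "\<And>x y. \<lbrakk>x \<in> carrier P; y \<in> carrier P\<rbrakk> \<Longrightarrow> l (x \<otimes>\<^bsub>P\<^esub> y) = l x \<otimes>\<^bsub>A\<^esub> r y \<ominus>\<^bsub>A\<^esub> r y \<otimes>\<^bsub>A\<^esub> l x"
    and ll: "\<And>x y. \<lbrakk>x \<in> carrier P; y \<in> carrier P\<rbrakk> \<Longrightarrow> (r y \<oplus>\<^bsub>A\<^esub> l y) \<otimes>\<^bsub>A\<^esub> l x = \<zero>\<^bsub>A\<^esub>"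
    and f: "\<And>x y. \<lbrakk>x \<in> carrier P; y \<in> carrier P\<rbrakk> \<Longrightarrow> f (x, y) = l x \<oplus>\<^bsub>A\<^esub> r y"
  shows "env_lift K A f \<in> alg_hom K (UL K P) A" "env_lift K A f \<one>\<^bsub>UL K P\<^esub> = \<one>\<^bsub>A\<^esub>"
    "x \<in> carrier P \<Longrightarrow> env_lift K A f (UL_l K P x) = l x"
    "x \<in> carrier P \<Longrightarrow> env_lift K A f (UL_r K P x) = r x"
proof -
  note p = bilinear_algebraD[OF P] and a = unital_algebraD[OF A]
  let ?T = "tensor_alg K (dsum P P)"
  note T = unital_algebraD[OF tensor_alg_unital[OF PP]]
  interpret T: module K ?T by (rule T)
  interpret A: module K A by (rule a)
  interpret P: module K P by (rule p)
  have fh: "f \<in> mod_hom K (dsum P P) A"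
    by (rule mod_hom_cong[OF dsum_hom[OF a(2) l r] PP]) (auto simp: dsum_simps f)
  note t = tensor_alg_lift[OF PP A fh]
  note z = mod_hom_neg(1)[OF p(1) a(2) l] mod_hom_neg(1)[OF p(1) a(2) r]
  have g: "f (x, \<zero>\<^bsub>P\<^esub>) = l x" "f (\<zero>\<^bsub>P\<^esub>, x) = r x" if "x \<in> carrier P" for x
    using that by (simp_all add: f z mod_homD(1)[OF l] mod_homD(1)[OF r])
  note s = bilinear_map_simps(1)[OF T(3)] bilinear_map_simps(1)[OF p(2)] bilinear_map_simps(1)[OF a(3)]
    mod_homD(1)[OF l] mod_homD(1)[OF r]
  have k: "tensor_alg_lift K A f z = \<zero>\<^bsub>A\<^esub>" if "z \<in> UL_rels K P" for z
    using that
    by (cases rule: UL_rels_cases)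
      (simp_all add: mod_hom_neg(3)[OF T(2) a(2) alg_homD(1)[OF t(1)]] gen_closed s t(3) alg_homD(2)[OF t(1)]
        mod_homD(2)[OF alg_homD(1)[OF t(1)]] dsum_simps g rr lr ll A.a_minus_eq_zero_iff)
  note E = env_lift[OF PP A fh UL_rels_closed k, folded UL_ideal_rels, folded UL_def, folded UL_gen_def]
  show "env_lift K A f \<in> alg_hom K (UL K P) A" "env_lift K A f \<one>\<^bsub>UL K P\<^esub> = \<one>\<^bsub>A\<^esub>"
    by (rule E; assumption)+
  show "env_lift K A f (UL_l K P x) = l x" "env_lift K A f (UL_r K P x) = r x" if "x \<in> carrier P"
    using E(3) that by (auto simp: dsum_simps g)
qed

text \<open>The defining relations read as identities between operators, the left factor acting
  first: \<open>l\<close> is applied after \<open>r n y \<oplus> l n y\<close> in the last one. A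
  pair in \<open>P \<oplus> P\<close> acts by \<open>l\<close> of its first and \<open>r\<close> of
  its second component, added up.\<close>

lemma UL_right_action:
  assumes N: "module K N" and l: "bilinear_map K N P N l" and r: "bilinear_map K N P N r"
    and rr: "\<And>n x y. \<lbrakk>n \<in> carrier N; x \<in> carrier P; y \<in> carrier P\<rbrakk> \<Longrightarrow> r n (x \<otimes>\<^bsub>P\<^esub> y) = r (r n x) y \<ominus>\<^bsub>N\<^esub> r (r n y) x"
    and lr: "\<And>n x y. \<lbrakk>n \<in> carrier N; x \<in> carrier P; y \<in> carrier P\<rbrakk> \<Longrightarrow> l n (x \<otimes>\<^bsub>P\<^esub> y) = r (l n x) y \<ominus>\<^bsub>N\<^esub> l (r n y) x"
    and ll: "\<And>n x y. \<lbrakk>n \<in> carrier N; x \<in> carrier P; y \<in> carrier P\<rbrakk> \<Longrightarrow> l (r n y \<oplus>\<^bsub>N\<^esub> l n y) x = \<zero>\<^bsub>N\<^esub>"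
  obtains R where "right_action K (UL K P) N R"
    "\<And>n x. \<lbrakk>n \<in> carrier N; x \<in> carrier P\<rbrakk> \<Longrightarrow> R n (UL_l K P x) = l n x"
    "\<And>n x. \<lbrakk>n \<in> carrier N; x \<in> carrier P\<rbrakk> \<Longrightarrow> R n (UL_r K P x) = r n x"
proof -
  note p = bilinear_algebraD[OF P]
  let ?T = "tensor_alg K (dsum P P)"
  note T = unital_algebraD[OF tensor_alg_unital[OF PP]]
  interpret T: module K ?T by (rule T)
  interpret N: module K N by (rule N)
  interpret P: module K P by (rule p)
  define g where "g = (\<lambda>n v. l n (fst v) \<oplus>\<^bsub>N\<^esub> r n (snd v))"
  have gb: "bilinear_map K N (dsum P P) N g"
    unfolding g_def
    by (rule bilinear_map_add[OF N bilinear_map_comp_right[OF l dsum_homs(3)[OF p(1) p(1)]]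
          bilinear_map_comp_right[OF r dsum_homs(4)[OF p(1) p(1)]]])
  note t = tensor_right_action[OF PP N gb]
  note z = bilinear_map_neg(1)[OF N p(1) N l] bilinear_map_neg(1)[OF N p(1) N r]
  have g: "g n (x, \<zero>\<^bsub>P\<^esub>) = l n x" "g n (\<zero>\<^bsub>P\<^esub>, x) = r n x" if "x \<in> carrier P" "n \<in> carrier N" for x n
    using that by (simp_all add: g_def z bilinear_map_simps(1)[OF l] bilinear_map_simps(1)[OF r])
  note s = bilinear_map_simps(1)[OF T(3)] bilinear_map_simps(1)[OF p(2)]
    bilinear_map_simps(1)[OF l] bilinear_map_simps(1)[OF r]
  note tb = right_actionD(1)[OF t(1)]
  have k: "quot_lift (lin_ext K N (\<lambda>w. foldl g m w)) z = \<zero>\<^bsub>N\<^esub>" if m: "m \<in> carrier N" and "z \<in> UL_rels K P" for z m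
    using that(2)
    by (cases rule: UL_rels_cases)
      (simp_all add: m bilinear_map_neg(5)[OF N T(2) N tb] bilinear_map_simps(2)[OF tb] gen_closed s t(2) right_actionD(2)[OF t(1)]
        dsum_simps g rr lr ll N.a_minus_eq_zero_iff)
  note E = env_right_action[OF PP N gb UL_rels_closed k, folded UL_ideal_rels, folded UL_def, folded UL_gen_def]
  show ?thesis
    by (rule that[OF E(1)]) (auto simp: E(2) dsum_simps g)
qed

end

lemma UL_map:
  assumes P: "bilinear_algebra K P" and P': "bilinear_algebra K P'" and f: "f \<in> alg_hom K P P'"
  shows "UL_map K P' f \<in> alg_hom K (UL K P) (UL K P')" "UL_map K P' f \<one>\<^bsub>UL K P\<^esub> = \<one>\<^bsub>UL K P'\<^esub>"
    "x \<in> carrier P \<Longrightarrow> UL_map K P' f (UL_l K P x) = UL_l K P' (f x)"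
    "x \<in> carrier P \<Longrightarrow> UL_map K P' f (UL_r K P x) = UL_r K P' (f x)"
proof -
  note h = mod_hom_comp[OF alg_homD(1)[OF f] UL_l_hom[OF P']] mod_hom_comp[OF alg_homD(1)[OF f] UL_r_hom[OF P']]
  note c = mod_homD(1)[OF alg_homD(1)[OF f]]
  note E = UL_lift[OF P UL_unital[OF P'] h, where f = "\<lambda>(x, y). UL_gen K P' (f x, f y)", folded UL_map_def]
  note rl = alg_homD(2)[OF f] UL_relations[OF P'] c
  have sp: "(case (x, y) of (x, y) \<Rightarrow> UL_gen K P' (f x, f y))
      = UL_l K P' (f x) \<oplus>\<^bsub>UL K P'\<^esub> UL_r K P' (f y)" if "x \<in> carrier P" "y \<in> carrier P" for x y
    using UL_gen_split[OF P' c[OF that(1)] c[OF that(2)]] by simp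
  show "UL_map K P' f \<in> alg_hom K (UL K P) (UL K P')" by (rule E(1); (rule sp)?; simp add: rl)
  show "UL_map K P' f \<one>\<^bsub>UL K P\<^esub> = \<one>\<^bsub>UL K P'\<^esub>" by (rule E(2); (rule sp)?; simp add: rl)
  show "UL_map K P' f (UL_l K P x) = UL_l K P' (f x)" if "x \<in> carrier P"
    by (rule E(3); (rule sp)?; simp add: rl that)
  show "UL_map K P' f (UL_r K P x) = UL_r K P' (f x)" if "x \<in> carrier P"
    by (rule E(4); (rule sp)?; simp add: rl that)
qed

subsection \<open>The isomorphism of \<open>UL(P)\<close> with \<open>(U(L) \<otimes> P) \<oplus> U(L)\<close>\<close>

lemma (in abelian_group) add_minus_cancel:
  "\<lbrakk>x \<in> carrier G; y \<in> carrier G\<rbrakk> \<Longrightarrow> x \<oplus> (y \<ominus> x) = y"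
  by (simp add: a_minus_def a_lcomm[of x y] r_neg)

lemma (in abelian_group) eq_minusI:
  "\<lbrakk>x = z \<oplus> y; z \<in> carrier G; y \<in> carrier G\<rbrakk> \<Longrightarrow> z = x \<ominus> y"
  by (simp add: a_minus_def a_assoc r_neg)

text \<open>The cancellation behind \<open>rg_bracket\<close>: two elements of \<open>L\<close>
  acting in both orders give four terms each, and the two mixed terms \<open>b\<close> and
  \<open>c\<close> occur on both sides.\<close>

lemma (in abelian_group) minus_sum_cancel:
  assumes "a \<in> carrier G" "a' \<in> carrier G" "b \<in> carrier G" "c \<in> carrier G" "d \<in> carrier G" "d' \<in> carrier G"
  shows "(a \<ominus> a') \<oplus> (d \<ominus> d') = ((a \<oplus> b) \<oplus> (c \<oplus> d)) \<ominus> ((a' \<oplus> c) \<oplus> (b \<oplus> d'))"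
proof -
  define s t where "s = a \<ominus> a'" and "t = d \<ominus> d'"
  have st: "s \<in> carrier G" "t \<in> carrier G" using assms by (auto simp: s_def t_def)
  have eq: "a = a' \<oplus> s" "d = d' \<oplus> t" using assms by (simp_all add: s_def t_def add_minus_cancel)
  have "s \<oplus> t = (((a' \<oplus> s) \<oplus> b) \<oplus> (c \<oplus> (d' \<oplus> t))) \<ominus> ((a' \<oplus> c) \<oplus> (b \<oplus> d'))"
    by (rule eq_minusI) (use assms st in \<open>simp_all add: a_ac\<close>)
  then show ?thesis by (simp only: eq[symmetric] s_def[symmetric] t_def[symmetric])
qed

text \<open>Moves \<open>g\<close> from the left of \<open>v\<close> to its right at the price of a
  commutator. It serves in \<open>U(L)\<close> for \<open>al_rg\<close> and in \<open>UL(P)\<close>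
  for \<open>iM_rg\<close>.\<close>

lemma (in ring) commutator_cancel:
  assumes "u \<in> carrier R" "g \<in> carrier R" "v \<in> carrier R"
  shows "u \<otimes> g \<otimes> v \<oplus> u \<otimes> (v \<otimes> g \<ominus> g \<otimes> v) = u \<otimes> v \<otimes> g"
proof -
  have "u \<otimes> (v \<otimes> g \<ominus> g \<otimes> v) = u \<otimes> v \<otimes> g \<ominus> u \<otimes> g \<otimes> v"
    using assms by (simp add: a_minus_def r_distr r_minus m_assoc)
  then show ?thesis using assms by (simp add: add_minus_cancel)
qed

text \<open>Prepared for \<open>rl_annihilates\<close>, with \<open>r v\<close> and
  \<open>l v\<close> for \<open>a\<close> and \<open>b\<close>: pulling \<open>x\<close> out to the
  left leaves the sum of two commutators, each of which a relation of \<open>UL(P)\<close>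
  evaluates.\<close>

lemma (in ring) commutator_sum_mult:
  assumes "a \<in> carrier R" "b \<in> carrier R" "x \<in> carrier R" "z \<in> carrier R"
  shows "(a \<oplus> b) \<otimes> (x \<otimes> z)
    = x \<otimes> ((a \<oplus> b) \<otimes> z) \<oplus> ((a \<otimes> x \<ominus> x \<otimes> a) \<oplus> (b \<otimes> x \<ominus> x \<otimes> b)) \<otimes> z"
proof -
  have "(a \<otimes> x \<ominus> x \<otimes> a) \<oplus> (b \<otimes> x \<ominus> x \<otimes> b) = (a \<oplus> b) \<otimes> x \<ominus> x \<otimes> (a \<oplus> b)"
    using assms by (simp add: a_minus_def l_distr r_distr minus_add a_ac)
  moreover have "((a \<oplus> b) \<otimes> x \<ominus> x \<otimes> (a \<oplus> b)) \<otimes> z = (a \<oplus> b) \<otimes> (x \<otimes> z) \<ominus> x \<otimes> ((a \<oplus> b) \<otimes> z)"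
    using assms by (simp add: a_minus_def l_distr[of _ _ z] l_minus m_assoc del: l_distr)
  ultimately show ?thesis using assms by (simp add: add_minus_cancel)
qed

lemma surj_kernel_factor:
  assumes M: "module K M" and L: "module K L" and N: "module K N"
    and p: "p \<in> mod_hom K M L" and surj: "p ` carrier M = carrier L"
    and h: "h \<in> mod_hom K M N" and ker: "\<And>x. \<lbrakk>x \<in> carrier M; p x = \<zero>\<^bsub>L\<^esub>\<rbrakk> \<Longrightarrow> h x = \<zero>\<^bsub>N\<^esub>"
  obtains f where "f \<in> mod_hom K L N" "\<And>x. x \<in> carrier M \<Longrightarrow> f (p x) = h x"
proof -
  interpret M: module K M by fact
  interpret L: module K L by fact
  interpret N: module K N by fact
  \<comment> \<open>Any preimage will do: two preimages differ by an element of the kernel of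
    \<open>p\<close>, and \<open>h\<close> kills that kernel.\<close>
  define f where "f g = h (inv_into (carrier M) p g)" for g
  have v: "f (p x) = h x" if x: "x \<in> carrier M" for x
  proof -
    let ?y = "inv_into (carrier M) p (p x)"
    have y: "?y \<in> carrier M" "p ?y = p x"
      using x by (auto intro: inv_into_into f_inv_into_f)
    then have "h (?y \<ominus>\<^bsub>M\<^esub> x) = \<zero>\<^bsub>N\<^esub>"
      using x mod_homD(1)[OF p] by (intro ker) (simp_all add: mod_hom_neg(3)[OF M L p] L.a_minus_eq_zero_iff)
    then show ?thesis
      using x y mod_homD(1)[OF h] by (simp add: f_def mod_hom_neg(3)[OF M N h] N.a_minus_eq_zero_iff)
  qed
  have "f \<in> mod_hom K L N"
    by (rule mod_homI)
      (auto simp: surj[symmetric] v mod_homD(2,3)[OF p, symmetric] mod_homD[OF h])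
  then show ?thesis using v that by blast
qed

text \<open>The assumption \<open>p_ker\<close> says that \<open>p\<close> identifies \<open>L\<close> with \<open>Lie(P)\<close>; it makes the locale applicable
  to \<open>\<qq> \<rtimes> \<pp> \<rightarrow> \<hh> \<rtimes> \<gg>\<close> without an isomorphism \<open>\<hh> \<rtimes> \<gg> \<cong> Lie(\<qq> \<rtimes> \<pp>)\<close>.\<close>

locale lie_quotient =
  fixes K :: "('k, 'z) ring_scheme" and P :: "('k, 'p) module" and L :: "('k, 'l) module"
    and p :: "'p \<Rightarrow> 'l" and act :: "'p \<Rightarrow> 'l \<Rightarrow> 'p"
  assumes leibniz: "leibniz_algebra K P" and L: "bilinear_algebra K L"
    and p: "p \<in> alg_hom K P L" and p_surj: "p ` carrier P = carrier L"
    and p_ker: "\<And>J x. \<lbrakk>alg_ideal K P J; \<And>y. y \<in> carrier P \<Longrightarrow> y \<otimes>\<^bsub>P\<^esub> y \<in> J;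
        x \<in> carrier P; p x = \<zero>\<^bsub>L\<^esub>\<rbrakk> \<Longrightarrow> x \<in> J"
    and act_p: "\<And>v w. \<lbrakk>v \<in> carrier P; w \<in> carrier P\<rbrakk> \<Longrightarrow> act v (p w) = v \<otimes>\<^bsub>P\<^esub> w"
begin

lemma P: "bilinear_algebra K P"
  using leibniz by (simp add: leibniz_algebra_def)

lemmas P_mod = bilinear_algebraD(1)[OF P]
lemmas P_bil = bilinear_algebraD(2)[OF P]
lemmas L_mod = bilinear_algebraD(1)[OF L]
lemmas L_bil = bilinear_algebraD(2)[OF L]
lemmas U_alg = U_unital[OF L]
lemmas UL_alg = UL_unital[OF P]

sublocale P: module K P by (rule P_mod)
sublocale L: module K L by (rule L_mod)
sublocale U: ring "U K L" by (rule unital_algebraD(4)[OF U_alg])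
sublocale UL: ring "UL K P" by (rule unital_algebraD(4)[OF UL_alg])
sublocale U_module: module K "U K L" by (rule unital_algebraD(2)[OF U_alg])
sublocale UL_module: module K "UL K P" by (rule unital_algebraD(2)[OF UL_alg])

abbreviation "M \<equiv> tprod K (U K L) P"
abbreviation "pt \<equiv> pure_tensor K (U K L) P"
abbreviation "gen \<equiv> U_gen K L"
abbreviation "l \<equiv> UL_l K P"
abbreviation "r \<equiv> UL_r K P"

lemmas U_mod = unital_algebraD(2)[OF U_alg]
lemmas U_bil = unital_algebraD(3)[OF U_alg]
lemmas UL_mod = unital_algebraD(2)[OF UL_alg]
lemmas UL_bil = unital_algebraD(3)[OF UL_alg]
lemmas M_mod = tprod_module[OF U_mod P_mod]

sublocale M: module K M by (rule M_mod)

lemmas p_closed = mod_homD(1)[OF alg_homD(1)[OF p]]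
lemmas p_mult = alg_homD(2)[OF p]
lemmas P_closed = bilinear_map_simps(1)[OF P_bil]
lemmas L_closed = bilinear_map_simps(1)[OF L_bil]
lemmas gen_closed = mod_homD(1)[OF U_gen_hom[OF L]]
lemmas l_closed = mod_homD(1)[OF UL_l_hom[OF P]]
lemmas r_closed = mod_homD(1)[OF UL_r_hom[OF P]]
lemmas pt_bil = pure_tensor_bilinear[OF U_mod P_mod]
lemmas pt_closed = bilinear_map_simps(1)[OF pt_bil]
lemmas pt_neg = bilinear_map_neg[OF U_mod P_mod M_mod pt_bil]

lemma L_cases:
  assumes "g \<in> carrier L" obtains x where "x \<in> carrier P" "g = p x"
  using assms p_surj by auto

lemma act_bil: "bilinear_map K P L P act"
proof -
  have id: "(\<lambda>x. x) \<in> mod_hom K P P" by (rule mod_homI) auto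
  show ?thesis
    by (rule bilinear_map_surj_image[OF P_bil P_mod P_mod id alg_homD(1)[OF p] id])
      (auto simp: p_surj act_p)
qed

text \<open>The Leibniz identity says that right multiplication by a product is the commutator of
  the right multiplications. This is what makes \<open>P\<close> a right representation of
  \<open>L\<close> in \<open>act_bracket\<close>.\<close>

lemma leibniz_minus:
  assumes "x \<in> carrier P" "y \<in> carrier P" "z \<in> carrier P"
  shows "x \<otimes>\<^bsub>P\<^esub> (y \<otimes>\<^bsub>P\<^esub> z) = (x \<otimes>\<^bsub>P\<^esub> y) \<otimes>\<^bsub>P\<^esub> z \<ominus>\<^bsub>P\<^esub> (x \<otimes>\<^bsub>P\<^esub> z) \<otimes>\<^bsub>P\<^esub> y"
  using leibniz_algebra.leibniz_identity[OF leibniz assms] assms P_closed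
  by (simp add: a_minus_def P.M.a_assoc P.M.r_neg)

lemma act_bracket:
  assumes "v \<in> carrier P" "g \<in> carrier L" "h \<in> carrier L"
  shows "act v (g \<otimes>\<^bsub>L\<^esub> h) = act (act v g) h \<ominus>\<^bsub>P\<^esub> act (act v h) g"
  using assms(2,3)
  by (elim L_cases) (simp add: assms(1) p_mult[symmetric] act_p P_closed leibniz_minus)

lemma p_act: "\<lbrakk>v \<in> carrier P; g \<in> carrier L\<rbrakk> \<Longrightarrow> p (act v g) = p v \<otimes>\<^bsub>L\<^esub> g"
  by (erule L_cases) (simp add: p_mult act_p)

lemmas act_closed = bilinear_map_simps(1)[OF act_bil]

text \<open>Short names for the structure of the bimodule \<open>U(L) \<otimes> P\<close>: the map
  \<alpha> to \<open>U(L)\<close>, the right action of a single element of \<open>L\<close>, the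
  right action of \<open>U(L)\<close>, and the left action of \<open>U(L)\<close>.\<close>

definition "al = U_tensor_map K L p"
definition "rg = U_tensor_ract_gen K L P act"
definition "R = U_tensor_ract K L P act"
definition "lc = U_tensor_lact K L P"

lemma al: "al \<in> mod_hom K M (U K L)"
  "\<lbrakk>u \<in> carrier (U K L); v \<in> carrier P\<rbrakk> \<Longrightarrow> al (pt u v) = u \<otimes>\<^bsub>U K L\<^esub> gen (p v)"
proof -
  note E = tprod_lift[OF U_mod P_mod U_mod bilinear_map_comp_right[OF U_bil mod_hom_comp[OF alg_homD(1)[OF p] U_gen_hom[OF L]]]]
  show "al \<in> mod_hom K M (U K L)" unfolding al_def U_tensor_map_def by (rule E(1))
  show "\<lbrakk>u \<in> carrier (U K L); v \<in> carrier P\<rbrakk> \<Longrightarrow> al (pt u v) = u \<otimes>\<^bsub>U K L\<^esub> gen (p v)"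
    unfolding al_def U_tensor_map_def by (rule E(2))
qed

lemma lc: "u \<in> carrier (U K L) \<Longrightarrow> lc u \<in> mod_hom K M M"
  "\<lbrakk>u \<in> carrier (U K L); x \<in> carrier (U K L); v \<in> carrier P\<rbrakk> \<Longrightarrow> lc u (pt x v) = pt (u \<otimes>\<^bsub>U K L\<^esub> x) v"
proof -
  note E = tprod_lift[OF U_mod P_mod M_mod bilinear_map_comp_left[OF pt_bil bilinear_mapD(1)[OF U_bil]]]
  show "lc u \<in> mod_hom K M M" if "u \<in> carrier (U K L)"
    unfolding lc_def U_tensor_lact_def by (rule E(1)[OF that])
  show "\<lbrakk>u \<in> carrier (U K L); x \<in> carrier (U K L); v \<in> carrier P\<rbrakk> \<Longrightarrow> lc u (pt x v) = pt (u \<otimes>\<^bsub>U K L\<^esub> x) v"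
    unfolding lc_def U_tensor_lact_def by (rule E(2))
qed

lemma rg: "g \<in> carrier L \<Longrightarrow> (\<lambda>m. rg m g) \<in> mod_hom K M M"
  "\<lbrakk>u \<in> carrier (U K L); v \<in> carrier P; g \<in> carrier L\<rbrakk>
    \<Longrightarrow> rg (pt u v) g = pt (u \<otimes>\<^bsub>U K L\<^esub> gen g) v \<oplus>\<^bsub>M\<^esub> pt u (act v g)"
proof -
  have b: "bilinear_map K (U K L) P M (\<lambda>x v. pt (x \<otimes>\<^bsub>U K L\<^esub> gen g) v \<oplus>\<^bsub>M\<^esub> pt x (act v g))"
    if "g \<in> carrier L" for g
    by (intro bilinear_map_add[OF M_mod] bilinear_map_comp_left[OF pt_bil]
        bilinear_map_comp_right[OF pt_bil] bilinear_mapD(2)[OF U_bil] bilinear_mapD(2)[OF act_bil] gen_closed that)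
  note E = tprod_lift[OF U_mod P_mod M_mod b]
  show "(\<lambda>m. rg m g) \<in> mod_hom K M M" if "g \<in> carrier L"
    unfolding rg_def U_tensor_ract_gen_def by (rule E(1)[OF that])
  show "rg (pt u v) g = pt (u \<otimes>\<^bsub>U K L\<^esub> gen g) v \<oplus>\<^bsub>M\<^esub> pt u (act v g)"
    if "u \<in> carrier (U K L)" "v \<in> carrier P" "g \<in> carrier L"
    unfolding rg_def U_tensor_ract_gen_def by (rule E(2)[OF that(3,1,2)])
qed

lemmas M_eq = tprod_hom_eq[OF U_mod P_mod]
lemmas U_simps = bilinear_map_simps[OF U_bil]
lemmas UL_simps = bilinear_map_simps[OF UL_bil]

text \<open>For each \<open>g\<close> separately, \<open>rg\<close> is obtained by lifting to the
  tensor product. Linearity in \<open>g\<close> is therefore not automatic and is checked on pure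
  tensors.\<close>

lemma rg_bil: "bilinear_map K M L M rg"
proof (rule bilinear_mapI[OF _ rg(1)])
  fix m assume m: "m \<in> carrier M"
  note gh = mod_homD[OF U_gen_hom[OF L]] and pb = bilinear_map_simps[OF pt_bil] and ab = bilinear_map_simps[OF act_bil]
  show "rg m \<in> mod_hom K L M"
  proof (rule mod_homI)
    show "rg m g \<in> carrier M" if "g \<in> carrier L" for g by (rule mod_homD(1)[OF rg(1)[OF that] m])
    fix g h assume g: "g \<in> carrier L" and h: "h \<in> carrier L"
    show "rg m (g \<oplus>\<^bsub>L\<^esub> h) = rg m g \<oplus>\<^bsub>M\<^esub> rg m h"
      by (rule M_eq[OF M_mod rg(1) mod_hom_add[OF M_mod rg(1) rg(1)] _ m])
        (use g h in \<open>simp_all add: rg(2) gh pb ab U_simps M.a_ac\<close>)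
  next
    fix k g assume k: "k \<in> carrier K" and g: "g \<in> carrier L"
    have s: "(\<lambda>x. k \<odot>\<^bsub>M\<^esub> x) \<in> mod_hom K M M"
      by (rule mod_homI) (use k in \<open>simp_all add: M.smult_r_distr M.smult_assoc1[symmetric] P.R.m_comm\<close>)
    show "rg m (k \<odot>\<^bsub>L\<^esub> g) = k \<odot>\<^bsub>M\<^esub> rg m g"
      by (rule M_eq[OF M_mod rg(1) mod_hom_comp[OF rg(1) s] _ m])
        (use g k in \<open>simp_all add: rg(2) gh pb ab U_simps M.smult_r_distr\<close>)
  qed
qed

text \<open>Two elements acting on \<open>u \<otimes> v\<close> give four terms. The mixed ones, in
  which one element acts on \<open>u\<close> and the other on \<open>v\<close>, agree for both
  orders and cancel. What remains is the bracket relation of \<open>U(L)\<close> next to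
  \<open>u\<close> and the Leibniz identity next to \<open>v\<close>.\<close>

lemma rg_bracket:
  assumes m: "m \<in> carrier M" and g: "g \<in> carrier L" and h: "h \<in> carrier L"
  shows "rg m (g \<otimes>\<^bsub>L\<^esub> h) = rg (rg m g) h \<ominus>\<^bsub>M\<^esub> rg (rg m h) g"
proof -
  note pb = bilinear_map_simps[OF pt_bil] and c = gen_closed act_closed L_closed
  have hom: "(\<lambda>m. rg (rg m g) h \<ominus>\<^bsub>M\<^esub> rg (rg m h) g) \<in> mod_hom K M M"
    unfolding a_minus_def
    by (intro mod_hom_add[OF M_mod] mod_hom_uminus[OF M_mod] mod_hom_comp[OF rg(1) rg(1)] g h)
  show ?thesis
  proof (rule M_eq[OF M_mod rg(1) hom _ m])
    show "g \<otimes>\<^bsub>L\<^esub> h \<in> carrier L" using g h by (rule L_closed)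
    fix u v assume u: "u \<in> carrier (U K L)" and v: "v \<in> carrier P"
    have exp: "rg (rg (pt u v) g) h = (pt (u \<otimes>\<^bsub>U K L\<^esub> gen g \<otimes>\<^bsub>U K L\<^esub> gen h) v \<oplus>\<^bsub>M\<^esub> pt (u \<otimes>\<^bsub>U K L\<^esub> gen g) (act v h))
        \<oplus>\<^bsub>M\<^esub> (pt (u \<otimes>\<^bsub>U K L\<^esub> gen h) (act v g) \<oplus>\<^bsub>M\<^esub> pt u (act (act v g) h))"
      if "g \<in> carrier L" "h \<in> carrier L" for g h
      using that u v by (simp add: rg(2) c U_simps pb mod_homD(2)[OF rg(1)])
    have "pt (u \<otimes>\<^bsub>U K L\<^esub> gen (g \<otimes>\<^bsub>L\<^esub> h)) v =
        pt (u \<otimes>\<^bsub>U K L\<^esub> gen g \<otimes>\<^bsub>U K L\<^esub> gen h) v \<ominus>\<^bsub>M\<^esub> pt (u \<otimes>\<^bsub>U K L\<^esub> gen h \<otimes>\<^bsub>U K L\<^esub> gen g) v"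
      using g h u v
      by (simp add: U_gen_bracket[OF L] c pt_neg(6)[symmetric] U_simps bilinear_map_neg(5)[OF U_mod U_mod U_mod U_bil] U.m_assoc)
    moreover have "pt u (act v (g \<otimes>\<^bsub>L\<^esub> h)) = pt u (act (act v g) h) \<ominus>\<^bsub>M\<^esub> pt u (act (act v h) g)"
      using g h u v by (simp add: act_bracket c pt_neg(5))
    ultimately show "rg (pt u v) (g \<otimes>\<^bsub>L\<^esub> h) = rg (rg (pt u v) g) h \<ominus>\<^bsub>M\<^esub> rg (rg (pt u v) h) g"
      unfolding exp[OF g h] exp[OF h g] using g h u v
      by (simp add: rg(2) c pb U_simps M.minus_sum_cancel)
  qed
qed

lemma R: "right_action K (U K L) M R" "\<lbrakk>m \<in> carrier M; g \<in> carrier L\<rbrakk> \<Longrightarrow> R m (gen g) = rg m g"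
proof -
  note E = U_right_action[OF L M_mod rg_bil rg_bracket]
  have eq: "R = (\<lambda>n. quot_lift (quot_lift (lin_ext K M (\<lambda>w. foldl rg n w))))"
    by (simp add: R_def rg_def U_tensor_ract_def[abs_def])
  show "right_action K (U K L) M R" unfolding eq by (rule E(1))
  show "R m (gen g) = rg m g" if "m \<in> carrier M" "g \<in> carrier L"
    unfolding eq by (rule E(2)) (use that in auto)
qed

lemmas R_bil = right_actionD(1)[OF R(1)]
lemmas R_closed = bilinear_map_simps(1)[OF R_bil]
lemmas al_closed = mod_homD(1)[OF al(1)]

text \<open>By \<open>p_act\<close>, the second term \<open>u \<otimes> [v,g]\<close> of the right
  action is mapped to \<open>u\<close> times the commutator that brings \<open>gen g\<close> to the
  right of \<open>gen (p v)\<close>.\<close>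

lemma al_rg:
  assumes m: "m \<in> carrier M" and g: "g \<in> carrier L"
  shows "al (rg m g) = al m \<otimes>\<^bsub>U K L\<^esub> gen g"
proof (rule M_eq[OF U_mod mod_hom_comp[OF rg(1) al(1)] mod_hom_comp[OF al(1) bilinear_mapD(2)[OF U_bil]] _ m])
  show "g \<in> carrier L" "gen g \<in> carrier (U K L)" using g by (auto simp: gen_closed)
  fix u v assume uv: "u \<in> carrier (U K L)" "v \<in> carrier P"
  have c: "gen g \<in> carrier (U K L)" "gen (p v) \<in> carrier (U K L)" using g uv by (auto intro!: gen_closed p_closed)
  then show "al (rg (pt u v) g) = al (pt u v) \<otimes>\<^bsub>U K L\<^esub> gen g"
    using g uv
    by (simp add: rg(2) mod_homD(2)[OF al(1)] pt_closed act_closed al(2) p_act U_gen_bracket[OF L] p_closed gen_closed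
        U.commutator_cancel)
qed

lemma al_R:
  assumes m: "m \<in> carrier M" and u: "u \<in> carrier (U K L)"
  shows "al (R m u) = al m \<otimes>\<^bsub>U K L\<^esub> u"
proof -
  let ?N = "{u \<in> carrier (U K L). al (R m u) = al m \<otimes>\<^bsub>U K L\<^esub> u}"
  have sub: "submodule ?N K (U K L)"
    by (rule submodule_equalizer[OF U_mod U_mod mod_hom_comp[OF bilinear_mapD(1)[OF R_bil m] al(1)]
          bilinear_mapD(1)[OF U_bil al_closed[OF m]]])
  have "u \<in> ?N"
    by (rule U_induct[OF L sub _ _ u])
      (use m in \<open>auto simp: right_actionD[OF R(1)] gen_closed al_closed R(2) R_closed al_rg U.m_assoc\<close>)
  then show ?thesis by simp
qed

lemma al_lc:
  assumes m: "m \<in> carrier M" and u: "u \<in> carrier (U K L)"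
  shows "al (lc u m) = u \<otimes>\<^bsub>U K L\<^esub> al m"
  by (rule M_eq[OF U_mod mod_hom_comp[OF lc(1)[OF u] al(1)] mod_hom_comp[OF al(1) bilinear_mapD(1)[OF U_bil u]] _ m])
    (use u in \<open>simp add: lc(2) al(2) gen_closed p_closed U.m_assoc\<close>)

section \<open>The map from \<open>(U(L) \<otimes> P) \<oplus> U(L)\<close> to
  \<open>UL(P)\<close>\<close>

lemma r_factor:
  obtains f where "f \<in> mod_hom K L (UL K P)" "\<And>x. x \<in> carrier P \<Longrightarrow> f (p x) = r x"
proof (rule surj_kernel_factor[OF P_mod L_mod UL_mod alg_homD(1)[OF p] p_surj UL_r_hom[OF P]])
  fix x assume x: "x \<in> carrier P" "p x = \<zero>\<^bsub>L\<^esub>"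
  \<comment> \<open>\<open>r\<close> turns products into commutators. Its kernel is therefore an
    ideal, and it contains the squares because an element commutes with itself. By
    \<open>p_ker\<close> it contains the kernel of \<open>p\<close>.\<close>
  let ?J = "{x \<in> carrier P. r x \<in> {\<zero>\<^bsub>UL K P\<^esub>}}"
  have "submodule ?J K P"
    by (rule submodule_preimage[OF P_mod UL_mod UL_r_hom[OF P] submodule_zero[OF UL_mod]])
  then have "alg_ideal K P ?J"
    by (rule alg_idealI) (auto simp: P_closed UL_relations[OF P] r_closed UL.minus_eq)
  then have "x \<in> ?J"
    by (rule p_ker[OF _ _ x]) (auto simp: P_closed UL_relations[OF P] r_closed UL.minus_eq UL.r_neg)
  then show "r x = \<zero>\<^bsub>UL K P\<^esub>" by simp
qed (rule that)

text \<open>The factorization of \<open>r\<close> through \<open>p\<close> exists by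
  \<open>r_factor\<close>, and its values on the carrier are forced because \<open>p\<close> is
  surjective; so the choice made by \<open>SOME\<close> is harmless.\<close>

definition "rU = env_lift K (UL K P) (SOME f. f \<in> mod_hom K L (UL K P) \<and> (\<forall>x\<in>carrier P. f (p x) = r x))"

lemma rU: "rU \<in> alg_hom K (U K L) (UL K P)" "rU \<one>\<^bsub>U K L\<^esub> = \<one>\<^bsub>UL K P\<^esub>"
  "x \<in> carrier P \<Longrightarrow> rU (gen (p x)) = r x"
proof -
  define f where "f = (SOME f. f \<in> mod_hom K L (UL K P) \<and> (\<forall>x\<in>carrier P. f (p x) = r x))"
  have "\<exists>f. f \<in> mod_hom K L (UL K P) \<and> (\<forall>x\<in>carrier P. f (p x) = r x)"
    by (rule r_factor) (intro exI conjI ballI; assumption)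
  then have "f \<in> mod_hom K L (UL K P) \<and> (\<forall>x\<in>carrier P. f (p x) = r x)"
    unfolding f_def by (rule someI_ex)
  then have f: "f \<in> mod_hom K L (UL K P)" "\<And>x. x \<in> carrier P \<Longrightarrow> f (p x) = r x" by auto
  have b: "f (x \<otimes>\<^bsub>L\<^esub> y) = f x \<otimes>\<^bsub>UL K P\<^esub> f y \<ominus>\<^bsub>UL K P\<^esub> f y \<otimes>\<^bsub>UL K P\<^esub> f x"
    if "x \<in> carrier L" "y \<in> carrier L" for x y
    using that by (elim L_cases) (simp add: p_mult[symmetric] f(2) P_closed UL_relations[OF P])
  note E = U_lift[OF L UL_alg f(1) b]
  show "rU \<in> alg_hom K (U K L) (UL K P)" "rU \<one>\<^bsub>U K L\<^esub> = \<one>\<^bsub>UL K P\<^esub>"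
    unfolding rU_def f_def[symmetric] by (rule E; assumption)+
  show "rU (gen (p x)) = r x" if "x \<in> carrier P"
    unfolding rU_def f_def[symmetric] using E(3)[OF _ _ p_closed[OF that]] f(2)[OF that] by simp
qed

lemmas rU_hom = alg_homD(1)[OF rU(1)]
lemmas rU_mult = alg_homD(2)[OF rU(1)]
lemmas rU_closed = mod_homD(1)[OF rU_hom]

text \<open>With the sign in \<open>u \<otimes> v \<mapsto> - u v\<^sub>l\<close>, the relation \<open>y\<^sub>l x\<^sub>l = - y\<^sub>r x\<^sub>l\<close> becomes the
  product rule \<open>a a' = \<alpha>(a) a'\<close> of the algebra \<open>(U(L) \<otimes> P) \<oplus> U(L)\<close>.\<close>

definition "iM = tprod_lift K (UL K P) (\<lambda>u v. \<ominus>\<^bsub>UL K P\<^esub> (rU u \<otimes>\<^bsub>UL K P\<^esub> l v))"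
definition "iota = (\<lambda>(a, u). iM a \<oplus>\<^bsub>UL K P\<^esub> rU u)"

lemma iM: "iM \<in> mod_hom K M (UL K P)"
  "\<lbrakk>u \<in> carrier (U K L); v \<in> carrier P\<rbrakk> \<Longrightarrow> iM (pt u v) = \<ominus>\<^bsub>UL K P\<^esub> (rU u \<otimes>\<^bsub>UL K P\<^esub> l v)"
proof -
  note E = tprod_lift[OF U_mod P_mod UL_mod bilinear_map_uminus[OF UL_mod
      bilinear_map_comp_left[OF bilinear_map_comp_right[OF UL_bil UL_l_hom[OF P]] rU_hom]]]
  show "iM \<in> mod_hom K M (UL K P)" unfolding iM_def by (rule E(1))
  show "\<lbrakk>u \<in> carrier (U K L); v \<in> carrier P\<rbrakk> \<Longrightarrow> iM (pt u v) = \<ominus>\<^bsub>UL K P\<^esub> (rU u \<otimes>\<^bsub>UL K P\<^esub> l v)"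
    unfolding iM_def by (rule E(2))
qed

lemmas iM_closed = mod_homD(1)[OF iM(1)]

text \<open>The relation for \<open>l\<close> of a product is the commutator that is needed to move
  \<open>r x\<close> past \<open>l v\<close>, and it corresponds to the second term of the right
  action.\<close>

lemma iM_rg:
  assumes m: "m \<in> carrier M" and x: "x \<in> carrier P"
  shows "iM (rg m (p x)) = iM m \<otimes>\<^bsub>UL K P\<^esub> r x"
proof (rule M_eq[OF UL_mod mod_hom_comp[OF rg(1) iM(1)] mod_hom_comp[OF iM(1) bilinear_mapD(2)[OF UL_bil]] _ m])
  show "p x \<in> carrier L" "r x \<in> carrier (UL K P)" using x by (auto simp: p_closed r_closed)
  fix u v assume uv: "u \<in> carrier (U K L)" "v \<in> carrier P"
  have c: "rU u \<in> carrier (UL K P)" "l v \<in> carrier (UL K P)" "r x \<in> carrier (UL K P)"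
    using x uv by (auto intro!: rU_closed l_closed r_closed)
  show "iM (rg (pt u v) (p x)) = iM (pt u v) \<otimes>\<^bsub>UL K P\<^esub> r x"
    using x uv c
    by (simp add: rg(2) p_closed mod_homD(2)[OF iM(1)] pt_closed act_p P_closed gen_closed iM(2) rU_mult rU(3) UL_relations[OF P]
        UL.minus_add[symmetric] UL.commutator_cancel UL.l_minus)
qed

lemma iM_R:
  assumes m: "m \<in> carrier M" and u: "u \<in> carrier (U K L)"
  shows "iM (R m u) = iM m \<otimes>\<^bsub>UL K P\<^esub> rU u"
proof -
  let ?N = "{u \<in> carrier (U K L). iM (R m u) = iM m \<otimes>\<^bsub>UL K P\<^esub> rU u}"
  have sub: "submodule ?N K (U K L)"
    by (rule submodule_equalizer[OF U_mod UL_mod mod_hom_comp[OF bilinear_mapD(1)[OF R_bil m] iM(1)]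
          mod_hom_comp[OF rU_hom bilinear_mapD(1)[OF UL_bil iM_closed[OF m]]]])
  have st: "y \<otimes>\<^bsub>U K L\<^esub> gen g \<in> ?N" if y: "y \<in> ?N" and g: "g \<in> carrier L" for y g
  proof -
    obtain x where x: "x \<in> carrier P" "g = p x" using L_cases[OF g] .
    show ?thesis using y m x
      by (simp add: right_actionD[OF R(1)] gen_closed p_closed R(2) R_closed iM_rg rU_mult rU(3) iM_closed rU_closed r_closed UL.m_assoc)
  qed
  have "u \<in> ?N"
    by (rule U_induct[OF L sub _ _ u])
      (use m st in \<open>auto simp: right_actionD[OF R(1)] rU(2) iM_closed\<close>)
  then show ?thesis by simp
qed

lemma iM_lc:
  assumes m: "m \<in> carrier M" and u: "u \<in> carrier (U K L)"
  shows "iM (lc u m) = rU u \<otimes>\<^bsub>UL K P\<^esub> iM m"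
  by (rule M_eq[OF UL_mod mod_hom_comp[OF lc(1)[OF u] iM(1)] mod_hom_comp[OF iM(1) bilinear_mapD(1)[OF UL_bil rU_closed[OF u]]] _ m])
    (use u in \<open>simp add: lc(2) iM(2) rU_mult rU_closed l_closed UL.m_assoc UL.r_minus\<close>)

text \<open>Induction on \<open>u\<close> by left multiplication with generators. Pulling
  \<open>r x\<close> to the left past \<open>r v \<oplus> l v\<close> costs a commutator, which the
  first two relations turn into the same expression with the product of \<open>v\<close> and
  \<open>x\<close> in place of \<open>v\<close>. Hence the induction hypothesis has to quantify over
  \<open>v\<close>. The start is the third relation.\<close>

lemma rl_annihilates:
  assumes v: "v \<in> carrier P" "w \<in> carrier P" and u: "u \<in> carrier (U K L)"
  shows "(r v \<oplus>\<^bsub>UL K P\<^esub> l v) \<otimes>\<^bsub>UL K P\<^esub> (rU u \<otimes>\<^bsub>UL K P\<^esub> l w) = \<zero>\<^bsub>UL K P\<^esub>"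
proof -
  let ?N = "{u \<in> carrier (U K L). \<forall>v\<in>carrier P. (r v \<oplus>\<^bsub>UL K P\<^esub> l v) \<otimes>\<^bsub>UL K P\<^esub> (rU u \<otimes>\<^bsub>UL K P\<^esub> l w) = \<zero>\<^bsub>UL K P\<^esub>}"
  have sub: "submodule ?N K (U K L)"
    by (rule submodule_intro[OF U_mod])
      (auto simp: mod_homD[OF rU_hom] mod_hom_neg[OF U_mod UL_mod rU_hom] l_closed r_closed v UL_simps(2-))
  have st: "gen g \<otimes>\<^bsub>U K L\<^esub> y \<in> ?N" if y: "y \<in> ?N" and g: "g \<in> carrier L" for y g
  proof -
    obtain x where x: "x \<in> carrier P" "g = p x" using L_cases[OF g] .
    have "(r v \<oplus>\<^bsub>UL K P\<^esub> l v) \<otimes>\<^bsub>UL K P\<^esub> ((r x \<otimes>\<^bsub>UL K P\<^esub> rU y) \<otimes>\<^bsub>UL K P\<^esub> l w) = \<zero>\<^bsub>UL K P\<^esub>"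
      if v': "v \<in> carrier P" for v
    proof -
      let ?z = "rU y \<otimes>\<^bsub>UL K P\<^esub> l w"
      have c: "r v \<in> carrier (UL K P)" "l v \<in> carrier (UL K P)" "r x \<in> carrier (UL K P)" "?z \<in> carrier (UL K P)"
        using v' x v y by (auto intro!: r_closed l_closed rU_closed)
      have "(r v \<oplus>\<^bsub>UL K P\<^esub> l v) \<otimes>\<^bsub>UL K P\<^esub> (r x \<otimes>\<^bsub>UL K P\<^esub> ?z)
        = r x \<otimes>\<^bsub>UL K P\<^esub> ((r v \<oplus>\<^bsub>UL K P\<^esub> l v) \<otimes>\<^bsub>UL K P\<^esub> ?z)
          \<oplus>\<^bsub>UL K P\<^esub> (r (v \<otimes>\<^bsub>P\<^esub> x) \<oplus>\<^bsub>UL K P\<^esub> l (v \<otimes>\<^bsub>P\<^esub> x)) \<otimes>\<^bsub>UL K P\<^esub> ?z"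
        unfolding UL_relations[OF P v' x(1)] by (rule UL.commutator_sum_mult) (rule c)+
      also have "\<dots> = \<zero>\<^bsub>UL K P\<^esub>"
        using y v' x(1) c by (simp add: P_closed)
      finally show ?thesis using c x y v by (simp add: UL.m_assoc rU_closed l_closed)
    qed
    then show ?thesis using y x v by (auto simp: gen_closed p_closed rU_mult rU(3))
  qed
  have "u \<in> ?N"
    by (rule U_induct[OF L sub _ _ u]) (use st in \<open>auto simp: rU(2) l_closed v UL_relations[OF P]\<close>)
  then show ?thesis using v by simp
qed

text \<open>By \<open>rl_annihilates\<close>, \<open>l v\<close> and \<open>- r v\<close> multiply
  every \<open>rU u l w\<close> in the same way, and \<open>r v\<close> is the image of
  \<open>gen (p v)\<close>. So the left factor may be replaced by the image of its value under
  \<alpha>.\<close>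

lemma iM_mult:
  assumes a: "a \<in> carrier M" and b: "b \<in> carrier M"
  shows "iM a \<otimes>\<^bsub>UL K P\<^esub> iM b = rU (al a) \<otimes>\<^bsub>UL K P\<^esub> iM b"
proof -
  have 1: "iM a \<otimes>\<^bsub>UL K P\<^esub> iM (pt u w) = rU (al a) \<otimes>\<^bsub>UL K P\<^esub> iM (pt u w)"
    if u: "u \<in> carrier (U K L)" and w: "w \<in> carrier P" for u w
  proof (rule M_eq[OF UL_mod mod_hom_comp[OF iM(1) bilinear_mapD(2)[OF UL_bil]]
        mod_hom_comp[OF mod_hom_comp[OF al(1) rU_hom] bilinear_mapD(2)[OF UL_bil]] _ a])
    show c: "iM (pt u w) \<in> carrier (UL K P)" "iM (pt u w) \<in> carrier (UL K P)" using u w by (auto intro!: iM_closed pt_closed)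
    fix x v assume xv: "x \<in> carrier (U K L)" "v \<in> carrier P"
    let ?z = "rU u \<otimes>\<^bsub>UL K P\<^esub> l w"
    have c: "rU x \<in> carrier (UL K P)" "?z \<in> carrier (UL K P)" "r v \<in> carrier (UL K P)" "l v \<in> carrier (UL K P)"
      using xv u w by (auto intro!: r_closed l_closed rU_closed)
    have "r v \<otimes>\<^bsub>UL K P\<^esub> ?z \<oplus>\<^bsub>UL K P\<^esub> l v \<otimes>\<^bsub>UL K P\<^esub> ?z = \<zero>\<^bsub>UL K P\<^esub>"
      using rl_annihilates[OF xv(2) w u] c by (simp add: UL.l_distr)
    then have "r v \<otimes>\<^bsub>UL K P\<^esub> ?z = \<ominus>\<^bsub>UL K P\<^esub> (l v \<otimes>\<^bsub>UL K P\<^esub> ?z)"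
      using c by (simp add: UL.minus_equality)
    then show "iM (pt x v) \<otimes>\<^bsub>UL K P\<^esub> iM (pt u w) = rU (al (pt x v)) \<otimes>\<^bsub>UL K P\<^esub> iM (pt u w)"
      using xv u w c
      by (simp add: iM(2) al(2) rU_mult gen_closed p_closed rU(3) UL.l_minus UL.r_minus UL.m_assoc[of "rU x" _ ?z])
  qed
  show ?thesis
    by (rule M_eq[OF UL_mod mod_hom_comp[OF iM(1) bilinear_mapD(1)[OF UL_bil iM_closed[OF a]]]
          mod_hom_comp[OF iM(1) bilinear_mapD(1)[OF UL_bil rU_closed[OF al_closed[OF a]]]] 1 b])
qed

end

lemma bilinear_map_pair:
  assumes "bilinear_map K N P M f" "bilinear_map K N P L g"
  shows "bilinear_map K N P (dsum M L) (\<lambda>x y. (f x y, g x y))"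
  by (intro bilinear_mapI mod_hom_pair bilinear_mapD[OF assms(1)] bilinear_mapD[OF assms(2)])

lemma (in abelian_group) minus_sum_left:
  "\<lbrakk>x \<in> carrier G; y \<in> carrier G\<rbrakk> \<Longrightarrow> \<ominus> (x \<oplus> y) \<ominus> (\<ominus> x) = \<ominus> y"
  by (simp add: a_minus_def minus_add a_assoc a_comm[of "\<ominus> y" x] r_neg1 r_neg2)

section \<open>Bijectivity and multiplicativity of \<open>iota\<close>\<close>

context lie_quotient begin

abbreviation "MU \<equiv> dsum M (U K L)"

lemmas MU_mod = dsum_module[OF M_mod U_mod]

lemma iota_hom: "iota \<in> mod_hom K MU (UL K P)"
  unfolding iota_def by (rule dsum_hom[OF UL_mod iM(1) rU_hom])

text \<open>Acting on \<open>(0, 1)\<close> is a left inverse of \<open>iota\<close>, so that no basis theorem for \<open>U(L)\<close> is needed.\<close>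

lemma iota_action:
  obtains T where "right_action K (UL K P) MU T"
    "\<And>a u x. \<lbrakk>a \<in> carrier M; u \<in> carrier (U K L); x \<in> carrier P\<rbrakk>
      \<Longrightarrow> T (a, u) (l x) = (\<ominus>\<^bsub>M\<^esub> pt (al a \<oplus>\<^bsub>U K L\<^esub> u) x, \<zero>\<^bsub>U K L\<^esub>)"
    "\<And>a u x. \<lbrakk>a \<in> carrier M; u \<in> carrier (U K L); x \<in> carrier P\<rbrakk>
      \<Longrightarrow> T (a, u) (r x) = (R a (gen (p x)), u \<otimes>\<^bsub>U K L\<^esub> gen (p x))"
proof -
  define gl where "gl = (\<lambda>n x. (\<ominus>\<^bsub>M\<^esub> pt ((\<lambda>(a, u). al a \<oplus>\<^bsub>U K L\<^esub> u) n) x, \<zero>\<^bsub>U K L\<^esub>))"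
  define gr where "gr = (\<lambda>n x. (R (fst n) (gen (p x)), snd n \<otimes>\<^bsub>U K L\<^esub> gen (p x)))"
  have id: "(\<lambda>x. x) \<in> mod_hom K (U K L) (U K L)" by (rule mod_homI) simp_all
  have zero: "bilinear_map K MU P (U K L) (\<lambda>x y. \<zero>\<^bsub>U K L\<^esub>)"
    by (intro bilinear_mapI mod_homI) simp_all
  note gp = mod_hom_comp[OF alg_homD(1)[OF p] U_gen_hom[OF L]]
  note prj = dsum_homs(3,4)[OF M_mod U_mod]
  have glb: "bilinear_map K MU P MU gl"
    unfolding gl_def
    by (intro bilinear_map_pair zero bilinear_map_uminus[OF M_mod] bilinear_map_comp_left[OF pt_bil]
        dsum_hom[OF U_mod al(1) id])
  have grb: "bilinear_map K MU P MU gr"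
    unfolding gr_def
    by (intro bilinear_map_pair bilinear_map_comp_left[OF bilinear_map_comp_right[OF R_bil gp] prj(1)]
        bilinear_map_comp_left[OF bilinear_map_comp_right[OF U_bil gp] prj(2)])
  note c = gen_closed p_closed R_closed P_closed pt_closed al_closed
  note Rn = bilinear_map_neg[OF M_mod U_mod M_mod R_bil]
  have R_pt: "R (pt u x) (gen (p y)) = pt (u \<otimes>\<^bsub>U K L\<^esub> gen (p y)) x \<oplus>\<^bsub>M\<^esub> pt u (x \<otimes>\<^bsub>P\<^esub> y)"
    if "u \<in> carrier (U K L)" "x \<in> carrier P" "y \<in> carrier P" for u x y
    using that by (simp add: R(2) pt_closed p_closed rg(2) act_p)
  show ?thesis
  proof (rule UL_right_action[OF P MU_mod glb grb])
    fix n x y assume n: "n \<in> carrier MU" and x: "x \<in> carrier P" and y: "y \<in> carrier P"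
    obtain a u where au: "n = (a, u)" "a \<in> carrier M" "u \<in> carrier (U K L)"
      using n by (auto simp: dsum_simps)
    show "gr n (x \<otimes>\<^bsub>P\<^esub> y) = gr (gr n x) y \<ominus>\<^bsub>MU\<^esub> gr (gr n y) x"
      using au x y
      by (simp add: gr_def dsum_minus[OF M_mod U_mod] c p_mult U_gen_bracket[OF L] Rn
          right_actionD(2)[OF R(1)] bilinear_map_neg(5)[OF U_mod U_mod U_mod U_bil] U.m_assoc)
    \<comment> \<open>First component of the relation for \<open>l\<close> of a product.
      \<open>r y\<close> produces two terms from a pure tensor; the one that changes the left factor
      is cancelled because \<alpha> commutes with the right action (\<open>al_R\<close>).\<close>
    have "R (\<ominus>\<^bsub>M\<^esub> pt (al a \<oplus>\<^bsub>U K L\<^esub> u) x) (gen (p y)) \<ominus>\<^bsub>M\<^esub> (\<ominus>\<^bsub>M\<^esub> pt (al (R a (gen (p y))) \<oplus>\<^bsub>U K L\<^esub> u \<otimes>\<^bsub>U K L\<^esub> gen (p y)) x)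
        = \<ominus>\<^bsub>M\<^esub> pt (al a \<oplus>\<^bsub>U K L\<^esub> u) (x \<otimes>\<^bsub>P\<^esub> y)"
      using au x y by (simp add: c Rn R_pt al_R U.l_distr[symmetric] M.minus_sum_left)
    then show "gl n (x \<otimes>\<^bsub>P\<^esub> y) = gr (gl n x) y \<ominus>\<^bsub>MU\<^esub> gl (gr n y) x"
      using au x y
      by (simp add: gl_def gr_def dsum_minus[OF M_mod U_mod] c U.minus_eq[of "\<zero>\<^bsub>U K L\<^esub>"])
    let ?g = "gen (p y)"
    \<comment> \<open>The operator \<open>l x\<close> sees a vector \<open>(a, u)\<close> only
      through \<open>al a \<oplus> u\<close>. On the vector that \<open>r y\<close> and
      \<open>l y\<close> give in sum this quantity is zero, which is the third relation.\<close>
    have "al (R a ?g \<oplus>\<^bsub>M\<^esub> \<ominus>\<^bsub>M\<^esub> pt (al a \<oplus>\<^bsub>U K L\<^esub> u) y) \<oplus>\<^bsub>U K L\<^esub> u \<otimes>\<^bsub>U K L\<^esub> ?g = \<zero>\<^bsub>U K L\<^esub>"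
    proof -
      have k: "al a \<otimes>\<^bsub>U K L\<^esub> ?g \<in> carrier (U K L)" "u \<otimes>\<^bsub>U K L\<^esub> ?g \<in> carrier (U K L)"
        using au y by (simp_all add: c)
      have "al (R a ?g \<oplus>\<^bsub>M\<^esub> \<ominus>\<^bsub>M\<^esub> pt (al a \<oplus>\<^bsub>U K L\<^esub> u) y)
          = al a \<otimes>\<^bsub>U K L\<^esub> ?g \<oplus>\<^bsub>U K L\<^esub> \<ominus>\<^bsub>U K L\<^esub> (al a \<otimes>\<^bsub>U K L\<^esub> ?g \<oplus>\<^bsub>U K L\<^esub> u \<otimes>\<^bsub>U K L\<^esub> ?g)"
        using au y
        by (simp add: mod_homD[OF al(1)] mod_hom_neg[OF M_mod U_mod al(1)] c al_R al(2) U.l_distr)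
      also have "\<dots> = \<ominus>\<^bsub>U K L\<^esub> (u \<otimes>\<^bsub>U K L\<^esub> ?g)"
        using k by (simp add: U.minus_add U.r_neg2 U.r_neg1)
      finally show ?thesis using k by (simp add: U.l_neg)
    qed
    then show "gl (gr n y \<oplus>\<^bsub>MU\<^esub> gl n y) x = \<zero>\<^bsub>MU\<^esub>"
      using au x y by (simp add: gl_def gr_def dsum_simps c pt_neg)
  next
    fix T assume T: "right_action K (UL K P) MU T"
      "\<And>n x. \<lbrakk>n \<in> carrier MU; x \<in> carrier P\<rbrakk> \<Longrightarrow> T n (l x) = gl n x"
      "\<And>n x. \<lbrakk>n \<in> carrier MU; x \<in> carrier P\<rbrakk> \<Longrightarrow> T n (r x) = gr n x"
    show thesis by (rule that[OF T(1)]) (simp_all add: T(2,3) gl_def gr_def dsum_simps)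
  qed
qed

lemma iota_inj: "inj_on iota (carrier MU)"
proof -
  obtain T where T: "right_action K (UL K P) MU T"
    "\<And>a u x. \<lbrakk>a \<in> carrier M; u \<in> carrier (U K L); x \<in> carrier P\<rbrakk>
      \<Longrightarrow> T (a, u) (l x) = (\<ominus>\<^bsub>M\<^esub> pt (al a \<oplus>\<^bsub>U K L\<^esub> u) x, \<zero>\<^bsub>U K L\<^esub>)"
    "\<And>a u x. \<lbrakk>a \<in> carrier M; u \<in> carrier (U K L); x \<in> carrier P\<rbrakk>
      \<Longrightarrow> T (a, u) (r x) = (R a (gen (p x)), u \<otimes>\<^bsub>U K L\<^esub> gen (p x))"
    using iota_action by blast
  let ?e = "(\<zero>\<^bsub>M\<^esub>, \<one>\<^bsub>U K L\<^esub>)"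
  have e: "?e \<in> carrier MU" by (simp add: dsum_simps)
  note Tb = right_actionD(1)[OF T(1)]
  note Th = bilinear_mapD(1)[OF Tb e]
  note inc = dsum_homs(1,2)[OF M_mod U_mod]
  have TU: "T ?e (rU u) = (\<zero>\<^bsub>M\<^esub>, u)" if u: "u \<in> carrier (U K L)" for u
  proof -
    let ?N = "{u \<in> carrier (U K L). T ?e (rU u) = (\<zero>\<^bsub>M\<^esub>, u)}"
    have sub: "submodule ?N K (U K L)"
      by (rule submodule_equalizer[OF U_mod MU_mod mod_hom_comp[OF rU_hom Th] inc(2)])
    have st: "y \<otimes>\<^bsub>U K L\<^esub> gen g \<in> ?N" if y: "y \<in> ?N" and g: "g \<in> carrier L" for y g
    proof -
      obtain x where x: "x \<in> carrier P" "g = p x" using L_cases[OF g] .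
      show ?thesis using y x e
        by (simp add: gen_closed p_closed rU_mult rU(3) right_actionD(2)[OF T(1)] rU_closed r_closed T(3)
            bilinear_map_neg(2)[OF M_mod U_mod M_mod R_bil])
    qed
    have "u \<in> ?N"
      by (rule U_induct[OF L sub _ _ u]) (use st e in \<open>auto simp: rU(2) right_actionD(3)[OF T(1)]\<close>)
    then show ?thesis by simp
  qed
  \<comment> \<open>On a pure tensor \<open>rU u\<close> leads from \<open>(0, 1)\<close> to
    \<open>(0, u)\<close>, and \<open>l v\<close> from there to \<open>(- u \<otimes> v, 0)\<close>;
    the sign in \<open>iM\<close> undoes the minus.\<close>
  have TM: "T ?e (iM a) = (a, \<zero>\<^bsub>U K L\<^esub>)" if a: "a \<in> carrier M" for a
  proof (rule M_eq[OF MU_mod mod_hom_comp[OF iM(1) Th] inc(1) _ a])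
    fix u v assume uv: "u \<in> carrier (U K L)" "v \<in> carrier P"
    then show "T ?e (iM (pt u v)) = (pt u v, \<zero>\<^bsub>U K L\<^esub>)"
      using e by (simp add: iM(2) bilinear_map_neg(3)[OF MU_mod UL_mod MU_mod Tb] right_actionD(2)[OF T(1)]
          rU_closed l_closed TU T(2) mod_hom_neg(1)[OF M_mod U_mod al(1)] dsum_neg[OF M_mod U_mod] pt_closed)
  qed
  have "T ?e (iota z) = z" if z: "z \<in> carrier MU" for z
    using z e by (auto simp: dsum_simps(1) iota_def bilinear_map_simps(2)[OF Tb] iM_closed rU_closed TM TU dsum_simps(3))
  then show ?thesis by (rule inj_on_inverseI)
qed

text \<open>Of the four partial products only the one of two elements of
  \<open>U(L) \<otimes> P\<close> is not a module operation; \<open>iM_mult\<close> makes it one.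
  The rest is \<open>iM_lc\<close>, \<open>iM_R\<close> and \<open>rU_mult\<close>.\<close>

lemma iota_mult:
  assumes "a \<in> carrier M" "u \<in> carrier (U K L)" "b \<in> carrier M" "w \<in> carrier (U K L)"
  shows "iota (a, u) \<otimes>\<^bsub>UL K P\<^esub> iota (b, w)
    = iota (lc (al a) b \<oplus>\<^bsub>M\<^esub> R a w \<oplus>\<^bsub>M\<^esub> lc u b, u \<otimes>\<^bsub>U K L\<^esub> w)"
proof -
  have c: "lc (al a) b \<in> carrier M" "R a w \<in> carrier M" "lc u b \<in> carrier M"
    using assms by (auto intro: mod_homD(1)[OF lc(1)] al_closed R_closed)
  then show ?thesis
    using assms
    by (simp add: iota_def mod_homD(2)[OF iM(1)] iM_lc iM_R rU_mult al_closed iM_closed rU_closed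
        iM_mult UL.l_distr UL.r_distr UL.a_ac)
qed

text \<open>The range is closed under products by \<open>iota_mult\<close>, so the induction over
  \<open>UL(P)\<close> reduces to exhibiting preimages of the unit and of the generators.\<close>

lemma iota_surj: "iota ` carrier MU = carrier (UL K P)"
proof
  show "iota ` carrier MU \<subseteq> carrier (UL K P)" using mod_homD(1)[OF iota_hom] by auto
  have sub: "submodule (iota ` carrier MU) K (UL K P)"
    by (rule submodule_image[OF MU_mod UL_mod iota_hom module.carrier_is_submodule[OF MU_mod]])
  have one: "\<one>\<^bsub>UL K P\<^esub> \<in> iota ` carrier MU"
    by (rule image_eqI[of _ _ "(\<zero>\<^bsub>M\<^esub>, \<one>\<^bsub>U K L\<^esub>)"])
      (simp_all add: dsum_simps iota_def mod_hom_neg(1)[OF M_mod UL_mod iM(1)] rU(2))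
  have gens: "l x \<in> iota ` carrier MU" "r x \<in> iota ` carrier MU" if x: "x \<in> carrier P" for x
  proof -
    show "l x \<in> iota ` carrier MU"
      by (rule image_eqI[of _ _ "(\<ominus>\<^bsub>M\<^esub> pt \<one>\<^bsub>U K L\<^esub> x, \<zero>\<^bsub>U K L\<^esub>)"])
        (use x in \<open>simp_all add: dsum_simps iota_def mod_hom_neg[OF M_mod UL_mod iM(1)] pt_closed iM(2)
          mod_hom_neg(1)[OF U_mod UL_mod rU_hom] rU(2) l_closed\<close>)
    show "r x \<in> iota ` carrier MU"
      by (rule image_eqI[of _ _ "(\<zero>\<^bsub>M\<^esub>, gen (p x))"])
        (use x in \<open>simp_all add: dsum_simps iota_def mod_hom_neg[OF M_mod UL_mod iM(1)]
          rU(3) r_closed gen_closed p_closed\<close>)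
  qed
  have mult: "y \<otimes>\<^bsub>UL K P\<^esub> z \<in> iota ` carrier MU" if yz: "y \<in> iota ` carrier MU" "z \<in> iota ` carrier MU" for y z
  proof -
    obtain a u b w where k: "y = iota (a, u)" "z = iota (b, w)" "a \<in> carrier M" "u \<in> carrier (U K L)"
      "b \<in> carrier M" "w \<in> carrier (U K L)"
      using yz by (auto simp: dsum_simps(1))
    then show ?thesis
      by (auto simp: iota_mult dsum_simps(1) al_closed R_closed mod_homD(1)[OF lc(1)] intro!: imageI)
  qed
  show "carrier (UL K P) \<subseteq> iota ` carrier MU"
  proof
    fix z assume z: "z \<in> carrier (UL K P)"
    show "z \<in> iota ` carrier MU"
      by (rule UL_induct[OF P sub one mult mult z]) (rule gens | assumption)+
  qed
qed

lemma iota_bij: "bij_betw iota (carrier MU) (carrier (UL K P))"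
  using iota_inj iota_surj by (simp add: bij_betw_def)

end

text \<open>A homomorphism together with a map of the Lie quotients that is compatible with it. The
  map \<open>h\<close> is given rather than induced, since for s, t and i it already has a
  definition of its own.\<close>

locale lie_quotient_hom =
  A: lie_quotient K P L p act + B: lie_quotient K P' L' p' act'
  for K :: "('k, 'z) ring_scheme" and P :: "('k, 'p) module" and L :: "('k, 'l) module" and p act
    and P' :: "('k, 'q) module" and L' :: "('k, 'm) module" and p' act' +
  fixes f :: "'p \<Rightarrow> 'q" and h :: "'l \<Rightarrow> 'm"
  assumes f: "f \<in> alg_hom K P P'" and h: "h \<in> alg_hom K L L'"
    and hp: "\<And>x. x \<in> carrier P \<Longrightarrow> h (p x) = p' (f x)"
begin

abbreviation "Uh \<equiv> U_map K L' h"
abbreviation "Mh \<equiv> tprod_map K (U K L') P' Uh f"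

lemmas Uh = U_map[OF A.L B.L h]
lemmas ULf = UL_map[OF A.P B.P f]
lemmas Mh = tprod_map[OF A.U_mod A.P_mod B.U_mod B.P_mod alg_homD(1)[OF Uh(1)] alg_homD(1)[OF f]]
lemmas f_closed = mod_homD(1)[OF alg_homD(1)[OF f]]
lemmas Uh_closed = mod_homD(1)[OF alg_homD(1)[OF Uh(1)]]

lemma rU_natural:
  assumes u: "u \<in> carrier (U K L)" shows "B.rU (Uh u) = UL_map K P' f (A.rU u)"
proof -
  let ?N = "{u \<in> carrier (U K L). B.rU (Uh u) = UL_map K P' f (A.rU u)}"
  have sub: "submodule ?N K (U K L)"
    by (rule submodule_equalizer[OF A.U_mod B.UL_mod mod_hom_comp[OF alg_homD(1)[OF Uh(1)] B.rU_hom]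
          mod_hom_comp[OF A.rU_hom alg_homD(1)[OF ULf(1)]]])
  have st: "y \<otimes>\<^bsub>U K L\<^esub> A.gen g \<in> ?N" if y: "y \<in> ?N" and g: "g \<in> carrier L" for y g
  proof -
    obtain x where x: "x \<in> carrier P" "g = p x" using A.L_cases[OF g] .
    show ?thesis using y x
      by (simp add: A.gen_closed A.p_closed alg_homD(2)[OF Uh(1)] Uh(3) hp B.rU_mult Uh_closed B.gen_closed
          B.p_closed f_closed B.rU(3) A.rU_mult A.rU(3) alg_homD(2)[OF ULf(1)] A.rU_closed A.r_closed ULf(4))
  qed
  have "u \<in> ?N"
    by (rule U_induct[OF A.L sub _ _ u]) (use st in \<open>auto simp: Uh(2) A.rU(2) B.rU(2) ULf(2)\<close>)
  then show ?thesis by simp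
qed

lemma iM_natural:
  assumes a: "a \<in> carrier A.M" shows "B.iM (Mh a) = UL_map K P' f (A.iM a)"
  by (rule A.M_eq[OF B.UL_mod mod_hom_comp[OF Mh(1) B.iM(1)] mod_hom_comp[OF A.iM(1) alg_homD(1)[OF ULf(1)]] _ a])
    (simp add: Mh(2) B.iM(2) A.iM(2) Uh_closed f_closed mod_hom_neg(2)[OF A.UL_mod B.UL_mod alg_homD(1)[OF ULf(1)]]
      A.rU_closed A.l_closed alg_homD(2)[OF ULf(1)] ULf(3) rU_natural)

lemma iota_natural:
  assumes "a \<in> carrier A.M" "u \<in> carrier (U K L)"
  shows "B.iota (Mh a, Uh u) = UL_map K P' f (A.iota (a, u))"
  using assms
  by (simp add: A.iota_def B.iota_def iM_natural rU_natural mod_homD(2)[OF alg_homD(1)[OF ULf(1)]]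
      A.iM_closed A.rU_closed)

lemma al_natural:
  assumes a: "a \<in> carrier A.M" shows "B.al (Mh a) = Uh (A.al a)"
  by (rule A.M_eq[OF B.U_mod mod_hom_comp[OF Mh(1) B.al(1)] mod_hom_comp[OF A.al(1) alg_homD(1)[OF Uh(1)]] _ a])
    (simp add: Mh(2) B.al(2) A.al(2) Uh_closed f_closed alg_homD(2)[OF Uh(1)] A.gen_closed A.p_closed Uh(3) hp)

text \<open>Naturality turns the left side into \<open>iota\<close> of the pair
  \<open>(Mh a, Uh u)\<close>, and injectivity of \<open>iota\<close> for the target splits it into
  components. Without injectivity, the kernel in \<open>UL\<close> could exceed the pair of
  kernels.\<close>

lemma kernel_iff:
  assumes "a \<in> carrier A.M" "u \<in> carrier (U K L)"
  shows "UL_map K P' f (A.iota (a, u)) = \<zero>\<^bsub>UL K P'\<^esub> \<longleftrightarrow> Mh a = \<zero>\<^bsub>B.M\<^esub> \<and> Uh u = \<zero>\<^bsub>U K L'\<^esub>"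
proof -
  have "B.iota (Mh a, Uh u) = B.iota \<zero>\<^bsub>B.MU\<^esub> \<longleftrightarrow> (Mh a, Uh u) = \<zero>\<^bsub>B.MU\<^esub>"
    by (rule inj_on_eq_iff[OF B.iota_inj])
      (use assms in \<open>auto simp: dsum_simps Uh_closed mod_homD(1)[OF Mh(1)]\<close>)
  then show ?thesis
    using assms by (simp add: iota_natural mod_hom_neg(1)[OF B.MU_mod B.UL_mod B.iota_hom]) (simp add: dsum_simps)
qed

end

subsection \<open>Semidirect products\<close>

lemma semidirect_simps:
  "carrier (semidirect D) = carrier (xtop D) \<times> carrier (xbase D)"
  "\<zero>\<^bsub>semidirect D\<^esub> = (\<zero>\<^bsub>xtop D\<^esub>, \<zero>\<^bsub>xbase D\<^esub>)"
  "(x, y) \<oplus>\<^bsub>semidirect D\<^esub> (x', y') = (x \<oplus>\<^bsub>xtop D\<^esub> x', y \<oplus>\<^bsub>xbase D\<^esub> y')"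
  "k \<odot>\<^bsub>semidirect D\<^esub> (x, y) = (k \<odot>\<^bsub>xtop D\<^esub> x, k \<odot>\<^bsub>xbase D\<^esub> y)"
  "(x, y) \<otimes>\<^bsub>semidirect D\<^esub> (x', y')
    = (x \<otimes>\<^bsub>xtop D\<^esub> x' \<oplus>\<^bsub>xtop D\<^esub> lact D y x' \<oplus>\<^bsub>xtop D\<^esub> ract D x y', y \<otimes>\<^bsub>xbase D\<^esub> y')"
  by (simp_all add: semidirect_def dsum_def)

text \<open>Only bilinearity and equivariance are required, so that the semidirect product and its
  maps s, t and i are treated once for the Leibniz crossed module and for the associated pair of
  \<hh> and \<gg>.\<close>

locale algebra_pair =
  fixes K :: "('k, 'z) ring_scheme" and D :: "('k, 'q, 'p) xmod"
  assumes top_alg: "bilinear_algebra K (xtop D)" and base_alg: "bilinear_algebra K (xbase D)"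
    and lact_bil: "bilinear_map K (xbase D) (xtop D) (xtop D) (lact D)"
    and ract_bil: "bilinear_map K (xtop D) (xbase D) (xtop D) (ract D)"
    and bd_hom: "bd D \<in> alg_hom K (xtop D) (xbase D)"
    and bd_lact: "\<lbrakk>p \<in> carrier (xbase D); q \<in> carrier (xtop D)\<rbrakk>
      \<Longrightarrow> bd D (lact D p q) = p \<otimes>\<^bsub>xbase D\<^esub> bd D q"
    and bd_ract: "\<lbrakk>p \<in> carrier (xbase D); q \<in> carrier (xtop D)\<rbrakk>
      \<Longrightarrow> bd D (ract D q p) = bd D q \<otimes>\<^bsub>xbase D\<^esub> p"
begin

abbreviation "Q \<equiv> xtop D"
abbreviation "P \<equiv> xbase D"
abbreviation "la \<equiv> lact D"
abbreviation "ra \<equiv> ract D"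
abbreviation "\<eta> \<equiv> bd D"
abbreviation "S \<equiv> semidirect D"

lemmas Q_mod = bilinear_algebraD(1)[OF top_alg]
lemmas P_mod = bilinear_algebraD(1)[OF base_alg]
lemmas Q_bil = bilinear_algebraD(2)[OF top_alg]
lemmas P_bil = bilinear_algebraD(2)[OF base_alg]

sublocale P: module K P by (rule P_mod)
sublocale Q: module K Q by (rule Q_mod)

lemmas closed = bilinear_map_simps(1)[OF Q_bil] bilinear_map_simps(1)[OF P_bil]
  bilinear_map_simps(1)[OF lact_bil] bilinear_map_simps(1)[OF ract_bil]
lemmas bd_closed = mod_homD(1)[OF alg_homD(1)[OF bd_hom]]
lemmas bd_add = mod_homD(2)[OF alg_homD(1)[OF bd_hom]]
lemmas bd_mult = alg_homD(2)[OF bd_hom]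
lemmas distribs = bilinear_map_simps(2-5)[OF Q_bil] bilinear_map_simps(2-5)[OF P_bil]
  bilinear_map_simps(2-5)[OF lact_bil] bilinear_map_simps(2-5)[OF ract_bil]
lemmas nulls = bilinear_map_neg(1,2)[OF Q_mod Q_mod Q_mod Q_bil] bilinear_map_neg(1,2)[OF P_mod P_mod P_mod P_bil]
  bilinear_map_neg(1,2)[OF P_mod Q_mod Q_mod lact_bil] bilinear_map_neg(1,2)[OF Q_mod P_mod Q_mod ract_bil]
lemmas minuses = bilinear_map_neg(5,6)[OF Q_mod Q_mod Q_mod Q_bil] bilinear_map_neg(5,6)[OF P_mod P_mod P_mod P_bil]
  bilinear_map_neg(5,6)[OF P_mod Q_mod Q_mod lact_bil] bilinear_map_neg(5,6)[OF Q_mod P_mod Q_mod ract_bil]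

lemma S_mod: "module K S"
  by (rule module_surj_image[where f = "\<lambda>x. x", OF dsum_module[OF Q_mod P_mod]])
    (auto simp: semidirect_simps dsum_simps)

lemma S_alg: "bilinear_algebra K S"
proof (rule bilinear_algebraI[OF S_mod])
  show "bilinear_map K S S S (\<otimes>\<^bsub>S\<^esub>)"
    by (intro bilinear_mapI mod_homI)
      (auto simp: semidirect_simps closed distribs Q.smult_r_distr Q.a_ac)
qed

lemma s_map_hom: "s_map \<in> alg_hom K S P"
  by (intro alg_homI mod_homI) (auto simp: semidirect_simps s_map_def)

lemma i_map_hom: "i_map D \<in> alg_hom K P S"
  by (intro alg_homI mod_homI) (auto simp: semidirect_simps i_map_def nulls)

lemma t_map_hom: "t_map D \<in> alg_hom K S P"
proof (rule alg_homI)
  have id: "(\<lambda>x. x) \<in> mod_hom K P P" by (rule mod_homI) simp_all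
  show h: "t_map D \<in> mod_hom K S P"
    using dsum_hom[OF P_mod alg_homD(1)[OF bd_hom] id]
    by (simp add: t_map_def mod_hom_def semidirect_def dsum_def)
  fix x y assume "x \<in> carrier S" "y \<in> carrier S"
  then show "t_map D (x \<otimes>\<^bsub>S\<^esub> y) = t_map D x \<otimes>\<^bsub>P\<^esub> t_map D y"
    by (auto simp: semidirect_simps t_map_def closed bd_add bd_mult bd_lact bd_ract bd_closed distribs P.a_ac)
qed

end

subsection \<open>Lie quotients of Leibniz algebras\<close>

text \<open>Expand \<open>(x + y)(x + y)\<close> and subtract the two squares.\<close>

lemma square_polarization:
  assumes A: "bilinear_algebra K A" and J: "submodule J K A"
    and sq: "\<And>y. y \<in> carrier A \<Longrightarrow> y \<otimes>\<^bsub>A\<^esub> y \<in> J" and x: "x \<in> carrier A" and y: "y \<in> carrier A"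
  shows "x \<otimes>\<^bsub>A\<^esub> y \<oplus>\<^bsub>A\<^esub> y \<otimes>\<^bsub>A\<^esub> x \<in> J"
proof -
  note a = bilinear_algebraD[OF A]
  interpret module K A by (rule a)
  note s = bilinear_map_simps[OF a(2)] and S = submodule_facts[OF a(1) J]
  let ?s = "x \<otimes>\<^bsub>A\<^esub> x \<oplus>\<^bsub>A\<^esub> y \<otimes>\<^bsub>A\<^esub> y"
  have "x \<otimes>\<^bsub>A\<^esub> y \<oplus>\<^bsub>A\<^esub> y \<otimes>\<^bsub>A\<^esub> x = (x \<oplus>\<^bsub>A\<^esub> y) \<otimes>\<^bsub>A\<^esub> (x \<oplus>\<^bsub>A\<^esub> y) \<ominus>\<^bsub>A\<^esub> ?s"
    by (rule M.eq_minusI) (use x y in \<open>simp_all add: s M.a_ac\<close>)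
  also have "\<dots> \<in> J" using x y by (intro S(3,6) sq) auto
  finally show ?thesis .
qed

lemma lie_ideal_squares:
  "x \<in> carrier A \<Longrightarrow> x \<otimes>\<^bsub>A\<^esub> x \<in> lie_ideal K A"
  unfolding lie_ideal_def by (rule subsetD[OF alg_idl_superset]) blast

lemma lie_ideal_least:
  "\<lbrakk>alg_ideal K A J; \<And>y. y \<in> carrier A \<Longrightarrow> y \<otimes>\<^bsub>A\<^esub> y \<in> J\<rbrakk> \<Longrightarrow> lie_ideal K A \<subseteq> J"
  unfolding lie_ideal_def by (rule alg_idl_least) auto

lemma lie_ideal_ideal:
  assumes "bilinear_algebra K A" shows "alg_ideal K A (lie_ideal K A)"
  unfolding lie_ideal_def
  by (rule alg_idl_ideal[OF assms]) (auto intro: bilinear_map_simps(1)[OF bilinear_algebraD(2)[OF assms]])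

lemma Lie_alg:
  assumes "bilinear_algebra K A"
  shows "bilinear_algebra K (Lie K A)" "lie_class K A \<in> alg_hom K A (Lie K A)"
    "lie_class K A ` carrier A = carrier (Lie K A)"
    "x \<in> carrier A \<Longrightarrow> lie_class K A x = \<zero>\<^bsub>Lie K A\<^esub> \<longleftrightarrow> x \<in> lie_ideal K A"
  using quot_algebra[OF assms lie_ideal_ideal[OF assms]]
    coset_eq_self_iff[OF bilinear_algebraD(1)[OF assms] alg_idealD(1)[OF lie_ideal_ideal[OF assms]]]
  by (simp_all add: Lie_def lie_class_def[abs_def] quot_simps)

text \<open>The Leibniz identity expresses \<open>x (y z)\<close> by
  \<open>(x y) z - (x z) y\<close>, which vanishes for \<open>z = y\<close>. So right multiplication
  factors through the Lie quotient, which makes \<open>base_rep\<close> and \<open>semi_rep\<close>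
  well defined.\<close>

lemma right_annihilator_ideal:
  assumes "leibniz_algebra K A"
  defines "J \<equiv> {z \<in> carrier A. \<forall>x\<in>carrier A. x \<otimes>\<^bsub>A\<^esub> z = \<zero>\<^bsub>A\<^esub>}"
  shows "alg_ideal K A J" "y \<in> carrier A \<Longrightarrow> y \<otimes>\<^bsub>A\<^esub> y \<in> J"
proof -
  interpret leibniz_algebra K A by fact
  note a = bilinear_algebraD[OF bilinear_algebra_axioms]
  note s = bilinear_map_simps[OF a(2)] and n = bilinear_map_neg[OF a(1) a(1) a(1) a(2)]
  have id: "x \<otimes>\<^bsub>A\<^esub> (y \<otimes>\<^bsub>A\<^esub> z) = (x \<otimes>\<^bsub>A\<^esub> y) \<otimes>\<^bsub>A\<^esub> z \<ominus>\<^bsub>A\<^esub> (x \<otimes>\<^bsub>A\<^esub> z) \<otimes>\<^bsub>A\<^esub> y"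
    if "x \<in> carrier A" "y \<in> carrier A" "z \<in> carrier A" for x y z
    by (rule M.eq_minusI[OF leibniz_identity[OF that]]) (use that in \<open>simp_all add: s\<close>)
  have "submodule J K A"
    by (rule submodule_intro[OF a(1)]) (auto simp: J_def s n)
  then show "alg_ideal K A J"
    by (rule alg_idealI) (auto simp: J_def s n id a_minus_def)
  show "y \<in> carrier A \<Longrightarrow> y \<otimes>\<^bsub>A\<^esub> y \<in> J"
    by (auto simp: J_def s id M.r_neg a_minus_def)
qed

lemma alg_ideal_surj_image:
  assumes A: "bilinear_algebra K A" and B: "bilinear_algebra K B" and f: "f \<in> alg_hom K A B"
    and surj: "f ` carrier A = carrier B" and J: "alg_ideal K A J"
  shows "alg_ideal K B (f ` J)"
proof (rule alg_idealI)
  note a = bilinear_algebraD[OF A] and b = bilinear_algebraD[OF B] and j = alg_idealD[OF J]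
  show "submodule (f ` J) K B" by (rule submodule_image[OF a(1) b(1) alg_homD(1)[OF f] j(1)])
  fix y z assume "y \<in> carrier B" "z \<in> f ` J"
  then obtain x w where x: "x \<in> carrier A" "y = f x" and w: "w \<in> J" "z = f w"
    unfolding surj[symmetric] by blast
  have wc: "w \<in> carrier A" using w submodule_facts(1)[OF a(1) j(1)] by auto
  show "y \<otimes>\<^bsub>B\<^esub> z \<in> f ` J" "z \<otimes>\<^bsub>B\<^esub> y \<in> f ` J"
    using x w wc j(2,3) by (auto simp: alg_homD(2)[OF f, symmetric])
qed

text \<open>Operations on classes are encoded as \<open>the_elem\<close> of the set of all values on
  representatives; what remains is independence of representatives.\<close>

lemma the_elem_const:
  assumes "x \<in> X" "\<And>y. y \<in> X \<Longrightarrow> y = x" shows "the_elem X = x"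
proof -
  have "X = {x}" using assms by blast
  then show ?thesis by simp
qed

lemma hom_eq_iff:
  assumes "module K M" "module K N" "f \<in> mod_hom K M N" "x \<in> carrier M" "y \<in> carrier M"
  shows "f x = f y \<longleftrightarrow> f (x \<ominus>\<^bsub>M\<^esub> y) = \<zero>\<^bsub>N\<^esub>"
proof -
  interpret N: module K N by fact
  show ?thesis using assms(4,5) mod_homD(1)[OF assms(3)]
    by (simp add: mod_hom_neg(3)[OF assms(1-3)] N.a_minus_eq_zero_iff)
qed

lemma mod_hom_surj_image:
  assumes "module K M" "f \<in> mod_hom K M N" "p \<in> mod_hom K M L" "p ` carrier M = carrier L"
    and "\<And>x. x \<in> carrier M \<Longrightarrow> g (p x) = f x"
  shows "g \<in> mod_hom K L N"
proof -
  interpret M: module K M by fact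
  show ?thesis
    by (rule mod_homI)
      (auto simp: assms(4)[symmetric] assms(5) mod_homD(2,3)[OF assms(3), symmetric] mod_homD[OF assms(2)])
qed

subsection \<open>The Lie crossed module of a Leibniz crossed module\<close>

locale leibniz_crossed_module =
  fixes K :: "('k, 'z) ring_scheme" and C :: "('k, 'q, 'p) xmod"
  assumes xmod: "leibniz_xmod K C"

sublocale leibniz_crossed_module \<subseteq> algebra_pair K C
  by (rule algebra_pair.intro)
    (use xmod in \<open>simp_all add: leibniz_xmod_def leibniz_action_def leibniz_algebra_def\<close>)

context leibniz_crossed_module
begin

lemma P_leibniz: "leibniz_algebra K P" and Q_leibniz: "leibniz_algebra K Q"
  using xmod by (auto simp: leibniz_xmod_def)

lemma action_ppq:
  assumes "p \<in> carrier P" "p' \<in> carrier P" "q \<in> carrier Q"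
  shows "ra (ra q p) p' = ra q (p \<otimes>\<^bsub>P\<^esub> p') \<oplus>\<^bsub>Q\<^esub> ra (ra q p') p"
    "ra (la p q) p' = la p (ra q p') \<oplus>\<^bsub>Q\<^esub> la (p \<otimes>\<^bsub>P\<^esub> p') q"
    "la (p \<otimes>\<^bsub>P\<^esub> p') q = la p (la p' q) \<oplus>\<^bsub>Q\<^esub> ra (la p q) p'"
  using xmod assms unfolding leibniz_xmod_def leibniz_action_def by blast+

lemma action_pqq:
  assumes "p \<in> carrier P" "q \<in> carrier Q" "q' \<in> carrier Q"
  shows "la p q \<otimes>\<^bsub>Q\<^esub> q' = la p (q \<otimes>\<^bsub>Q\<^esub> q') \<oplus>\<^bsub>Q\<^esub> la p q' \<otimes>\<^bsub>Q\<^esub> q"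
    "ra q p \<otimes>\<^bsub>Q\<^esub> q' = q \<otimes>\<^bsub>Q\<^esub> la p q' \<oplus>\<^bsub>Q\<^esub> ra (q \<otimes>\<^bsub>Q\<^esub> q') p"
    "ra (q \<otimes>\<^bsub>Q\<^esub> q') p = q \<otimes>\<^bsub>Q\<^esub> ra q' p \<oplus>\<^bsub>Q\<^esub> ra q p \<otimes>\<^bsub>Q\<^esub> q'"
  using xmod assms unfolding leibniz_xmod_def leibniz_action_def by blast+

lemma S_leibniz: "leibniz_algebra K S"
  unfolding leibniz_algebra_def leibniz_algebra_axioms_def
proof (intro conjI allI impI S_alg)
  fix x y z assume "x \<in> carrier S" "y \<in> carrier S" "z \<in> carrier S"
  then obtain q1 p1 q2 p2 q3 p3 where xyz: "x = (q1, p1)" "y = (q2, p2)" "z = (q3, p3)"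
    and c: "q1 \<in> carrier Q" "p1 \<in> carrier P" "q2 \<in> carrier Q" "p2 \<in> carrier P" "q3 \<in> carrier Q" "p3 \<in> carrier P"
    by (auto simp: semidirect_simps)
  \<comment> \<open>One identity for each of the seven ways to choose the three arguments from \<qq>
    and \<pp> with at least one from \<qq>. The eighth, with all arguments in \<pp>, is the second
    component.\<close>
  note li = leibniz_algebra.leibniz_identity[OF Q_leibniz c(1,3,5)] action_pqq(1)[OF c(2,3,5)]
    action_pqq(2)[OF c(4,1,5)] action_ppq(3)[OF c(2,4,5)] action_pqq(3)[OF c(6,1,3)]
    action_ppq(2)[OF c(2,6,3)] action_ppq(1)[OF c(4,6,1)]
  have "(q1 \<otimes>\<^bsub>Q\<^esub> q2 \<oplus>\<^bsub>Q\<^esub> la p1 q2 \<oplus>\<^bsub>Q\<^esub> ra q1 p2) \<otimes>\<^bsub>Q\<^esub> q3 \<oplus>\<^bsub>Q\<^esub> la (p1 \<otimes>\<^bsub>P\<^esub> p2) q3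
        \<oplus>\<^bsub>Q\<^esub> ra (q1 \<otimes>\<^bsub>Q\<^esub> q2 \<oplus>\<^bsub>Q\<^esub> la p1 q2 \<oplus>\<^bsub>Q\<^esub> ra q1 p2) p3
      = q1 \<otimes>\<^bsub>Q\<^esub> (q2 \<otimes>\<^bsub>Q\<^esub> q3 \<oplus>\<^bsub>Q\<^esub> la p2 q3 \<oplus>\<^bsub>Q\<^esub> ra q2 p3) \<oplus>\<^bsub>Q\<^esub> la p1 (q2 \<otimes>\<^bsub>Q\<^esub> q3 \<oplus>\<^bsub>Q\<^esub> la p2 q3 \<oplus>\<^bsub>Q\<^esub> ra q2 p3)
        \<oplus>\<^bsub>Q\<^esub> ra q1 (p2 \<otimes>\<^bsub>P\<^esub> p3) \<oplus>\<^bsub>Q\<^esub>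
        ((q1 \<otimes>\<^bsub>Q\<^esub> q3 \<oplus>\<^bsub>Q\<^esub> la p1 q3 \<oplus>\<^bsub>Q\<^esub> ra q1 p3) \<otimes>\<^bsub>Q\<^esub> q2 \<oplus>\<^bsub>Q\<^esub> la (p1 \<otimes>\<^bsub>P\<^esub> p3) q2
        \<oplus>\<^bsub>Q\<^esub> ra (q1 \<otimes>\<^bsub>Q\<^esub> q3 \<oplus>\<^bsub>Q\<^esub> la p1 q3 \<oplus>\<^bsub>Q\<^esub> ra q1 p3) p2)"
    using c by (simp add: distribs closed li Q.a_ac)
  then show "x \<otimes>\<^bsub>S\<^esub> y \<otimes>\<^bsub>S\<^esub> z = x \<otimes>\<^bsub>S\<^esub> (y \<otimes>\<^bsub>S\<^esub> z) \<oplus>\<^bsub>S\<^esub> x \<otimes>\<^bsub>S\<^esub> z \<otimes>\<^bsub>S\<^esub> y"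
    using leibniz_algebra.leibniz_identity[OF P_leibniz c(2,4,6)]
    by (simp add: xyz semidirect_simps)
qed

section \<open>The quotients \<gg> and \<hh>\<close>

abbreviation "clP \<equiv> lie_class K P"
abbreviation "clQ \<equiv> lie_top_class K C"
abbreviation "G \<equiv> Lie K P"
abbreviation "H \<equiv> lie_top K C"

lemmas G_alg = Lie_alg(1)[OF base_alg]
lemmas clP_hom = Lie_alg(2)[OF base_alg]
lemmas clP_surj = Lie_alg(3)[OF base_alg]
lemmas clP_zero = Lie_alg(4)[OF base_alg]
lemmas G_mod = bilinear_algebraD(1)[OF G_alg]

sublocale G: module K G by (rule G_mod)

lemma cross_ideal_ideal: "alg_ideal K (Lie K Q) (cross_ideal K C)"
  unfolding cross_ideal_def
  by (rule alg_idl_ideal[OF Lie_alg(1)[OF top_alg]])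
    (auto intro!: mod_homD(1)[OF alg_homD(1)[OF Lie_alg(2)[OF top_alg]]] simp: closed)

lemma H_alg: "bilinear_algebra K H"
  unfolding lie_top_def by (rule quot_algebra[OF Lie_alg(1)[OF top_alg] cross_ideal_ideal])

lemmas H_mod = bilinear_algebraD(1)[OF H_alg]
sublocale H: module K H by (rule H_mod)

lemma clQ_hom: "clQ \<in> alg_hom K Q H"
proof -
  note 1 = Lie_alg(2)[OF top_alg] and 2 = quot_algebra(2)[OF Lie_alg(1)[OF top_alg] cross_ideal_ideal, folded lie_top_def]
  show ?thesis
    unfolding lie_top_class_def[abs_def]
    by (rule alg_homI[OF mod_hom_comp[OF alg_homD(1)[OF 1] alg_homD(1)[OF 2]]])
      (simp add: alg_homD(2)[OF 1] alg_homD(2)[OF 2] mod_homD(1)[OF alg_homD(1)[OF 1]])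
qed

lemmas clQ_closed = mod_homD(1)[OF alg_homD(1)[OF clQ_hom]]

lemma clQ_surj: "clQ ` carrier Q = carrier H"
  unfolding lie_top_def quot_simps Lie_alg(3)[OF top_alg, symmetric] lie_top_class_def[abs_def] image_image ..

lemma clQ_zero_iff: "q \<in> carrier Q \<Longrightarrow> clQ q = \<zero>\<^bsub>H\<^esub> \<longleftrightarrow> lie_class K Q q \<in> cross_ideal K C"
  unfolding lie_top_class_def lie_top_def quot_simps
  by (rule coset_eq_self_iff[OF bilinear_algebraD(1)[OF Lie_alg(1)[OF top_alg]] alg_idealD(1)[OF cross_ideal_ideal]
        mod_homD(1)[OF alg_homD(1)[OF Lie_alg(2)[OF top_alg]]]])

text \<open>\<hh> is a quotient of a quotient; this lets its kernel be handled as one ideal of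
  \<qq>. The image of \<open>J\<close> in \<open>Lie(\<qq>)\<close> is an ideal that contains the
  generators of \<open>cross_ideal\<close>, so \<open>q\<close> agrees with an element of
  \<open>J\<close> up to the Lie ideal, and the Lie ideal lies in \<open>J\<close> as well.\<close>

lemma clQ_least:
  assumes J: "alg_ideal K Q J" and sq: "\<And>y. y \<in> carrier Q \<Longrightarrow> y \<otimes>\<^bsub>Q\<^esub> y \<in> J"
    and cr: "\<And>q p. \<lbrakk>q \<in> carrier Q; p \<in> carrier P\<rbrakk> \<Longrightarrow> ra q p \<oplus>\<^bsub>Q\<^esub> la p q \<in> J"
    and q: "q \<in> carrier Q" "clQ q = \<zero>\<^bsub>H\<^esub>"
  shows "q \<in> J"
proof -
  note LQ = Lie_alg[OF top_alg]
  have lJ: "lie_ideal K Q \<subseteq> J" by (rule lie_ideal_least[OF J sq])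
  have "cross_ideal K C \<subseteq> lie_class K Q ` J"
    unfolding cross_ideal_def
    by (rule alg_idl_least[OF alg_ideal_surj_image[OF top_alg LQ(1,2,3) J]]) (auto intro!: imageI cr)
  then obtain j where j: "j \<in> J" "lie_class K Q q = lie_class K Q j" using clQ_zero_iff q by auto
  note S = submodule_facts[OF Q_mod alg_idealD(1)[OF J]]
  have jc: "j \<in> carrier Q" using j S(1) by auto
  have "q \<ominus>\<^bsub>Q\<^esub> j \<in> J"
    using hom_eq_iff[OF Q_mod bilinear_algebraD(1)[OF LQ(1)] alg_homD(1)[OF LQ(2)] q(1) jc] j(2) LQ(4) q(1) jc lJ by auto
  then have "j \<oplus>\<^bsub>Q\<^esub> (q \<ominus>\<^bsub>Q\<^esub> j) \<in> J" using S(3) j by blast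
  then show ?thesis using q jc by (simp add: Q.M.add_minus_cancel)
qed

section \<open>The kernel of \<qq> \<rightarrow> \<hh>\<close>

definition "N = {q \<in> carrier Q. clQ q = \<zero>\<^bsub>H\<^esub>}"

lemma N_iff: "q \<in> N \<longleftrightarrow> q \<in> carrier Q \<and> clQ q = \<zero>\<^bsub>H\<^esub>"
  by (simp add: N_def)

lemma N_ideal: "alg_ideal K Q N"
  using alg_ideal_preimage[OF top_alg H_alg clQ_hom alg_ideal_zero[OF H_alg]] by (simp add: N_def)

lemmas N_sub = submodule_facts[OF Q_mod alg_idealD(1)[OF N_ideal]]

lemma N_squares: assumes "q \<in> carrier Q" shows "q \<otimes>\<^bsub>Q\<^esub> q \<in> N"
proof -
  have c: "q \<otimes>\<^bsub>Q\<^esub> q \<in> carrier Q" using assms by (intro closed)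
  have "lie_class K Q (q \<otimes>\<^bsub>Q\<^esub> q) = \<zero>\<^bsub>Lie K Q\<^esub>"
    unfolding Lie_alg(4)[OF top_alg c] by (rule lie_ideal_squares[OF assms])
  then have "lie_class K Q (q \<otimes>\<^bsub>Q\<^esub> q) \<in> cross_ideal K C"
    using submodule_facts(2)[OF bilinear_algebraD(1)[OF Lie_alg(1)[OF top_alg]] alg_idealD(1)[OF cross_ideal_ideal]]
    by simp
  then show ?thesis using c by (simp add: N_iff clQ_zero_iff)
qed

lemma N_cross: assumes "q \<in> carrier Q" "p \<in> carrier P" shows "ra q p \<oplus>\<^bsub>Q\<^esub> la p q \<in> N"
proof -
  have "lie_class K Q (ra q p \<oplus>\<^bsub>Q\<^esub> la p q) \<in> cross_ideal K C"
    unfolding cross_ideal_def by (rule subsetD[OF alg_idl_superset]) (use assms in blast)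
  then show ?thesis using assms by (simp add: N_iff clQ_zero_iff closed)
qed

lemma N_polar: "\<lbrakk>x \<in> carrier Q; y \<in> carrier Q\<rbrakk> \<Longrightarrow> x \<otimes>\<^bsub>Q\<^esub> y \<oplus>\<^bsub>Q\<^esub> y \<otimes>\<^bsub>Q\<^esub> x \<in> N"
  by (rule square_polarization[OF top_alg alg_idealD(1)[OF N_ideal] N_squares])

lemma clQ_la: assumes "q \<in> carrier Q" "p \<in> carrier P" shows "clQ (la p q) = \<ominus>\<^bsub>H\<^esub> clQ (ra q p)"
proof -
  have "clQ (ra q p) \<oplus>\<^bsub>H\<^esub> clQ (la p q) = \<zero>\<^bsub>H\<^esub>"
    using N_cross[OF assms] assms by (simp add: N_iff mod_homD(2)[OF alg_homD(1)[OF clQ_hom]] closed)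
  then show ?thesis
    using assms by (intro H.M.minus_equality[symmetric]) (simp_all add: clQ_closed closed H.M.a_comm)
qed

text \<open>\<open>N\<close> is generated as an ideal by squares and by the sums
  \<open>[q,p] + [p,q]\<close>, and \<pp> acts from the right by derivations. So the elements of
  \<open>N\<close> that all of \<pp> keeps inside \<open>N\<close> form an ideal, and only the two
  kinds of generators are left.\<close>

lemma N_ra: assumes n: "n \<in> N" and p: "p \<in> carrier P" shows "ra n p \<in> N"
proof -
  let ?J = "{n \<in> N. \<forall>p\<in>carrier P. ra n p \<in> N}"
  note ideal = alg_idealD(2,3)[OF N_ideal]
  have sub: "submodule ?J K Q"
    by (rule submodule_intro[OF Q_mod]) (use N_sub(1-4) in \<open>auto simp: distribs nulls closed subset_iff\<close>)
  have J: "alg_ideal K Q ?J"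
  proof (rule alg_idealI[OF sub])
    fix x y assume x: "x \<in> carrier Q" and y: "y \<in> ?J"
    then have yc: "y \<in> carrier Q" by (simp add: N_iff)
    have "ra (x \<otimes>\<^bsub>Q\<^esub> y) p \<in> N" "ra (y \<otimes>\<^bsub>Q\<^esub> x) p \<in> N" if p: "p \<in> carrier P" for p
    proof -
      have yN: "y \<in> N" "ra y p \<in> N" using y p by auto
      show "ra (x \<otimes>\<^bsub>Q\<^esub> y) p \<in> N" "ra (y \<otimes>\<^bsub>Q\<^esub> x) p \<in> N"
        unfolding action_pqq(3)[OF p x yc] action_pqq(3)[OF p yc x]
        by (intro N_sub(3) ideal x yN closed(4) p)+
    qed
    then show "x \<otimes>\<^bsub>Q\<^esub> y \<in> ?J" "y \<otimes>\<^bsub>Q\<^esub> x \<in> ?J" using ideal x y by auto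
  qed
  \<comment> \<open>By the derivation rule, \<open>[[y,y],p] = [y,[y,p]] + [[y,p],y]\<close>, a
    polarized square.\<close>
  have sq: "y \<otimes>\<^bsub>Q\<^esub> y \<in> ?J" if y: "y \<in> carrier Q" for y
    using N_squares[OF y] N_polar[OF y closed(4)[OF y]] action_pqq(3)[OF _ y y] by simp
  have cr: "ra q p \<oplus>\<^bsub>Q\<^esub> la p q \<in> ?J" if q: "q \<in> carrier Q" and p: "p \<in> carrier P" for q p
  proof -
    have "ra (ra q p \<oplus>\<^bsub>Q\<^esub> la p q) p' \<in> N" if p': "p' \<in> carrier P" for p'
    proof -
      \<comment> \<open>The action identities regroup the expression into the generator for
        \<open>q\<close> and \<open>[p,p']\<close> plus the generator for \<open>[q,p']\<close> and
        \<open>p\<close>.\<close>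
      have "ra (ra q p \<oplus>\<^bsub>Q\<^esub> la p q) p' = (ra q (p \<otimes>\<^bsub>P\<^esub> p') \<oplus>\<^bsub>Q\<^esub> la (p \<otimes>\<^bsub>P\<^esub> p') q)
          \<oplus>\<^bsub>Q\<^esub> (ra (ra q p') p \<oplus>\<^bsub>Q\<^esub> la p (ra q p'))"
        using q p p' by (simp add: distribs closed action_ppq(1)[OF p p' q] action_ppq(2)[OF p p' q] Q.a_ac)
      also have "\<dots> \<in> N" using q p p' by (intro N_sub(3) N_cross closed)
      finally show ?thesis .
    qed
    then show ?thesis using N_cross[OF q p] by blast
  qed
  have "n \<in> ?J" by (rule clQ_least[OF J sq cr]) (use n in \<open>auto simp: N_iff\<close>)
  then show ?thesis using p by blast
qed

text \<open>From \<open>[q,[x,y]] = [[q,x],y] - [[q,y],x]\<close> and the stability of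
  \<open>N\<close> under \<pp>, the elements that send all of \<qq> into \<open>N\<close> form an
  ideal of \<pp>. The same identity with \<open>x = y\<close> shows that squares belong to
  it.\<close>

lemma N_ra_lie_ideal: assumes m: "m \<in> lie_ideal K P" and q: "q \<in> carrier Q" shows "ra q m \<in> N"
proof -
  let ?J = "{m \<in> carrier P. \<forall>q\<in>carrier Q. ra q m \<in> N}"
  have sub: "submodule ?J K P"
    by (rule submodule_intro[OF P_mod]) (use N_sub(2-4) in \<open>auto simp: distribs nulls closed\<close>)
  have id: "ra q (x \<otimes>\<^bsub>P\<^esub> y) = ra (ra q x) y \<ominus>\<^bsub>Q\<^esub> ra (ra q y) x"
    if "x \<in> carrier P" "y \<in> carrier P" "q \<in> carrier Q" for x y q
    by (rule Q.M.eq_minusI[OF action_ppq(1)[OF that]]) (use that in \<open>simp_all add: closed\<close>)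
  have J: "alg_ideal K P ?J"
  proof (rule alg_idealI[OF sub])
    fix x y assume x: "x \<in> carrier P" and y: "y \<in> ?J"
    then have yc: "y \<in> carrier P" by simp
    have "ra q (x \<otimes>\<^bsub>P\<^esub> y) \<in> N" "ra q (y \<otimes>\<^bsub>P\<^esub> x) \<in> N" if q: "q \<in> carrier Q" for q
    proof -
      have yN: "ra (ra q x) y \<in> N" "ra q y \<in> N" using y q x closed(4) by auto
      show "ra q (x \<otimes>\<^bsub>P\<^esub> y) \<in> N" "ra q (y \<otimes>\<^bsub>P\<^esub> x) \<in> N"
        unfolding id[OF x yc q] id[OF yc x q] by (intro N_sub(6) N_ra yN x)+
    qed
    then show "x \<otimes>\<^bsub>P\<^esub> y \<in> ?J" "y \<otimes>\<^bsub>P\<^esub> x \<in> ?J" using closed x yc by auto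
  qed
  have "lie_ideal K P \<subseteq> ?J"
    by (rule lie_ideal_least[OF J]) (use N_sub(2) in \<open>auto simp: closed id Q.M.r_neg a_minus_def\<close>)
  then show ?thesis using m q by blast
qed

text \<open>The preimage of the Lie ideal of \<pp> contains the squares, and it contains
  \<open>[q,p] + [p,q]\<close> because \<eta> sends this to a polarized square of \<pp>.\<close>

lemma bd_N: assumes n: "n \<in> N" shows "\<eta> n \<in> lie_ideal K P"
proof -
  note I = lie_ideal_ideal[OF base_alg]
  have "n \<in> {q \<in> carrier Q. \<eta> q \<in> lie_ideal K P}"
    by (rule clQ_least[OF alg_ideal_preimage[OF top_alg base_alg bd_hom I]])
      (use n in \<open>auto simp: N_iff closed bd_mult bd_add bd_ract bd_lact bd_closed lie_ideal_squares
        intro!: square_polarization[OF base_alg alg_idealD(1)[OF I]]\<close>)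
  then show ?thesis by simp
qed

section \<open>Operations on classes\<close>

lemma clQ_eq_iff: "\<lbrakk>x \<in> carrier Q; y \<in> carrier Q\<rbrakk> \<Longrightarrow> clQ x = clQ y \<longleftrightarrow> x \<ominus>\<^bsub>Q\<^esub> y \<in> N"
  using hom_eq_iff[OF Q_mod H_mod alg_homD(1)[OF clQ_hom]] by (simp add: N_iff)

lemma clP_eq_iff: "\<lbrakk>x \<in> carrier P; y \<in> carrier P\<rbrakk> \<Longrightarrow> clP x = clP y \<longleftrightarrow> x \<ominus>\<^bsub>P\<^esub> y \<in> lie_ideal K P"
  using hom_eq_iff[OF P_mod G_mod alg_homD(1)[OF clP_hom]] clP_zero by simp

lemma lie_ract_class:
  assumes q: "q \<in> carrier Q" and p: "p \<in> carrier P"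
  shows "lie_ract K C (clQ q) (clP p) = clQ (ra q p)"
  unfolding lie_ract_def
proof (rule the_elem_const)
  show "clQ (ra q p) \<in> {clQ (ra q' p') |q' p'. q' \<in> carrier Q \<and> p' \<in> carrier P \<and> clQ q' = clQ q \<and> clP p' = clP p}"
    using q p by blast
  fix y assume "y \<in> {clQ (ra q' p') |q' p'. q' \<in> carrier Q \<and> p' \<in> carrier P \<and> clQ q' = clQ q \<and> clP p' = clP p}"
  then obtain q' p' where y: "y = clQ (ra q' p')" "q' \<in> carrier Q" "p' \<in> carrier P" "clQ q' = clQ q" "clP p' = clP p"
    by blast
  \<comment> \<open>The first representative is exchanged while \<open>p'\<close> is kept, and the
    second one afterwards.\<close>
  have "ra q' p' \<ominus>\<^bsub>Q\<^esub> ra q p' \<in> N" "ra q p' \<ominus>\<^bsub>Q\<^esub> ra q p \<in> N"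
    using N_ra[of "q' \<ominus>\<^bsub>Q\<^esub> q" p'] N_ra_lie_ideal[of "p' \<ominus>\<^bsub>P\<^esub> p" q] y q p clQ_eq_iff clP_eq_iff
    by (auto simp: minuses)
  then show "y = clQ (ra q p)" using y q p clQ_eq_iff[of "ra q' p'" "ra q p'"] clQ_eq_iff[of "ra q p'" "ra q p"]
    by (simp add: closed)
qed

abbreviation "LC \<equiv> lie_xmod K C"

lemma LC_simps: "xtop LC = H" "xbase LC = G" "ract LC = lie_ract K C"
  "lact LC = (\<lambda>g h. \<ominus>\<^bsub>H\<^esub> lie_ract K C h g)"
  by (simp_all add: lie_xmod_def)

lemma LC_bd: assumes q: "q \<in> carrier Q" shows "bd LC (clQ q) = clP (\<eta> q)"
proof -
  have "the_elem {clP (\<eta> q') |q'. q' \<in> carrier Q \<and> clQ q' = clQ q} = clP (\<eta> q)"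
  proof (rule the_elem_const)
    show "clP (\<eta> q) \<in> {clP (\<eta> q') |q'. q' \<in> carrier Q \<and> clQ q' = clQ q}" using q by blast
    fix y assume "y \<in> {clP (\<eta> q') |q'. q' \<in> carrier Q \<and> clQ q' = clQ q}"
    then obtain q' where y: "y = clP (\<eta> q')" "q' \<in> carrier Q" "clQ q' = clQ q" by blast
    have "\<eta> q' \<ominus>\<^bsub>P\<^esub> \<eta> q \<in> lie_ideal K P"
      using bd_N[of "q' \<ominus>\<^bsub>Q\<^esub> q"] y q clQ_eq_iff mod_hom_neg(3)[OF Q_mod P_mod alg_homD(1)[OF bd_hom]] by auto
    then show "y = clP (\<eta> q)" using y q clP_eq_iff by (simp add: bd_closed)
  qed
  then show ?thesis by (simp add: lie_xmod_def)
qed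

lemma lie_ract_bil: "bilinear_map K H G H (lie_ract K C)"
  by (rule bilinear_map_surj_image[OF ract_bil Q_mod P_mod alg_homD(1)[OF clQ_hom] alg_homD(1)[OF clP_hom]
        alg_homD(1)[OF clQ_hom] clQ_surj[symmetric] clP_surj[symmetric] lie_ract_class])

lemma H_cases: assumes "h \<in> carrier H" obtains q where "q \<in> carrier Q" "h = clQ q"
  using assms clQ_surj by auto

lemma G_cases: assumes "g \<in> carrier G" obtains p where "p \<in> carrier P" "g = clP p"
  using assms clP_surj by auto

text \<open>The construction only makes squares vanish in \<gg>; polarization in the zero submodule
  gives the rule. It is what makes the boundary map equivariant for the left action, which is minus
  the right one.\<close>

lemma G_antisym: assumes "x \<in> carrier G" "y \<in> carrier G" shows "x \<otimes>\<^bsub>G\<^esub> y = \<ominus>\<^bsub>G\<^esub> (y \<otimes>\<^bsub>G\<^esub> x)"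
proof -
  have sq: "z \<otimes>\<^bsub>G\<^esub> z \<in> {\<zero>\<^bsub>G\<^esub>}" if z: "z \<in> carrier G" for z
  proof -
    obtain p where p: "p \<in> carrier P" "z = clP p" using G_cases[OF z] .
    then show ?thesis using clP_zero[of "p \<otimes>\<^bsub>P\<^esub> p"] lie_ideal_squares[OF p(1)] closed
      by (simp add: alg_homD(2)[OF clP_hom, symmetric])
  qed
  have "x \<otimes>\<^bsub>G\<^esub> y \<oplus>\<^bsub>G\<^esub> y \<otimes>\<^bsub>G\<^esub> x = \<zero>\<^bsub>G\<^esub>"
    using square_polarization[OF G_alg submodule_zero[OF G_mod] sq assms] by simp
  then show ?thesis
    using assms by (intro G.M.minus_equality[symmetric]) (auto simp: bilinear_map_simps(1)[OF bilinear_algebraD(2)[OF G_alg]])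
qed

sublocale LC: algebra_pair K "lie_xmod K C"
proof (rule algebra_pair.intro, unfold LC_simps)
  show "bilinear_algebra K H" by (rule H_alg)
  show "bilinear_algebra K G" by (rule G_alg)
  show "bilinear_map K H G H (lie_ract K C)" by (rule lie_ract_bil)
  show "bilinear_map K G H H (\<lambda>g h. \<ominus>\<^bsub>H\<^esub> lie_ract K C h g)"
    by (intro bilinear_mapI mod_hom_uminus[OF H_mod] bilinear_mapD[OF lie_ract_bil])
  have bh: "bd LC \<in> mod_hom K H G"
    by (rule mod_hom_surj_image[OF Q_mod mod_hom_comp[OF alg_homD(1)[OF bd_hom] alg_homD(1)[OF clP_hom]]
          alg_homD(1)[OF clQ_hom] clQ_surj LC_bd])
  show "bd LC \<in> alg_hom K H G"
  proof (rule alg_homI[OF bh])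
    fix x y assume "x \<in> carrier H" "y \<in> carrier H"
    then show "bd LC (x \<otimes>\<^bsub>H\<^esub> y) = bd LC x \<otimes>\<^bsub>G\<^esub> bd LC y"
      by (elim H_cases) (simp add: alg_homD(2)[OF clQ_hom, symmetric] LC_bd closed bd_mult alg_homD(2)[OF clP_hom] bd_closed)
  qed
  have br: "bd LC (lie_ract K C q p) = bd LC q \<otimes>\<^bsub>G\<^esub> p" if "p \<in> carrier G" "q \<in> carrier H" for p q
    using that by (elim H_cases G_cases)
      (simp add: lie_ract_class LC_bd closed bd_ract alg_homD(2)[OF clP_hom] bd_closed)
  then show "bd LC (lie_ract K C q p) = bd LC q \<otimes>\<^bsub>G\<^esub> p" if "p \<in> carrier G" "q \<in> carrier H" for p q
    using that by simp
  show "bd LC (\<ominus>\<^bsub>H\<^esub> lie_ract K C q p) = p \<otimes>\<^bsub>G\<^esub> bd LC q" if "p \<in> carrier G" "q \<in> carrier H" for p q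
    using that by (simp add: mod_hom_neg(2)[OF H_mod G_mod bh] bilinear_map_simps(1)[OF lie_ract_bil] br
        G_antisym[of p] mod_homD(1)[OF bh])
qed

abbreviation "clS \<equiv> semi_class K C"
abbreviation "SL \<equiv> semidirect (lie_xmod K C)"

lemma clS_pair: "clS (q, p) = (clQ q, clP p)"
  by (simp add: semi_class_def)

text \<open>The left action of \<pp> on \<qq> becomes minus the right action after passing to \<hh>
  (\<open>clQ_la\<close>), which is the left action built into \<open>lie_xmod\<close>.\<close>

lemma clS_hom: "clS \<in> alg_hom K S SL"
proof (intro alg_homI mod_homI)
  note q = alg_homD(1)[OF clQ_hom]
  show "clS (x \<otimes>\<^bsub>S\<^esub> y) = clS x \<otimes>\<^bsub>SL\<^esub> clS y" if "x \<in> carrier S" "y \<in> carrier S" for x y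
    using that by (auto simp: semidirect_simps clS_pair LC_simps lie_ract_class closed mod_homD[OF q] alg_homD(2)[OF clQ_hom]
        alg_homD(2)[OF clP_hom] clQ_la)
qed (auto simp: semidirect_simps clS_pair LC_simps mod_homD[OF alg_homD(1)[OF clQ_hom]] mod_homD[OF alg_homD(1)[OF clP_hom]])

lemma clS_surj: "clS ` carrier S = carrier SL"
proof -
  have "clS ` (carrier Q \<times> carrier P) = (clQ ` carrier Q) \<times> (clP ` carrier P)"
    by (auto simp: semi_class_def image_iff)
  then show ?thesis by (simp add: semidirect_simps LC_simps clQ_surj clP_surj)
qed

text \<open>This is the condition \<open>p_ker\<close> for \<qq> \<rtimes> \<pp>. Split
  \<open>x\<close> as \<open>(q,0) + (0,p)\<close>. The part on \<pp> is the minimality of its Lie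
  ideal. On \<qq>, the squares of the semidirect product yield squares and, polarized on
  \<open>(q,0)\<close> and \<open>(0,p)\<close>, the sums \<open>[q,p] + [p,q]\<close>: this is why
  \<hh> is smaller than \<open>Lie(\<qq>)\<close>.\<close>

lemma clS_least:
  assumes J: "alg_ideal K S J" and sq: "\<And>y. y \<in> carrier S \<Longrightarrow> y \<otimes>\<^bsub>S\<^esub> y \<in> J"
    and x: "x \<in> carrier S" "clS x = \<zero>\<^bsub>SL\<^esub>"
  shows "x \<in> J"
proof -
  note Js = submodule_facts[OF S_mod alg_idealD(1)[OF J]]
  obtain q p where qp: "x = (q, p)" "q \<in> carrier Q" "p \<in> carrier P" "clQ q = \<zero>\<^bsub>H\<^esub>" "clP p = \<zero>\<^bsub>G\<^esub>"
    using x by (auto simp: semidirect_simps clS_pair LC_simps)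
  have "q \<in> {q \<in> carrier Q. (q, \<zero>\<^bsub>P\<^esub>) \<in> J}"
  proof (rule clQ_least[OF _ _ _ qp(2,4)])
    have inc: "(\<lambda>q. (q, \<zero>\<^bsub>P\<^esub>)) \<in> alg_hom K Q S"
      by (intro alg_homI mod_homI) (auto simp: semidirect_simps nulls closed)
    show "alg_ideal K Q {q \<in> carrier Q. (q, \<zero>\<^bsub>P\<^esub>) \<in> J}"
      by (rule alg_ideal_preimage[OF top_alg S_alg inc J])
    fix y assume y: "y \<in> carrier Q"
    then show "y \<otimes>\<^bsub>Q\<^esub> y \<in> {q \<in> carrier Q. (q, \<zero>\<^bsub>P\<^esub>) \<in> J}"
      using sq[of "(y, \<zero>\<^bsub>P\<^esub>)"] by (simp add: semidirect_simps nulls closed)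
    fix p assume p: "p \<in> carrier P"
    show "ra y p \<oplus>\<^bsub>Q\<^esub> la p y \<in> {q \<in> carrier Q. (q, \<zero>\<^bsub>P\<^esub>) \<in> J}"
      using square_polarization[OF S_alg alg_idealD(1)[OF J] sq, of "(y, \<zero>\<^bsub>P\<^esub>)" "(\<zero>\<^bsub>Q\<^esub>, p)"] y p
      by (simp add: semidirect_simps nulls closed)
  qed
  moreover have "p \<in> {p \<in> carrier P. i_map C p \<in> J}"
  proof (rule subsetD[OF lie_ideal_least])
    show "alg_ideal K P {p \<in> carrier P. i_map C p \<in> J}"
      by (rule alg_ideal_preimage[OF base_alg S_alg i_map_hom J])
    show "y \<otimes>\<^bsub>P\<^esub> y \<in> {p \<in> carrier P. i_map C p \<in> J}" if "y \<in> carrier P" for y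
      using that sq[of "(\<zero>\<^bsub>Q\<^esub>, y)"] by (simp add: i_map_def semidirect_simps nulls closed)
    show "p \<in> lie_ideal K P" using qp clP_zero by simp
  qed
  ultimately have "(q, \<zero>\<^bsub>P\<^esub>) \<oplus>\<^bsub>S\<^esub> (\<zero>\<^bsub>Q\<^esub>, p) \<in> J" using Js(3) by (auto simp: i_map_def)
  then show ?thesis using qp by (simp add: semidirect_simps)
qed

text \<open>The right annihilator is an ideal that contains the squares, hence the whole Lie ideal;
  so the product depends on the second factor through its class only.\<close>

lemma base_rep_class:
  assumes v: "v \<in> carrier P" and w: "w \<in> carrier P"
  shows "base_rep K C v (clP w) = v \<otimes>\<^bsub>P\<^esub> w"
  unfolding base_rep_def
proof (rule the_elem_const)
  show "v \<otimes>\<^bsub>P\<^esub> w \<in> {v \<otimes>\<^bsub>P\<^esub> p' |p'. p' \<in> carrier P \<and> clP p' = clP w}" using w by blast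
  fix y assume "y \<in> {v \<otimes>\<^bsub>P\<^esub> p' |p'. p' \<in> carrier P \<and> clP p' = clP w}"
  then obtain p' where y: "y = v \<otimes>\<^bsub>P\<^esub> p'" "p' \<in> carrier P" "clP p' = clP w" by blast
  have "p' \<ominus>\<^bsub>P\<^esub> w \<in> lie_ideal K P" using y w clP_eq_iff by blast
  then have "v \<otimes>\<^bsub>P\<^esub> (p' \<ominus>\<^bsub>P\<^esub> w) = \<zero>\<^bsub>P\<^esub>"
    using lie_ideal_least[OF right_annihilator_ideal[OF P_leibniz]] v by blast
  then show "y = v \<otimes>\<^bsub>P\<^esub> w" using v w y by (simp add: minuses P.M.a_minus_eq_zero_iff closed)
qed

text \<open>The argument of \<open>base_rep_class\<close> in \<qq> \<rtimes> \<pp>, with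
  \<open>clS_least\<close> in the place of the minimality of the Lie ideal.\<close>

lemma semi_rep_class:
  assumes v: "v \<in> carrier S" and w: "w \<in> carrier S"
  shows "semi_rep K C v (clS w) = v \<otimes>\<^bsub>S\<^esub> w"
proof -
  obtain a b where ab: "w = (a, b)" "a \<in> carrier Q" "b \<in> carrier P" using w by (auto simp: semidirect_simps)
  interpret Sm: module K S by (rule S_mod)
  have "the_elem {v \<otimes>\<^bsub>S\<^esub> (q', p') |q' p'. q' \<in> carrier Q \<and> p' \<in> carrier P \<and> clQ q' = clQ a \<and> clP p' = clP b} = v \<otimes>\<^bsub>S\<^esub> w"
  proof (rule the_elem_const)
    show "v \<otimes>\<^bsub>S\<^esub> w \<in> {v \<otimes>\<^bsub>S\<^esub> (q', p') |q' p'. q' \<in> carrier Q \<and> p' \<in> carrier P \<and> clQ q' = clQ a \<and> clP p' = clP b}"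
      using ab by blast
    fix y assume "y \<in> {v \<otimes>\<^bsub>S\<^esub> (q', p') |q' p'. q' \<in> carrier Q \<and> p' \<in> carrier P \<and> clQ q' = clQ a \<and> clP p' = clP b}"
    then obtain q' p' where y: "y = v \<otimes>\<^bsub>S\<^esub> (q', p')" "q' \<in> carrier Q" "p' \<in> carrier P" "clQ q' = clQ a" "clP p' = clP b"
      by blast
    have c: "(q', p') \<in> carrier S" using y by (simp add: semidirect_simps)
    have "clS (q', p') = clS w" using y ab by (simp add: clS_pair)
    then have "clS ((q', p') \<ominus>\<^bsub>S\<^esub> w) = \<zero>\<^bsub>SL\<^esub>"
      using hom_eq_iff[OF S_mod LC.S_mod alg_homD(1)[OF clS_hom] c w] by simp
    then have "(q', p') \<ominus>\<^bsub>S\<^esub> w \<in> {z \<in> carrier S. \<forall>x\<in>carrier S. x \<otimes>\<^bsub>S\<^esub> z = \<zero>\<^bsub>S\<^esub>}"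
      using c w by (intro clS_least[OF right_annihilator_ideal[OF S_leibniz]]) simp_all
    then have "v \<otimes>\<^bsub>S\<^esub> ((q', p') \<ominus>\<^bsub>S\<^esub> w) = \<zero>\<^bsub>S\<^esub>" using v by blast
    then show "y = v \<otimes>\<^bsub>S\<^esub> w"
      using v w y c bilinear_map_simps(1)[OF bilinear_algebraD(2)[OF S_alg]]
      by (simp add: bilinear_map_neg(5)[OF S_mod S_mod S_mod bilinear_algebraD(2)[OF S_alg]] Sm.M.a_minus_eq_zero_iff)
  qed
  then show ?thesis by (simp add: semi_rep_def ab(1) clS_pair)
qed

end

subsection \<open>Spans of products\<close>

lemma prod_span_submodule:
  assumes "module K M" "\<And>a b. \<lbrakk>a \<in> A; b \<in> B\<rbrakk> \<Longrightarrow> f a b \<in> carrier M"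
  shows "submodule (prod_span K M f A B) K M"
  unfolding prod_span_def by (rule mod_span_submodule[OF assms(1)]) (use assms(2) in auto)

lemma prod_span_mem: "\<lbrakk>a \<in> A; b \<in> B\<rbrakk> \<Longrightarrow> f a b \<in> prod_span K M f A B"
  unfolding prod_span_def by (rule subsetD[OF mod_span_superset]) blast

lemma prod_span_image:
  assumes "module K M" "module K N" "h \<in> mod_hom K M N" "submodule N' K N"
    and "\<And>a b. \<lbrakk>a \<in> A; b \<in> B\<rbrakk> \<Longrightarrow> f a b \<in> carrier M"
    and "\<And>a b. \<lbrakk>a \<in> A; b \<in> B\<rbrakk> \<Longrightarrow> h (f a b) \<in> N'"
    and "z \<in> prod_span K M f A B"
  shows "h z \<in> N'"
  by (rule mod_hom_span[OF assms(1-4) _ _ assms(7)[unfolded prod_span_def]]) (use assms(5,6) in auto)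

lemma set_add_submodule:
  assumes M: "module K M" and A: "submodule A K M" and B: "submodule B K M"
  shows "submodule (A <+>\<^bsub>M\<^esub> B) K M" "A \<subseteq> A <+>\<^bsub>M\<^esub> B" "B \<subseteq> A <+>\<^bsub>M\<^esub> B"
proof -
  interpret M: module K M by fact
  note a = submodule_facts[OF M A] and b = submodule_facts[OF M B]
  note ac = subsetD[OF a(1)] and bc = subsetD[OF b(1)]
  have mem: "z \<in> A <+>\<^bsub>M\<^esub> B \<longleftrightarrow> (\<exists>x\<in>A. \<exists>y\<in>B. z = x \<oplus>\<^bsub>M\<^esub> y)" for z by (simp add: set_add_def')
  show "submodule (A <+>\<^bsub>M\<^esub> B) K M"
  proof (rule submodule_intro[OF M])
    show "A <+>\<^bsub>M\<^esub> B \<subseteq> carrier M" unfolding set_add_def' using ac bc by auto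
    show "\<zero>\<^bsub>M\<^esub> \<in> A <+>\<^bsub>M\<^esub> B" unfolding mem by (intro bexI[OF _ a(2)] bexI[OF _ b(2)]) simp
  next
    fix z w assume "z \<in> A <+>\<^bsub>M\<^esub> B" "w \<in> A <+>\<^bsub>M\<^esub> B"
    then obtain x y x' y' where k: "x \<in> A" "y \<in> B" "z = x \<oplus>\<^bsub>M\<^esub> y" "x' \<in> A" "y' \<in> B" "w = x' \<oplus>\<^bsub>M\<^esub> y'"
      unfolding mem by blast
    show "z \<oplus>\<^bsub>M\<^esub> w \<in> A <+>\<^bsub>M\<^esub> B"
      unfolding mem
      by (rule bexI[OF _ a(3)[OF k(1,4)]], rule bexI[OF _ b(3)[OF k(2,5)]])
        (use k ac bc in \<open>simp add: M.a_ac\<close>)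
  next
    fix c z assume c: "c \<in> carrier K" "z \<in> A <+>\<^bsub>M\<^esub> B"
    then obtain x y where k: "x \<in> A" "y \<in> B" "z = x \<oplus>\<^bsub>M\<^esub> y" unfolding mem by blast
    show "c \<odot>\<^bsub>M\<^esub> z \<in> A <+>\<^bsub>M\<^esub> B"
      unfolding mem
      by (rule bexI[OF _ a(4)[OF c(1) k(1)]], rule bexI[OF _ b(4)[OF c(1) k(2)]])
        (use k c ac bc in \<open>simp add: M.smult_r_distr\<close>)
  qed
  show "A \<subseteq> A <+>\<^bsub>M\<^esub> B"
  proof
    fix x assume x: "x \<in> A"
    show "x \<in> A <+>\<^bsub>M\<^esub> B" unfolding mem by (intro bexI[OF _ x] bexI[OF _ b(2)]) (use ac x in simp)
  qed
  show "B \<subseteq> A <+>\<^bsub>M\<^esub> B"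
  proof
    fix x assume x: "x \<in> B"
    show "x \<in> A <+>\<^bsub>M\<^esub> B" unfolding mem by (rule bexI[OF _ a(2)], rule bexI[OF _ x]) (use bc x in simp)
  qed
qed

lemma set_add_image:
  assumes M: "module K M" and N: "module K N" and h: "h \<in> mod_hom K M N" and N': "submodule N' K N"
    and A: "submodule A K M" and B: "submodule B K M"
    and "\<And>x. x \<in> A \<Longrightarrow> h x \<in> N'" "\<And>x. x \<in> B \<Longrightarrow> h x \<in> N'" and z: "z \<in> A <+>\<^bsub>M\<^esub> B"
  shows "h z \<in> N'"
proof -
  obtain x y where k: "x \<in> A" "y \<in> B" "z = x \<oplus>\<^bsub>M\<^esub> y" using z by (auto simp: set_add_def')
  then have "h z = h x \<oplus>\<^bsub>N\<^esub> h y"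
    using subsetD[OF submodule_facts(1)[OF M A]] subsetD[OF submodule_facts(1)[OF M B]]
    by (simp add: mod_homD(2)[OF h])
  then show ?thesis using submodule_facts(3)[OF N N'] assms(7,8) k by simp
qed

lemma a_kernel_submodule:
  assumes "module K M" "module K N" "f \<in> mod_hom K M N"
  shows "submodule (a_kernel M N f) K M"
proof -
  have "a_kernel M N f = {x \<in> carrier M. f x \<in> {\<zero>\<^bsub>N\<^esub>}}" by (auto simp: mem_a_kernel)
  then show ?thesis using submodule_preimage[OF assms submodule_zero[OF assms(2)]] by simp
qed

subsection \<open>Crossed modules from pairs of retractions\<close>

lemma subalgebra:
  assumes A: "assoc_algebra K A" and N: "submodule N K A"
    and mult: "\<And>x y. \<lbrakk>x \<in> N; y \<in> N\<rbrakk> \<Longrightarrow> x \<otimes>\<^bsub>A\<^esub> y \<in> N"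
  shows "assoc_algebra K (A\<lparr>carrier := N\<rparr>)"
proof -
  interpret A: assoc_algebra K A by fact
  note b = bilinear_algebraD[OF A.bilinear_algebra_axioms]
  note s = bilinear_map_simps[OF b(2)]
  have c: "x \<in> carrier A" if "x \<in> N" for x using submodule_facts(1)[OF b(1) N] that by auto
  have "bilinear_algebra K (A\<lparr>carrier := N\<rparr>)"
    by (rule bilinear_algebraI[OF submodule.submodule_is_module[OF N b(1)]], intro bilinear_mapI mod_homI)
      (auto simp: mult s c)
  then show ?thesis
    by (auto simp: assoc_algebra_def assoc_algebra_axioms_def c A.mult_assoc)
qed

text \<open>A pre-cat1-algebra: two retractions of \<open>E\<close> onto \<open>F\<close> with a
  common section. Dividing by \<open>J\<close> forces the cat1 condition, that the kernels of
  \<open>s\<close> and \<open>t\<close> annihilate each other, and \<open>XM\<close> is the crossed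
  module that corresponds to the result.\<close>

locale cat1_algebra =
  fixes K :: "('k, 'z) ring_scheme" and E :: "('k, 'e) module" and F :: "('k, 'f) module"
    and s t :: "'e \<Rightarrow> 'f" and i :: "'f \<Rightarrow> 'e"
  assumes E: "unital_algebra K E" and F: "unital_algebra K F"
    and s: "s \<in> alg_hom K E F" and t: "t \<in> alg_hom K E F" and i: "i \<in> alg_hom K F E"
    and si: "\<And>x. x \<in> carrier F \<Longrightarrow> s (i x) = x" and ti: "\<And>x. x \<in> carrier F \<Longrightarrow> t (i x) = x"
begin

definition "J = prod_span K E (\<otimes>\<^bsub>E\<^esub>) (a_kernel E F s) (a_kernel E F t)
  <+>\<^bsub>E\<^esub> prod_span K E (\<otimes>\<^bsub>E\<^esub>) (a_kernel E F t) (a_kernel E F s)"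

definition "XM = (let k = a_kernel (quot E J) F (quot_lift s); j = (\<lambda>a. J +>\<^bsub>E\<^esub> i a) in
  \<lparr>xtop = (quot E J)\<lparr>carrier := k\<rparr>, xbase = F, bd = quot_lift t,
    lact = (\<lambda>a b. j a \<otimes>\<^bsub>quot E J\<^esub> b), ract = (\<lambda>b a. b \<otimes>\<^bsub>quot E J\<^esub> j a)\<rparr>)"

sublocale E: ring E by (rule unital_algebraD(4)[OF E])
sublocale F: ring F by (rule unital_algebraD(4)[OF F])

lemmas E_alg = unital_algebraD(1)[OF E]
lemmas E_mod = unital_algebraD(2)[OF E]
lemmas E_bil = unital_algebraD(3)[OF E]
lemmas F_alg = unital_algebraD(1)[OF F]
lemmas F_mod = unital_algebraD(2)[OF F]
lemmas s_hom = alg_homD(1)[OF s]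
lemmas t_hom = alg_homD(1)[OF t]
lemmas i_hom = alg_homD(1)[OF i]

text \<open>A multiplier on the left is absorbed by the first factor, one on the right by the
  second, since kernels are ideals.\<close>

lemma ker_prod_ideal:
  assumes f: "f \<in> alg_hom K E F" and g: "g \<in> alg_hom K E F"
  shows "alg_ideal K E (prod_span K E (\<otimes>\<^bsub>E\<^esub>) (a_kernel E F f) (a_kernel E F g))"
proof -
  let ?A = "a_kernel E F f" and ?B = "a_kernel E F g"
  note fh = mod_homD(1)[OF alg_homD(1)[OF f]] and gh = mod_homD(1)[OF alg_homD(1)[OF g]]
  have c: "a \<otimes>\<^bsub>E\<^esub> b \<in> carrier E" if "a \<in> ?A" "b \<in> ?B" for a b using that by (simp add: mem_a_kernel)
  have sub: "submodule (prod_span K E (\<otimes>\<^bsub>E\<^esub>) ?A ?B) K E" by (rule prod_span_submodule[OF E_mod c])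
  show ?thesis
  proof (rule alg_idealI[OF sub])
    fix a z assume a: "a \<in> carrier E" and z: "z \<in> prod_span K E (\<otimes>\<^bsub>E\<^esub>) ?A ?B"
    show "a \<otimes>\<^bsub>E\<^esub> z \<in> prod_span K E (\<otimes>\<^bsub>E\<^esub>) ?A ?B"
    proof (rule prod_span_image[OF E_mod E_mod bilinear_mapD(1)[OF E_bil a] sub c _ z])
      fix x y assume xy: "x \<in> ?A" "y \<in> ?B"
      have "(a \<otimes>\<^bsub>E\<^esub> x) \<otimes>\<^bsub>E\<^esub> y \<in> prod_span K E (\<otimes>\<^bsub>E\<^esub>) ?A ?B"
        by (rule prod_span_mem) (use xy a in \<open>simp_all add: mem_a_kernel alg_homD(2)[OF f] fh\<close>)
      then show "a \<otimes>\<^bsub>E\<^esub> (x \<otimes>\<^bsub>E\<^esub> y) \<in> prod_span K E (\<otimes>\<^bsub>E\<^esub>) ?A ?B"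
        using a xy by (simp add: mem_a_kernel E.m_assoc)
    qed
    show "z \<otimes>\<^bsub>E\<^esub> a \<in> prod_span K E (\<otimes>\<^bsub>E\<^esub>) ?A ?B"
    proof (rule prod_span_image[OF E_mod E_mod bilinear_mapD(2)[OF E_bil a] sub c _ z])
      fix x y assume xy: "x \<in> ?A" "y \<in> ?B"
      have "x \<otimes>\<^bsub>E\<^esub> (y \<otimes>\<^bsub>E\<^esub> a) \<in> prod_span K E (\<otimes>\<^bsub>E\<^esub>) ?A ?B"
        by (rule prod_span_mem) (use xy a in \<open>simp_all add: mem_a_kernel alg_homD(2)[OF g] gh\<close>)
      then show "(x \<otimes>\<^bsub>E\<^esub> y) \<otimes>\<^bsub>E\<^esub> a \<in> prod_span K E (\<otimes>\<^bsub>E\<^esub>) ?A ?B"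
        using a xy by (simp add: mem_a_kernel E.m_assoc)
    qed
  qed
qed

lemmas st_ideal = ker_prod_ideal[OF s t]
lemmas ts_ideal = ker_prod_ideal[OF t s]
lemmas J_add = set_add_submodule[OF E_mod alg_idealD(1)[OF st_ideal] alg_idealD(1)[OF ts_ideal], folded J_def]

lemma J_least:
  assumes N: "submodule N K E"
    and "\<And>x y. \<lbrakk>x \<in> carrier E; y \<in> carrier E; s x = \<zero>\<^bsub>F\<^esub>; t y = \<zero>\<^bsub>F\<^esub>\<rbrakk> \<Longrightarrow> x \<otimes>\<^bsub>E\<^esub> y \<in> N"
    and "\<And>x y. \<lbrakk>x \<in> carrier E; y \<in> carrier E; s x = \<zero>\<^bsub>F\<^esub>; t y = \<zero>\<^bsub>F\<^esub>\<rbrakk> \<Longrightarrow> y \<otimes>\<^bsub>E\<^esub> x \<in> N"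
  shows "J \<subseteq> N"
proof
  have id: "(\<lambda>x. x) \<in> mod_hom K E E" by (rule mod_homI) simp_all
  have 1: "prod_span K E (\<otimes>\<^bsub>E\<^esub>) (a_kernel E F s) (a_kernel E F t) \<subseteq> N"
    "prod_span K E (\<otimes>\<^bsub>E\<^esub>) (a_kernel E F t) (a_kernel E F s) \<subseteq> N"
    unfolding prod_span_def by (rule mod_span_least[OF N]; use assms(2,3) in \<open>auto simp: mem_a_kernel\<close>)+
  fix z assume "z \<in> J"
  then show "z \<in> N"
    by (rule set_add_image[OF E_mod E_mod id N alg_idealD(1)[OF st_ideal] alg_idealD(1)[OF ts_ideal] _ _, folded J_def, rotated 2])
      (use 1 in auto)
qed

lemma J_mem:
  assumes "x \<in> carrier E" "y \<in> carrier E" "s x = \<zero>\<^bsub>F\<^esub>" "t y = \<zero>\<^bsub>F\<^esub>"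
  shows "x \<otimes>\<^bsub>E\<^esub> y \<in> J" "y \<otimes>\<^bsub>E\<^esub> x \<in> J"
  by (rule subsetD[OF J_add(2) prod_span_mem], use assms in \<open>simp_all add: mem_a_kernel\<close>)
    (rule subsetD[OF J_add(3) prod_span_mem], use assms in \<open>simp_all add: mem_a_kernel\<close>)

lemma J_ideal: "alg_ideal K E J"
proof (rule alg_idealI[OF J_add(1)])
  fix a z assume a: "a \<in> carrier E" and z: "z \<in> J"
  show "a \<otimes>\<^bsub>E\<^esub> z \<in> J"
    by (rule set_add_image[OF E_mod E_mod bilinear_mapD(1)[OF E_bil a] J_add(1) alg_idealD(1)[OF st_ideal]
          alg_idealD(1)[OF ts_ideal] _ _ z[unfolded J_def]])
      (use alg_idealD(2)[OF st_ideal a] alg_idealD(2)[OF ts_ideal a] J_add(2,3) in auto)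
  show "z \<otimes>\<^bsub>E\<^esub> a \<in> J"
    by (rule set_add_image[OF E_mod E_mod bilinear_mapD(2)[OF E_bil a] J_add(1) alg_idealD(1)[OF st_ideal]
          alg_idealD(1)[OF ts_ideal] _ _ z[unfolded J_def]])
      (use alg_idealD(3)[OF st_ideal a] alg_idealD(3)[OF ts_ideal a] J_add(2,3) in auto)
qed

lemmas J_sub = alg_idealD(1)[OF J_ideal]
lemmas Q_unital = unital_algebra_quot[OF E J_ideal]

text \<open>Each product that generates \<open>J\<close> has one factor in the kernel of
  \<open>s\<close> and one in the kernel of \<open>t\<close>, so both maps kill it.\<close>

lemma J_kernel: assumes "z \<in> J" shows "s z = \<zero>\<^bsub>F\<^esub>" "t z = \<zero>\<^bsub>F\<^esub>"
proof -
  note sc = mod_homD(1)[OF s_hom] and tc = mod_homD(1)[OF t_hom]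
  have "J \<subseteq> a_kernel E F s" "J \<subseteq> a_kernel E F t"
    by (rule J_least[OF a_kernel_submodule[OF E_mod F_mod s_hom]] J_least[OF a_kernel_submodule[OF E_mod F_mod t_hom]];
        simp add: mem_a_kernel alg_homD(2)[OF s] alg_homD(2)[OF t] sc tc)+
  then show "s z = \<zero>\<^bsub>F\<^esub>" "t z = \<zero>\<^bsub>F\<^esub>" using assms by (auto simp: mem_a_kernel)
qed

lemmas s_bar = quot_lift_alg_hom[OF E_alg F_alg J_ideal s J_kernel(1)]
lemmas t_bar = quot_lift_alg_hom[OF E_alg F_alg J_ideal t J_kernel(2)]

lemma s_bar_coset: "x \<in> carrier E \<Longrightarrow> quot_lift s (J +>\<^bsub>E\<^esub> x) = s x"
  by (rule quot_lift_hom[OF E_mod F_mod J_sub s_hom J_kernel(1)])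

lemma t_bar_coset: "x \<in> carrier E \<Longrightarrow> quot_lift t (J +>\<^bsub>E\<^esub> x) = t x"
  by (rule quot_lift_hom[OF E_mod F_mod J_sub t_hom J_kernel(2)])

lemma XM_assoc_xmod: "assoc_xmod K XM"
proof -
  let ?q = "quot E J" and ?s = "quot_lift s" and ?t = "quot_lift t" and ?j = "\<lambda>a. J +>\<^bsub>E\<^esub> i a"
  let ?k = "a_kernel ?q F ?s"
  let ?T = "?q\<lparr>carrier := ?k\<rparr>"
  interpret Q: unital_algebra K ?q by (rule Q_unital)
  note q = unital_algebraD[OF Q_unital]
  interpret Qr: ring ?q by (rule q)
  note Qs = bilinear_map_simps[OF q(3)]
  note sh = alg_homD[OF s_bar] and th = alg_homD[OF t_bar]
  have sub: "submodule ?k K ?q" by (rule a_kernel_submodule[OF q(2) F_mod sh(1)])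
  have kc: "x \<in> carrier ?q" if "x \<in> ?k" for x using that by (simp add: mem_a_kernel)
  have km: "x \<otimes>\<^bsub>?q\<^esub> y \<in> ?k" if "x \<in> carrier ?q" "y \<in> carrier ?q" "x \<in> ?k \<or> y \<in> ?k" for x y
    using that by (auto simp: mem_a_kernel sh(2) mod_homD(1)[OF sh(1)])
  have j: "?j \<in> alg_hom K F ?q"
    by (rule alg_homI[OF mod_hom_comp[OF i_hom alg_homD(1)[OF quot_algebra(2)[OF E_alg J_ideal]]]])
      (simp add: alg_homD(2)[OF i] alg_homD(2)[OF quot_algebra(2)[OF E_alg J_ideal]] mod_homD(1)[OF i_hom])
  note jc = mod_homD[OF alg_homD(1)[OF j]] and jm = alg_homD(2)[OF j]
  have tj: "?t (?j a) = a" if "a \<in> carrier F" for a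
    using that by (simp add: t_bar_coset mod_homD(1)[OF i_hom] ti)
  have "assoc_algebra K ?T"
    by (rule subalgebra[OF Q.assoc_algebra_axioms sub]) (simp add: km kc)
  moreover have "assoc_algebra K F"
    using F by (simp add: unital_algebra_def)
  moreover have "?t \<in> alg_hom K ?T F"
    using t_bar kc by (auto simp: alg_hom_def mod_hom_def)
  moreover have "bilinear_map K F ?T ?T (\<lambda>a b. ?j a \<otimes>\<^bsub>?q\<^esub> b)"
    by (intro bilinear_mapI mod_homI) (auto simp: km kc jc Qs)
  moreover have "bilinear_map K ?T F ?T (\<lambda>b a. b \<otimes>\<^bsub>?q\<^esub> ?j a)"
    by (intro bilinear_mapI mod_homI) (auto simp: km kc jc Qs)
  moreover have "?j (?t x) \<otimes>\<^bsub>?q\<^esub> y = x \<otimes>\<^bsub>?q\<^esub> y" "x \<otimes>\<^bsub>?q\<^esub> ?j (?t y) = x \<otimes>\<^bsub>?q\<^esub> y" if xy: "x \<in> ?k" "y \<in> ?k" for x y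
  proof -
    obtain a b where ab: "x = J +>\<^bsub>E\<^esub> a" "a \<in> carrier E" "s a = \<zero>\<^bsub>F\<^esub>" "y = J +>\<^bsub>E\<^esub> b" "b \<in> carrier E" "s b = \<zero>\<^bsub>F\<^esub>"
      using xy by (auto simp: mem_a_kernel quot_simps(1) s_bar_coset)
    note tc = mod_homD(1)[OF t_hom] and ic = mod_homD(1)[OF i_hom]
    \<comment> \<open>The Peiffer identities: modulo \<open>J\<close> a difference in the kernel of
      \<open>t\<close> multiplies the kernel of \<open>s\<close> to zero, so \<open>i (t z)\<close>
      and \<open>z\<close> multiply that kernel alike. The two identities use the two orders of the
      factors, and \<open>J\<close> contains both.\<close>
    have d: "i (t z) \<ominus>\<^bsub>E\<^esub> z \<in> carrier E" "t (i (t z) \<ominus>\<^bsub>E\<^esub> z) = \<zero>\<^bsub>F\<^esub>" if "z \<in> carrier E" for z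
      using that by (auto simp: tc ic mod_hom_neg(3)[OF E_mod F_mod t_hom] ti F.minus_eq F.r_neg)
    have "(i (t a) \<ominus>\<^bsub>E\<^esub> a) \<otimes>\<^bsub>E\<^esub> b \<in> J" "a \<otimes>\<^bsub>E\<^esub> (i (t b) \<ominus>\<^bsub>E\<^esub> b) \<in> J"
      using J_mem(2)[OF ab(5) d(1)[OF ab(2)] ab(6) d(2)[OF ab(2)]] J_mem(1)[OF ab(2) d(1)[OF ab(5)] ab(3) d(2)[OF ab(5)]] .
    then have "i (t a) \<otimes>\<^bsub>E\<^esub> b \<ominus>\<^bsub>E\<^esub> a \<otimes>\<^bsub>E\<^esub> b \<in> J" "a \<otimes>\<^bsub>E\<^esub> i (t b) \<ominus>\<^bsub>E\<^esub> a \<otimes>\<^bsub>E\<^esub> b \<in> J"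
      using ab by (simp_all add: bilinear_map_neg(5,6)[OF E_mod E_mod E_mod E_bil] tc ic)
    then show "?j (?t x) \<otimes>\<^bsub>?q\<^esub> y = x \<otimes>\<^bsub>?q\<^esub> y" "x \<otimes>\<^bsub>?q\<^esub> ?j (?t y) = x \<otimes>\<^bsub>?q\<^esub> y"
      using ab by (simp_all add: t_bar_coset quot_mult[OF E_alg J_ideal] tc ic coset_eq_iff[OF E_mod J_sub])
  qed
  ultimately show ?thesis
    unfolding assoc_xmod_def XM_def Let_def
    by (simp add: jm jc kc Qr.m_assoc th(2) tj)
qed

end

subsection \<open>Transport of structure\<close>

text \<open>Nothing is presupposed about \<open>D\<close>: closure of its operations is among the
  conditions, and every axiom is carried over from \<open>X\<close> through the inverse bijections.
  The maps run from \<open>D\<close> to \<open>X\<close>, against the final isomorphism, because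
  \<open>kappa\<close> and \<open>iota\<close> are built in that direction.\<close>

lemma assoc_xmod_transport:
  fixes X :: "('k, 'b, 'a) xmod" and D :: "('k, 'd, 'c) xmod"
  assumes X: "assoc_xmod K X"
    and bij: "bij_betw \<phi> (carrier (xtop D)) (carrier (xtop X))" "bij_betw \<psi> (carrier (xbase D)) (carrier (xbase X))"
    and \<phi>_zero: "\<zero>\<^bsub>xtop D\<^esub> \<in> carrier (xtop D)" "\<phi> \<zero>\<^bsub>xtop D\<^esub> = \<zero>\<^bsub>xtop X\<^esub>"
    and \<phi>_add: "\<And>x y. \<lbrakk>x \<in> carrier (xtop D); y \<in> carrier (xtop D)\<rbrakk> \<Longrightarrow>
      x \<oplus>\<^bsub>xtop D\<^esub> y \<in> carrier (xtop D) \<and> \<phi> (x \<oplus>\<^bsub>xtop D\<^esub> y) = \<phi> x \<oplus>\<^bsub>xtop X\<^esub> \<phi> y"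
    and \<phi>_smult: "\<And>k x. \<lbrakk>k \<in> carrier K; x \<in> carrier (xtop D)\<rbrakk> \<Longrightarrow>
      k \<odot>\<^bsub>xtop D\<^esub> x \<in> carrier (xtop D) \<and> \<phi> (k \<odot>\<^bsub>xtop D\<^esub> x) = k \<odot>\<^bsub>xtop X\<^esub> \<phi> x"
    and \<phi>_mult: "\<And>x y. \<lbrakk>x \<in> carrier (xtop D); y \<in> carrier (xtop D)\<rbrakk> \<Longrightarrow>
      x \<otimes>\<^bsub>xtop D\<^esub> y \<in> carrier (xtop D) \<and> \<phi> (x \<otimes>\<^bsub>xtop D\<^esub> y) = \<phi> x \<otimes>\<^bsub>xtop X\<^esub> \<phi> y"
    and \<psi>_zero: "\<zero>\<^bsub>xbase D\<^esub> \<in> carrier (xbase D)" "\<psi> \<zero>\<^bsub>xbase D\<^esub> = \<zero>\<^bsub>xbase X\<^esub>"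
    and \<psi>_add: "\<And>x y. \<lbrakk>x \<in> carrier (xbase D); y \<in> carrier (xbase D)\<rbrakk> \<Longrightarrow>
      x \<oplus>\<^bsub>xbase D\<^esub> y \<in> carrier (xbase D) \<and> \<psi> (x \<oplus>\<^bsub>xbase D\<^esub> y) = \<psi> x \<oplus>\<^bsub>xbase X\<^esub> \<psi> y"
    and \<psi>_smult: "\<And>k x. \<lbrakk>k \<in> carrier K; x \<in> carrier (xbase D)\<rbrakk> \<Longrightarrow>
      k \<odot>\<^bsub>xbase D\<^esub> x \<in> carrier (xbase D) \<and> \<psi> (k \<odot>\<^bsub>xbase D\<^esub> x) = k \<odot>\<^bsub>xbase X\<^esub> \<psi> x"
    and \<psi>_mult: "\<And>x y. \<lbrakk>x \<in> carrier (xbase D); y \<in> carrier (xbase D)\<rbrakk> \<Longrightarrow>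
      x \<otimes>\<^bsub>xbase D\<^esub> y \<in> carrier (xbase D) \<and> \<psi> (x \<otimes>\<^bsub>xbase D\<^esub> y) = \<psi> x \<otimes>\<^bsub>xbase X\<^esub> \<psi> y"
    and bd: "\<And>x. x \<in> carrier (xtop D) \<Longrightarrow> bd D x \<in> carrier (xbase D) \<and> \<psi> (bd D x) = bd X (\<phi> x)"
    and lact: "\<And>a x. \<lbrakk>a \<in> carrier (xbase D); x \<in> carrier (xtop D)\<rbrakk> \<Longrightarrow>
      lact D a x \<in> carrier (xtop D) \<and> \<phi> (lact D a x) = lact X (\<psi> a) (\<phi> x)"
    and ract: "\<And>a x. \<lbrakk>a \<in> carrier (xbase D); x \<in> carrier (xtop D)\<rbrakk> \<Longrightarrow>
      ract D x a \<in> carrier (xtop D) \<and> \<phi> (ract D x a) = ract X (\<phi> x) (\<psi> a)"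
  shows "assoc_xmod_isomorphic K X D"
proof -
  define f where "f = inv_into (carrier (xtop D)) \<phi>"
  define g where "g = inv_into (carrier (xbase D)) \<psi>"
  note X' = X[unfolded assoc_xmod_def]
  have XT: "assoc_algebra K (xtop X)" and XB: "assoc_algebra K (xbase X)" using X' by blast+
  note xt = bilinear_algebraD[OF assoc_algebra.axioms(1)[OF XT]]
    and xb = bilinear_algebraD[OF assoc_algebra.axioms(1)[OF XB]]
  note ib = bij_betw_inv_into[OF bij(1), folded f_def] bij_betw_inv_into[OF bij(2), folded g_def]
  have sf: "carrier (xtop D) = f ` carrier (xtop X)" "carrier (xbase D) = g ` carrier (xbase X)"
    using ib by (simp_all add: bij_betw_def)
  have f\<phi>: "f (\<phi> x) = x" if "x \<in> carrier (xtop D)" for x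
    using bij(1) that by (simp add: bij_betw_inv_into_left f_def g_def)
  have g\<psi>: "g (\<psi> x) = x" if "x \<in> carrier (xbase D)" for x
    using bij(2) that by (simp add: bij_betw_inv_into_left f_def g_def)
  have \<phi>f: "\<phi> (f x) = x" "f x \<in> carrier (xtop D)" if "x \<in> carrier (xtop X)" for x
    using bij_betw_inv_into_right[OF bij(1) that] ib(1) that by (auto simp: f_def bij_betw_def)
  have \<psi>g: "\<psi> (g x) = x" "g x \<in> carrier (xbase D)" if "x \<in> carrier (xbase X)" for x
    using bij_betw_inv_into_right[OF bij(2) that] ib(2) that by (auto simp: g_def bij_betw_def)
  have f_add: "f x \<oplus>\<^bsub>xtop D\<^esub> f y = f (x \<oplus>\<^bsub>xtop X\<^esub> y)" if "x \<in> carrier (xtop X)" "y \<in> carrier (xtop X)" for x y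
    using f\<phi>[of "f x \<oplus>\<^bsub>xtop D\<^esub> f y"] \<phi>_add \<phi>f that by simp
  have f_smult: "k \<odot>\<^bsub>xtop D\<^esub> f x = f (k \<odot>\<^bsub>xtop X\<^esub> x)" if "k \<in> carrier K" "x \<in> carrier (xtop X)" for k x
    using f\<phi>[of "k \<odot>\<^bsub>xtop D\<^esub> f x"] \<phi>_smult \<phi>f that by simp
  have f_mult: "f x \<otimes>\<^bsub>xtop D\<^esub> f y = f (x \<otimes>\<^bsub>xtop X\<^esub> y)" if "x \<in> carrier (xtop X)" "y \<in> carrier (xtop X)" for x y
    using f\<phi>[of "f x \<otimes>\<^bsub>xtop D\<^esub> f y"] \<phi>_mult \<phi>f that by simp
  have g_add: "g x \<oplus>\<^bsub>xbase D\<^esub> g y = g (x \<oplus>\<^bsub>xbase X\<^esub> y)" if "x \<in> carrier (xbase X)" "y \<in> carrier (xbase X)" for x y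
    using g\<psi>[of "g x \<oplus>\<^bsub>xbase D\<^esub> g y"] \<psi>_add \<psi>g that by simp
  have g_smult: "k \<odot>\<^bsub>xbase D\<^esub> g x = g (k \<odot>\<^bsub>xbase X\<^esub> x)" if "k \<in> carrier K" "x \<in> carrier (xbase X)" for k x
    using g\<psi>[of "k \<odot>\<^bsub>xbase D\<^esub> g x"] \<psi>_smult \<psi>g that by simp
  have g_mult: "g x \<otimes>\<^bsub>xbase D\<^esub> g y = g (x \<otimes>\<^bsub>xbase X\<^esub> y)" if "x \<in> carrier (xbase X)" "y \<in> carrier (xbase X)" for x y
    using g\<psi>[of "g x \<otimes>\<^bsub>xbase D\<^esub> g y"] \<psi>_mult \<psi>g that by simp
  have f_zero: "f \<zero>\<^bsub>xtop X\<^esub> = \<zero>\<^bsub>xtop D\<^esub>" using f\<phi>[OF \<phi>_zero(1)] \<phi>_zero(2) by simp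
  have g_zero: "g \<zero>\<^bsub>xbase X\<^esub> = \<zero>\<^bsub>xbase D\<^esub>" using g\<psi>[OF \<psi>_zero(1)] \<psi>_zero(2) by simp
  have g_bd: "bd D (f x) = g (bd X x)" if "x \<in> carrier (xtop X)" for x
    using g\<psi>[of "bd D (f x)"] bd \<phi>f that by simp
  have f_lact: "lact D (g a) (f x) = f (lact X a x)" if "a \<in> carrier (xbase X)" "x \<in> carrier (xtop X)" for a x
    using f\<phi>[of "lact D (g a) (f x)"] lact \<phi>f \<psi>g that by simp
  have f_ract: "ract D (f x) (g a) = f (ract X x a)" if "a \<in> carrier (xbase X)" "x \<in> carrier (xtop X)" for a x
    using f\<phi>[of "ract D (f x) (g a)"] ract \<phi>f \<psi>g that by simp
  have fh: "f \<in> mod_hom K (xtop X) (xtop D)"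
    by (rule mod_homI) (simp_all add: \<phi>f f_add f_smult)
  have gh: "g \<in> mod_hom K (xbase X) (xbase D)"
    by (rule mod_homI) (simp_all add: \<psi>g g_add g_smult)
  have DT: "module K (xtop D)" by (rule module_surj_image[OF xt(1) sf(1) f_zero f_add f_smult])
  have DB: "module K (xbase D)" by (rule module_surj_image[OF xb(1) sf(2) g_zero g_add g_smult])
  have XL: "bilinear_map K (xbase X) (xtop X) (xtop X) (lact X)"
    and XR: "bilinear_map K (xtop X) (xbase X) (xtop X) (ract X)"
    and Xbd: "bd X \<in> alg_hom K (xtop X) (xbase X)" using X' by blast+
  note cl = bilinear_map_simps(1)[OF xt(2)] bilinear_map_simps(1)[OF xb(2)]
    bilinear_map_simps(1)[OF XL] bilinear_map_simps(1)[OF XR] mod_homD(1)[OF alg_homD(1)[OF Xbd]]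
  have 1: "assoc_algebra K (xtop D)"
    unfolding assoc_algebra_def assoc_algebra_axioms_def
    by (intro conjI bilinear_algebraI[OF DT] bilinear_map_surj_image[OF xt(2) xt(1) xt(1) fh fh fh sf(1) sf(1)])
      (auto simp: sf(1) f_mult cl assoc_algebra.mult_assoc[OF XT])
  have 2: "assoc_algebra K (xbase D)"
    unfolding assoc_algebra_def assoc_algebra_axioms_def
    by (intro conjI bilinear_algebraI[OF DB] bilinear_map_surj_image[OF xb(2) xb(1) xb(1) gh gh gh sf(2) sf(2)])
      (auto simp: sf(2) g_mult cl assoc_algebra.mult_assoc[OF XB])
  have 3: "bd D \<in> alg_hom K (xtop D) (xbase D)"
    by (rule alg_homI[OF mod_hom_surj_image[OF xt(1) mod_hom_comp[OF alg_homD(1)[OF Xbd] gh] fh sf(1)[symmetric] g_bd]])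
      (auto simp: sf(1) f_mult g_bd g_mult cl alg_homD(2)[OF Xbd])
  have 4: "bilinear_map K (xbase D) (xtop D) (xtop D) (lact D)"
    by (rule bilinear_map_surj_image[OF XL xb(1) xt(1) gh fh fh sf(2,1) f_lact])
  have 5: "bilinear_map K (xtop D) (xbase D) (xtop D) (ract D)"
    by (rule bilinear_map_surj_image[OF XR xt(1) xb(1) fh gh fh sf(1,2)]) (simp add: f_ract)
  note eqs = X'[THEN conjunct2, THEN conjunct2, THEN conjunct2, THEN conjunct2, THEN conjunct2]
  have "assoc_xmod K D"
    unfolding assoc_xmod_def
  proof (intro conjI 1 2 3 4 5 ballI; unfold sf; elim imageE; hypsubst)
  qed (simp_all add: f_lact f_ract f_mult g_mult g_bd cl eqs)
  moreover have "(f, g) \<in> assoc_xmod_hom K X D"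
    unfolding assoc_xmod_hom_def
    by (auto simp: f_lact f_ract g_bd intro!: alg_homI fh gh f_mult[symmetric] g_mult[symmetric])
  ultimately show ?thesis
    unfolding assoc_xmod_isomorphic_def using X ib by blast
qed

subsection \<open>Crossed modules of enveloping algebras\<close>

text \<open>The situation of the theorem without crossed modules: \<qq> \<rtimes> \<pp> and \<pp>
  with their Lie quotients, the two maps s and t, and their common section i.\<close>

locale cat1_lie =
  s: lie_quotient_hom K P L p act P' L' p' act' f h +
  t: lie_quotient_hom K P L p act P' L' p' act' f' h' +
  i: lie_quotient_hom K P' L' p' act' P L p act g k
  for K :: "('k, 'z) ring_scheme" and P :: "('k, 'p) module" and L :: "('k, 'l) module" and p act
    and P' :: "('k, 'q) module" and L' :: "('k, 'm) module" and p' act' f h f' h' g k +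
  assumes fg: "\<And>x. x \<in> carrier P' \<Longrightarrow> f (g x) = x" and f'g: "\<And>x. x \<in> carrier P' \<Longrightarrow> f' (g x) = x"
begin

text \<open>Both composites agree with the identity on the unit and on the generators, and the
  induction over \<open>UL\<close> does the rest. \<open>U_section\<close> is the same for the Lie
  quotients.\<close>

lemma UL_section:
  assumes "e \<in> alg_hom K P P'" "\<And>x. x \<in> carrier P' \<Longrightarrow> e (g x) = x" "y \<in> carrier (UL K P')"
  shows "UL_map K P' e (UL_map K P g y) = y"
proof -
  note E = UL_map[OF s.A.P s.B.P assms(1)] and G = UL_map[OF s.B.P s.A.P i.f]
  have id: "(\<lambda>x. x) \<in> mod_hom K (UL K P') (UL K P')" by (rule mod_homI) simp_all
  let ?N = "{y \<in> carrier (UL K P'). UL_map K P' e (UL_map K P g y) = y}"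
  have sub: "submodule ?N K (UL K P')"
    by (rule submodule_equalizer[OF s.B.UL_mod s.B.UL_mod mod_hom_comp[OF alg_homD(1)[OF G(1)] alg_homD(1)[OF E(1)]] id])
  note c = mod_homD(1)[OF alg_homD(1)[OF G(1)]]
  have "y \<in> ?N"
    by (rule UL_induct[OF s.B.P sub _ _ _ assms(3)])
      (simp_all add: G E c alg_homD(2)[OF G(1)] alg_homD(2)[OF E(1)] s.B.l_closed s.B.r_closed
        s.A.l_closed s.A.r_closed i.f_closed assms(2))
  then show ?thesis by simp
qed

lemma U_section:
  assumes "e \<in> alg_hom K L L'" "\<And>x. x \<in> carrier L' \<Longrightarrow> e (k x) = x" "y \<in> carrier (U K L')"
  shows "U_map K L' e (U_map K L k y) = y"
proof -
  note E = U_map[OF s.A.L s.B.L assms(1)] and G = i.Uh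
  have id: "(\<lambda>x. x) \<in> mod_hom K (U K L') (U K L')" by (rule mod_homI) simp_all
  let ?N = "{y \<in> carrier (U K L'). U_map K L' e (U_map K L k y) = y}"
  have sub: "submodule ?N K (U K L')"
    by (rule submodule_equalizer[OF s.B.U_mod s.B.U_mod mod_hom_comp[OF alg_homD(1)[OF G(1)] alg_homD(1)[OF E(1)]] id])
  note c = mod_homD(1)[OF alg_homD(1)[OF G(1)]] mod_homD(1)[OF alg_homD(1)[OF i.h]]
  have "y \<in> ?N"
    by (rule U_induct[OF s.B.L sub _ _ assms(3)])
      (auto simp: G E c alg_homD(2)[OF G(1)] alg_homD(2)[OF E(1)] s.B.gen_closed s.A.gen_closed assms(2))
  then show ?thesis by simp
qed

lemma hk: "x \<in> carrier L' \<Longrightarrow> h (k x) = x" "x \<in> carrier L' \<Longrightarrow> h' (k x) = x"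
  by (erule s.B.L_cases, simp add: i.hp s.hp i.f_closed fg)
    (erule s.B.L_cases, simp add: i.hp t.hp i.f_closed f'g)

sublocale cat: cat1_algebra K "UL K P" "UL K P'" "UL_map K P' f" "UL_map K P' f'" "UL_map K P g"
  by (rule cat1_algebra.intro)
    (simp_all add: s.A.UL_alg s.B.UL_alg s.ULf t.ULf i.ULf UL_section[OF s.f] UL_section[OF t.f] fg f'g)

sublocale catU: cat1_algebra K "U K L" "U K L'" "s.Uh" "t.Uh" "i.Uh"
  by (rule cat1_algebra.intro)
    (simp_all add: s.A.U_alg s.B.U_alg s.Uh t.Uh i.Uh U_section[OF s.h] U_section[OF t.h] hk)

abbreviation "M \<equiv> s.A.M"
abbreviation "E \<equiv> UL K P"
abbreviation "V \<equiv> U K L"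
abbreviation "X \<equiv> catU.J"
abbreviation "J \<equiv> cat.J"
abbreviation "Ks \<equiv> a_kernel s.A.M s.B.M s.Mh"
abbreviation "Kt \<equiv> a_kernel s.A.M s.B.M t.Mh"
abbreviation "Us \<equiv> a_kernel (U K L) (U K L') s.Uh"
abbreviation "Ut \<equiv> a_kernel (U K L) (U K L') t.Uh"

definition "Y = prod_span K M s.A.R Ks Ut <+>\<^bsub>M\<^esub> prod_span K M s.A.lc Us Kt
  <+>\<^bsub>M\<^esub> prod_span K M s.A.R Kt Us <+>\<^bsub>M\<^esub> prod_span K M s.A.lc Ut Ks"

lemmas lc_closed = mod_homD(1)[OF s.A.lc(1)]

lemma Y_parts:
  "submodule (prod_span K M s.A.R Ks Ut) K M" "submodule (prod_span K M s.A.lc Us Kt) K M"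
  "submodule (prod_span K M s.A.R Kt Us) K M" "submodule (prod_span K M s.A.lc Ut Ks) K M"
  by (rule prod_span_submodule[OF s.A.M_mod]; simp add: mem_a_kernel lc_closed s.A.R_closed)+

lemmas Y_sum1 = set_add_submodule[OF s.A.M_mod Y_parts(1,2)]
lemmas Y_sum2 = set_add_submodule[OF s.A.M_mod Y_sum1(1) Y_parts(3)]
lemmas Y_sum3 = set_add_submodule[OF s.A.M_mod Y_sum2(1) Y_parts(4), folded Y_def]
lemmas Y_sub = Y_sum3(1)

lemma Y_mem:
  "\<lbrakk>a \<in> Ks; u \<in> Ut\<rbrakk> \<Longrightarrow> s.A.R a u \<in> Y" "\<lbrakk>u \<in> Us; a \<in> Kt\<rbrakk> \<Longrightarrow> s.A.lc u a \<in> Y"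
  "\<lbrakk>a \<in> Kt; u \<in> Us\<rbrakk> \<Longrightarrow> s.A.R a u \<in> Y" "\<lbrakk>u \<in> Ut; a \<in> Ks\<rbrakk> \<Longrightarrow> s.A.lc u a \<in> Y"
proof -
  show "\<lbrakk>a \<in> Ks; u \<in> Ut\<rbrakk> \<Longrightarrow> s.A.R a u \<in> Y"
    by (rule subsetD[OF Y_sum3(2) subsetD[OF Y_sum2(2) subsetD[OF Y_sum1(2) prod_span_mem]]])
  show "\<lbrakk>u \<in> Us; a \<in> Kt\<rbrakk> \<Longrightarrow> s.A.lc u a \<in> Y"
    by (rule subsetD[OF Y_sum3(2) subsetD[OF Y_sum2(2) subsetD[OF Y_sum1(3) prod_span_mem]]])
  show "\<lbrakk>a \<in> Kt; u \<in> Us\<rbrakk> \<Longrightarrow> s.A.R a u \<in> Y"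
    by (rule subsetD[OF Y_sum3(2) subsetD[OF Y_sum2(3) prod_span_mem]])
  show "\<lbrakk>u \<in> Ut; a \<in> Ks\<rbrakk> \<Longrightarrow> s.A.lc u a \<in> Y"
    by (rule subsetD[OF Y_sum3(3) prod_span_mem])
qed

text \<open>Nested sums and spans are unwound once here, so that later arguments only meet the four
  kinds of generating products.\<close>

lemma Y_image:
  assumes N: "module K N" and e: "e \<in> mod_hom K M N" and N': "submodule N' K N"
    and 1: "\<And>a u. \<lbrakk>a \<in> Ks; u \<in> Ut\<rbrakk> \<Longrightarrow> e (s.A.R a u) \<in> N'"
    and 2: "\<And>a u. \<lbrakk>u \<in> Us; a \<in> Kt\<rbrakk> \<Longrightarrow> e (s.A.lc u a) \<in> N'"
    and 3: "\<And>a u. \<lbrakk>a \<in> Kt; u \<in> Us\<rbrakk> \<Longrightarrow> e (s.A.R a u) \<in> N'"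
    and 4: "\<And>a u. \<lbrakk>u \<in> Ut; a \<in> Ks\<rbrakk> \<Longrightarrow> e (s.A.lc u a) \<in> N'"
    and z: "z \<in> Y"
  shows "e z \<in> N'"
proof -
  note add = set_add_image[OF s.A.M_mod N e N']
  note im = prod_span_image[OF s.A.M_mod N e N']
  have c: "s.A.R a u \<in> carrier M" "s.A.lc u a \<in> carrier M" if "a \<in> carrier M" "u \<in> carrier V" for a u
    using that by (simp_all add: lc_closed s.A.R_closed)
  have p1: "e z \<in> N'" if "z \<in> prod_span K M s.A.R Ks Ut" for z
    by (rule im[OF _ 1 that]) (simp_all add: mem_a_kernel c)
  have p2: "e z \<in> N'" if "z \<in> prod_span K M s.A.lc Us Kt" for z
    by (rule im[OF _ 2 that]) (simp_all add: mem_a_kernel c)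
  have p3: "e z \<in> N'" if "z \<in> prod_span K M s.A.R Kt Us" for z
    by (rule im[OF _ 3 that]) (simp_all add: mem_a_kernel c)
  have p4: "e z \<in> N'" if "z \<in> prod_span K M s.A.lc Ut Ks" for z
    by (rule im[OF _ 4 that]) (simp_all add: mem_a_kernel c)
  have q1: "e z \<in> N'" if "z \<in> prod_span K M s.A.R Ks Ut <+>\<^bsub>M\<^esub> prod_span K M s.A.lc Us Kt" for z
    by (rule add[OF Y_parts(1,2) p1 p2 that])
  have q2: "e z \<in> N'" if "z \<in> prod_span K M s.A.R Ks Ut <+>\<^bsub>M\<^esub> prod_span K M s.A.lc Us Kt
      <+>\<^bsub>M\<^esub> prod_span K M s.A.R Kt Us" for z
    by (rule add[OF Y_sum1(1) Y_parts(3) q1 p3 that])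
  show ?thesis by (rule add[OF Y_sum2(1) Y_parts(4) q2 p4 z[unfolded Y_def]])
qed

text \<open>\<alpha> is a bimodule map, and by naturality it sends the kernels on the tensor
  products into the kernels on \<open>U\<close>. So every generating product of \<open>Y\<close>
  goes to a product of the two kernels, in one order or the other. The boundary map of the quotient
  rests on this.\<close>

lemma al_Y: assumes "z \<in> Y" shows "s.A.al z \<in> X"
proof (rule Y_image[OF s.A.U_mod s.A.al(1) catU.J_sub _ _ _ _ assms])
  have al: "s.Uh (s.A.al a) = \<zero>\<^bsub>U K L'\<^esub>" if "a \<in> Ks" for a
    using that by (simp add: mem_a_kernel s.al_natural[symmetric] mod_hom_neg(1)[OF s.B.M_mod s.B.U_mod s.B.al(1)])
  have al': "t.Uh (s.A.al a) = \<zero>\<^bsub>U K L'\<^esub>" if "a \<in> Kt" for a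
    using that by (simp add: mem_a_kernel t.al_natural[symmetric] mod_hom_neg(1)[OF s.B.M_mod s.B.U_mod s.B.al(1)])
  note m = mem_a_kernel s.A.al_closed s.A.al_R s.A.al_lc
  show "s.A.al (s.A.R a u) \<in> X" if "a \<in> Ks" "u \<in> Ut" for a u
    using that al[OF that(1)] by (auto simp: m intro!: catU.J_mem(1))
  show "s.A.al (s.A.lc u a) \<in> X" if "u \<in> Us" "a \<in> Kt" for a u
    using that al'[OF that(2)] by (auto simp: m intro!: catU.J_mem(1))
  show "s.A.al (s.A.R a u) \<in> X" if "a \<in> Kt" "u \<in> Us" for a u
    using that al'[OF that(1)] by (auto simp: m intro!: catU.J_mem(2))
  show "s.A.al (s.A.lc u a) \<in> X" if "u \<in> Ut" "a \<in> Ks" for a u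
    using that al[OF that(2)] by (auto simp: m intro!: catU.J_mem(2))
qed

abbreviation "iota \<equiv> s.A.iota"

text \<open>The first component of the product of \<open>(a, u)\<close> and \<open>(b, w)\<close>,
  common to the algebra before and after passing to the quotient.\<close>

definition "mu a u b w = s.A.lc (s.A.al a) b \<oplus>\<^bsub>M\<^esub> s.A.R a w \<oplus>\<^bsub>M\<^esub> s.A.lc u b"

lemma mu_closed:
  "\<lbrakk>a \<in> carrier M; u \<in> carrier V; b \<in> carrier M; w \<in> carrier V\<rbrakk> \<Longrightarrow> mu a u b w \<in> carrier M"
  by (simp add: mu_def lc_closed s.A.R_closed s.A.al_closed)

lemma iota_mu:
  "\<lbrakk>a \<in> carrier M; u \<in> carrier V; b \<in> carrier M; w \<in> carrier V\<rbrakk>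
    \<Longrightarrow> iota (mu a u b w, u \<otimes>\<^bsub>V\<^esub> w) = iota (a, u) \<otimes>\<^bsub>E\<^esub> iota (b, w)"
  by (simp add: mu_def s.A.iota_mult)

lemma iota_closed: "\<lbrakk>a \<in> carrier M; u \<in> carrier V\<rbrakk> \<Longrightarrow> iota (a, u) \<in> carrier E"
  by (rule mod_homD(1)[OF s.A.iota_hom]) (simp add: dsum_simps)

lemma E_cases:
  assumes "e \<in> carrier E" obtains a u where "a \<in> carrier M" "u \<in> carrier V" "e = iota (a, u)"
  using assms unfolding s.A.iota_surj[symmetric] by (auto simp: dsum_simps(1))

lemma iota_iM: "a \<in> carrier M \<Longrightarrow> s.A.iM a = iota (a, \<zero>\<^bsub>V\<^esub>)"
  by (simp add: s.A.iota_def s.A.iM_closed mod_hom_neg(1)[OF s.A.U_mod s.A.UL_mod s.A.rU_hom])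

lemma iota_rU: "u \<in> carrier V \<Longrightarrow> s.A.rU u = iota (\<zero>\<^bsub>M\<^esub>, u)"
  by (simp add: s.A.iota_def s.A.rU_closed mod_hom_neg(1)[OF s.A.M_mod s.A.UL_mod s.A.iM(1)])

lemma zero_maps: "s.Mh \<zero>\<^bsub>M\<^esub> = \<zero>\<^bsub>s.B.M\<^esub>" "t.Mh \<zero>\<^bsub>M\<^esub> = \<zero>\<^bsub>s.B.M\<^esub>" "s.Uh \<zero>\<^bsub>V\<^esub> = \<zero>\<^bsub>U K L'\<^esub>" "t.Uh \<zero>\<^bsub>V\<^esub> = \<zero>\<^bsub>U K L'\<^esub>"
  by (simp_all add: mod_hom_neg(1)[OF s.A.M_mod s.B.M_mod s.Mh(1)] mod_hom_neg(1)[OF s.A.M_mod s.B.M_mod t.Mh(1)]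
    mod_hom_neg(1)[OF s.A.U_mod s.B.U_mod alg_homD(1)[OF s.Uh(1)]] mod_hom_neg(1)[OF s.A.U_mod s.B.U_mod alg_homD(1)[OF t.Uh(1)]])

text \<open>\<open>kernel_iff\<close> for pairs with one component zero, where the other half of the
  condition holds by itself.\<close>

lemma kernels:
  "a \<in> carrier M \<Longrightarrow> UL_map K P' f (s.A.iM a) = \<zero>\<^bsub>UL K P'\<^esub> \<longleftrightarrow> a \<in> Ks"
  "a \<in> carrier M \<Longrightarrow> UL_map K P' f' (s.A.iM a) = \<zero>\<^bsub>UL K P'\<^esub> \<longleftrightarrow> a \<in> Kt"
  "u \<in> carrier V \<Longrightarrow> UL_map K P' f (s.A.rU u) = \<zero>\<^bsub>UL K P'\<^esub> \<longleftrightarrow> u \<in> Us"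
  "u \<in> carrier V \<Longrightarrow> UL_map K P' f' (s.A.rU u) = \<zero>\<^bsub>UL K P'\<^esub> \<longleftrightarrow> u \<in> Ut"
  by (simp_all add: iota_iM iota_rU s.kernel_iff t.kernel_iff zero_maps mem_a_kernel)

lemma kernels_iota:
  assumes "a \<in> carrier M" "u \<in> carrier V"
  shows "UL_map K P' f (iota (a, u)) = \<zero>\<^bsub>UL K P'\<^esub> \<longleftrightarrow> a \<in> Ks \<and> u \<in> Us"
    "UL_map K P' f' (iota (a, u)) = \<zero>\<^bsub>UL K P'\<^esub> \<longleftrightarrow> a \<in> Kt \<and> u \<in> Ut"
  using assms by (simp_all add: s.kernel_iff t.kernel_iff mem_a_kernel)

text \<open>\<open>iM\<close> respects both actions, so each generating product of \<open>Y\<close>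
  becomes a product in \<open>E\<close> of an element of one kernel with an element of the other, in
  the same order.\<close>

lemma iM_Y: assumes "z \<in> Y" shows "s.A.iM z \<in> J"
proof (rule Y_image[OF s.A.UL_mod s.A.iM(1) cat.J_sub _ _ _ _ assms])
  have c: "a \<in> carrier M" if "a \<in> Ks \<or> a \<in> Kt" for a using that by (auto simp: mem_a_kernel)
  have d: "u \<in> carrier V" if "u \<in> Us \<or> u \<in> Ut" for u using that by (auto simp: mem_a_kernel)
  note m = c d s.A.iM_R s.A.iM_lc s.A.iM_closed s.A.rU_closed kernels
  show "s.A.iM (s.A.R a u) \<in> J" if "a \<in> Ks" "u \<in> Ut" for a u
    using that cat.J_mem(1)[of "s.A.iM a" "s.A.rU u"] by (simp add: m)
  show "s.A.iM (s.A.lc u a) \<in> J" if "u \<in> Us" "a \<in> Kt" for a u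
    using that cat.J_mem(1)[of "s.A.rU u" "s.A.iM a"] by (simp add: m)
  show "s.A.iM (s.A.R a u) \<in> J" if "a \<in> Kt" "u \<in> Us" for a u
    using that cat.J_mem(2)[of "s.A.rU u" "s.A.iM a"] by (simp add: m)
  show "s.A.iM (s.A.lc u a) \<in> J" if "u \<in> Ut" "a \<in> Ks" for a u
    using that cat.J_mem(2)[of "s.A.iM a" "s.A.rU u"] by (simp add: m)
qed

lemma rU_X: assumes "z \<in> X" shows "s.A.rU z \<in> J"
proof -
  note pre = submodule_preimage[OF s.A.U_mod s.A.UL_mod s.A.rU_hom cat.J_sub]
  have "X \<subseteq> {u \<in> carrier V. s.A.rU u \<in> J}"
  proof (rule catU.J_least[OF pre])
    fix x y assume xy: "x \<in> carrier V" "y \<in> carrier V" "s.Uh x = \<zero>\<^bsub>U K L'\<^esub>" "t.Uh y = \<zero>\<^bsub>U K L'\<^esub>"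
    have "s.A.rU x \<otimes>\<^bsub>E\<^esub> s.A.rU y \<in> J" "s.A.rU y \<otimes>\<^bsub>E\<^esub> s.A.rU x \<in> J"
      by (rule cat.J_mem; use xy in \<open>simp add: s.A.rU_closed kernels mem_a_kernel\<close>)+
    then show "x \<otimes>\<^bsub>V\<^esub> y \<in> {u \<in> carrier V. s.A.rU u \<in> J}" "y \<otimes>\<^bsub>V\<^esub> x \<in> {u \<in> carrier V. s.A.rU u \<in> J}"
      using xy by (simp_all add: s.A.rU_mult)
  qed
  then show ?thesis using assms by auto
qed

text \<open>\<open>J\<close>, \<open>Y\<close> and \<open>X\<close> are the \<open>\<X>\<close>, \<open>\<Y>'\<close> and \<open>\<X>'\<close> of the informal statement.\<close>

lemma J_iff:
  assumes a: "a \<in> carrier M" and u: "u \<in> carrier V"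
  shows "iota (a, u) \<in> J \<longleftrightarrow> a \<in> Y \<and> u \<in> X"
proof
  note Js = submodule_facts[OF s.A.UL_mod cat.J_sub]
  note Ys = submodule_facts[OF s.A.M_mod Y_sub] and Xs = submodule_facts[OF s.A.U_mod catU.J_sub]
  assume "a \<in> Y \<and> u \<in> X"
  then show "iota (a, u) \<in> J" using iM_Y rU_X Js(3) by (simp add: s.A.iota_def)
next
  note Ys = submodule_facts[OF s.A.M_mod Y_sub] and Xs = submodule_facts[OF s.A.U_mod catU.J_sub]
  have YX: "submodule (Y \<times> X) K s.A.MU"
    by (rule submodule_intro[OF s.A.MU_mod]) (use Ys Xs in \<open>auto simp: dsum_simps\<close>)
  have sub: "submodule (iota ` (Y \<times> X)) K E"
    by (rule submodule_image[OF s.A.MU_mod s.A.UL_mod s.A.iota_hom YX])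
  have al: "s.A.al b \<in> Us" if "b \<in> Ks" for b
    using that by (simp add: mem_a_kernel s.A.al_closed s.al_natural[symmetric] mod_hom_neg(1)[OF s.B.M_mod s.B.U_mod s.B.al(1)])
  have al': "s.A.al b \<in> Ut" if "b \<in> Kt" for b
    using that by (simp add: mem_a_kernel s.A.al_closed t.al_natural[symmetric] mod_hom_neg(1)[OF s.B.M_mod s.B.U_mod s.B.al(1)])
  have "J \<subseteq> iota ` (Y \<times> X)"
  proof (rule cat.J_least[OF sub])
    fix x y assume xy: "x \<in> carrier E" "y \<in> carrier E" "UL_map K P' f x = \<zero>\<^bsub>UL K P'\<^esub>" "UL_map K P' f' y = \<zero>\<^bsub>UL K P'\<^esub>"
    obtain b v where b: "b \<in> carrier M" "v \<in> carrier V" "x = iota (b, v)" using E_cases[OF xy(1)] .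
    obtain d w where d: "d \<in> carrier M" "w \<in> carrier V" "y = iota (d, w)" using E_cases[OF xy(2)] .
    have k: "b \<in> Ks" "v \<in> Us" "d \<in> Kt" "w \<in> Ut" using xy b d kernels_iota by simp_all
    have vw: "s.Uh v = \<zero>\<^bsub>U K L'\<^esub>" "t.Uh w = \<zero>\<^bsub>U K L'\<^esub>" using k by (simp_all add: mem_a_kernel)
    \<comment> \<open>The three summands of \<open>mu b v d w\<close> are of the kinds Us Kt, Ks Ut
      and Us Kt, the first because \<open>al b\<close> lies in \<open>Us\<close>. With the factors
      exchanged the kinds are Ut Ks, Kt Us and Ut Ks. These are the four terms of
      \<open>Y\<close>.\<close>
    have "mu b v d w \<in> Y" unfolding mu_def by (intro Ys(3) Y_mem al k)
    moreover have "v \<otimes>\<^bsub>V\<^esub> w \<in> X" by (rule catU.J_mem(1)[OF b(2) d(2) vw])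
    ultimately show "x \<otimes>\<^bsub>E\<^esub> y \<in> iota ` (Y \<times> X)"
      using b d by (intro image_eqI[of _ _ "(mu b v d w, v \<otimes>\<^bsub>V\<^esub> w)"]) (simp_all add: iota_mu)
    have "mu d w b v \<in> Y" unfolding mu_def by (intro Ys(3) Y_mem al' k)
    moreover have "w \<otimes>\<^bsub>V\<^esub> v \<in> X" by (rule catU.J_mem(2)[OF b(2) d(2) vw])
    ultimately show "y \<otimes>\<^bsub>E\<^esub> x \<in> iota ` (Y \<times> X)"
      using b d by (intro image_eqI[of _ _ "(mu d w b v, w \<otimes>\<^bsub>V\<^esub> v)"]) (simp_all add: iota_mu)
  qed
  moreover assume "iota (a, u) \<in> J"
  ultimately obtain y x where yx: "y \<in> Y" "x \<in> X" "iota (a, u) = iota (y, x)" by auto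
  then have "(a, u) = (y, x)"
    using a u Ys(1) Xs(1) inj_onD[OF s.A.iota_inj, of "(a, u)" "(y, x)"] by (auto simp: dsum_simps(1))
  then show "a \<in> Y \<and> u \<in> X" using yx by simp
qed

section \<open>Classes modulo \<open>J\<close>, \<open>Y\<close> and \<open>X\<close>\<close>

abbreviation "EJ \<equiv> quot E J"

text \<open>By \<open>J_iff\<close> the kernels of \<open>cM\<close> and \<open>cU\<close> are
  \<open>Y\<close> and \<open>X\<close>. Equality of cosets of \<open>Y\<close> or \<open>X\<close>
  can thus be decided in \<open>EJ\<close>, where both module actions have become multiplication
  (\<open>cM_lc\<close>, \<open>cM_R\<close>).\<close>

definition "cM a = J +>\<^bsub>E\<^esub> s.A.iM a"
definition "cU u = J +>\<^bsub>E\<^esub> s.A.rU u"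

lemmas E_quot = quot_module[OF s.A.UL_mod cat.J_sub]
lemmas EJ_mult = quot_mult[OF cat.E_alg cat.J_ideal]

sublocale EJ: module K EJ by (rule E_quot(1))

lemma cM_hom: "cM \<in> mod_hom K M EJ"
  unfolding cM_def[abs_def] by (rule mod_hom_comp[OF s.A.iM(1) E_quot(2)])

lemma cU_hom: "cU \<in> mod_hom K V EJ"
  unfolding cU_def[abs_def] by (rule mod_hom_comp[OF s.A.rU_hom E_quot(2)])

lemma J_coset: "e \<in> carrier E \<Longrightarrow> J +>\<^bsub>E\<^esub> e = J \<longleftrightarrow> e \<in> J"
  by (rule coset_eq_self_iff[OF s.A.UL_mod cat.J_sub])

lemma cM_zero: "a \<in> carrier M \<Longrightarrow> cM a = \<zero>\<^bsub>EJ\<^esub> \<longleftrightarrow> a \<in> Y"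
  using submodule_facts(2)[OF s.A.U_mod catU.J_sub]
  by (simp add: cM_def quot_simps(2) J_coset s.A.iM_closed) (simp add: iota_iM J_iff)

lemma cU_zero: "u \<in> carrier V \<Longrightarrow> cU u = \<zero>\<^bsub>EJ\<^esub> \<longleftrightarrow> u \<in> X"
  using submodule_facts(2)[OF s.A.M_mod Y_sub]
  by (simp add: cU_def quot_simps(2) J_coset s.A.rU_closed) (simp add: iota_rU J_iff)

lemma cM_eq: "\<lbrakk>a \<in> carrier M; b \<in> carrier M\<rbrakk> \<Longrightarrow> cM a = cM b \<longleftrightarrow> a \<ominus>\<^bsub>M\<^esub> b \<in> Y"
  using hom_eq_iff[OF s.A.M_mod E_quot(1) cM_hom] cM_zero by simp

lemma cU_eq: "\<lbrakk>a \<in> carrier V; b \<in> carrier V\<rbrakk> \<Longrightarrow> cU a = cU b \<longleftrightarrow> a \<ominus>\<^bsub>V\<^esub> b \<in> X"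
  using hom_eq_iff[OF s.A.U_mod E_quot(1) cU_hom] cU_zero by simp

lemma cM_lc: "\<lbrakk>u \<in> carrier V; a \<in> carrier M\<rbrakk> \<Longrightarrow> cM (s.A.lc u a) = cU u \<otimes>\<^bsub>EJ\<^esub> cM a"
  by (simp add: cM_def cU_def s.A.iM_lc EJ_mult s.A.iM_closed s.A.rU_closed)

lemma cM_R: "\<lbrakk>u \<in> carrier V; a \<in> carrier M\<rbrakk> \<Longrightarrow> cM (s.A.R a u) = cM a \<otimes>\<^bsub>EJ\<^esub> cU u"
  by (simp add: cM_def cU_def s.A.iM_R EJ_mult s.A.iM_closed s.A.rU_closed)

lemmas M_coset_mem = mem_coset_iff[OF s.A.M_mod Y_sub]
lemmas V_coset_mem = mem_coset_iff[OF s.A.U_mod catU.J_sub]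
lemmas M_coset_eq = coset_eq_iff[OF s.A.M_mod Y_sub]

lemma M_self: "a \<in> carrier M \<Longrightarrow> a \<in> Y +>\<^bsub>M\<^esub> a"
  using submodule_facts(2)[OF s.A.M_mod Y_sub] by (simp add: M_coset_mem s.A.M.M.minus_eq s.A.M.M.r_neg)

lemma V_self: "u \<in> carrier V \<Longrightarrow> u \<in> X +>\<^bsub>V\<^esub> u"
  using submodule_facts(2)[OF s.A.U_mod catU.J_sub] by (simp add: V_coset_mem s.A.U.minus_eq s.A.U.r_neg)

section \<open>The algebra \<open>E\<^sub>1\<close> and the comparison of the two crossed
  modules\<close>

abbreviation "env \<equiv> LM_env K L P act p"
abbreviation "env' \<equiv> LM_env K L' P' act' p'"

lemma env_simps:
  "xtop env = M" "xbase env = V" "bd env = s.A.al" "lact env = s.A.lc" "ract env = s.A.R"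
  "xtop env' = s.B.M" "xbase env' = U K L'" "bd env' = s.B.al" "lact env' = s.B.lc" "ract env' = s.B.R"
  by (simp_all add: LM_env_def s.A.al_def s.A.lc_def s.A.R_def s.B.al_def s.B.lc_def s.B.R_def)

abbreviation "ebar \<equiv> xmod_quot env Y X"

lemma ebar_simps: "xtop ebar = quot M Y" "xbase ebar = quot V X"
  by (simp_all add: xmod_quot_def env_simps)

lemma ebar_bd: "a \<in> carrier M \<Longrightarrow> bd ebar (Y +>\<^bsub>M\<^esub> a) = X +>\<^bsub>V\<^esub> s.A.al a"
proof -
  assume a: "a \<in> carrier M"
  note q = quot_module[OF s.A.U_mod catU.J_sub]
  have z: "X +>\<^bsub>V\<^esub> s.A.al y = \<zero>\<^bsub>quot V X\<^esub>" if "y \<in> Y" for y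
    using al_Y[OF that] subsetD[OF submodule_facts(1)[OF s.A.M_mod Y_sub] that]
    by (simp add: quot_simps(2) coset_eq_self_iff[OF s.A.U_mod catU.J_sub] s.A.al_closed)
  show ?thesis
    unfolding xmod_quot_def env_simps
    by simp (rule quot_lift_hom[OF s.A.M_mod q(1) Y_sub mod_hom_comp[OF s.A.al(1) q(2)] z a])
qed

text \<open>Independence of representatives is verified after applying \<open>cM\<close>: there the
  actions are products in \<open>EJ\<close>, which depend on the classes only.\<close>

lemma ebar_lact:
  assumes a: "a \<in> carrier M" and u: "u \<in> carrier V"
  shows "lact ebar (X +>\<^bsub>V\<^esub> u) (Y +>\<^bsub>M\<^esub> a) = Y +>\<^bsub>M\<^esub> s.A.lc u a"
    and "ract ebar (Y +>\<^bsub>M\<^esub> a) (X +>\<^bsub>V\<^esub> u) = Y +>\<^bsub>M\<^esub> s.A.R a u"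
proof -
  have eq: "Y +>\<^bsub>M\<^esub> s.A.lc w b = Y +>\<^bsub>M\<^esub> s.A.lc u a" "Y +>\<^bsub>M\<^esub> s.A.R b w = Y +>\<^bsub>M\<^esub> s.A.R a u"
    if "w \<in> X +>\<^bsub>V\<^esub> u" "b \<in> Y +>\<^bsub>M\<^esub> a" for w b
  proof -
    have c: "w \<in> carrier V" "b \<in> carrier M" and e: "cU w = cU u" "cM b = cM a"
      using that a u by (auto simp: M_coset_mem V_coset_mem cU_eq cM_eq)
    show "Y +>\<^bsub>M\<^esub> s.A.lc w b = Y +>\<^bsub>M\<^esub> s.A.lc u a" "Y +>\<^bsub>M\<^esub> s.A.R b w = Y +>\<^bsub>M\<^esub> s.A.R a u"
      using c a u e by (simp_all add: M_coset_eq lc_closed s.A.R_closed cM_eq[symmetric] cM_lc cM_R)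
  qed
  have "the_elem {Y +>\<^bsub>M\<^esub> s.A.lc w b |w b. w \<in> X +>\<^bsub>V\<^esub> u \<and> b \<in> Y +>\<^bsub>M\<^esub> a} = Y +>\<^bsub>M\<^esub> s.A.lc u a"
    by (rule the_elem_const) (use eq M_self[OF a] V_self[OF u] in blast)+
  then show "lact ebar (X +>\<^bsub>V\<^esub> u) (Y +>\<^bsub>M\<^esub> a) = Y +>\<^bsub>M\<^esub> s.A.lc u a" by (simp add: xmod_quot_def env_simps)
  have "the_elem {Y +>\<^bsub>M\<^esub> s.A.R b w |w b. w \<in> X +>\<^bsub>V\<^esub> u \<and> b \<in> Y +>\<^bsub>M\<^esub> a} = Y +>\<^bsub>M\<^esub> s.A.R a u"
    by (rule the_elem_const) (use eq M_self[OF a] V_self[OF u] in blast)+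
  then show "ract ebar (Y +>\<^bsub>M\<^esub> a) (X +>\<^bsub>V\<^esub> u) = Y +>\<^bsub>M\<^esub> s.A.R a u" by (simp add: xmod_quot_def env_simps)
qed

definition "cls a u = (Y +>\<^bsub>M\<^esub> a, X +>\<^bsub>V\<^esub> u)"

abbreviation "EY \<equiv> LM_sum_alg ebar"

lemma LM_sum_alg_simps:
  "carrier (LM_sum_alg C) = carrier (xtop C) \<times> carrier (xbase C)"
  "\<zero>\<^bsub>LM_sum_alg C\<^esub> = (\<zero>\<^bsub>xtop C\<^esub>, \<zero>\<^bsub>xbase C\<^esub>)"
  "(a, r) \<oplus>\<^bsub>LM_sum_alg C\<^esub> (a', r') = (a \<oplus>\<^bsub>xtop C\<^esub> a', r \<oplus>\<^bsub>xbase C\<^esub> r')"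
  "c \<odot>\<^bsub>LM_sum_alg C\<^esub> (a, r) = (c \<odot>\<^bsub>xtop C\<^esub> a, c \<odot>\<^bsub>xbase C\<^esub> r)"
  "(a, r) \<otimes>\<^bsub>LM_sum_alg C\<^esub> (a', r')
    = (lact C (bd C a) a' \<oplus>\<^bsub>xtop C\<^esub> ract C a r' \<oplus>\<^bsub>xtop C\<^esub> lact C r a', r \<otimes>\<^bsub>xbase C\<^esub> r')"
  by (simp_all add: LM_sum_alg_def dsum_def)

lemma EY_ops:
  "\<zero>\<^bsub>EY\<^esub> = cls \<zero>\<^bsub>M\<^esub> \<zero>\<^bsub>V\<^esub>"
  "\<lbrakk>a \<in> carrier M; u \<in> carrier V; b \<in> carrier M; w \<in> carrier V\<rbrakk>
    \<Longrightarrow> cls a u \<oplus>\<^bsub>EY\<^esub> cls b w = cls (a \<oplus>\<^bsub>M\<^esub> b) (u \<oplus>\<^bsub>V\<^esub> w)"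
  "\<lbrakk>c \<in> carrier K; a \<in> carrier M; u \<in> carrier V\<rbrakk> \<Longrightarrow> c \<odot>\<^bsub>EY\<^esub> cls a u = cls (c \<odot>\<^bsub>M\<^esub> a) (c \<odot>\<^bsub>V\<^esub> u)"
  "\<lbrakk>a \<in> carrier M; u \<in> carrier V; b \<in> carrier M; w \<in> carrier V\<rbrakk>
    \<Longrightarrow> cls a u \<otimes>\<^bsub>EY\<^esub> cls b w = cls (mu a u b w) (u \<otimes>\<^bsub>V\<^esub> w)"
proof -
  have "Y +>\<^bsub>M\<^esub> \<zero>\<^bsub>M\<^esub> = Y" "X +>\<^bsub>V\<^esub> \<zero>\<^bsub>V\<^esub> = X"
    using coset_eq_self_iff[OF s.A.M_mod Y_sub] coset_eq_self_iff[OF s.A.U_mod catU.J_sub]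
      submodule_facts(2)[OF s.A.U_mod catU.J_sub] submodule_facts(2)[OF s.A.M_mod Y_sub] by simp_all
  then show "\<zero>\<^bsub>EY\<^esub> = cls \<zero>\<^bsub>M\<^esub> \<zero>\<^bsub>V\<^esub>" by (simp add: LM_sum_alg_simps ebar_simps quot_simps(2) cls_def)
qed (simp_all add: LM_sum_alg_simps ebar_simps cls_def quot_add[OF s.A.M_mod Y_sub] quot_add[OF s.A.U_mod catU.J_sub]
    quot_smult[OF s.A.M_mod Y_sub] quot_smult[OF s.A.U_mod catU.J_sub] quot_mult[OF catU.E_alg catU.J_ideal]
    ebar_bd ebar_lact s.A.al_closed lc_closed s.A.R_closed mu_def)

definition "kappa = (\<lambda>(a, u). quot_lift cM a \<oplus>\<^bsub>EJ\<^esub> quot_lift cU u)"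

lemma kappa_cls:
  assumes a: "a \<in> carrier M" and u: "u \<in> carrier V"
  shows "kappa (cls a u) = J +>\<^bsub>E\<^esub> iota (a, u)"
proof -
  have z: "cM y = \<zero>\<^bsub>EJ\<^esub>" if "y \<in> Y" for y
    using that cM_zero subsetD[OF submodule_facts(1)[OF s.A.M_mod Y_sub] that] by blast
  have z': "cU y = \<zero>\<^bsub>EJ\<^esub>" if "y \<in> X" for y
    using that cU_zero subsetD[OF submodule_facts(1)[OF s.A.U_mod catU.J_sub] that] by blast
  show ?thesis
    using a u
    by (simp add: kappa_def cls_def quot_lift_hom[OF s.A.M_mod E_quot(1) Y_sub cM_hom z]
        quot_lift_hom[OF s.A.U_mod E_quot(1) catU.J_sub cU_hom z'])
      (simp add: cM_def cU_def quot_add[OF s.A.UL_mod cat.J_sub] s.A.iM_closed s.A.rU_closed s.A.iota_def)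
qed

text \<open>The body follows \<open>LM_xmod\<close> field by field over the abstract data, so that
  the two agree by unfolding once the locale is interpreted.\<close>

definition "LMX = (let j = (\<lambda>(a, r). (Y +>\<^bsub>M\<^esub> i.Mh a, X +>\<^bsub>V\<^esub> i.Uh r)) in
  \<lparr>xtop = EY\<lparr>carrier := a_kernel (xtop ebar) s.B.M (quot_lift s.Mh) \<times> a_kernel (xbase ebar) (U K L') (quot_lift s.Uh)\<rparr>,
   xbase = LM_sum_alg env',
   bd = (\<lambda>(a, r). (quot_lift t.Mh a, quot_lift t.Uh r)),
   lact = (\<lambda>e b. j e \<otimes>\<^bsub>EY\<^esub> b),
   ract = (\<lambda>b e. b \<otimes>\<^bsub>EY\<^esub> j e)\<rparr>)"

text \<open>\<open>Y\<close> is mapped into \<open>J\<close> by \<open>iM\<close>, \<open>J\<close>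
  lies in the kernels of both maps of \<open>UL\<close>, and \<open>kernels\<close> translates this
  back to the tensor product.\<close>

lemma quot_maps:
  "a \<in> carrier M \<Longrightarrow> quot_lift s.Mh (Y +>\<^bsub>M\<^esub> a) = s.Mh a" "a \<in> carrier M \<Longrightarrow> quot_lift t.Mh (Y +>\<^bsub>M\<^esub> a) = t.Mh a"
  "u \<in> carrier V \<Longrightarrow> quot_lift s.Uh (X +>\<^bsub>V\<^esub> u) = s.Uh u" "u \<in> carrier V \<Longrightarrow> quot_lift t.Uh (X +>\<^bsub>V\<^esub> u) = t.Uh u"
proof -
  have y: "s.Mh y = \<zero>\<^bsub>s.B.M\<^esub>" "t.Mh y = \<zero>\<^bsub>s.B.M\<^esub>" if "y \<in> Y" for y
    using cat.J_kernel[OF iM_Y[OF that]] subsetD[OF submodule_facts(1)[OF s.A.M_mod Y_sub] that]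
    by (simp_all add: kernels) (simp_all add: mem_a_kernel)
  show "a \<in> carrier M \<Longrightarrow> quot_lift s.Mh (Y +>\<^bsub>M\<^esub> a) = s.Mh a"
    by (rule quot_lift_hom[OF s.A.M_mod s.B.M_mod Y_sub s.Mh(1) y(1)])
  show "a \<in> carrier M \<Longrightarrow> quot_lift t.Mh (Y +>\<^bsub>M\<^esub> a) = t.Mh a"
    by (rule quot_lift_hom[OF s.A.M_mod s.B.M_mod Y_sub t.Mh(1) y(2)])
qed (rule catU.s_bar_coset catU.t_bar_coset; assumption)+

lemma LMX_carrier:
  assumes a: "a \<in> carrier M" and u: "u \<in> carrier V"
  shows "cls a u \<in> carrier (xtop LMX) \<longleftrightarrow> UL_map K P' f (iota (a, u)) = \<zero>\<^bsub>UL K P'\<^esub>"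
  using a u
  by (simp add: LMX_def Let_def cls_def ebar_simps mem_a_kernel quot_maps kernels_iota quot_simps(1))

lemma LMX_cases:
  assumes "x \<in> carrier (xtop LMX)"
  obtains a u where "a \<in> carrier M" "u \<in> carrier V" "x = cls a u" "UL_map K P' f (iota (a, u)) = \<zero>\<^bsub>UL K P'\<^esub>"
proof -
  obtain a u where au: "a \<in> carrier M" "u \<in> carrier V" "x = cls a u"
    using assms by (auto simp: LMX_def Let_def ebar_simps mem_a_kernel quot_simps(1) cls_def)
  then show ?thesis using that LMX_carrier assms by blast
qed

text \<open>Injectivity is \<open>J_iff\<close> for a difference, surjectivity is that of
  \<open>iota\<close>. The condition that cuts out the top algebra is the same on both sides by
  \<open>LMX_carrier\<close>.\<close>

lemma kappa_bij: "bij_betw kappa (carrier (xtop LMX)) (carrier (xtop cat.XM))"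
proof -
  have XMc: "carrier (xtop cat.XM) = a_kernel EJ (UL K P') (quot_lift (UL_map K P' f))"
    by (simp add: cat.XM_def Let_def)
  have inj: "x = y" if x: "x \<in> carrier (xtop LMX)" and y: "y \<in> carrier (xtop LMX)" and eq: "kappa x = kappa y" for x y
  proof -
    obtain a u where au: "a \<in> carrier M" "u \<in> carrier V" "x = cls a u" by (rule LMX_cases[OF x])
    obtain b w where bw: "b \<in> carrier M" "w \<in> carrier V" "y = cls b w" by (rule LMX_cases[OF y])
    have "iota (a, u) \<ominus>\<^bsub>E\<^esub> iota (b, w) \<in> J"
      using eq au bw by (simp add: kappa_cls coset_eq_iff[OF s.A.UL_mod cat.J_sub] iota_closed)
    moreover have "iota (a, u) \<ominus>\<^bsub>E\<^esub> iota (b, w) = iota (a \<ominus>\<^bsub>M\<^esub> b, u \<ominus>\<^bsub>V\<^esub> w)"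
      using au bw mod_hom_neg(3)[OF s.A.MU_mod s.A.UL_mod s.A.iota_hom, of "(a, u)" "(b, w)"]
      by (simp add: dsum_minus[OF s.A.M_mod s.A.U_mod] dsum_simps(1))
    ultimately show ?thesis
      using au bw by (simp add: J_iff cls_def M_coset_eq coset_eq_iff[OF s.A.U_mod catU.J_sub])
  qed
  have "kappa ` carrier (xtop LMX) = carrier (xtop cat.XM)"
  proof (intro equalityI subsetI)
    fix z assume "z \<in> kappa ` carrier (xtop LMX)"
    then obtain x where x: "x \<in> carrier (xtop LMX)" "z = kappa x" by blast
    obtain a u where "a \<in> carrier M" "u \<in> carrier V" "x = cls a u" "UL_map K P' f (iota (a, u)) = \<zero>\<^bsub>UL K P'\<^esub>"
      using LMX_cases[OF x(1)] .
    then show "z \<in> carrier (xtop cat.XM)"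
      using x(2) by (simp add: XMc mem_a_kernel kappa_cls quot_simps(1) cat.s_bar_coset iota_closed)
  next
    fix z assume "z \<in> carrier (xtop cat.XM)"
    then obtain e where e: "e \<in> carrier E" "z = J +>\<^bsub>E\<^esub> e" "UL_map K P' f e = \<zero>\<^bsub>UL K P'\<^esub>"
      by (auto simp: XMc mem_a_kernel quot_simps(1) cat.s_bar_coset)
    obtain a u where "a \<in> carrier M" "u \<in> carrier V" "e = iota (a, u)" using E_cases[OF e(1)] .
    then show "z \<in> kappa ` carrier (xtop LMX)"
      using e by (intro image_eqI[of _ _ "cls a u"]) (simp_all add: kappa_cls LMX_carrier)
  qed
  then show ?thesis unfolding bij_betw_def by (intro conjI inj_onI inj)
qed

lemma XM_isomorphic_LMX: "assoc_xmod_isomorphic K cat.XM LMX"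
proof (rule assoc_xmod_transport[OF cat.XM_assoc_xmod kappa_bij, where \<psi> = s.B.iota])
  note Eh = mod_homD[OF alg_homD(1)[OF s.ULf(1)]] and Em = alg_homD(2)[OF s.ULf(1)]
  note Ez = mod_hom_neg(1)[OF s.A.UL_mod s.B.UL_mod alg_homD(1)[OF s.ULf(1)]]
  have tops: "\<zero>\<^bsub>xtop LMX\<^esub> = \<zero>\<^bsub>EY\<^esub>" "x \<oplus>\<^bsub>xtop LMX\<^esub> y = x \<oplus>\<^bsub>EY\<^esub> y" "c \<odot>\<^bsub>xtop LMX\<^esub> x = c \<odot>\<^bsub>EY\<^esub> x"
    "x \<otimes>\<^bsub>xtop LMX\<^esub> y = x \<otimes>\<^bsub>EY\<^esub> y" for x y c
    by (simp_all add: LMX_def Let_def)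
  have XMs: "\<zero>\<^bsub>xtop cat.XM\<^esub> = \<zero>\<^bsub>EJ\<^esub>" "A \<oplus>\<^bsub>xtop cat.XM\<^esub> B = A \<oplus>\<^bsub>EJ\<^esub> B" "c \<odot>\<^bsub>xtop cat.XM\<^esub> A = c \<odot>\<^bsub>EJ\<^esub> A"
    "A \<otimes>\<^bsub>xtop cat.XM\<^esub> B = A \<otimes>\<^bsub>EJ\<^esub> B" "xbase cat.XM = UL K P'" for A B c
    by (simp_all add: cat.XM_def Let_def)
  have base: "xbase LMX = LM_sum_alg env'" by (simp add: LMX_def Let_def)
  note bs = LM_sum_alg_simps env_simps
  have iota_lin: "iota (a \<oplus>\<^bsub>M\<^esub> b, u \<oplus>\<^bsub>V\<^esub> w) = iota (a, u) \<oplus>\<^bsub>E\<^esub> iota (b, w)"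
    if "a \<in> carrier M" "u \<in> carrier V" "b \<in> carrier M" "w \<in> carrier V" for a u b w
    using that mod_homD(2)[OF s.A.iota_hom, of "(a, u)" "(b, w)"] by (simp add: dsum_simps)
  have iota_smult: "iota (c \<odot>\<^bsub>M\<^esub> a, c \<odot>\<^bsub>V\<^esub> u) = c \<odot>\<^bsub>E\<^esub> iota (a, u)"
    if "a \<in> carrier M" "u \<in> carrier V" "c \<in> carrier K" for a u c
    using that mod_homD(3)[OF s.A.iota_hom, of c "(a, u)"] by (simp add: dsum_simps)
  have iota_z: "iota (\<zero>\<^bsub>M\<^esub>, \<zero>\<^bsub>V\<^esub>) = \<zero>\<^bsub>E\<^esub>"
    using mod_hom_neg(1)[OF s.A.MU_mod s.A.UL_mod s.A.iota_hom] by (simp add: dsum_simps)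
  have Jz: "J +>\<^bsub>E\<^esub> \<zero>\<^bsub>E\<^esub> = \<zero>\<^bsub>EJ\<^esub>" by (rule mod_hom_neg(1)[OF s.A.UL_mod E_quot])
  show "\<zero>\<^bsub>xtop LMX\<^esub> \<in> carrier (xtop LMX)" "kappa \<zero>\<^bsub>xtop LMX\<^esub> = \<zero>\<^bsub>xtop cat.XM\<^esub>"
    by (simp_all add: tops XMs EY_ops(1) LMX_carrier kappa_cls iota_z Ez Jz)
  show "x \<oplus>\<^bsub>xtop LMX\<^esub> y \<in> carrier (xtop LMX) \<and> kappa (x \<oplus>\<^bsub>xtop LMX\<^esub> y) = kappa x \<oplus>\<^bsub>xtop cat.XM\<^esub> kappa y"
    if "x \<in> carrier (xtop LMX)" "y \<in> carrier (xtop LMX)" for x y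
    by (rule LMX_cases[OF that(1)], rule LMX_cases[OF that(2)])
      (simp add: tops XMs EY_ops LMX_carrier kappa_cls iota_lin Eh iota_closed quot_add[OF s.A.UL_mod cat.J_sub])
  show "c \<odot>\<^bsub>xtop LMX\<^esub> x \<in> carrier (xtop LMX) \<and> kappa (c \<odot>\<^bsub>xtop LMX\<^esub> x) = c \<odot>\<^bsub>xtop cat.XM\<^esub> kappa x"
    if "c \<in> carrier K" "x \<in> carrier (xtop LMX)" for c x
    by (rule LMX_cases[OF that(2)])
      (simp add: that(1) tops XMs EY_ops LMX_carrier kappa_cls iota_smult Eh iota_closed quot_smult[OF s.A.UL_mod cat.J_sub])
  \<comment> \<open>One factor in the kernel of s suffices. This covers the product of two elements
    of the top algebra and also the two actions, where the other factor comes from the base.\<close>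
  have mult: "cls a u \<otimes>\<^bsub>EY\<^esub> cls b w \<in> carrier (xtop LMX) \<and>
      kappa (cls a u \<otimes>\<^bsub>EY\<^esub> cls b w) = (J +>\<^bsub>E\<^esub> iota (a, u)) \<otimes>\<^bsub>EJ\<^esub> (J +>\<^bsub>E\<^esub> iota (b, w))"
    if "a \<in> carrier M" "u \<in> carrier V" "b \<in> carrier M" "w \<in> carrier V"
      "UL_map K P' f (iota (a, u)) = \<zero>\<^bsub>UL K P'\<^esub> \<or> UL_map K P' f (iota (b, w)) = \<zero>\<^bsub>UL K P'\<^esub>" for a u b w
  proof -
    have c: "iota (a, u) \<in> carrier E" "iota (b, w) \<in> carrier E" using that by (simp_all add: iota_closed)
    then have "UL_map K P' f (iota (a, u) \<otimes>\<^bsub>E\<^esub> iota (b, w)) = \<zero>\<^bsub>UL K P'\<^esub>"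
      using that(5) by (elim disjE) (simp_all add: Em Eh(1))
    then show ?thesis
      using c that(1-4) by (simp add: EY_ops LMX_carrier kappa_cls mu_closed iota_mu EJ_mult)
  qed
  show "x \<otimes>\<^bsub>xtop LMX\<^esub> y \<in> carrier (xtop LMX) \<and> kappa (x \<otimes>\<^bsub>xtop LMX\<^esub> y) = kappa x \<otimes>\<^bsub>xtop cat.XM\<^esub> kappa y"
    if "x \<in> carrier (xtop LMX)" "y \<in> carrier (xtop LMX)" for x y
    by (rule LMX_cases[OF that(1)], rule LMX_cases[OF that(2)]) (simp add: tops XMs mult kappa_cls)
  show "bij_betw s.B.iota (carrier (xbase LMX)) (carrier (xbase cat.XM))"
    using s.B.iota_bij by (simp add: base XMs bs dsum_simps)
  show "\<zero>\<^bsub>xbase LMX\<^esub> \<in> carrier (xbase LMX)" "s.B.iota \<zero>\<^bsub>xbase LMX\<^esub> = \<zero>\<^bsub>xbase cat.XM\<^esub>"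
    using mod_hom_neg(1)[OF s.B.MU_mod s.B.UL_mod s.B.iota_hom] by (simp_all add: base XMs bs dsum_simps)
  have base_cases: thesis
    if "x \<in> carrier (xbase LMX)" "\<And>a u. \<lbrakk>a \<in> carrier s.B.M; u \<in> carrier (U K L'); x = (a, u)\<rbrakk> \<Longrightarrow> thesis" for x thesis
    by (rule that(2)[of "fst x" "snd x"]) (use that(1) in \<open>simp_all add: base bs mem_Times_iff\<close>)
  have pair: "(a, u) \<in> carrier s.B.MU" if "a \<in> carrier s.B.M" "u \<in> carrier (U K L')" for a u
    using that by (simp add: dsum_simps)
  show "x \<oplus>\<^bsub>xbase LMX\<^esub> y \<in> carrier (xbase LMX) \<and> s.B.iota (x \<oplus>\<^bsub>xbase LMX\<^esub> y) = s.B.iota x \<oplus>\<^bsub>xbase cat.XM\<^esub> s.B.iota y"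
    if "x \<in> carrier (xbase LMX)" "y \<in> carrier (xbase LMX)" for x y
    by (rule base_cases[OF that(1)], rule base_cases[OF that(2)])
      (simp add: base XMs bs mod_homD(2)[OF s.B.iota_hom pair pair, symmetric] dsum_simps(3))
  show "c \<odot>\<^bsub>xbase LMX\<^esub> x \<in> carrier (xbase LMX) \<and> s.B.iota (c \<odot>\<^bsub>xbase LMX\<^esub> x) = c \<odot>\<^bsub>xbase cat.XM\<^esub> s.B.iota x"
    if "c \<in> carrier K" "x \<in> carrier (xbase LMX)" for c x
    by (rule base_cases[OF that(2)])
      (simp add: that(1) base XMs bs mod_homD(3)[OF s.B.iota_hom _ pair, symmetric] dsum_simps(4))
  show "x \<otimes>\<^bsub>xbase LMX\<^esub> y \<in> carrier (xbase LMX) \<and> s.B.iota (x \<otimes>\<^bsub>xbase LMX\<^esub> y) = s.B.iota x \<otimes>\<^bsub>xbase cat.XM\<^esub> s.B.iota y"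
    if "x \<in> carrier (xbase LMX)" "y \<in> carrier (xbase LMX)" for x y
    by (rule base_cases[OF that(1)], rule base_cases[OF that(2)])
      (simp add: base XMs bs s.B.iota_mult s.B.al_closed s.B.R_closed mod_homD(1)[OF s.B.lc(1)])
  show "bd LMX x \<in> carrier (xbase LMX) \<and> s.B.iota (bd LMX x) = bd cat.XM (kappa x)"
    if x: "x \<in> carrier (xtop LMX)" for x
  proof -
    obtain a u where au: "a \<in> carrier M" "u \<in> carrier V" "x = cls a u" by (rule LMX_cases[OF x])
    have "bd LMX x = (t.Mh a, t.Uh u)" using au by (simp add: LMX_def Let_def cls_def quot_maps)
    moreover have "bd cat.XM (kappa x) = UL_map K P' f' (iota (a, u))"
      using au by (simp add: cat.XM_def Let_def kappa_cls cat.t_bar_coset iota_closed)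
    ultimately show ?thesis
      using au by (simp add: base bs t.iota_natural mod_homD(1)[OF t.Mh(1)] t.Uh_closed)
  qed
  have acts: "lact LMX e x \<in> carrier (xtop LMX) \<and> kappa (lact LMX e x) = lact cat.XM (s.B.iota e) (kappa x)"
    "ract LMX x e \<in> carrier (xtop LMX) \<and> kappa (ract LMX x e) = ract cat.XM (kappa x) (s.B.iota e)"
    if e: "e \<in> carrier (xbase LMX)" and x: "x \<in> carrier (xtop LMX)" for e x
  proof -
    obtain a u where au: "a \<in> carrier M" "u \<in> carrier V" "x = cls a u" "UL_map K P' f (iota (a, u)) = \<zero>\<^bsub>UL K P'\<^esub>"
      using LMX_cases[OF x] .
    obtain b w where bw: "b \<in> carrier s.B.M" "w \<in> carrier (U K L')" "e = (b, w)"
      by (rule base_cases[OF e])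
    have c: "i.Mh b \<in> carrier M" "i.Uh w \<in> carrier V"
      using bw by (auto intro: mod_homD(1)[OF i.Mh(1)] i.Uh_closed)
    \<comment> \<open>Naturality of \<open>iota\<close> for the section i matches the two embeddings
      of the base, so that both actions become cases of \<open>mult\<close>.\<close>
    have "iota (i.Mh b, i.Uh w) = UL_map K P g (s.B.iota e)" using bw by (simp add: i.iota_natural)
    moreover have "lact LMX e x = cls (i.Mh b) (i.Uh w) \<otimes>\<^bsub>EY\<^esub> x" "ract LMX x e = x \<otimes>\<^bsub>EY\<^esub> cls (i.Mh b) (i.Uh w)"
      using bw by (simp_all add: LMX_def Let_def cls_def)
    ultimately show "lact LMX e x \<in> carrier (xtop LMX) \<and> kappa (lact LMX e x) = lact cat.XM (s.B.iota e) (kappa x)"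
      "ract LMX x e \<in> carrier (xtop LMX) \<and> kappa (ract LMX x e) = ract cat.XM (kappa x) (s.B.iota e)"
      using au c by (simp_all add: mult kappa_cls cat.XM_def Let_def)
  qed
  show "lact LMX e x \<in> carrier (xtop LMX) \<and> kappa (lact LMX e x) = lact cat.XM (s.B.iota e) (kappa x)"
    "ract LMX x e \<in> carrier (xtop LMX) \<and> kappa (ract LMX x e) = ract cat.XM (kappa x) (s.B.iota e)"
    if "e \<in> carrier (xbase LMX)" "x \<in> carrier (xtop LMX)" for e x
    by (rule acts[OF that])+
qed

end

context leibniz_crossed_module
begin

sublocale base_lie: lie_quotient K P G clP "base_rep K C"
  by (rule lie_quotient.intro[OF P_leibniz G_alg clP_hom clP_surj _ base_rep_class])
    (use lie_ideal_least clP_zero in blast)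

text \<open>The locale is met by \<qq> \<rtimes> \<pp> with \<hh> \<rtimes> \<gg> itself as its Lie
  quotient; \<open>clS_least\<close> provides the condition on the kernel.\<close>

sublocale semi_lie: lie_quotient K S SL clS "semi_rep K C"
  by (rule lie_quotient.intro[OF S_leibniz LC.S_alg clS_hom clS_surj clS_least semi_rep_class])

end

theorem theorem6p6:
  fixes K :: "('k, 'z) ring_scheme" and C :: "('k, 'q, 'p) xmod"
  assumes "cring K" and "leibniz_xmod K C"
  shows "assoc_xmod_isomorphic K (XUL K C) (LM_xmod K C)"
proof -
  interpret leibniz_crossed_module K C by (rule leibniz_crossed_module.intro[OF assms(2)])
  have hom: "lie_quotient_hom K S SL clS (semi_rep K C) P G clP (base_rep K C) f h"
    if "f \<in> alg_hom K S P" "h \<in> alg_hom K SL G" "\<And>x. x \<in> carrier S \<Longrightarrow> h (clS x) = clP (f x)" for f h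
    by (intro lie_quotient_hom.intro semi_lie.lie_quotient_axioms base_lie.lie_quotient_axioms
        lie_quotient_hom_axioms.intro that)
  have s: "lie_quotient_hom K S SL clS (semi_rep K C) P G clP (base_rep K C) s_map s_map"
    by (rule hom[OF s_map_hom LC.s_map_hom[unfolded LC_simps]]) (auto simp: semidirect_simps s_map_def clS_pair)
  have t: "lie_quotient_hom K S SL clS (semi_rep K C) P G clP (base_rep K C) (t_map C) (t_map LC)"
    by (rule hom[OF t_map_hom LC.t_map_hom[unfolded LC_simps]])
      (auto simp: semidirect_simps t_map_def clS_pair LC_bd LC_simps mod_homD(2)[OF alg_homD(1)[OF clP_hom]] bd_closed)
  have i: "lie_quotient_hom K P G clP (base_rep K C) S SL clS (semi_rep K C) (i_map C) (i_map LC)"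
    by (intro lie_quotient_hom.intro semi_lie.lie_quotient_axioms base_lie.lie_quotient_axioms
        lie_quotient_hom_axioms.intro i_map_hom LC.i_map_hom[unfolded LC_simps])
      (simp add: i_map_def clS_pair LC_simps mod_hom_neg(1)[OF Q_mod H_mod alg_homD(1)[OF clQ_hom]])
  interpret X: cat1_lie K S SL clS "semi_rep K C" P G clP "base_rep K C" s_map s_map "t_map C" "t_map LC" "i_map C" "i_map LC"
    by (intro cat1_lie.intro s t i cat1_lie_axioms.intro)
      (simp_all add: s_map_def t_map_def i_map_def mod_hom_neg(1)[OF Q_mod P_mod alg_homD(1)[OF bd_hom]])
  \<comment> \<open>The abstract constructions have the same shape as the given definitions. After
    the ideals are matched, both crossed modules are identified by unfolding.\<close>
  have J: "XUL_ideal K C = X.cat.J"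
    by (simp add: XUL_ideal_def X.cat.J_def Let_def)
  have "XUL K C = X.cat.XM"
    by (simp add: XUL_def X.cat.XM_def UL_bar_def J Let_def)
  moreover have env: "env0 K C = X.env'" "env1 K C = X.env"
    by (simp_all add: env0_def env1_def)
  have Y: "Y_ideal K C = X.Y" and I: "X_ideal K C = X.X"
    by (simp_all add: Y_ideal_def X.Y_def X_ideal_def X.catU.J_def Let_def env X.env_simps
        Us1_def Ut1_def Us2_def Ut2_def)
  have "LM_xmod K C = X.LMX"
    by (simp add: LM_xmod_def X.LMX_def Let_def E1_def E0_def env1_bar_def E0_to_E1_def env Y I X.env_simps
        Us1_def Ut1_def Us2_def Ut2_def Ui1_def Ui2_def)
  ultimately show ?thesis using X.XM_isomorphic_LMX by simp
qed

end
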